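(* It is consistent with $\mathsf{ZF}+\mathsf{DC}$ that there exists a $\mathrm{CCC}_2$ notion of forcing which collapses cardinals.
   Context: Consistency is relative to the consistency of $\mathsf{ZFC}$ (equivalently, of $\mathsf{ZF}$). $\mathsf{DC}$ is the Principle of Dependent Choice. A notion of forcing is a preordered set $\mathbb P$ with a maximum. Conditions are compatible if they have a common extension, and an antichain is a set of conditions any two distinct members of which are incompatible. $\mathbb P$ is $\mathrm{CCC}_2$ if every antichain in $\mathbb P$ is countable. A forcing collapses cardinals if some well-ordered cardinal ($\aleph$ number) of the ground model is no longer a cardinal in the generic extension. *)

theory Defs
  imports Main
begin

section \<open>First-order logic in the language of set theory\<close>

text \<open>De Bruijn indices; the only terms are variables, so substitution is renaming.\<close>

datatype fm = Mem nat nat | Eq nat nat | Neg fm | And fm fm | All fm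

primrec rename :: "(nat \<Rightarrow> nat) \<Rightarrow> fm \<Rightarrow> fm" where
  "rename r (Mem i j) = Mem (r i) (r j)"
| "rename r (Eq i j) = Eq (r i) (r j)"
| "rename r (Neg A) = Neg (rename r A)"
| "rename r (And A B) = And (rename r A) (rename r B)"
| "rename r (All A) = All (rename (case_nat 0 (\<lambda>i. Suc (r i))) A)"

definition inst :: "fm \<Rightarrow> nat \<Rightarrow> fm" where
  "inst A t = rename (case_nat t (\<lambda>i. i)) A"

text \<open>All free indices of the formula are smaller than the given number.\<close>

primrec bounded_by :: "nat \<Rightarrow> fm \<Rightarrow> bool" where
  "bounded_by n (Mem i j) \<longleftrightarrow> i < n \<and> j < n"
| "bounded_by n (Eq i j) \<longleftrightarrow> i < n \<and> j < n"
| "bounded_by n (Neg A) \<longleftrightarrow> bounded_by n A"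
| "bounded_by n (And A B) \<longleftrightarrow> bounded_by n A \<and> bounded_by n B"
| "bounded_by n (All A) \<longleftrightarrow> bounded_by (Suc n) A"

text \<open>Classical natural deduction with equality. In \<open>AllI\<close> the hypotheses are shifted, so that
  index 0 is the eigenvariable.\<close>

inductive derives :: "fm set \<Rightarrow> fm \<Rightarrow> bool" (infix "\<turnstile>" 50) where
  Assm: "A \<in> \<Gamma> \<Longrightarrow> \<Gamma> \<turnstile> A"
| AndI: "\<Gamma> \<turnstile> A \<Longrightarrow> \<Gamma> \<turnstile> B \<Longrightarrow> \<Gamma> \<turnstile> And A B"
| AndE1: "\<Gamma> \<turnstile> And A B \<Longrightarrow> \<Gamma> \<turnstile> A"
| AndE2: "\<Gamma> \<turnstile> And A B \<Longrightarrow> \<Gamma> \<turnstile> B"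
| NegI: "insert A \<Gamma> \<turnstile> B \<Longrightarrow> insert A \<Gamma> \<turnstile> Neg B \<Longrightarrow> \<Gamma> \<turnstile> Neg A"
| NegE: "insert (Neg A) \<Gamma> \<turnstile> B \<Longrightarrow> insert (Neg A) \<Gamma> \<turnstile> Neg B \<Longrightarrow> \<Gamma> \<turnstile> A"
| AllI: "rename Suc ` \<Gamma> \<turnstile> A \<Longrightarrow> \<Gamma> \<turnstile> All A"
| AllE: "\<Gamma> \<turnstile> All A \<Longrightarrow> \<Gamma> \<turnstile> inst A t"
| EqRefl: "\<Gamma> \<turnstile> Eq t t"
| EqSubst: "\<Gamma> \<turnstile> Eq s t \<Longrightarrow> \<Gamma> \<turnstile> inst A s \<Longrightarrow> \<Gamma> \<turnstile> inst A t"

definition consistent :: "fm set \<Rightarrow> bool" where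
  "consistent T \<longleftrightarrow> \<not> (\<exists>A. T \<turnstile> A \<and> T \<turnstile> Neg A)"


section \<open>Writing formulas with bound names\<close>

text \<open>To write concrete formulas without index arithmetic, a formula is presented as a function of
  the number \<open>d\<close> of variables in scope. These variables are the levels \<open>0, \<dots>, d - 1\<close>, counted from
  the outside; level \<open>x\<close> has de Bruijn index \<open>d - Suc x\<close>. A quantifier introduces level \<open>d\<close>. Hence
  \<open>F 0\<close> is a sentence, and in \<open>F n\<close> the levels \<open>0, \<dots>, n - 1\<close> are free. In the definitions below,
  variables of type \<^typ>\<open>nat\<close> are levels, that is, object-language variables.\<close>

type_synonym lfm = "nat \<Rightarrow> fm"

definition mem :: "nat \<Rightarrow> nat \<Rightarrow> lfm" (infix "\<^bold>\<in>" 50) where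
  "(x \<^bold>\<in> y) d = Mem (d - Suc x) (d - Suc y)"

definition eq :: "nat \<Rightarrow> nat \<Rightarrow> lfm" (infix "\<^bold>=" 50) where
  "(x \<^bold>= y) d = Eq (d - Suc x) (d - Suc y)"

definition neg :: "lfm \<Rightarrow> lfm" ("\<^bold>\<not> _" [40] 40) where
  "(\<^bold>\<not> F) d = Neg (F d)"

definition con :: "lfm \<Rightarrow> lfm \<Rightarrow> lfm" (infixr "\<^bold>\<and>" 35) where
  "(F \<^bold>\<and> G) d = And (F d) (G d)"

definition dis :: "lfm \<Rightarrow> lfm \<Rightarrow> lfm" (infixr "\<^bold>\<or>" 30) where
  "(F \<^bold>\<or> G) = (\<^bold>\<not> ((\<^bold>\<not> F) \<^bold>\<and> (\<^bold>\<not> G)))"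

definition imp :: "lfm \<Rightarrow> lfm \<Rightarrow> lfm" (infixr "\<^bold>\<longrightarrow>" 25) where
  "(F \<^bold>\<longrightarrow> G) = (\<^bold>\<not> (F \<^bold>\<and> (\<^bold>\<not> G)))"

definition iff :: "lfm \<Rightarrow> lfm \<Rightarrow> lfm" (infixr "\<^bold>\<longleftrightarrow>" 25) where
  "(F \<^bold>\<longleftrightarrow> G) = ((F \<^bold>\<longrightarrow> G) \<^bold>\<and> (G \<^bold>\<longrightarrow> F))"

definition all :: "(nat \<Rightarrow> lfm) \<Rightarrow> lfm" (binder "\<^bold>\<forall>" 10) where
  "all F d = All (F d (Suc d))"

definition ex :: "(nat \<Rightarrow> lfm) \<Rightarrow> lfm" (binder "\<^bold>\<exists>" 10) where
  "ex F = (\<^bold>\<not> (\<^bold>\<forall>x. \<^bold>\<not> F x))"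

text \<open>\<open>A\<close> with its free index \<open>i\<close> read as the level \<open>\<rho> i\<close>.\<close>

definition at_levels :: "fm \<Rightarrow> (nat \<Rightarrow> nat) \<Rightarrow> lfm" where
  "at_levels A \<rho> d = rename (\<lambda>i. d - Suc (\<rho> i)) A"


section \<open>Basic set-theoretic notions\<close>

definition subset :: "nat \<Rightarrow> nat \<Rightarrow> lfm" (infix "\<^bold>\<subseteq>" 50) where
  "(x \<^bold>\<subseteq> y) = (\<^bold>\<forall>z. z \<^bold>\<in> x \<^bold>\<longrightarrow> z \<^bold>\<in> y)"

definition is_empty :: "nat \<Rightarrow> lfm" where
  "is_empty x = (\<^bold>\<not> (\<^bold>\<exists>z. z \<^bold>\<in> x))"

definition is_succ :: "nat \<Rightarrow> nat \<Rightarrow> lfm" where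
  "is_succ s x = (\<^bold>\<forall>z. z \<^bold>\<in> s \<^bold>\<longleftrightarrow> z \<^bold>\<in> x \<^bold>\<or> z \<^bold>= x)"

definition is_upair :: "nat \<Rightarrow> nat \<Rightarrow> nat \<Rightarrow> lfm" where
  "is_upair u x y = (\<^bold>\<forall>z. z \<^bold>\<in> u \<^bold>\<longleftrightarrow> z \<^bold>= x \<^bold>\<or> z \<^bold>= y)"

definition is_pair :: "nat \<Rightarrow> nat \<Rightarrow> nat \<Rightarrow> lfm" where
  "is_pair t x y = (\<^bold>\<exists>u. \<^bold>\<exists>v. is_upair u x x \<^bold>\<and> is_upair v x y \<^bold>\<and> is_upair t u v)"

definition pair_in :: "nat \<Rightarrow> nat \<Rightarrow> nat \<Rightarrow> lfm" where
  "pair_in x y R = (\<^bold>\<exists>t. t \<^bold>\<in> R \<^bold>\<and> is_pair t x y)"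

definition triple_in :: "nat \<Rightarrow> nat \<Rightarrow> nat \<Rightarrow> nat \<Rightarrow> lfm" where
  "triple_in x y z R = (\<^bold>\<exists>u. is_pair u y z \<^bold>\<and> pair_in x u R)"

definition is_relation :: "nat \<Rightarrow> nat \<Rightarrow> nat \<Rightarrow> lfm" where
  "is_relation R A B =
     (\<^bold>\<forall>t. t \<^bold>\<in> R \<^bold>\<longrightarrow> (\<^bold>\<exists>x. \<^bold>\<exists>y. x \<^bold>\<in> A \<^bold>\<and> y \<^bold>\<in> B \<^bold>\<and> is_pair t x y))"

definition is_function :: "nat \<Rightarrow> nat \<Rightarrow> nat \<Rightarrow> lfm" where
  "is_function f A B =
     (is_relation f A B \<^bold>\<and>
      (\<^bold>\<forall>x. x \<^bold>\<in> A \<^bold>\<longrightarrow> (\<^bold>\<exists>y. pair_in x y f \<^bold>\<and> (\<^bold>\<forall>z. pair_in x z f \<^bold>\<longrightarrow> z \<^bold>= y))))"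

definition is_injection :: "nat \<Rightarrow> nat \<Rightarrow> nat \<Rightarrow> lfm" where
  "is_injection f A B =
     (is_function f A B \<^bold>\<and>
      (\<^bold>\<forall>x. \<^bold>\<forall>y. \<^bold>\<forall>z. pair_in x z f \<^bold>\<and> pair_in y z f \<^bold>\<longrightarrow> x \<^bold>= y))"

definition is_bijection :: "nat \<Rightarrow> nat \<Rightarrow> nat \<Rightarrow> lfm" where
  "is_bijection f A B =
     (is_injection f A B \<^bold>\<and> (\<^bold>\<forall>y. y \<^bold>\<in> B \<^bold>\<longrightarrow> (\<^bold>\<exists>x. pair_in x y f)))"

definition is_inductive :: "nat \<Rightarrow> lfm" where
  "is_inductive I =
     ((\<^bold>\<exists>e. is_empty e \<^bold>\<and> e \<^bold>\<in> I) \<^bold>\<and>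
      (\<^bold>\<forall>x. x \<^bold>\<in> I \<^bold>\<longrightarrow> (\<^bold>\<exists>s. is_succ s x \<^bold>\<and> s \<^bold>\<in> I)))"

definition is_omega :: "nat \<Rightarrow> lfm" where
  "is_omega w = (\<^bold>\<forall>x. x \<^bold>\<in> w \<^bold>\<longleftrightarrow> (\<^bold>\<forall>I. is_inductive I \<^bold>\<longrightarrow> x \<^bold>\<in> I))"

definition countable_set :: "nat \<Rightarrow> lfm" where
  "countable_set A = (\<^bold>\<exists>w. \<^bold>\<exists>f. is_omega w \<^bold>\<and> is_injection f A w)"

definition transitive_set :: "nat \<Rightarrow> lfm" where
  "transitive_set x = (\<^bold>\<forall>y. y \<^bold>\<in> x \<^bold>\<longrightarrow> y \<^bold>\<subseteq> x)"

text \<open>In the presence of Foundation, ordinals are the transitive sets of transitive sets.\<close>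

definition ordinal :: "nat \<Rightarrow> lfm" where
  "ordinal x = (transitive_set x \<^bold>\<and> (\<^bold>\<forall>y. y \<^bold>\<in> x \<^bold>\<longrightarrow> transitive_set y))"

text \<open>Well-ordered cardinals are the initial ordinals; the alephs are the infinite ones.\<close>

definition cardinal :: "nat \<Rightarrow> lfm" where
  "cardinal k =
     (ordinal k \<^bold>\<and> (\<^bold>\<forall>a. a \<^bold>\<in> k \<^bold>\<longrightarrow> \<^bold>\<not> (\<^bold>\<exists>f. is_bijection f a k)))"

definition aleph :: "nat \<Rightarrow> lfm" where
  "aleph k = (cardinal k \<^bold>\<and> (\<^bold>\<exists>w. is_omega w \<^bold>\<and> w \<^bold>\<subseteq> k))"


section \<open>The theories ZF and ZFC, and Dependent Choice\<close>

definition extensionality :: fm where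
  "extensionality = (\<^bold>\<forall>x. \<^bold>\<forall>y. (\<^bold>\<forall>z. z \<^bold>\<in> x \<^bold>\<longleftrightarrow> z \<^bold>\<in> y) \<^bold>\<longrightarrow> x \<^bold>= y) 0"

definition foundation :: fm where
  "foundation =
     (\<^bold>\<forall>x. (\<^bold>\<exists>y. y \<^bold>\<in> x) \<^bold>\<longrightarrow> (\<^bold>\<exists>y. y \<^bold>\<in> x \<^bold>\<and> \<^bold>\<not> (\<^bold>\<exists>z. z \<^bold>\<in> x \<^bold>\<and> z \<^bold>\<in> y))) 0"

definition pairing :: fm where
  "pairing = (\<^bold>\<forall>x. \<^bold>\<forall>y. \<^bold>\<exists>u. is_upair u x y) 0"

definition union :: fm where
  "union = (\<^bold>\<forall>x. \<^bold>\<exists>u. \<^bold>\<forall>z. z \<^bold>\<in> u \<^bold>\<longleftrightarrow> (\<^bold>\<exists>y. y \<^bold>\<in> x \<^bold>\<and> z \<^bold>\<in> y)) 0"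

definition powerset :: fm where
  "powerset = (\<^bold>\<forall>x. \<^bold>\<exists>u. \<^bold>\<forall>z. z \<^bold>\<in> u \<^bold>\<longleftrightarrow> z \<^bold>\<subseteq> x) 0"

definition infinity :: fm where
  "infinity = (\<^bold>\<exists>I. is_inductive I) 0"

text \<open>In the schemata, the parameters of \<open>A\<close> are the levels \<open>0, \<dots>, n - 1\<close>, which \<open>All ^^ n\<close> closes
  universally. For Separation, index 0 of \<open>A\<close> is the separated element and index \<open>i + 1\<close> is
  parameter \<open>i\<close>; for Replacement, indices 0 and 1 are argument and value and index \<open>i + 2\<close> is
  parameter \<open>i\<close>.\<close>

definition separation :: "nat \<Rightarrow> fm \<Rightarrow> fm" where
  "separation n A =
     (All ^^ n)
       ((\<^bold>\<forall>a. \<^bold>\<exists>b. \<^bold>\<forall>x. x \<^bold>\<in> b \<^bold>\<longleftrightarrow>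
          x \<^bold>\<in> a \<^bold>\<and> at_levels A (case_nat x (\<lambda>i. i))) n)"

definition replacement :: "nat \<Rightarrow> fm \<Rightarrow> fm" where
  "replacement n A =
     (let R = (\<lambda>x y. at_levels A (case_nat x (case_nat y (\<lambda>i. i)))) in
      (All ^^ n)
        ((\<^bold>\<forall>a. (\<^bold>\<forall>x. x \<^bold>\<in> a \<^bold>\<longrightarrow> (\<^bold>\<forall>y. \<^bold>\<forall>z. R x y \<^bold>\<and> R x z \<^bold>\<longrightarrow> y \<^bold>= z)) \<^bold>\<longrightarrow>
          (\<^bold>\<exists>b. \<^bold>\<forall>y. y \<^bold>\<in> b \<^bold>\<longleftrightarrow> (\<^bold>\<exists>x. x \<^bold>\<in> a \<^bold>\<and> R x y))) n))"

definition choice :: fm where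
  "choice =
     (\<^bold>\<forall>A. (\<^bold>\<forall>a. a \<^bold>\<in> A \<^bold>\<longrightarrow> \<^bold>\<not> is_empty a) \<^bold>\<longrightarrow>
       (\<^bold>\<exists>U. \<^bold>\<exists>f. is_function f A U \<^bold>\<and> (\<^bold>\<forall>a. \<^bold>\<forall>y. pair_in a y f \<^bold>\<longrightarrow> y \<^bold>\<in> a))) 0"

definition dependent_choice :: fm where
  "dependent_choice =
     (\<^bold>\<forall>X. \<^bold>\<forall>R.
       \<^bold>\<not> is_empty X \<^bold>\<and>
       (\<^bold>\<forall>x. x \<^bold>\<in> X \<^bold>\<longrightarrow> (\<^bold>\<exists>y. y \<^bold>\<in> X \<^bold>\<and> pair_in x y R)) \<^bold>\<longrightarrow>
       (\<^bold>\<exists>w. \<^bold>\<exists>f. is_omega w \<^bold>\<and> is_function f w X \<^bold>\<and>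
         (\<^bold>\<forall>n. \<^bold>\<forall>s. \<^bold>\<forall>x. \<^bold>\<forall>y.
           is_succ s n \<^bold>\<and> pair_in n x f \<^bold>\<and> pair_in s y f \<^bold>\<longrightarrow> pair_in x y R))) 0"

definition ZF :: "fm set" where
  "ZF = {extensionality, foundation, pairing, union, powerset, infinity}
        \<union> {separation n A | n A. bounded_by (n + 1) A}
        \<union> {replacement n A | n A. bounded_by (n + 2) A}"

definition ZFC :: "fm set" where
  "ZFC = insert choice ZF"


section \<open>Notions of forcing\<close>

text \<open>\<open>L\<close> is a preorder on \<open>P\<close> with maximum \<open>m\<close>. The pair \<open>(q, p)\<close> belongs to \<open>L\<close> if \<open>q\<close> extends
  \<open>p\<close>, written \<open>q \<le> p\<close> in the comments below.\<close>

definition notion_of_forcing :: "nat \<Rightarrow> nat \<Rightarrow> nat \<Rightarrow> lfm" where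
  "notion_of_forcing P L m =
     (is_relation L P P \<^bold>\<and>
      (\<^bold>\<forall>p. p \<^bold>\<in> P \<^bold>\<longrightarrow> pair_in p p L) \<^bold>\<and>
      (\<^bold>\<forall>p. \<^bold>\<forall>q. \<^bold>\<forall>r. pair_in p q L \<^bold>\<and> pair_in q r L \<^bold>\<longrightarrow> pair_in p r L) \<^bold>\<and>
      m \<^bold>\<in> P \<^bold>\<and> (\<^bold>\<forall>p. p \<^bold>\<in> P \<^bold>\<longrightarrow> pair_in p m L))"

definition compatible :: "nat \<Rightarrow> nat \<Rightarrow> nat \<Rightarrow> lfm" where
  "compatible L p q = (\<^bold>\<exists>r. pair_in r p L \<^bold>\<and> pair_in r q L)"

definition antichain :: "nat \<Rightarrow> nat \<Rightarrow> nat \<Rightarrow> lfm" where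
  "antichain P L A =
     (A \<^bold>\<subseteq> P \<^bold>\<and>
      (\<^bold>\<forall>p. \<^bold>\<forall>q. p \<^bold>\<in> A \<^bold>\<and> q \<^bold>\<in> A \<^bold>\<and> \<^bold>\<not> (p \<^bold>= q) \<^bold>\<longrightarrow> \<^bold>\<not> compatible L p q))"

definition CCC2 :: "nat \<Rightarrow> nat \<Rightarrow> lfm" where
  "CCC2 P L = (\<^bold>\<forall>A. antichain P L A \<^bold>\<longrightarrow> countable_set A)"


section \<open>Names and the forcing relation\<close>

text \<open>The \<open>P\<close>-names are, recursively, the sets of pairs \<open>(z, p)\<close> with \<open>z\<close> a \<open>P\<close>-name and \<open>p \<in> P\<close>.
  By Foundation, \<open>x\<close> is a \<open>P\<close>-name iff it belongs to a set \<open>T\<close> all of whose elements are subsets of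
  \<open>T \<times> P\<close>.\<close>

definition name_system :: "nat \<Rightarrow> nat \<Rightarrow> lfm" where
  "name_system P T = (\<^bold>\<forall>x. x \<^bold>\<in> T \<^bold>\<longrightarrow> is_relation x T P)"

definition is_name :: "nat \<Rightarrow> nat \<Rightarrow> lfm" where
  "is_name P x = (\<^bold>\<exists>T. name_system P T \<^bold>\<and> x \<^bold>\<in> T)"

definition in_dom :: "nat \<Rightarrow> nat \<Rightarrow> lfm" where
  "in_dom z x = (\<^bold>\<exists>s. pair_in z s x)"

text \<open>The forcing relation for atomic formulas is given by the recursion
  \<^item> \<open>p\<close> forces \<open>x = y\<close> iff for all \<open>z \<in> dom x \<union> dom y\<close> and all \<open>q \<le> p\<close>:
    \<open>q\<close> forces \<open>z \<in> x\<close> iff \<open>q\<close> forces \<open>z \<in> y\<close>;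
  \<^item> \<open>p\<close> forces \<open>x \<in> y\<close> iff the set of \<open>r\<close> for which there is \<open>(z, s) \<in> y\<close> with \<open>r \<le> s\<close> and
    \<open>r\<close> forces \<open>x = z\<close> is dense below \<open>p\<close>.

  As usual, the recursion is expressed through sets \<open>E\<close> and \<open>M\<close> of triples in \<open>P \<times> T \<times> T\<close> that
  satisfy both clauses on a set \<open>T\<close> of names as above; they are uniquely determined on
  \<open>P \<times> T \<times> T\<close>.\<close>

definition atomic_forcing_system :: "nat \<Rightarrow> nat \<Rightarrow> nat \<Rightarrow> nat \<Rightarrow> nat \<Rightarrow> lfm" where
  "atomic_forcing_system P L T E M =
     (name_system P T \<^bold>\<and>
      (\<^bold>\<forall>p. \<^bold>\<forall>x. \<^bold>\<forall>y. p \<^bold>\<in> P \<^bold>\<and> x \<^bold>\<in> T \<^bold>\<and> y \<^bold>\<in> T \<^bold>\<longrightarrow>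
        (triple_in p x y E \<^bold>\<longleftrightarrow>
          (\<^bold>\<forall>z. \<^bold>\<forall>q. (in_dom z x \<^bold>\<or> in_dom z y) \<^bold>\<and> pair_in q p L \<^bold>\<longrightarrow>
            (triple_in q z x M \<^bold>\<longleftrightarrow> triple_in q z y M))) \<^bold>\<and>
        (triple_in p x y M \<^bold>\<longleftrightarrow>
          (\<^bold>\<forall>q. pair_in q p L \<^bold>\<longrightarrow>
            (\<^bold>\<exists>r. pair_in r q L \<^bold>\<and>
              (\<^bold>\<exists>z. \<^bold>\<exists>s. pair_in z s y \<^bold>\<and> pair_in r s L \<^bold>\<and> triple_in r x z E))))))"

definition forces_eq :: "nat \<Rightarrow> nat \<Rightarrow> nat \<Rightarrow> nat \<Rightarrow> nat \<Rightarrow> lfm" where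
  "forces_eq P L p x y =
     (\<^bold>\<exists>T. \<^bold>\<exists>E. \<^bold>\<exists>M. atomic_forcing_system P L T E M \<^bold>\<and> x \<^bold>\<in> T \<^bold>\<and> y \<^bold>\<in> T \<^bold>\<and> triple_in p x y E)"

definition forces_mem :: "nat \<Rightarrow> nat \<Rightarrow> nat \<Rightarrow> nat \<Rightarrow> nat \<Rightarrow> lfm" where
  "forces_mem P L p x y =
     (\<^bold>\<exists>T. \<^bold>\<exists>E. \<^bold>\<exists>M. atomic_forcing_system P L T E M \<^bold>\<and> x \<^bold>\<in> T \<^bold>\<and> y \<^bold>\<in> T \<^bold>\<and> triple_in p x y M)"

text \<open>\<open>forces A P L p \<rho>\<close>: the condition \<open>p\<close> forces \<open>A\<close>, the free index \<open>i\<close> of \<open>A\<close> being interpreted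
  by the name \<open>\<rho> i\<close>.\<close>

primrec forces :: "fm \<Rightarrow> nat \<Rightarrow> nat \<Rightarrow> nat \<Rightarrow> (nat \<Rightarrow> nat) \<Rightarrow> lfm" where
  "forces (Mem i j) P L p \<rho> = forces_mem P L p (\<rho> i) (\<rho> j)"
| "forces (Eq i j) P L p \<rho> = forces_eq P L p (\<rho> i) (\<rho> j)"
| "forces (Neg A) P L p \<rho> = (\<^bold>\<forall>q. pair_in q p L \<^bold>\<longrightarrow> \<^bold>\<not> forces A P L q \<rho>)"
| "forces (And A B) P L p \<rho> = (forces A P L p \<rho> \<^bold>\<and> forces B P L p \<rho>)"
| "forces (All A) P L p \<rho> = (\<^bold>\<forall>x. is_name P x \<^bold>\<longrightarrow> forces A P L p (case_nat x \<rho>))"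

text \<open>\<open>c\<close> is the canonical name of \<open>x\<close>: the recursion mapping \<open>y\<close> to the set of all pairs of the
  canonical name of an element of \<open>y\<close> and the condition \<open>m\<close>, run by a function \<open>C\<close> on a transitive
  set \<open>D\<close> containing \<open>x\<close>.\<close>

definition is_check_name :: "nat \<Rightarrow> nat \<Rightarrow> nat \<Rightarrow> lfm" where
  "is_check_name m x c =
     (\<^bold>\<exists>D. \<^bold>\<exists>R. \<^bold>\<exists>C. transitive_set D \<^bold>\<and> x \<^bold>\<in> D \<^bold>\<and> is_function C D R \<^bold>\<and>
       (\<^bold>\<forall>y. \<^bold>\<forall>d. pair_in y d C \<^bold>\<longrightarrow>
         (\<^bold>\<forall>t. t \<^bold>\<in> d \<^bold>\<longleftrightarrow> (\<^bold>\<exists>z. \<^bold>\<exists>e. z \<^bold>\<in> y \<^bold>\<and> pair_in z e C \<^bold>\<and> is_pair t e m))) \<^bold>\<and>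
       pair_in x c C)"

text \<open>For some ground-model aleph \<open>k\<close>, the maximum forces (that is, it holds in every generic
  extension) that \<open>k\<close> is not a cardinal. In
  \<^term>\<open>(\<^bold>\<not> cardinal 0) 1\<close>, level 0 is the only free variable and has index 0.\<close>

definition collapses_cardinals :: "nat \<Rightarrow> nat \<Rightarrow> nat \<Rightarrow> lfm" where
  "collapses_cardinals P L m =
     (\<^bold>\<exists>k. \<^bold>\<exists>c. aleph k \<^bold>\<and> is_check_name m k c \<^bold>\<and>
       forces ((\<^bold>\<not> cardinal 0) 1) P L m (\<lambda>_. c))"

definition ex_CCC2_collapsing_cardinals :: fm where
  "ex_CCC2_collapsing_cardinals =
     (\<^bold>\<exists>P. \<^bold>\<exists>L. \<^bold>\<exists>m. notion_of_forcing P L m \<^bold>\<and> CCC2 P L \<^bold>\<and> collapses_cardinals P L m) 0"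

end

theory Submission
  imports Defs "HOL-Library.Countable_Set"
begin

text \<open>Force over a countable model of ZFC with countable conditions to add, for every finite partial injection \<open>q\<close>
  from \<open>\<omega>\<close> to \<open>\<omega>\<^sub>1\<close>, a generic subset of \<open>\<omega>\<^sub>1\<close>, and let \<open>A q\<close> be the set of all sets whose symmetric difference with it
  lies in the ground model. Names supported by countably many \<open>q\<close> form a symmetric submodel. Since the conditions
  are countably closed, it satisfies DC and \<open>\<omega>\<^sub>1\<close> remains uncountable in it; by symmetry, every partial choice function for the
  family \<open>A\<close> has a countable domain. Order the pairs \<open>(q, a)\<close> with \<open>a \<in> A q\<close> by extension of \<open>q\<close> alone. Two pairs
  with the same \<open>q\<close> are equivalent, so an antichain is a partial choice function and therefore countable. But forcing with
  these pairs amounts to forcing with the finite partial injections, which collapses \<open>\<omega>\<^sub>1\<close>. Countable models are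
  supplied by the completeness theorem; they need not be well-founded, so generic extensions are built as
  quotients of the class of names by forced equality.\<close>

section \<open>Soundness and completeness\<close>

text \<open>Under choice, a forcing with only countable antichains preserves cardinals. The finite
  partial injections from \<open>om\<close> to \<open>w1\<close> collapse \<open>w1\<close> but have
  uncountable antichains; a second component that cannot be picked for uncountably many
  \<open>q\<close> at once destroys these. The remaining design follows from what the model must
  satisfy. The symmetries are bit flips, a commutative group, so a support of a name supports all
  its images and normality of the filter is automatic. Supports are countable rather than finite
  because the sequence demanded by DC is named using the supports of countably many names.
  Conditions are countable so that every column, having \<open>w1\<close> bits, keeps an undecided
  one: flipping it fixes a condition but changes the named set. The second forcing lives over a
  model without choice, so generic extensions are developed over ZF for a class of hereditary names
  given by a parameter; this is applied once to symmetric names and once to all names of the second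
  forcing. Countable models let forced statements be proved by reasoning in arbitrary generic
  extensions (\<open>fc_if_generic\<close>) instead of by manipulating conditions.\<close>

primrec satq :: "'a set \<Rightarrow> ('a \<Rightarrow> 'a \<Rightarrow> bool) \<Rightarrow> ('a \<Rightarrow> 'a \<Rightarrow> bool) \<Rightarrow> (nat \<Rightarrow> 'a) \<Rightarrow> fm \<Rightarrow> bool" where
  "satq C R Q e (Mem i j) = R (e i) (e j)"
| "satq C R Q e (Eq i j) = Q (e i) (e j)"
| "satq C R Q e (Neg A) = (\<not> satq C R Q e A)"
| "satq C R Q e (And A B) = (satq C R Q e A \<and> satq C R Q e B)"
| "satq C R Q e (All A) = (\<forall>x\<in>C. satq C R Q (case_nat x e) A)"

text \<open>The carrier and the interpretation of equality are parameters of \<open>satq\<close>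
  because the Henkin model and the class of names are at first only structures up to an equivalence
  relation.\<close>

abbreviation sat :: "('a \<Rightarrow> 'a \<Rightarrow> bool) \<Rightarrow> (nat \<Rightarrow> 'a) \<Rightarrow> fm \<Rightarrow> bool" where
  "sat E \<equiv> satq UNIV E (=)"

lemma satq_rename: "satq C R Q e (rename r A) = satq C R Q (\<lambda>i. e (r i)) A"
proof (induction A arbitrary: e r)
  case (All A)
  have "(\<lambda>i. case_nat x e (case_nat 0 (\<lambda>i. Suc (r i)) i)) = case_nat x (\<lambda>i. e (r i))" for x
    by (auto split: nat.split)
  then show ?case using All by simp
qed auto

lemma satq_cong:
  "bounded_by n A \<Longrightarrow> (\<And>i. i < n \<Longrightarrow> e i = e' i) \<Longrightarrow> satq C R Q e A = satq C R Q e' A"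
proof (induction A arbitrary: n e e')
  case (All A)
  have "satq C R Q (case_nat x e) A = satq C R Q (case_nat x e') A" for x
    by (rule All.IH[of "Suc n"]) (use All.prems in \<open>auto split: nat.split\<close>)
  then show ?case by simp
next
  case (Neg A)
  have "satq C R Q e A = satq C R Q e' A" by (rule Neg.IH[OF _ Neg.prems(2)]) (use Neg.prems(1) in simp)
  then show ?case by simp
next
  case (And A B)
  have "satq C R Q e A = satq C R Q e' A" by (rule And.IH(1)[OF _ And.prems(2)]) (use And.prems(1) in auto)
  moreover have "satq C R Q e B = satq C R Q e' B" by (rule And.IH(2)[OF _ And.prems(2)]) (use And.prems(1) in auto)
  ultimately show ?case by simp
qed simp_all

lemma bounded_by_mono: "bounded_by n A \<Longrightarrow> n \<le> m \<Longrightarrow> bounded_by m A"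
  by (induction A arbitrary: n m) auto

lemma bounded_by_ex: "\<exists>n. bounded_by n A"
proof (induction A)
  case (Mem i j) show ?case by (rule exI[of _ "Suc (max i j)"]) auto
next
  case (Eq i j) show ?case by (rule exI[of _ "Suc (max i j)"]) auto
next
  case (And A B)
  then obtain n m where "bounded_by n A" "bounded_by m B" by auto
  then have "bounded_by (max n m) (And A B)" using bounded_by_mono by auto
  then show ?case ..
next
  case (All A)
  then obtain n where "bounded_by n A" by auto
  then have "bounded_by n (All A)" using bounded_by_mono[of n A "Suc n"] by simp
  then show ?case ..
qed auto

lemma satq_inst: "satq C R Q e (inst A t) = satq C R Q (case_nat (e t) e) A"
proof -
  have "(\<lambda>i. e (case_nat t (\<lambda>i. i) i)) = case_nat (e t) e" by (auto split: nat.split)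
  then show ?thesis by (simp add: inst_def satq_rename)
qed

lemma soundness: "\<Gamma> \<turnstile> A \<Longrightarrow> (\<And>B. B \<in> \<Gamma> \<Longrightarrow> sat E e B) \<Longrightarrow> sat E e A"
proof (induction arbitrary: e rule: derives.induct)
  case (NegI A \<Gamma> B) then show ?case by (metis insert_iff satq.simps(3))
next
  case (NegE A \<Gamma> B) then show ?case by (metis insert_iff satq.simps(3))
next
  case (AllI \<Gamma> A)
  have "sat E (case_nat x e) A" for x
    by (rule AllI.IH) (use AllI.prems in \<open>auto simp: satq_rename\<close>)
  then show ?case by simp
next
  case (EqSubst \<Gamma> s t A)
  then have "e s = e t" "sat E (case_nat (e s) e) A" by (auto simp: satq_inst)
  then show ?case by (simp add: satq_inst)
next
  case (AllE \<Gamma> A t)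
  then have "sat E e (All A)" by blast
  then show ?case by (simp add: satq_inst)
qed simp_all

section \<open>Renaming and structural properties of derivations\<close>

lemma rename_rename: "rename r (rename s A) = rename (\<lambda>i. r (s i)) A"
proof (induction A arbitrary: r s)
  case (All A)
  have "(\<lambda>i. case_nat 0 (\<lambda>i. Suc (r i)) (case_nat 0 (\<lambda>i. Suc (s i)) i)) = case_nat 0 (\<lambda>i. Suc (r (s i)))"
    by (auto split: nat.split)
  then show ?case using All by simp
qed auto

lemma rename_id: "rename (\<lambda>i. i) A = A"
proof (induction A)
  case (All A)
  have "case_nat 0 (\<lambda>i. Suc i) = (\<lambda>i. i)" by (auto split: nat.split)
  then show ?case using All by simp
qed auto

text \<open>Upper bounds as in \<open>bounded_by\<close> do not suffice for the Henkin construction: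
  a theory may use infinitely many indices and still leave infinitely many free for
  witnesses.\<close>

primrec fv :: "fm \<Rightarrow> nat set" where
  "fv (Mem i j) = {i, j}"
| "fv (Eq i j) = {i, j}"
| "fv (Neg A) = fv A"
| "fv (And A B) = fv A \<union> fv B"
| "fv (All A) = {i. Suc i \<in> fv A}"

lemma finite_fv: "finite (fv A)"
proof (induction A)
  case (All A)
  then have "finite (Suc -` fv A)" by (intro finite_vimageI) auto
  then show ?case by (simp add: vimage_def)
qed auto

lemma rename_cong: "(\<And>i. i \<in> fv A \<Longrightarrow> r i = s i) \<Longrightarrow> rename r A = rename s A"
proof (induction A arbitrary: r s)
  case (All A)
  have "rename (case_nat 0 (\<lambda>i. Suc (r i))) A = rename (case_nat 0 (\<lambda>i. Suc (s i))) A"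
    by (rule All.IH) (use All.prems in \<open>auto split: nat.split\<close>)
  then show ?case by simp
next
  case (Neg A)
  have "rename r A = rename s A" by (rule Neg.IH) (use Neg.prems in simp)
  then show ?case by simp
next
  case (And A B)
  have "rename r A = rename s A" by (rule And.IH(1)) (use And.prems in simp)
  moreover have "rename r B = rename s B" by (rule And.IH(2)) (use And.prems in simp)
  ultimately show ?case by simp
qed simp_all

lemma fv_rename: "fv (rename r A) = r ` fv A"
proof (induction A arbitrary: r)
  case (All A)
  show ?case
  proof (intro set_eqI iffI)
    fix i assume "i \<in> fv (rename r (All A))"
    then obtain j where "j \<in> fv A" "Suc i = case_nat 0 (\<lambda>i. Suc (r i)) j" by (auto simp: All)
    then show "i \<in> r ` fv (All A)" by (cases j) auto
  next
    fix i assume "i \<in> r ` fv (All A)"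
    then obtain j where "Suc j \<in> fv A" "i = r j" by auto
    then have "Suc i \<in> case_nat 0 (\<lambda>i. Suc (r i)) ` fv A" by (metis image_eqI nat.case(2))
    then show "i \<in> fv (rename r (All A))" by (simp add: All)
  qed
qed auto

lemma rename_inst: "rename r (inst A t) = inst (rename (case_nat 0 (\<lambda>i. Suc (r i))) A) (r t)"
proof -
  have "(\<lambda>i. r (case_nat t (\<lambda>i. i) i)) = (\<lambda>i. case_nat (r t) (\<lambda>i. i) (case_nat 0 (\<lambda>i. Suc (r i)) i))"
    by (auto split: nat.split)
  then show ?thesis by (simp add: inst_def rename_rename)
qed

lemma derives_mono: "\<Gamma> \<turnstile> A \<Longrightarrow> \<Gamma> \<subseteq> \<Delta> \<Longrightarrow> \<Delta> \<turnstile> A"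
proof (induction arbitrary: \<Delta> rule: derives.induct)
  case (Assm A \<Gamma>) then show ?case by (meson derives.Assm subsetD)
next
  case AndI then show ?case by (meson derives.AndI)
next
  case AndE1 then show ?case by (meson derives.AndE1)
next
  case AndE2 then show ?case by (meson derives.AndE2)
next
  case NegI then show ?case by (meson derives.NegI insert_mono)
next
  case NegE then show ?case by (meson derives.NegE insert_mono)
next
  case AllI then show ?case by (meson derives.AllI image_mono)
next
  case AllE then show ?case by (meson derives.AllE)
next
  case EqRefl then show ?case by (meson derives.EqRefl)
next
  case EqSubst then show ?case by (meson derives.EqSubst)
qed

lemma derives_rename: "\<Gamma> \<turnstile> A \<Longrightarrow> rename r ` \<Gamma> \<turnstile> rename r A"
proof (induction arbitrary: r rule: derives.induct)
  case (Assm A \<Gamma>) then show ?case by (simp add: derives.Assm)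
next
  case AndI then show ?case by (simp add: derives.AndI)
next
  case AndE1 then show ?case by (metis derives.AndE1 rename.simps(4))
next
  case AndE2 then show ?case by (metis derives.AndE2 rename.simps(4))
next
  case (NegI A \<Gamma> B) then show ?case using derives.NegI[of "rename r A" "rename r ` \<Gamma>" "rename r B"] by simp
next
  case (NegE A \<Gamma> B) then show ?case using derives.NegE[of "rename r A" "rename r ` \<Gamma>" "rename r B"] by simp
next
  case (AllI \<Gamma> A)
  let ?r = "case_nat 0 (\<lambda>i. Suc (r i))"
  have "rename ?r ` rename Suc ` \<Gamma> = rename Suc ` rename r ` \<Gamma>"
    by (simp add: image_image rename_rename)
  then have "rename Suc ` rename r ` \<Gamma> \<turnstile> rename ?r A" using AllI.IH[of ?r] by metis
  then show ?case by (simp add: derives.AllI)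
next
  case (AllE \<Gamma> A t) then show ?case using derives.AllE by (simp add: rename_inst)
next
  case EqRefl then show ?case by (simp add: derives.EqRefl)
next
  case (EqSubst \<Gamma> s t A)
  then show ?case unfolding rename_inst using derives.EqSubst[of "rename r ` \<Gamma>" "r s" "r t"] by simp
qed

lemma derives_finite: "\<Gamma> \<turnstile> A \<Longrightarrow> \<exists>\<Delta>\<subseteq>\<Gamma>. finite \<Delta> \<and> \<Delta> \<turnstile> A"
proof (induction rule: derives.induct)
  case (Assm A \<Gamma>)
  then show ?case by (intro exI[of _ "{A}"]) (auto intro: derives.Assm)
next
  case (AndI \<Gamma> A B)
  then obtain D1 D2 where "D1 \<subseteq> \<Gamma>" "D2 \<subseteq> \<Gamma>" "finite D1" "finite D2" "D1 \<turnstile> A" "D2 \<turnstile> B" by blast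
  then show ?case
    by (intro exI[of _ "D1 \<union> D2"]) (auto intro!: derives.AndI elim: derives_mono)
next
  case AndE1 then show ?case by (meson derives.AndE1)
next
  case AndE2 then show ?case by (meson derives.AndE2)
next
  case (NegI A \<Gamma> B)
  then obtain D1 D2 where D: "D1 \<subseteq> insert A \<Gamma>" "D2 \<subseteq> insert A \<Gamma>" "finite D1" "finite D2" "D1 \<turnstile> B" "D2 \<turnstile> Neg B" by blast
  let ?D = "(D1 \<union> D2) - {A}"
  have "insert A ?D \<turnstile> B" "insert A ?D \<turnstile> Neg B" using D by (auto elim!: derives_mono)
  then have "?D \<turnstile> Neg A" by (rule derives.NegI)
  then show ?case using D by (intro exI[of _ ?D]) auto
next
  case (NegE A \<Gamma> B)
  then obtain D1 D2 where D: "D1 \<subseteq> insert (Neg A) \<Gamma>" "D2 \<subseteq> insert (Neg A) \<Gamma>" "finite D1" "finite D2" "D1 \<turnstile> B" "D2 \<turnstile> Neg B" by blast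
  let ?D = "(D1 \<union> D2) - {Neg A}"
  have "insert (Neg A) ?D \<turnstile> B" "insert (Neg A) ?D \<turnstile> Neg B" using D by (auto elim!: derives_mono)
  then have "?D \<turnstile> A" by (rule derives.NegE)
  then show ?case using D by (intro exI[of _ ?D]) auto
next
  case (AllI \<Gamma> A)
  then obtain D where D: "D \<subseteq> rename Suc ` \<Gamma>" "finite D" "D \<turnstile> A" by blast
  then obtain D' where "D' \<subseteq> \<Gamma>" "finite D'" "D = rename Suc ` D'" by (meson finite_subset_image)
  then show ?case using D derives.AllI by blast
next
  case AllE then show ?case by (meson derives.AllE)
next
  case EqRefl then show ?case by (meson derives.EqRefl empty_subsetI finite.emptyI)
next
  case (EqSubst \<Gamma> s t A)
  then obtain D1 D2 where "D1 \<subseteq> \<Gamma>" "D2 \<subseteq> \<Gamma>" "finite D1" "finite D2" "D1 \<turnstile> Eq s t" "D2 \<turnstile> inst A s" by blast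
  then show ?case
    by (intro exI[of _ "D1 \<union> D2"]) (auto intro!: derives.EqSubst[where s = s and t = t] elim: derives_mono)
qed

lemma derives_cut: "insert A \<Gamma> \<turnstile> B \<Longrightarrow> \<Gamma> \<turnstile> A \<Longrightarrow> \<Gamma> \<turnstile> B"
proof (rule derives.NegE[where B = A])
  assume 1: "insert A \<Gamma> \<turnstile> B" "\<Gamma> \<turnstile> A"
  show "insert (Neg B) \<Gamma> \<turnstile> A" using 1 by (auto elim: derives_mono)
  show "insert (Neg B) \<Gamma> \<turnstile> Neg A"
    by (rule derives.NegI[where B = B]) (use 1 in \<open>auto elim: derives_mono intro: derives.Assm\<close>)
qed

lemma generalization:
  assumes "\<Gamma> \<turnstile> inst B c" and c: "\<And>A. A \<in> \<Gamma> \<Longrightarrow> c \<notin> fv A" "c \<notin> fv (All B)"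
  shows "\<Gamma> \<turnstile> All B"
proof -
  let ?r = "\<lambda>i. if i = c then 0 else Suc i"
  have "rename ?r ` \<Gamma> = rename Suc ` \<Gamma>"
    using c(1) by (intro image_cong refl rename_cong) auto
  moreover have "rename ?r (inst B c) = B"
  proof -
    have "rename ?r (inst B c) = rename (\<lambda>i. i) B"
      unfolding inst_def rename_rename
      by (rule rename_cong) (use c(2) in \<open>auto split: nat.split\<close>)
    then show ?thesis by (simp add: rename_id)
  qed
  ultimately show ?thesis using derives_rename[OF assms(1), of ?r] by (metis derives.AllI)
qed

lemma inconsistent_insert: "\<not> consistent (insert A T) \<Longrightarrow> T \<turnstile> Neg A"
  unfolding consistent_def by (meson derives.NegI)

lemma inconsistent_insert_Neg: "\<not> consistent (insert (Neg A) T) \<Longrightarrow> T \<turnstile> A"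
  unfolding consistent_def by (meson derives.NegE)

lemma consistent_Union:
  assumes ch: "subset.chain {T. consistent T} \<C>" and ne: "\<C> \<noteq> {}"
  shows "consistent (\<Union>\<C>)"
proof (rule ccontr)
  assume "\<not> consistent (\<Union>\<C>)"
  then obtain A where A: "\<Union>\<C> \<turnstile> A" "\<Union>\<C> \<turnstile> Neg A" by (auto simp: consistent_def)
  obtain D1 D2 where D: "D1 \<subseteq> \<Union>\<C>" "finite D1" "D1 \<turnstile> A" "D2 \<subseteq> \<Union>\<C>" "finite D2" "D2 \<turnstile> Neg A"
    using derives_finite[OF A(1)] derives_finite[OF A(2)] by blast
  then obtain T where T: "T \<in> \<C>" "D1 \<union> D2 \<subseteq> T"
    using finite_subset_Union_chain[of "D1 \<union> D2" \<C> "{T. consistent T}"] ch ne by auto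
  then have "T \<turnstile> A" "T \<turnstile> Neg A" using D derives_mono by (meson le_sup_iff)+
  moreover have "consistent T" using ch T(1) by (auto simp: subset.chain_def)
  ultimately show False by (auto simp: consistent_def)
qed

section \<open>Henkin extensions and the completeness theorem\<close>

instance fm :: countable by countable_datatype

definition fresh :: "fm set \<Rightarrow> fm \<Rightarrow> nat" where
  "fresh T B = (SOME c. c \<notin> (\<Union>A\<in>T. fv A) \<union> fv (All B))"

text \<open>The formula added at stage \<open>n\<close> is the implication from \<open>B\<close> at
  the fresh variable to \<open>All B\<close>, so this variable is a counterexample whenever there is
  one. Every formula occurs as some \<open>from_nat n\<close>.\<close>

primrec henkin :: "fm set \<Rightarrow> nat \<Rightarrow> fm set" where
  "henkin T 0 = T"
| "henkin T (Suc n) = (let B = from_nat n in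
     insert (Neg (And (inst B (fresh (henkin T n) B)) (Neg (All B)))) (henkin T n))"

text \<open>Each stage uses up finitely many indices, so a fresh one always remains. An
  inconsistency would derive both \<open>inst B c\<close> and \<open>Neg (All B)\<close>, and
  generalization over the fresh \<open>c\<close> contradicts the latter.\<close>

lemma henkin_invariant:
  assumes "consistent T" "infinite (- (\<Union>A\<in>T. fv A))"
  shows "consistent (henkin T n) \<and> infinite (- (\<Union>A\<in>henkin T n. fv A))"
proof (induction n)
  case (Suc n)
  define B :: fm where "B = from_nat n"
  define H where "H = henkin T n"
  define c where "c = fresh H B"
  define F where "F = Neg (And (inst B c) (Neg (All B)))"
  have H: "consistent H" "infinite (- (\<Union>A\<in>H. fv A))" using Suc by (auto simp: H_def)
  have eq: "henkin T (Suc n) = insert F H" by (simp add: F_def H_def B_def c_def Let_def)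
  have "infinite (- (\<Union>A\<in>H. fv A) - fv (All B))"
    using H(2) finite_fv by (meson Diff_infinite_finite)
  then have "\<exists>c. c \<in> - (\<Union>A\<in>H. fv A) - fv (All B)" using infinite_imp_nonempty by blast
  then have c: "c \<notin> (\<Union>A\<in>H. fv A) \<union> fv (All B)"
    unfolding c_def fresh_def by (rule_tac someI_ex) auto
  have "consistent (insert F H)"
  proof (rule ccontr)
    assume "\<not> consistent (insert F H)"
    then have *: "H \<turnstile> And (inst B c) (Neg (All B))"
      unfolding F_def by (rule inconsistent_insert_Neg)
    have "H \<turnstile> All B" by (rule generalization[OF derives.AndE1[OF *]]) (use c in auto)
    then show False using H(1) derives.AndE2[OF *] by (auto simp: consistent_def)
  qed
  moreover have "infinite (- (\<Union>A\<in>insert F H. fv A))"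
  proof -
    have "infinite (- (\<Union>A\<in>H. fv A) - fv F)" using H(2) finite_fv by (meson Diff_infinite_finite)
    moreover have "- (\<Union>A\<in>insert F H. fv A) = - (\<Union>A\<in>H. fv A) - fv F" by auto
    ultimately show ?thesis by simp
  qed
  ultimately show ?case unfolding eq by blast
qed (use assms in auto)

lemma henkin_mono: "m \<le> n \<Longrightarrow> henkin T m \<subseteq> henkin T n"
  by (rule lift_Suc_mono_le) (auto simp: Let_def)

lemma consistent_rename_inj:
  assumes "consistent T" "\<And>i. s (r i) = i"
  shows "consistent (rename r ` T)"
proof (rule ccontr)
  assume "\<not> consistent (rename r ` T)"
  then obtain A where "rename r ` T \<turnstile> A" "rename r ` T \<turnstile> Neg A" by (auto simp: consistent_def)
  then have "rename s ` rename r ` T \<turnstile> rename s A" "rename s ` rename r ` T \<turnstile> Neg (rename s A)"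
    using derives_rename by (blast, metis derives_rename rename.simps(3))
  moreover have "rename s ` rename r ` T = T" by (simp add: image_image rename_rename assms(2) rename_id)
  ultimately show False using assms(1) by (auto simp: consistent_def)
qed

text \<open>Since the only terms are variables, a maximal consistent Henkin theory has a model whose
  elements are the variables, that is, the natural numbers. Provable equality becomes the relation
  \<open>Q\<close>; the quotient is taken separately.\<close>

theorem completeness:
  assumes "consistent T"
  shows "\<exists>(R :: nat \<Rightarrow> nat \<Rightarrow> bool) Q e. equivp Q \<and> (\<forall>x x' y y'. Q x x' \<longrightarrow> Q y y' \<longrightarrow> R x y \<longrightarrow> R x' y')
    \<and> (\<forall>A\<in>T. satq UNIV R Q e A)"
proof -
  \<comment> \<open>Moving all indices to the even ones keeps the odd ones available as Henkin
    witnesses.\<close>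
  define T' where "T' = rename (\<lambda>i. 2 * i) ` T"
  have "consistent T'" unfolding T'_def by (rule consistent_rename_inj[OF assms, where s = "\<lambda>i. i div 2"]) auto
  moreover have "infinite (- (\<Union>A\<in>T'. fv A))"
  proof -
    have "range (\<lambda>i. 2 * i + 1) \<subseteq> - (\<Union>A\<in>T'. fv A)"
      by (auto simp: T'_def fv_rename) presburger
    moreover have "infinite (range (\<lambda>i. 2 * i + 1 :: nat))" by (rule range_inj_infinite) (auto simp: inj_def)
    ultimately show ?thesis using infinite_super by blast
  qed
  ultimately have hk: "consistent (henkin T' n)" for n using henkin_invariant by blast
  define U where "U = \<Union>(range (henkin T'))"
  have "subset.chain {T. consistent T} (range (henkin T'))"
    unfolding subset_chain_def using hk henkin_mono nat_le_linear by (auto, meson subsetD)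
  then have U: "consistent U" unfolding U_def by (intro consistent_Union) auto
  have "\<exists>S\<in>{S. consistent S \<and> U \<subseteq> S}. \<forall>X\<in>{S. consistent S \<and> U \<subseteq> S}. S \<subseteq> X \<longrightarrow> X = S"
  proof (rule subset_Zorn_nonempty)
    fix \<C> assume C: "\<C> \<noteq> {}" "subset.chain {S. consistent S \<and> U \<subseteq> S} \<C>"
    then have "subset.chain {S. consistent S} \<C>" by (auto simp: subset.chain_def)
    then have "consistent (\<Union>\<C>)" using consistent_Union C(1) by blast
    moreover obtain X where "X \<in> \<C>" using C(1) by blast
    then have "U \<subseteq> \<Union>\<C>" using C(2) unfolding subset_chain_def by blast
    ultimately show "\<Union>\<C> \<in> {S. consistent S \<and> U \<subseteq> S}" by blast
  qed (use U in auto)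
  then obtain S where S: "consistent S" "U \<subseteq> S" and max: "\<And>X. consistent X \<Longrightarrow> S \<subseteq> X \<Longrightarrow> X = S" by auto
  have der: "A \<in> S" if "S \<turnstile> A" for A
  proof -
    have "S \<turnstile> B" if "insert A S \<turnstile> B" for B using derives_cut[OF that \<open>S \<turnstile> A\<close>] .
    then have "consistent (insert A S)" using S(1) unfolding consistent_def by metis
    then show ?thesis using max by blast
  qed
  have mem_iff: "A \<in> S \<longleftrightarrow> S \<turnstile> A" for A using der derives.Assm by blast
  have neg: "Neg A \<in> S \<longleftrightarrow> A \<notin> S" for A
  proof
    show "A \<notin> S" if "Neg A \<in> S" using that S(1) mem_iff by (auto simp: consistent_def)
    assume "A \<notin> S"
    then have "\<not> consistent (insert A S)" using max by blast
    then show "Neg A \<in> S" using inconsistent_insert mem_iff by blast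
  qed
  have con: "And A B \<in> S \<longleftrightarrow> A \<in> S \<and> B \<in> S" for A B
    using mem_iff by (meson derives.AndI derives.AndE1 derives.AndE2)
  have all: "All B \<in> S \<longleftrightarrow> (\<forall>t. inst B t \<in> S)" for B
  proof
    assume "All B \<in> S" then show "\<forall>t. inst B t \<in> S" using mem_iff derives.AllE by blast
  next
    assume *: "\<forall>t. inst B t \<in> S"
    \<comment> \<open>Stage \<open>to_nat B\<close> of the construction is the one that treats
      \<open>B\<close>.\<close>
    define n where "n = to_nat B"
    have "\<exists>c. Neg (And (inst B c) (Neg (All B))) \<in> henkin T' (Suc n)"
      by (auto simp: Let_def n_def)
    then obtain c where "Neg (And (inst B c) (Neg (All B))) \<in> henkin T' (Suc n)" by (rule exE)
    then have "Neg (And (inst B c) (Neg (All B))) \<in> S" using S(2) unfolding U_def by blast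
    then show "All B \<in> S" using * unfolding neg con by simp
  qed
  define Q where "Q = (\<lambda>x y. Eq x y \<in> S)"
  define R where "R = (\<lambda>x y. Mem x y \<in> S)"
  have subst: "inst A y \<in> S" if "Q x y" "inst A x \<in> S" for A x y
    using that unfolding Q_def mem_iff by (rule derives.EqSubst)
  have Qrefl: "Q x x" for x by (simp add: Q_def mem_iff derives.EqRefl)
  \<comment> \<open>In each instance of substitution, index 0 is the place that changes, and a
    successor index is a variable that stays fixed.\<close>
  have Qsym: "Q y x" if "Q x y" for x y
    using subst[OF that, of "Eq 0 (Suc x)"] Qrefl by (simp add: inst_def Q_def)
  have Qtrans: "Q x z" if "Q x y" "Q y z" for x y z
    using subst[OF that(2), of "Eq (Suc x) 0"] that by (simp add: inst_def Q_def)
  have equiv: "equivp Q" 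
    using Qrefl Qsym Qtrans by (intro equivpI reflpI sympI transpI) blast+
  have cong: "R x' y'" if "Q x x'" "Q y y'" "R x y" for x x' y y'
    using subst[OF that(1), of "Mem 0 (Suc y)"] subst[OF that(2), of "Mem (Suc x') 0"] that
    by (simp add: inst_def R_def)
  have truth: "satq UNIV R Q e A \<longleftrightarrow> rename e A \<in> S" for e A
  proof (induction A arbitrary: e)
    case (All A)
    have "inst (rename (case_nat 0 (\<lambda>i. Suc (e i))) A) t = rename (case_nat t e) A" for t
    proof -
      have "(\<lambda>i. case_nat t (\<lambda>i. i) (case_nat 0 (\<lambda>i. Suc (e i)) i)) = case_nat t e"
        by (auto split: nat.split)
      then show ?thesis by (simp add: inst_def rename_rename)
    qed
    then show ?case using All by (simp add: all)
  qed (auto simp: R_def Q_def neg con)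
  have "satq UNIV R Q (\<lambda>i. 2 * i) A" if "A \<in> T" for A
  proof -
    have "rename (\<lambda>i. 2 * i) A \<in> henkin T' 0" using that by (simp add: T'_def)
    then show ?thesis using S(2) truth unfolding U_def by blast
  qed
  then show ?thesis using equiv cong by blast
qed

text \<open>Singletons make the classes of \<open>Q\<close> a Dedekind-infinite set, so they can be indexed by \<^typ>\<open>nat\<close>.\<close>

theorem quotient_model:
  fixes C :: "nat set"
  assumes refl: "\<And>x. x \<in> C \<Longrightarrow> Q x x" and sym: "\<And>x y. Q x y \<Longrightarrow> Q y x"
    and trans: "\<And>x y z. Q x y \<Longrightarrow> Q y z \<Longrightarrow> Q x z"
    and cong: "\<And>x x' y y'. Q x x' \<Longrightarrow> Q y y' \<Longrightarrow> R x y \<Longrightarrow> R x' y'"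
    and empty: "\<exists>v\<in>C. \<forall>z\<in>C. \<not> R z v"
    and single: "\<And>x. x \<in> C \<Longrightarrow> \<exists>u\<in>C. \<forall>z\<in>C. R z u \<longleftrightarrow> Q z x"
  shows "\<exists>(E :: nat \<Rightarrow> nat \<Rightarrow> bool) h. h ` C = UNIV \<and> (\<forall>x\<in>C. \<forall>y\<in>C. h x = h y \<longleftrightarrow> Q x y)
    \<and> (\<forall>x\<in>C. \<forall>y\<in>C. E (h x) (h y) \<longleftrightarrow> R x y)
    \<and> (\<forall>A e. (\<forall>i. e i \<in> C) \<longrightarrow> (sat E (\<lambda>i. h (e i)) A \<longleftrightarrow> satq C R Q e A))"
proof -
  define cl where "cl x = {y\<in>C. Q x y}" for x
  have cl: "cl x = cl y \<longleftrightarrow> Q x y" if "x \<in> C" "y \<in> C" for x y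
    using that refl sym trans unfolding cl_def by blast
  obtain s where s: "\<And>x. x \<in> C \<Longrightarrow> s x \<in> C \<and> (\<forall>z\<in>C. R z (s x) \<longleftrightarrow> Q z x)" using single by metis
  obtain o' where o': "o' \<in> C" "\<And>z. z \<in> C \<Longrightarrow> \<not> R z o'" using empty by blast
  \<comment> \<open>The map from a class to the class of its singleton is injective and misses the
    class of the empty set \<open>o'\<close>; on a finite set an injective self-map would be
    onto.\<close>
  have "infinite (cl ` C)"
  proof
    assume fin: "finite (cl ` C)"
    define rp where "rp X = (SOME x. x \<in> C \<and> cl x = X)" for X
    have rp: "rp X \<in> C \<and> cl (rp X) = X" if "X \<in> cl ` C" for X
      unfolding rp_def by (rule someI_ex) (use that in auto)
    define f where "f X = cl (s (rp X))" for X
    have sub: "f ` cl ` C \<subseteq> cl ` C" using rp s by (auto simp: f_def)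
    have inj: "inj_on f (cl ` C)"
    proof (rule inj_onI)
      fix X Y assume X: "X \<in> cl ` C" and Y: "Y \<in> cl ` C" and "f X = f Y"
      then have "Q (s (rp X)) (s (rp Y))" using cl rp s by (auto simp: f_def)
      moreover have "R (rp X) (s (rp X))" using rp[OF X] s refl by blast
      ultimately have "R (rp X) (s (rp Y))" using cong refl rp[OF X] by blast
      then have "Q (rp X) (rp Y)" using s rp X Y by blast
      then show "X = Y" using cl rp X Y by metis
    qed
    have "f ` cl ` C = cl ` C" by (rule endo_inj_surj[OF fin sub inj])
    then obtain X where X: "X \<in> cl ` C" "f X = cl o'" using o'(1) by (metis (no_types, lifting) image_iff)
    then have "Q (s (rp X)) o'" using cl o' rp s by (auto simp: f_def)
    moreover have "R (rp X) (s (rp X))" using rp[OF X(1)] s refl by blast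
    ultimately have "R (rp X) o'" using cong refl rp[OF X(1)] by blast
    then show False using o' rp X by blast
  qed
  moreover have "countable (cl ` C)" by (simp add: countable_subset)
  ultimately have bij: "bij_betw (to_nat_on (cl ` C)) (cl ` C) UNIV" by (simp add: to_nat_on_infinite)
  define h where "h x = to_nat_on (cl ` C) (cl x)" for x
  have h1: "h ` C = UNIV" using bij unfolding h_def bij_betw_def by (metis image_image)
  have h2: "h x = h y \<longleftrightarrow> Q x y" if "x \<in> C" "y \<in> C" for x y
  proof -
    have "h x = h y \<longleftrightarrow> cl x = cl y"
      unfolding h_def using bij that by (auto simp: bij_betw_def dest: inj_onD)
    then show ?thesis using cl[OF that] by simp
  qed
  define E where "E a b \<longleftrightarrow> (\<exists>x\<in>C. \<exists>y\<in>C. a = h x \<and> b = h y \<and> R x y)" for a b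
  have h3: "E (h x) (h y) \<longleftrightarrow> R x y" if "x \<in> C" "y \<in> C" for x y
  proof
    assume "E (h x) (h y)"
    then obtain u v where "u \<in> C" "v \<in> C" "h x = h u" "h y = h v" "R u v" unfolding E_def by blast
    then show "R x y" using h2 that cong[of u x v y] by metis
  next
    assume "R x y" then show "E (h x) (h y)" using that unfolding E_def by blast
  qed
  have "sat E (\<lambda>i. h (e i)) A \<longleftrightarrow> satq C R Q e A" if "\<forall>i. e i \<in> C" for A e
    using that
  proof (induction A arbitrary: e)
    case (All A)
    have "sat E (case_nat (h x) (\<lambda>i. h (e i))) A = satq C R Q (case_nat x e) A" if "x \<in> C" for x
    proof -
      have "case_nat (h x) (\<lambda>i. h (e i)) = (\<lambda>i. h (case_nat x e i))" by (auto split: nat.split)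
      moreover have "\<forall>i. case_nat x e i \<in> C" using that All.prems by (auto split: nat.split)
      ultimately show ?thesis using All.IH[of "case_nat x e"] by simp
    qed
    moreover have "(\<forall>a. \<phi> a) \<longleftrightarrow> (\<forall>x\<in>C. \<phi> (h x))" for \<phi> using h1 by (metis UNIV_I imageE)
    ultimately show ?case by simp
  qed (simp_all add: h2 h3)
  then show ?thesis using h1 h2 h3 by (intro exI[of _ E] exI[of _ h]) auto
qed

section \<open>Definable predicates\<close>

lemma case_nat_tail: "case_nat (e 0) (\<lambda>i. e (Suc i)) = e"
  by (rule ext) (simp split: nat.split)

lemma case_nat_tail2: "case_nat (e 0) (case_nat (e (Suc 0)) (\<lambda>i. e (Suc (Suc i)))) = e"
  by (rule ext) (simp split: nat.split)

definition mix :: "(nat \<Rightarrow> 'a) \<Rightarrow> (nat \<Rightarrow> 'a) \<Rightarrow> nat \<Rightarrow> 'a" where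
  "mix e c i = (if even i then e (i div 2) else c (i div 2))"

lemma mix_even [simp]: "mix e c (2 * i) = e i"
  and mix_odd [simp]: "mix e c (Suc (2 * i)) = c i"
  by (simp_all add: mix_def)

text \<open>Separation, replacement, induction and recursion in a model apply to definable
  predicates only. With these rules the side condition is discharged along the syntax of the
  expression by \<open>intro dfns\<close>.\<close>

named_theorems dfns

locale set_structure =
  fixes E :: "'a \<Rightarrow> 'a \<Rightarrow> bool" (infix "\<epsilon>" 50)
begin

text \<open>First-order definability with parameters: the even indices are the arguments, the odd ones the parameters.\<close>

definition dfn :: "((nat \<Rightarrow> 'a) \<Rightarrow> bool) \<Rightarrow> bool" where
  "dfn P \<longleftrightarrow> (\<exists>A c. \<forall>e. P e \<longleftrightarrow> sat E (mix e c) A)"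

definition dfnt :: "((nat \<Rightarrow> 'a) \<Rightarrow> 'a) \<Rightarrow> bool" where
  "dfnt t \<longleftrightarrow> dfn (\<lambda>e. e 0 = t (\<lambda>i. e (Suc i)))"

lemma dfnI: "(\<And>e. P e \<longleftrightarrow> sat E (mix e c) A) \<Longrightarrow> dfn P"
  unfolding dfn_def by blast

lemma dfn_ren:
  assumes "dfn P" shows "dfn (\<lambda>e. P (\<lambda>i. e (r i)))"
proof -
  obtain A c where A: "\<And>e. P e \<longleftrightarrow> sat E (mix e c) A" using assms unfolding dfn_def by blast
  let ?s = "\<lambda>i. if even i then 2 * r (i div 2) else i"
  have "(\<lambda>i. mix e c (?s i)) = mix (\<lambda>i. e (r i)) c" for e by (auto simp: mix_def)
  then show ?thesis by (intro dfnI[of _ c "rename ?s A"]) (simp add: A satq_rename)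
qed

text \<open>Turns all arguments from \<open>k\<close> on into parameters. This is how a predicate
  with a whole environment as argument becomes a unary or binary one, as the schemata
  require.\<close>

lemma dfn_fix:
  assumes "dfn P" shows "dfn (\<lambda>e. P (\<lambda>i. if i < k then e i else d i))"
proof -
  obtain A c where A: "\<And>e. P e \<longleftrightarrow> sat E (mix e c) A" using assms unfolding dfn_def by blast
  \<comment> \<open>The new parameter sequence \<open>mix d c\<close> holds \<open>d\<close> at even
    and \<open>c\<close> at odd positions, hence the doubly coded indices.\<close>
  let ?s = "\<lambda>i. if even i then if i div 2 < k then i else Suc (2 * (2 * (i div 2))) else Suc (2 * (Suc (2 * (i div 2))))"
  have "(\<lambda>i. mix e (mix d c) (?s i)) = mix (\<lambda>i. if i < k then e i else d i) c" for e
    by (rule ext) (simp add: mix_def)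
  then show ?thesis by (intro dfnI[of _ "mix d c" "rename ?s A"]) (simp add: A satq_rename)
qed

lemma dfn_not [dfns]:
  assumes "dfn P" shows "dfn (\<lambda>e. \<not> P e)"
proof -
  obtain A c where A: "\<And>e. P e \<longleftrightarrow> sat E (mix e c) A" using assms unfolding dfn_def by blast
  then show ?thesis by (intro dfnI[of _ c "Neg A"]) simp
qed

lemma dfn_and [dfns]:
  assumes "dfn P" "dfn Q" shows "dfn (\<lambda>e. P e \<and> Q e)"
proof -
  obtain A c where A: "\<And>e. P e \<longleftrightarrow> sat E (mix e c) A" using assms(1) unfolding dfn_def by blast
  obtain B d where B: "\<And>e. Q e \<longleftrightarrow> sat E (mix e d) B" using assms(2) unfolding dfn_def by blast
  let ?s = "\<lambda>i. if even i then i else Suc (2 * (2 * (i div 2)))"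
  let ?t = "\<lambda>i. if even i then i else Suc (2 * (Suc (2 * (i div 2))))"
  have "(\<lambda>i. mix e (mix c d) (?s i)) = mix e c" "(\<lambda>i. mix e (mix c d) (?t i)) = mix e d" for e
    by (rule ext; simp add: mix_def; presburger?; auto elim!: oddE)+
  then show ?thesis
    by (intro dfnI[of _ "mix c d" "And (rename ?s A) (rename ?t B)"]) (simp add: A B satq_rename)
qed

lemma dfn_or [dfns]:
  assumes "dfn P" "dfn Q" shows "dfn (\<lambda>e. P e \<or> Q e)"
  using dfn_not[OF dfn_and[OF dfn_not[OF assms(1)] dfn_not[OF assms(2)]]] by simp

lemma dfn_imp [dfns]:
  assumes "dfn P" "dfn Q" shows "dfn (\<lambda>e. P e \<longrightarrow> Q e)"
  using dfn_or[OF dfn_not[OF assms(1)] assms(2)] by simp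

lemma dfn_iff [dfns]: "dfn P \<Longrightarrow> dfn Q \<Longrightarrow> dfn (\<lambda>e. P e \<longleftrightarrow> Q e)"
  unfolding iff_conv_conj_imp by (intro dfn_and dfn_imp)

lemma dfn_all [dfns]:
  assumes "dfn (\<lambda>e. P (e 0) (\<lambda>i. e (Suc i)))" shows "dfn (\<lambda>e. \<forall>x. P x e)"
proof -
  obtain A c where A: "\<And>e. P (e 0) (\<lambda>i. e (Suc i)) \<longleftrightarrow> sat E (mix e c) A" using assms unfolding dfn_def by blast
  have A': "P x e \<longleftrightarrow> sat E (mix (case_nat x e) c) A" for x e using A[of "case_nat x e"] by simp
  \<comment> \<open>A quantifier moves every index of \<open>mix e c\<close> up by one, whereas a
    new first argument moves the other arguments, at even indices, up by two. So an even index
    \<open>i > 0\<close> corresponds to the old index \<open>i - 2\<close>, shifted by one.\<close>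
  let ?s = "\<lambda>i. if i = 0 then 0 else if even i then Suc (i - 2) else Suc i"
  have "case_nat x (mix e c) (?s i) = mix (case_nat x e) c i" for x e i
    by (cases "i = 0"; cases "even i") (auto elim!: evenE oddE simp: mix_def split: nat.split)
  then show ?thesis by (intro dfnI[of _ c "All (rename ?s A)"]) (simp add: A' satq_rename)
qed

lemma dfn_ex [dfns]:
  assumes "dfn (\<lambda>e. P (e 0) (\<lambda>i. e (Suc i)))" shows "dfn (\<lambda>e. \<exists>x. P x e)"
  using dfn_not[OF dfn_all[of "\<lambda>x e. \<not> P x e", OF dfn_not[OF assms]]] by simp

lemma dfn_sat: "dfn (\<lambda>e. sat E e A)"
proof (rule dfnI[of _ "\<lambda>_. undefined" "rename (\<lambda>i. 2 * i) A"])
  fix e show "sat E e A = sat E (mix e (\<lambda>_. undefined)) (rename (\<lambda>i. 2 * i) A)" by (simp add: satq_rename)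
qed

lemma dfn_const [dfns]: "dfn (\<lambda>e. b)"
  by (cases b) (use dfn_sat[of "Eq 0 0"] dfn_sat[of "Neg (Eq 0 0)"] in simp_all)

lemma dfnt_var [dfns]: "dfnt (\<lambda>e. e i)"
  unfolding dfnt_def using dfn_sat[of "Eq 0 (Suc i)"] by simp

lemma dfnt_const [dfns]: "dfnt (\<lambda>e. a)"
  unfolding dfnt_def by (intro dfnI[of _ "\<lambda>_. a" "Eq 0 1"]) (simp add: mix_def)

lemma dfnt_ren: "dfnt t \<Longrightarrow> dfnt (\<lambda>e. t (\<lambda>i. e (r i)))"
  unfolding dfnt_def by (drule dfn_ren[of _ "case_nat 0 (\<lambda>i. Suc (r i))"]) simp

text \<open>The formal language has no terms besides variables, so a definable operation is
  substituted by quantifying over its value.\<close>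

lemma dfn_subst:
  assumes "dfnt s" "dfn (\<lambda>e. P (e 0) (\<lambda>i. e (Suc i)))" shows "dfn (\<lambda>e. P (s e) e)"
proof -
  have "dfn (\<lambda>e. \<exists>u. u = s e \<and> P u e)"
    by (intro dfn_ex dfn_and assms(2) assms(1)[unfolded dfnt_def])
  then show ?thesis by simp
qed

lemma dfn1:
  assumes "dfn (\<lambda>e. Q (e 0))" "dfnt s" shows "dfn (\<lambda>e. Q (s e))"
  using dfn_subst[of s "\<lambda>u e. Q u", OF assms(2) assms(1)] .

lemma dfn2:
  assumes Q: "dfn (\<lambda>e. Q (e 0) (e 1))" and s: "dfnt s" and t: "dfnt t" shows "dfn (\<lambda>e. Q (s e) (t e))"
proof -
  have "dfn (\<lambda>e. Q (e 0) (t (\<lambda>i. e (Suc i))))"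
    by (rule dfn_subst[of "\<lambda>e. t (\<lambda>i. e (Suc i))" "\<lambda>u e. Q (e 0) u", OF dfnt_ren[OF t]])
      (use dfn_ren[OF Q, of "\<lambda>i. if i = 0 then 1 else 0"] in simp)
  then show ?thesis by (rule dfn_subst[of s "\<lambda>u e. Q u (t e)", OF s])
qed

lemma dfn3:
  assumes Q: "dfn (\<lambda>e. Q (e 0) (e 1) (e 2))" and s: "dfnt s" and t: "dfnt t" and v: "dfnt v"
  shows "dfn (\<lambda>e. Q (s e) (t e) (v e))"
proof -
  have 1: "dfn (\<lambda>e. Q (e 2) (e 1) (e 0))" using dfn_ren[OF Q, of "\<lambda>i. 2 - i"] by simp
  have "dfn (\<lambda>e. Q (e 1) (e 0) (v (\<lambda>i. e (Suc (Suc i)))))"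
    by (rule dfn_subst[of "\<lambda>e. v (\<lambda>i. e (Suc (Suc i)))" "\<lambda>u e. Q (e 1) (e 0) u", OF dfnt_ren[OF v]])
      (use 1 in \<open>simp add: numeral_2_eq_2\<close>)
  then have "dfn (\<lambda>e. Q (e 0) (t (\<lambda>i. e (Suc i))) (v (\<lambda>i. e (Suc i))))"
    by (intro dfn_subst[of "\<lambda>e. t (\<lambda>i. e (Suc i))" "\<lambda>u e. Q (e 0) u (v (\<lambda>i. e (Suc i)))", OF dfnt_ren[OF t]]) simp
  then show ?thesis by (rule dfn_subst[of s "\<lambda>u e. Q u (t e) (v e)", OF s])
qed

lemma dfn4:
  assumes Q: "dfn (\<lambda>e. Q (e 0) (e 1) (e 2) (e 3))" and s: "dfnt s" and t: "dfnt t" and v: "dfnt v" and w: "dfnt w"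
  shows "dfn (\<lambda>e. Q (s e) (t e) (v e) (w e))"
proof -
  have 1: "dfn (\<lambda>e. Q (e 3) (e 2) (e 1) (e 0))" using dfn_ren[OF Q, of "\<lambda>i. 3 - i"] by simp
  have 2: "dfn (\<lambda>e. Q (e 2) (e 1) (e 0) (w (\<lambda>i. e (Suc (Suc (Suc i))))))"
    by (rule dfn_subst[of "\<lambda>e. w (\<lambda>i. e (Suc (Suc (Suc i))))" "\<lambda>u e. Q (e 2) (e 1) (e 0) u", OF dfnt_ren[OF w]])
      (use 1 in \<open>simp add: numeral_2_eq_2 numeral_3_eq_3\<close>)
  have "dfn (\<lambda>e. Q (e 1) (e 0) (v (\<lambda>i. e (Suc (Suc i)))) (w (\<lambda>i. e (Suc (Suc i)))))"
    by (rule dfn_subst[of "\<lambda>e. v (\<lambda>i. e (Suc (Suc i)))" "\<lambda>u e. Q (e 1) (e 0) u (w (\<lambda>i. e (Suc (Suc i))))", OF dfnt_ren[OF v]])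
      (use 2 in \<open>simp add: numeral_2_eq_2\<close>)
  then have "dfn (\<lambda>e. Q (e 0) (t (\<lambda>i. e (Suc i))) (v (\<lambda>i. e (Suc i))) (w (\<lambda>i. e (Suc i))))"
    by (intro dfn_subst[of "\<lambda>e. t (\<lambda>i. e (Suc i))" "\<lambda>u e. Q (e 0) u (v (\<lambda>i. e (Suc i))) (w (\<lambda>i. e (Suc i)))", OF dfnt_ren[OF t]]) simp
  then show ?thesis by (rule dfn_subst[of s "\<lambda>u e. Q u (t e) (v e) (w e)", OF s])
qed

lemma dfn_mem [dfns]: "dfnt s \<Longrightarrow> dfnt t \<Longrightarrow> dfn (\<lambda>e. s e \<epsilon> t e)"
  by (rule dfn2) (use dfn_sat[of "Mem 0 1"] in simp_all)

lemma dfn_eq [dfns]: "dfnt s \<Longrightarrow> dfnt t \<Longrightarrow> dfn (\<lambda>e. s e = t e)"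
  by (rule dfn2) (use dfn_sat[of "Eq 0 1"] in simp_all)

lemma dfnt1: "dfn (\<lambda>e. e 0 = F (e 1)) \<Longrightarrow> dfnt s \<Longrightarrow> dfnt (\<lambda>e. F (s e))"
  unfolding dfnt_def[of "\<lambda>e. F (s e)"]
  by (rule dfn2[of "\<lambda>a b. a = F b"]) (auto intro: dfnt_var dfnt_ren)

lemma dfnt2: "dfn (\<lambda>e. e 0 = F (e 1) (e 2)) \<Longrightarrow> dfnt s \<Longrightarrow> dfnt t \<Longrightarrow> dfnt (\<lambda>e. F (s e) (t e))"
  unfolding dfnt_def[of "\<lambda>e. F (s e) (t e)"]
  by (rule dfn3[of "\<lambda>a b c. a = F b c"]) (auto intro: dfnt_var dfnt_ren)

lemma dfnt3: "dfn (\<lambda>e. e 0 = F (e 1) (e 2) (e 3)) \<Longrightarrow> dfnt s \<Longrightarrow> dfnt t \<Longrightarrow> dfnt v \<Longrightarrow> dfnt (\<lambda>e. F (s e) (t e) (v e))"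
  unfolding dfnt_def[of "\<lambda>e. F (s e) (t e) (v e)"]
  by (rule dfn4[of "\<lambda>a b c d. a = F b c d"]) (auto intro: dfnt_var dfnt_ren)

lemma dfnt_app: "dfnt (\<lambda>e. F (e 0)) \<Longrightarrow> dfnt s \<Longrightarrow> dfnt (\<lambda>e. F (s e))"
  by (rule dfnt1) (simp_all add: dfnt_def)

lemma dfnt_app2: "dfnt (\<lambda>e. F (e 0) (e 1)) \<Longrightarrow> dfnt s \<Longrightarrow> dfnt t \<Longrightarrow> dfnt (\<lambda>e. F (s e) (t e))"
  by (rule dfnt2) (simp_all add: dfnt_def numeral_2_eq_2)

lemma dfnt_app3: "dfnt (\<lambda>e. F (e 0) (e 1) (e 2)) \<Longrightarrow> dfnt s \<Longrightarrow> dfnt t \<Longrightarrow> dfnt v \<Longrightarrow> dfnt (\<lambda>e. F (s e) (t e) (v e))"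
  by (rule dfnt3) (simp_all add: dfnt_def numeral_2_eq_2 numeral_3_eq_3)

lemma dfn_at: "dfn (\<lambda>e. P (e 0) (\<lambda>i. e (Suc i))) \<Longrightarrow> dfn (\<lambda>e. P (e 0) d)"
  by (drule dfn_fix[of _ 1 "case_nat undefined d"]) simp

lemma dfn_at2: "dfn (\<lambda>e. P (e 0) (e 1) (\<lambda>i. e (Suc (Suc i)))) \<Longrightarrow> dfn (\<lambda>e. P (e 0) (e 1) d)"
  by (drule dfn_fix[of _ 2 "case_nat undefined (case_nat undefined d)"]) simp

end

section \<open>Satisfaction of formulas written with levels\<close>

text \<open>The de Bruijn environment belonging to the values \<open>v\<close> of the
  \<open>d\<close> levels in scope; indices beyond these read the outer environment
  \<open>z\<close>.\<close>

definition env :: "(nat \<Rightarrow> 'a) \<Rightarrow> (nat \<Rightarrow> 'a) \<Rightarrow> nat \<Rightarrow> nat \<Rightarrow> 'a" where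
  "env z v d i = (if i < d then v (d - Suc i) else z (i - d))"

definition tv :: "('a \<Rightarrow> 'a \<Rightarrow> bool) \<Rightarrow> (nat \<Rightarrow> 'a) \<Rightarrow> (nat \<Rightarrow> 'a) \<Rightarrow> nat \<Rightarrow> lfm \<Rightarrow> bool" where
  "tv E z v d F = sat E (env z v d) (F d)"

lemma env_0 [simp]: "env z v 0 = z"
  by (auto simp: env_def)

lemma env_Suc: "case_nat a (env z v d) = env z (v(d := a)) (Suc d)"
  by (rule ext) (auto simp: env_def split: nat.split)

lemma env_level: "x < d \<Longrightarrow> env z v d (d - Suc x) = v x"
  by (simp add: env_def)

text \<open>A level keeps its value under further quantifiers, in contrast to an index. Hence
  concrete formulas are evaluated by rewriting alone.\<close>

lemma tv_simps [simp]:
  "x < d \<Longrightarrow> y < d \<Longrightarrow> tv E z v d (x \<^bold>\<in> y) \<longleftrightarrow> E (v x) (v y)"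
  "x < d \<Longrightarrow> y < d \<Longrightarrow> tv E z v d (x \<^bold>= y) \<longleftrightarrow> v x = v y"
  "tv E z v d (\<^bold>\<not> F) \<longleftrightarrow> \<not> tv E z v d F"
  "tv E z v d (F \<^bold>\<and> G) \<longleftrightarrow> tv E z v d F \<and> tv E z v d G"
  "tv E z v d (F \<^bold>\<or> G) \<longleftrightarrow> tv E z v d F \<or> tv E z v d G"
  "tv E z v d (F \<^bold>\<longrightarrow> G) \<longleftrightarrow> (tv E z v d F \<longrightarrow> tv E z v d G)"
  "tv E z v d (F \<^bold>\<longleftrightarrow> G) \<longleftrightarrow> (tv E z v d F \<longleftrightarrow> tv E z v d G)"
  "tv E z v d (all Q) \<longleftrightarrow> (\<forall>a. tv E z (v(d := a)) (Suc d) (Q d))"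
  "tv E z v d (ex Q) \<longleftrightarrow> (\<exists>a. tv E z (v(d := a)) (Suc d) (Q d))"
  by (auto simp: tv_def mem_def eq_def neg_def con_def dis_def imp_def iff_def all_def ex_def env_level env_Suc)

lemma tv_at_levels:
  "bounded_by n A \<Longrightarrow> (\<And>i. i < n \<Longrightarrow> \<rho> i < d) \<Longrightarrow> tv E z v d (at_levels A \<rho>) \<longleftrightarrow> sat E (\<lambda>i. v (\<rho> i)) A"
  unfolding tv_def at_levels_def satq_rename by (rule satq_cong) (auto simp: env_level)

lemma sat_0: "sat E z (F 0) = tv E z v 0 F"
  by (simp add: tv_def)

lemma sat_All_pow:
  "sat E (env z v m) ((All ^^ n) A) \<longleftrightarrow> (\<forall>v'. (\<forall>i<m. v' i = v i) \<longrightarrow> sat E (env z v' (m + n)) A)"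
proof (induction n arbitrary: m v)
  case 0
  have "env z v' m = env z v m" if "\<forall>i<m. v' i = v i" for v'
    using that by (auto simp: env_def)
  then show ?case by (simp only: funpow_0 add_0_right) metis
next
  case (Suc n)
  have "sat E (env z v m) ((All ^^ Suc n) A) \<longleftrightarrow>
    (\<forall>a v'. (\<forall>i<Suc m. v' i = (v(m := a)) i) \<longrightarrow> sat E (env z v' (Suc m + n)) A)"
    by (simp add: env_Suc Suc.IH)
  also have "\<dots> \<longleftrightarrow> (\<forall>v'. (\<forall>i<m. v' i = v i) \<longrightarrow> sat E (env z v' (m + Suc n)) A)"
    by (auto simp: less_Suc_eq)
  finally show ?case .
qed

lemma sat_All_pow_0: "sat E z ((All ^^ n) (F n)) \<longleftrightarrow> (\<forall>v. tv E z v n F)"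
  using sat_All_pow[of E z z 0 n] by (simp add: tv_def)

lemma sat_separation:
  assumes "bounded_by (n + 1) A"
  shows "sat E z (separation n A) \<longleftrightarrow> (\<forall>v a. \<exists>b. \<forall>x. E x b \<longleftrightarrow> E x a \<and> sat E (case_nat x v) A)"
proof -
  have *: "tv E z (v(n := a, Suc n := b, Suc (Suc n) := x)) (Suc (Suc (Suc n))) (at_levels A (case_nat (Suc (Suc n)) (\<lambda>i. i)))
    \<longleftrightarrow> sat E (case_nat x v) A" for v a b x
  proof -
    have "tv E z (v(n := a, Suc n := b, Suc (Suc n) := x)) (Suc (Suc (Suc n))) (at_levels A (case_nat (Suc (Suc n)) (\<lambda>i. i)))
      \<longleftrightarrow> sat E (\<lambda>i. (v(n := a, Suc n := b, Suc (Suc n) := x)) (case_nat (Suc (Suc n)) (\<lambda>i. i) i)) A"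
      by (rule tv_at_levels[OF assms]) (auto split: nat.split)
    also have "\<dots> \<longleftrightarrow> sat E (case_nat x v) A"
      by (rule satq_cong[OF assms]) (auto split: nat.split)
    finally show ?thesis .
  qed
  show ?thesis unfolding separation_def sat_All_pow_0 by (simp add: *)
qed

lemma sat_replacement:
  assumes "bounded_by (n + 2) A"
  shows "sat E z (replacement n A) \<longleftrightarrow> (\<forall>v a. (\<forall>x. E x a \<longrightarrow> (\<forall>y y'. sat E (case_nat x (case_nat y v)) A \<and> sat E (case_nat x (case_nat y' v)) A \<longrightarrow> y = y'))
    \<longrightarrow> (\<exists>b. \<forall>y. E y b \<longleftrightarrow> (\<exists>x. E x a \<and> sat E (case_nat x (case_nat y v)) A)))"
proof -
  have *: "tv E z v' d (at_levels A (case_nat x (case_nat y (\<lambda>i. i)))) \<longleftrightarrow> sat E (case_nat (v' x) (case_nat (v' y) v)) A"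
    if "x < d" "y < d" "n \<le> d" "\<forall>i<n. v' i = v i" for v v' d x y
  proof -
    have "tv E z v' d (at_levels A (case_nat x (case_nat y (\<lambda>i. i))))
      \<longleftrightarrow> sat E (\<lambda>i. v' (case_nat x (case_nat y (\<lambda>i. i)) i)) A"
      by (rule tv_at_levels[OF assms]) (use that in \<open>auto split: nat.split\<close>)
    also have "\<dots> \<longleftrightarrow> sat E (case_nat (v' x) (case_nat (v' y) v)) A"
      by (rule satq_cong[OF assms]) (use that in \<open>auto split: nat.split\<close>)
    finally show ?thesis .
  qed
  show ?thesis unfolding replacement_def Let_def sat_All_pow_0
    apply (rule all_cong1)
    subgoal for v by (simp add: *[where v = v])
    done
qed

section \<open>Models of ZF\<close>

text \<open>The schemata speak of definable predicates instead of formulas, so that proofs inside a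
  model stay free of syntax. \<open>zf_if_sat_ZF\<close> and \<open>sat_ZF\<close> give the
  equivalence with the axioms.\<close>

locale zf = set_structure +
  assumes ext: "\<And>x y. (\<And>z. z \<epsilon> x \<longleftrightarrow> z \<epsilon> y) \<Longrightarrow> x = y"
    and found: "\<And>x. \<exists>y. y \<epsilon> x \<Longrightarrow> \<exists>y. y \<epsilon> x \<and> \<not> (\<exists>z. z \<epsilon> x \<and> z \<epsilon> y)"
    and upair_ex: "\<And>x y. \<exists>u. \<forall>z. z \<epsilon> u \<longleftrightarrow> z = x \<or> z = y"
    and union_ex: "\<And>x. \<exists>u. \<forall>z. z \<epsilon> u \<longleftrightarrow> (\<exists>y. y \<epsilon> x \<and> z \<epsilon> y)"
    and pow_ex: "\<And>x. \<exists>u. \<forall>z. z \<epsilon> u \<longleftrightarrow> (\<forall>t. t \<epsilon> z \<longrightarrow> t \<epsilon> x)"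
    and inf_ex: "\<exists>I. (\<exists>o'. o' \<epsilon> I \<and> \<not> (\<exists>z. z \<epsilon> o')) \<and> (\<forall>x. x \<epsilon> I \<longrightarrow> (\<exists>s. s \<epsilon> I \<and> (\<forall>z. z \<epsilon> s \<longleftrightarrow> z \<epsilon> x \<or> z = x)))"
    and sep_ex: "\<And>\<phi> a. dfn (\<lambda>e. \<phi> (e 0)) \<Longrightarrow> \<exists>b. \<forall>x. x \<epsilon> b \<longleftrightarrow> x \<epsilon> a \<and> \<phi> x"
    and rep_ex: "\<And>\<psi> a. dfn (\<lambda>e. \<psi> (e 0) (e 1)) \<Longrightarrow> (\<And>x y y'. x \<epsilon> a \<Longrightarrow> \<psi> x y \<Longrightarrow> \<psi> x y' \<Longrightarrow> y = y')
      \<Longrightarrow> \<exists>b. \<forall>y. y \<epsilon> b \<longleftrightarrow> (\<exists>x. x \<epsilon> a \<and> \<psi> x y)"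

lemmas finite_axiom_defs = extensionality_def foundation_def pairing_def union_def powerset_def infinity_def
  is_upair_def subset_def is_inductive_def is_empty_def is_succ_def

context set_structure
begin

lemma dfn_unary:
  assumes "dfn (\<lambda>e. \<phi> (e 0))" shows "\<exists>A c. \<forall>x. \<phi> x \<longleftrightarrow> sat E (case_nat x c) A"
proof -
  obtain A c where A: "\<And>e. \<phi> (e 0) \<longleftrightarrow> sat E (mix e c) A" using assms unfolding dfn_def by blast
  have "\<phi> x \<longleftrightarrow> sat E (case_nat x c) (rename (\<lambda>i. if even i then 0 else Suc (i div 2)) A)" for x
  proof -
    have "(\<lambda>i. case_nat x c (if even i then 0 else Suc (i div 2))) = mix (\<lambda>_. x) c" by (auto simp: mix_def)
    then show ?thesis using A[of "\<lambda>_. x"] by (simp add: satq_rename)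
  qed
  then show ?thesis by blast
qed

lemma dfn_binary:
  assumes "dfn (\<lambda>e. \<psi> (e 0) (e 1))" shows "\<exists>A c. \<forall>x y. \<psi> x y \<longleftrightarrow> sat E (case_nat x (case_nat y c)) A"
proof -
  obtain A c where A: "\<And>e. \<psi> (e 0) (e 1) \<longleftrightarrow> sat E (mix e c) A" using assms unfolding dfn_def by blast
  define r where "r = (\<lambda>i :: nat. if even i then if i = 0 then 0 else 1 else Suc (Suc (i div 2)))"
  have "\<psi> x y \<longleftrightarrow> sat E (case_nat x (case_nat y c)) (rename r A)" for x y
  proof -
    have "(\<lambda>i. case_nat x (case_nat y c) (r i)) = mix (case_nat x (\<lambda>_. y)) c"
      by (rule ext) (auto simp: mix_def r_def split: nat.split elim!: evenE)
    then show ?thesis using A[of "case_nat x (\<lambda>_. y)"] by (simp add: satq_rename)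
  qed
  then show ?thesis by blast
qed

lemma zf_if_sat_ZF:
  assumes sat: "\<And>A. A \<in> ZF \<Longrightarrow> sat E z A"
  shows "zf E"
proof -
  have ax: "sat E z extensionality" "sat E z foundation" "sat E z pairing" "sat E z union" "sat E z powerset" "sat E z infinity"
    using sat unfolding ZF_def by blast+
  note ax = ax[unfolded finite_axiom_defs sat_0[where v = z], simplified]
  show ?thesis
  proof
    show "x = y" if "\<And>u. u \<epsilon> x \<longleftrightarrow> u \<epsilon> y" for x y using ax(1) that by blast
    show "\<exists>y. y \<epsilon> x \<and> \<not> (\<exists>z. z \<epsilon> x \<and> z \<epsilon> y)" if "\<exists>y. y \<epsilon> x" for x using ax(2)[rule_format, of x] that by meson
    show "\<exists>u. \<forall>z. z \<epsilon> u \<longleftrightarrow> z = x \<or> z = y" for x y using ax(3) by meson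
    show "\<exists>u. \<forall>z. z \<epsilon> u \<longleftrightarrow> (\<exists>y. y \<epsilon> x \<and> z \<epsilon> y)" for x using ax(4) by meson
    show "\<exists>u. \<forall>z. z \<epsilon> u \<longleftrightarrow> (\<forall>t. t \<epsilon> z \<longrightarrow> t \<epsilon> x)" for x using ax(5) by meson
    show "\<exists>I. (\<exists>o'. o' \<epsilon> I \<and> \<not> (\<exists>z. z \<epsilon> o')) \<and> (\<forall>x. x \<epsilon> I \<longrightarrow> (\<exists>s. s \<epsilon> I \<and> (\<forall>z. z \<epsilon> s \<longleftrightarrow> z \<epsilon> x \<or> z = x)))"
      using ax(6) by meson
  next
    fix \<phi> a assume "dfn (\<lambda>e. \<phi> (e 0))"
    then obtain B c where B: "\<And>x. \<phi> x \<longleftrightarrow> sat E (case_nat x c) B" using dfn_unary by blast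
    obtain n where n: "bounded_by (n + 1) B" using bounded_by_ex bounded_by_mono le_add1 by metis
    then have "sat E z (separation n B)" using sat unfolding ZF_def by blast
    then show "\<exists>b. \<forall>x. x \<epsilon> b \<longleftrightarrow> x \<epsilon> a \<and> \<phi> x" unfolding sat_separation[OF n] B by blast
  next
    fix \<psi> a assume "dfn (\<lambda>e. \<psi> (e 0) (e 1))" and func: "\<And>x y y'. x \<epsilon> a \<Longrightarrow> \<psi> x y \<Longrightarrow> \<psi> x y' \<Longrightarrow> y = y'"
    then obtain B c where B: "\<And>x y. \<psi> x y \<longleftrightarrow> sat E (case_nat x (case_nat y c)) B" using dfn_binary by blast
    obtain n where n: "bounded_by (n + 2) B" using bounded_by_ex bounded_by_mono le_add1 by metis
    then have "sat E z (replacement n B)" using sat unfolding ZF_def by blast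
    then show "\<exists>b. \<forall>y. y \<epsilon> b \<longleftrightarrow> (\<exists>x. x \<epsilon> a \<and> \<psi> x y)"
      unfolding sat_replacement[OF n] using func unfolding B by blast
  qed
qed

end

context zf
begin

lemma sat_ZF: "A \<in> ZF \<Longrightarrow> sat E z A"
proof -
  have "sat E z extensionality" unfolding finite_axiom_defs sat_0[where v = z] by simp (meson ext)
  moreover have "sat E z foundation" unfolding finite_axiom_defs sat_0[where v = z] by simp (meson found)
  moreover have "sat E z pairing" unfolding finite_axiom_defs sat_0[where v = z] by (simp add: upair_ex)
  moreover have "sat E z union" unfolding finite_axiom_defs sat_0[where v = z] by (simp add: union_ex)
  moreover have "sat E z powerset" unfolding finite_axiom_defs sat_0[where v = z] by (simp add: pow_ex)
  moreover have "sat E z infinity" unfolding finite_axiom_defs sat_0[where v = z] using inf_ex by simp meson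
  moreover
  have sep: "sat E z (separation n A)" if n: "bounded_by (n + 1) A" for n A
    unfolding sat_separation[OF n]
  proof (intro allI)
    fix v a
    have "dfn (\<lambda>e. sat E (case_nat (e 0) v) A)"
      by (rule dfn_at[of "\<lambda>x e. sat E (case_nat x e) A"]) (use dfn_sat[of A] in \<open>simp add: case_nat_tail case_nat_tail2\<close>)
    then show "\<exists>b. \<forall>x. x \<epsilon> b \<longleftrightarrow> x \<epsilon> a \<and> sat E (case_nat x v) A" by (rule sep_ex)
  qed
  moreover have rep: "sat E z (replacement n A)" if n: "bounded_by (n + 2) A" for n A
    unfolding sat_replacement[OF n]
  proof (intro allI impI)
    fix v a assume *: "\<forall>x. x \<epsilon> a \<longrightarrow> (\<forall>y y'. sat E (case_nat x (case_nat y v)) A \<and> sat E (case_nat x (case_nat y' v)) A \<longrightarrow> y = y')"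
    have "dfn (\<lambda>e. sat E (case_nat (e 0) (case_nat (e 1) v)) A)"
      by (rule dfn_at2[of "\<lambda>x y e. sat E (case_nat x (case_nat y e)) A"]) (use dfn_sat[of A] in \<open>simp add: case_nat_tail case_nat_tail2\<close>)
    then show "\<exists>b. \<forall>y. y \<epsilon> b \<longleftrightarrow> (\<exists>x. x \<epsilon> a \<and> sat E (case_nat x (case_nat y v)) A)"
      by (rule rep_ex) (use * in blast)
  qed
  ultimately show "sat E z A" if "A \<in> ZF" using that unfolding ZF_def by blast
qed

end

section \<open>Basic set theory in a model of ZF\<close>

context zf
begin

text \<open>By extensionality a set is determined by its elements, so defining the elements defines
  the operation.\<close>

lemma dfnt_set:
  assumes mem: "\<And>x e. x \<epsilon> t e \<longleftrightarrow> \<phi> x e" and dfn: "dfn (\<lambda>e. \<phi> (e 0) (\<lambda>i. e (Suc i)))"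
  shows "dfnt t"
proof -
  have "dfn (\<lambda>e. \<phi> (e 0) (\<lambda>i. e (Suc (Suc i))))"
    using dfn_ren[OF dfn, of "case_nat 0 (\<lambda>i. Suc (Suc i))"] by simp
  then have "dfn (\<lambda>e. \<forall>x. x \<epsilon> e 0 \<longleftrightarrow> \<phi> x (\<lambda>i. e (Suc i)))" by (intro dfn_all dfn_iff dfns)
  moreover have "y = t e \<longleftrightarrow> (\<forall>x. x \<epsilon> y \<longleftrightarrow> \<phi> x e)" for y e using mem ext[of y "t e"] by blast
  ultimately show ?thesis unfolding dfnt_def by simp
qed

lemma dfnt_THE:
  assumes uniq: "\<And>y y' e. R y e \<Longrightarrow> R y' e \<Longrightarrow> y = y'" and dfn: "dfn (\<lambda>e. R (e 0) (\<lambda>i. e (Suc i)))"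
  shows "dfnt (\<lambda>e. THE y. R y e)"
proof -
  \<comment> \<open>Where no value exists, \<open>THE\<close> yields one fixed object, the same for
    all arguments; it enters the definition as a parameter.\<close>
  have 1: "y = (THE y. R y e) \<longleftrightarrow> R y e \<or> (\<not> (\<exists>y. R y e) \<and> y = (THE y. False))" for y e
  proof (cases "\<exists>y. R y e")
    case True
    then obtain u where u: "R u e" by blast
    then have "(THE y. R y e) = u" using uniq by (intro the_equality) blast+
    then show ?thesis using u uniq by metis
  next
    case False
    then have "(\<lambda>y. R y e) = (\<lambda>y. False)" by blast
    then have "(THE y. R y e) = (THE y. False)" by (rule arg_cong)
    then show ?thesis using False by metis
  qed
  have 2: "dfn (\<lambda>e. R (e 0) (\<lambda>i. e (Suc (Suc i))))"
    using dfn_ren[OF dfn, of "case_nat 0 (\<lambda>i. Suc (Suc i))"] by simp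
  show ?thesis unfolding dfnt_def 1 by (intro dfn_or dfn_and dfn_not dfn_ex dfn 2 dfns)
qed

lemma dfnt_if [dfns]:
  assumes "dfn P" "dfnt s" "dfnt t" shows "dfnt (\<lambda>e. if P e then s e else t e)"
proof -
  have "dfn (\<lambda>e. (P (\<lambda>i. e (Suc i)) \<and> e 0 = s (\<lambda>i. e (Suc i))) \<or> (\<not> P (\<lambda>i. e (Suc i)) \<and> e 0 = t (\<lambda>i. e (Suc i))))"
    by (intro dfn_or dfn_and dfn_not dfn_ren[OF assms(1)] dfn_eq dfnt_var dfnt_ren[OF assms(2)] dfnt_ren[OF assms(3)])
  then show ?thesis unfolding dfnt_def by (rule back_subst[of dfn]) auto
qed

definition setof :: "('a \<Rightarrow> bool) \<Rightarrow> 'a" where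
  "setof \<phi> = (THE b. \<forall>x. x \<epsilon> b \<longleftrightarrow> \<phi> x)"

lemma mem_setof: "\<exists>b. \<forall>x. x \<epsilon> b \<longleftrightarrow> \<phi> x \<Longrightarrow> x \<epsilon> setof \<phi> \<longleftrightarrow> \<phi> x"
proof -
  assume "\<exists>b. \<forall>x. x \<epsilon> b \<longleftrightarrow> \<phi> x"
  then have "\<exists>!b. \<forall>x. x \<epsilon> b \<longleftrightarrow> \<phi> x" using ext by metis
  from theI'[OF this] show ?thesis unfolding setof_def by blast
qed

definition sub :: "'a \<Rightarrow> 'a \<Rightarrow> bool" where "sub x y \<longleftrightarrow> (\<forall>z. z \<epsilon> x \<longrightarrow> z \<epsilon> y)"
definition Sep :: "'a \<Rightarrow> ('a \<Rightarrow> bool) \<Rightarrow> 'a" where "Sep a \<phi> = setof (\<lambda>x. x \<epsilon> a \<and> \<phi> x)"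
definition Img :: "('a \<Rightarrow> 'a) \<Rightarrow> 'a \<Rightarrow> 'a" where "Img F a = setof (\<lambda>y. \<exists>x. x \<epsilon> a \<and> y = F x)"
definition Upr :: "'a \<Rightarrow> 'a \<Rightarrow> 'a" where "Upr x y = setof (\<lambda>z. z = x \<or> z = y)"
definition Uni :: "'a \<Rightarrow> 'a" where "Uni x = setof (\<lambda>z. \<exists>y. y \<epsilon> x \<and> z \<epsilon> y)"
definition Pow :: "'a \<Rightarrow> 'a" where "Pow x = setof (\<lambda>z. sub z x)"
definition Cup :: "'a \<Rightarrow> 'a \<Rightarrow> 'a" where "Cup x y = Uni (Upr x y)"
definition emp :: 'a where "emp = setof (\<lambda>_. False)"
definition suc :: "'a \<Rightarrow> 'a" where "suc x = Cup x (Upr x x)"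
definition Pr :: "'a \<Rightarrow> 'a \<Rightarrow> 'a" where "Pr x y = Upr (Upr x x) (Upr x y)"
definition Dif :: "'a \<Rightarrow> 'a \<Rightarrow> 'a" where "Dif a b = Sep a (\<lambda>x. \<not> x \<epsilon> b)"
definition Itr :: "'a \<Rightarrow> 'a \<Rightarrow> 'a" where "Itr a b = Sep a (\<lambda>x. x \<epsilon> b)"
definition Times :: "'a \<Rightarrow> 'a \<Rightarrow> 'a" where "Times a b = Uni (Img (\<lambda>x. Img (\<lambda>y. Pr x y) b) a)"
definition Dom :: "'a \<Rightarrow> 'a" where "Dom r = Sep (Uni (Uni r)) (\<lambda>x. \<exists>y. Pr x y \<epsilon> r)"
definition Ran :: "'a \<Rightarrow> 'a" where "Ran r = Sep (Uni (Uni r)) (\<lambda>y. \<exists>x. Pr x y \<epsilon> r)"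
definition Res :: "'a \<Rightarrow> 'a \<Rightarrow> 'a" where "Res f a = Sep f (\<lambda>t. \<exists>u v. u \<epsilon> a \<and> t = Pr u v)"
text \<open>The union of the set of values is the value itself when there is exactly one. In this
  form application is a total definable operation.\<close>

definition App :: "'a \<Rightarrow> 'a \<Rightarrow> 'a" where "App f x = Uni (Sep (Ran f) (\<lambda>y. Pr x y \<epsilon> f))"

lemma mem_Sep: "dfn (\<lambda>e. \<phi> (e 0)) \<Longrightarrow> x \<epsilon> Sep a \<phi> \<longleftrightarrow> x \<epsilon> a \<and> \<phi> x"
  unfolding Sep_def by (intro mem_setof sep_ex)

lemma mem_Img: "dfnt (\<lambda>e. F (e 0)) \<Longrightarrow> y \<epsilon> Img F a \<longleftrightarrow> (\<exists>x. x \<epsilon> a \<and> y = F x)"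
  unfolding Img_def by (rule mem_setof, rule rep_ex, rule dfn_eq, rule dfnt_var, assumption, simp)

lemma mem_Upr [simp]: "z \<epsilon> Upr x y \<longleftrightarrow> z = x \<or> z = y"
  unfolding Upr_def by (intro mem_setof upair_ex)

lemma mem_Uni [simp]: "z \<epsilon> Uni x \<longleftrightarrow> (\<exists>y. y \<epsilon> x \<and> z \<epsilon> y)"
  unfolding Uni_def by (intro mem_setof union_ex)

lemma mem_Pow [simp]: "z \<epsilon> Pow x \<longleftrightarrow> sub z x"
  unfolding Pow_def sub_def by (intro mem_setof pow_ex)

lemma mem_Cup [simp]: "z \<epsilon> Cup x y \<longleftrightarrow> z \<epsilon> x \<or> z \<epsilon> y"
  by (auto simp: Cup_def)

lemma mem_emp [simp]: "\<not> z \<epsilon> emp"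
proof -
  have "\<exists>b. \<forall>x. x \<epsilon> b \<longleftrightarrow> False" using sep_ex[OF dfn_const[of False]] by simp
  then show ?thesis unfolding emp_def using mem_setof[of "\<lambda>_. False"] by blast
qed

lemma mem_suc [simp]: "z \<epsilon> suc x \<longleftrightarrow> z \<epsilon> x \<or> z = x"
  by (auto simp: suc_def)

lemma Sep_dfn [dfns]:
  assumes a: "dfnt a" and p: "dfn (\<lambda>e. \<phi> (e 0) (\<lambda>i. e (Suc i)))"
  shows "dfnt (\<lambda>e. Sep (a e) (\<lambda>x. \<phi> x e))"
proof (rule dfnt_set)
  show "x \<epsilon> Sep (a e) (\<lambda>x. \<phi> x e) \<longleftrightarrow> x \<epsilon> a e \<and> \<phi> x e" for x e by (rule mem_Sep[OF dfn_at[OF p]])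
  show "dfn (\<lambda>e. e 0 \<epsilon> a (\<lambda>i. e (Suc i)) \<and> \<phi> (e 0) (\<lambda>i. e (Suc i)))"
    by (intro dfn_and dfn_mem dfnt_var dfnt_ren[OF a] p)
qed

lemma dfnt_at: "dfnt (\<lambda>e. F (e 0) (\<lambda>i. e (Suc i))) \<Longrightarrow> dfnt (\<lambda>e. F (e 0) d)"
  using dfn_at2[of "\<lambda>x y e. x = F y e" d] by (simp add: dfnt_def)

lemma Img_dfn [dfns]:
  assumes a: "dfnt a" and F: "dfnt (\<lambda>e. F (e 0) (\<lambda>i. e (Suc i)))"
  shows "dfnt (\<lambda>e. Img (\<lambda>x. F x e) (a e))"
proof (rule dfnt_set)
  show "y \<epsilon> Img (\<lambda>x. F x e) (a e) \<longleftrightarrow> (\<exists>x. x \<epsilon> a e \<and> y = F x e)" for y e by (rule mem_Img[OF dfnt_at[OF F]])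
  have "dfnt (\<lambda>e. F (e 0) (\<lambda>i. e (Suc (Suc i))))" using dfnt_ren[OF F, of "case_nat 0 (\<lambda>i. Suc (Suc i))"] by simp
  then show "dfn (\<lambda>e. \<exists>x. x \<epsilon> a (\<lambda>i. e (Suc i)) \<and> e 0 = F x (\<lambda>i. e (Suc i)))"
    by (intro dfn_ex dfn_and dfn_mem dfn_eq dfnt_var dfnt_ren[OF a])
qed

lemma sub_dfn [dfns]: "dfnt s \<Longrightarrow> dfnt t \<Longrightarrow> dfn (\<lambda>e. sub (s e) (t e))"
  by (rule dfn2[of sub]; (assumption | (unfold sub_def, intro dfns)))

lemma Upr_dfn [dfns]: "dfnt s \<Longrightarrow> dfnt t \<Longrightarrow> dfnt (\<lambda>e. Upr (s e) (t e))"
  by (rule dfnt_app2[of Upr]; (assumption | (rule dfnt_set, rule mem_Upr, intro dfns)))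

lemma Uni_dfn [dfns]: "dfnt s \<Longrightarrow> dfnt (\<lambda>e. Uni (s e))"
  by (rule dfnt_app[of Uni]; (assumption | (rule dfnt_set, rule mem_Uni, intro dfns)))

lemma Pow_dfn [dfns]: "dfnt s \<Longrightarrow> dfnt (\<lambda>e. Pow (s e))"
  by (rule dfnt_app[of Pow]; (assumption | (rule dfnt_set, rule mem_Pow, intro dfns)))

lemma Cup_dfn [dfns]: "dfnt s \<Longrightarrow> dfnt t \<Longrightarrow> dfnt (\<lambda>e. Cup (s e) (t e))"
  unfolding Cup_def by (intro dfns)

lemma suc_dfn [dfns]: "dfnt s \<Longrightarrow> dfnt (\<lambda>e. suc (s e))"
  unfolding suc_def by (intro dfns)

lemma Pr_dfn [dfns]: "dfnt s \<Longrightarrow> dfnt t \<Longrightarrow> dfnt (\<lambda>e. Pr (s e) (t e))"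
  unfolding Pr_def by (intro dfns)

lemma Upr_eq_iff: "Upr a b = Upr c d \<longleftrightarrow> (a = c \<and> b = d) \<or> (a = d \<and> b = c)"
proof
  assume eq: "Upr a b = Upr c d"
  have "z = a \<or> z = b \<longleftrightarrow> z = c \<or> z = d" for z using mem_Upr[of z a b] mem_Upr[of z c d] eq by simp
  then show "(a = c \<and> b = d) \<or> (a = d \<and> b = c)" by metis
next
  assume "(a = c \<and> b = d) \<or> (a = d \<and> b = c)"
  then show "Upr a b = Upr c d" by (intro ext) auto
qed

lemma Pr_eq [simp]: "Pr a b = Pr c d \<longleftrightarrow> a = c \<and> b = d"
  unfolding Pr_def Upr_eq_iff by auto

lemma mem_Dif [simp]: "x \<epsilon> Dif a b \<longleftrightarrow> x \<epsilon> a \<and> \<not> x \<epsilon> b"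
  unfolding Dif_def by (rule mem_Sep) (intro dfns)

lemma mem_Itr [simp]: "x \<epsilon> Itr a b \<longleftrightarrow> x \<epsilon> a \<and> x \<epsilon> b"
  unfolding Itr_def by (rule mem_Sep) (intro dfns)

lemma mem_Times [simp]: "t \<epsilon> Times a b \<longleftrightarrow> (\<exists>x y. x \<epsilon> a \<and> y \<epsilon> b \<and> t = Pr x y)"
proof -
  have 1: "z \<epsilon> Img (\<lambda>y. Pr x y) b \<longleftrightarrow> (\<exists>y. y \<epsilon> b \<and> z = Pr x y)" for x z by (rule mem_Img) (intro dfns)
  have 2: "z \<epsilon> Img (\<lambda>x. Img (\<lambda>y. Pr x y) b) a \<longleftrightarrow> (\<exists>x. x \<epsilon> a \<and> z = Img (\<lambda>y. Pr x y) b)" for z by (rule mem_Img) (intro dfns)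
  show ?thesis unfolding Times_def mem_Uni 2 using 1 by auto
qed

lemma Pr_Uni_Uni: "Pr x y \<epsilon> r \<Longrightarrow> x \<epsilon> Uni (Uni r) \<and> y \<epsilon> Uni (Uni r)"
  unfolding mem_Uni Pr_def by (metis mem_Upr)

lemma mem_Dom [simp]: "x \<epsilon> Dom r \<longleftrightarrow> (\<exists>y. Pr x y \<epsilon> r)"
proof -
  have "x \<epsilon> Dom r \<longleftrightarrow> x \<epsilon> Uni (Uni r) \<and> (\<exists>y. Pr x y \<epsilon> r)" unfolding Dom_def by (rule mem_Sep) (intro dfns)
  then show ?thesis using Pr_Uni_Uni by blast
qed

lemma mem_Ran [simp]: "y \<epsilon> Ran r \<longleftrightarrow> (\<exists>x. Pr x y \<epsilon> r)"
proof -
  have "y \<epsilon> Ran r \<longleftrightarrow> y \<epsilon> Uni (Uni r) \<and> (\<exists>x. Pr x y \<epsilon> r)" unfolding Ran_def by (rule mem_Sep) (intro dfns)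
  then show ?thesis using Pr_Uni_Uni by blast
qed

lemma mem_Res [simp]: "t \<epsilon> Res f a \<longleftrightarrow> t \<epsilon> f \<and> (\<exists>u v. u \<epsilon> a \<and> t = Pr u v)"
  unfolding Res_def by (rule mem_Sep) (intro dfns)

lemma Dif_dfn [dfns]: "dfnt s \<Longrightarrow> dfnt t \<Longrightarrow> dfnt (\<lambda>e. Dif (s e) (t e))"
  by (rule dfnt_app2[of Dif]; (assumption | (rule dfnt_set, rule mem_Dif, intro dfns)))

lemma Itr_dfn [dfns]: "dfnt s \<Longrightarrow> dfnt t \<Longrightarrow> dfnt (\<lambda>e. Itr (s e) (t e))"
  by (rule dfnt_app2[of Itr]; (assumption | (rule dfnt_set, rule mem_Itr, intro dfns)))

lemma Times_dfn [dfns]: "dfnt s \<Longrightarrow> dfnt t \<Longrightarrow> dfnt (\<lambda>e. Times (s e) (t e))"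
  by (rule dfnt_app2[of Times]; (assumption | (rule dfnt_set, rule mem_Times, intro dfns)))

lemma Dom_dfn [dfns]: "dfnt s \<Longrightarrow> dfnt (\<lambda>e. Dom (s e))"
  by (rule dfnt_app[of Dom]; (assumption | (rule dfnt_set, rule mem_Dom, intro dfns)))

lemma Ran_dfn [dfns]: "dfnt s \<Longrightarrow> dfnt (\<lambda>e. Ran (s e))"
  by (rule dfnt_app[of Ran]; (assumption | (rule dfnt_set, rule mem_Ran, intro dfns)))

lemma Res_dfn [dfns]: "dfnt s \<Longrightarrow> dfnt t \<Longrightarrow> dfnt (\<lambda>e. Res (s e) (t e))"
  by (rule dfnt_app2[of Res]; (assumption | (rule dfnt_set, rule mem_Res, intro dfns)))

lemma App_dfn [dfns]: "dfnt s \<Longrightarrow> dfnt t \<Longrightarrow> dfnt (\<lambda>e. App (s e) (t e))"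
  by (rule dfnt_app2[of App]; (assumption | (unfold App_def, intro dfns)))

lemma App_eq: 
  assumes "Pr x y \<epsilon> f" "\<And>y'. Pr x y' \<epsilon> f \<Longrightarrow> y' = y" shows "App f x = y"
proof -
  have "z \<epsilon> Sep (Ran f) (\<lambda>y. Pr x y \<epsilon> f) \<longleftrightarrow> z \<epsilon> Ran f \<and> Pr x z \<epsilon> f" for z by (rule mem_Sep) (intro dfns)
  then have "z \<epsilon> App f x \<longleftrightarrow> (\<exists>y'. Pr x y' \<epsilon> f \<and> z \<epsilon> y')" for z unfolding App_def mem_Uni mem_Ran by blast
  then have "z \<epsilon> App f x \<longleftrightarrow> z \<epsilon> y" for z using assms by metis
  then show ?thesis by (rule ext)
qed

lemma sub_refl [simp]: "sub x x" by (simp add: sub_def)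

lemma sub_antisym: "sub x y \<Longrightarrow> sub y x \<Longrightarrow> x = y"
  unfolding sub_def by (rule ext) blast

lemma irrefl [simp]: "\<not> x \<epsilon> x"
  using found[of "Upr x x"] by auto

lemma no_2cycle: "x \<epsilon> y \<Longrightarrow> \<not> y \<epsilon> x"
  using found[of "Upr x y"] by auto

section \<open>The natural numbers\<close>

definition inductv :: "'a \<Rightarrow> bool" where
  "inductv I \<longleftrightarrow> emp \<epsilon> I \<and> (\<forall>x. x \<epsilon> I \<longrightarrow> suc x \<epsilon> I)"

definition om :: 'a where "om = setof (\<lambda>x. \<forall>I. inductv I \<longrightarrow> x \<epsilon> I)"

lemma inductv_dfn [dfns]: "dfnt s \<Longrightarrow> dfn (\<lambda>e. inductv (s e))"
  by (rule dfn1[of inductv]; (assumption | (unfold inductv_def, intro dfns)))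

lemma empI: "(\<And>z. \<not> z \<epsilon> x) \<Longrightarrow> x = emp"
  by (rule ext) simp

lemma inductv_ex: "\<exists>I. inductv I"
proof -
  obtain I o' where I: "o' \<epsilon> I" "\<not> (\<exists>z. z \<epsilon> o')" "\<And>x. x \<epsilon> I \<Longrightarrow> \<exists>s. s \<epsilon> I \<and> (\<forall>z. z \<epsilon> s \<longleftrightarrow> z \<epsilon> x \<or> z = x)"
    using inf_ex by blast
  have "emp \<epsilon> I" using I(1,2) empI by metis
  moreover have "suc x \<epsilon> I" if xI: "x \<epsilon> I" for x
  proof -
    obtain s where s: "s \<epsilon> I" "\<forall>z. z \<epsilon> s \<longleftrightarrow> z \<epsilon> x \<or> z = x" using I(3)[OF xI] by blast
    have "s = suc x" by (rule ext) (use s in auto)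
    then show ?thesis using s by simp
  qed
  ultimately show ?thesis by (auto simp: inductv_def)
qed

lemma mem_om: "x \<epsilon> om \<longleftrightarrow> (\<forall>I. inductv I \<longrightarrow> x \<epsilon> I)"
proof -
  obtain I where I: "inductv I" using inductv_ex by blast
  have "\<exists>b. \<forall>x. x \<epsilon> b \<longleftrightarrow> x \<epsilon> I \<and> (\<forall>I. inductv I \<longrightarrow> x \<epsilon> I)" by (rule sep_ex) (intro dfns)
  then have "\<exists>b. \<forall>x. x \<epsilon> b \<longleftrightarrow> (\<forall>I. inductv I \<longrightarrow> x \<epsilon> I)" using I by blast
  then show ?thesis unfolding om_def by (rule mem_setof)
qed

lemma emp_om [simp]: "emp \<epsilon> om" and suc_om [simp]: "n \<epsilon> om \<Longrightarrow> suc n \<epsilon> om"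
  by (auto simp: mem_om inductv_def)

text \<open>The natural numbers of the model may be nonstandard, which is why \<phi> must be
  definable.\<close>

lemma om_induct:
  assumes "n \<epsilon> om" and d: "dfn (\<lambda>e. \<phi> (e 0))" and "\<phi> emp" "\<And>n. n \<epsilon> om \<Longrightarrow> \<phi> n \<Longrightarrow> \<phi> (suc n)"
  shows "\<phi> n"
proof -
  have m: "x \<epsilon> Sep om \<phi> \<longleftrightarrow> x \<epsilon> om \<and> \<phi> x" for x by (rule mem_Sep[OF d])
  have "inductv (Sep om \<phi>)" unfolding inductv_def m using assms by simp
  then show ?thesis using assms(1) m mem_om by blast
qed

lemma om_cases: 
  assumes "n \<epsilon> om" shows "n = emp \<or> (\<exists>m. m \<epsilon> om \<and> n = suc m)"
  by (rule om_induct[OF assms]) (intro dfns, auto)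

definition trans_set :: "'a \<Rightarrow> bool" where "trans_set x \<longleftrightarrow> (\<forall>y. y \<epsilon> x \<longrightarrow> sub y x)"

lemma trans_set_dfn [dfns]: "dfnt s \<Longrightarrow> dfn (\<lambda>e. trans_set (s e))"
  by (rule dfn1[of trans_set]; (assumption | (unfold trans_set_def, intro dfns)))

lemma om_mem_sub: 
  assumes "n \<epsilon> om" shows "sub n om"
  by (rule om_induct[OF assms]) (intro dfns, auto simp: sub_def)

lemma trans_om: "trans_set om"
  using om_mem_sub by (simp add: trans_set_def)

lemma om_mem_trans: "n \<epsilon> om \<Longrightarrow> m \<epsilon> n \<Longrightarrow> m \<epsilon> om"
  using om_mem_sub by (auto simp: sub_def)

section \<open>Recursion\<close>

text \<open>Course-of-values recursion along \<open>z \<epsilon> c x\<close> with a parameter \<open>w\<close>.\<close>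

definition rgood :: "('a \<Rightarrow> 'a) \<Rightarrow> ('a \<Rightarrow> 'a \<Rightarrow> 'a \<Rightarrow> 'a) \<Rightarrow> 'a \<Rightarrow> 'a \<Rightarrow> bool" where
  "rgood c H w f \<longleftrightarrow> (\<forall>t. t \<epsilon> f \<longrightarrow> (\<exists>x y. t = Pr x y)) \<and> (\<forall>x y y'. Pr x y \<epsilon> f \<longrightarrow> Pr x y' \<epsilon> f \<longrightarrow> y = y') \<and>
    (\<forall>x y. Pr x y \<epsilon> f \<longrightarrow> sub (c x) (Dom f) \<and> y = H w x (Res f (c x)))"

definition Rec :: "('a \<Rightarrow> 'a) \<Rightarrow> ('a \<Rightarrow> 'a \<Rightarrow> 'a \<Rightarrow> 'a) \<Rightarrow> 'a \<Rightarrow> 'a \<Rightarrow> 'a" where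
  "Rec c H w x = (THE y. \<exists>f. rgood c H w f \<and> Pr x y \<epsilon> f)"

text \<open>The relation \<open>c\<close> is instantiated by the identity, for recursion along
  membership, and by \<open>Dom\<close>, for recursion along the names occurring in a name.\<close>

context
  fixes c and H
  assumes cd: "dfnt (\<lambda>e. c (e 0))" and Hd: "dfnt (\<lambda>e. H (e 0) (e 1) (e 2))"
    and wf: "\<And>B. \<exists>x. x \<epsilon> B \<Longrightarrow> \<exists>x. x \<epsilon> B \<and> (\<forall>z. z \<epsilon> c x \<longrightarrow> \<not> z \<epsilon> B)"
begin

lemma rgood_dfn: "dfnt s \<Longrightarrow> dfnt t \<Longrightarrow> dfn (\<lambda>e. rgood c H (s e) (t e))"
  by (rule dfn2[of "rgood c H"]; (assumption | (unfold rgood_def, intro dfns dfnt_app3[OF Hd] dfnt_app[OF cd])))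

lemma rgood_unique:
  assumes f: "rgood c H w f" "Pr x y \<epsilon> f" and g: "rgood c H w g" "Pr x y' \<epsilon> g"
  shows "y = y'"
proof (rule ccontr)
  assume "y \<noteq> y'"
  let ?\<phi> = "\<lambda>x. \<exists>y y'. Pr x y \<epsilon> f \<and> Pr x y' \<epsilon> g \<and> y \<noteq> y'"
  have m: "x \<epsilon> Sep (Dom f) ?\<phi> \<longleftrightarrow> x \<epsilon> Dom f \<and> ?\<phi> x" for x by (rule mem_Sep) (intro dfns)
  have "x \<epsilon> Sep (Dom f) ?\<phi>" unfolding m mem_Dom using f g \<open>y \<noteq> y'\<close> by blast
  then obtain x where x: "?\<phi> x" and min: "\<And>z. z \<epsilon> c x \<Longrightarrow> \<not> ?\<phi> z"
    using wf[of "Sep (Dom f) ?\<phi>"] unfolding m mem_Dom by blast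
  then obtain y y' where y: "Pr x y \<epsilon> f" "Pr x y' \<epsilon> g" "y \<noteq> y'" by blast
  have sf: "sub (c x) (Dom f)" and yf: "y = H w x (Res f (c x))" using f(1) y(1) unfolding rgood_def by blast+
  have sg: "sub (c x) (Dom g)" and yg: "y' = H w x (Res g (c x))" using g(1) y(2) unfolding rgood_def by blast+
  have "Pr u v \<epsilon> f \<longleftrightarrow> Pr u v \<epsilon> g" if "u \<epsilon> c x" for u v
    using min[OF that] sf sg that unfolding sub_def mem_Dom by metis
  then have "Res f (c x) = Res g (c x)" by (intro ext) auto
  then show False using yf yg y(3) by simp
qed

lemma Rec_eqI: "rgood c H w f \<Longrightarrow> Pr x y \<epsilon> f \<Longrightarrow> Rec c H w x = y"
  unfolding Rec_def by (rule the_equality) (use rgood_unique in blast)+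

lemma Rec_dfn: "dfnt s \<Longrightarrow> dfnt t \<Longrightarrow> dfnt (\<lambda>e. Rec c H (s e) (t e))"
proof (rule dfnt_app2[of "Rec c H"])
  show "dfnt (\<lambda>e. Rec c H (e 0) (e 1))" unfolding Rec_def
    by (rule dfnt_THE) (use rgood_unique in blast, intro dfns rgood_dfn)
qed

lemma Rec_ex:
  assumes D: "\<And>x. x \<epsilon> D \<Longrightarrow> sub (c x) D" and "x \<epsilon> D"
  shows "\<exists>f y. rgood c H w f \<and> Pr x y \<epsilon> f"
proof (rule ccontr)
  assume n: "\<not> ?thesis"
  let ?R = "\<lambda>x. \<exists>f y. rgood c H w f \<and> Pr x y \<epsilon> f"
  have m: "x \<epsilon> Sep D (\<lambda>x. \<not> ?R x) \<longleftrightarrow> x \<epsilon> D \<and> \<not> ?R x" for x by (rule mem_Sep) (intro dfns rgood_dfn)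
  obtain x where x: "x \<epsilon> D" "\<not> ?R x" and min: "\<And>z. z \<epsilon> c x \<Longrightarrow> z \<epsilon> D \<Longrightarrow> ?R z"
    using wf[of "Sep D (\<lambda>x. \<not> ?R x)"] unfolding m using assms(2) n by blast
  \<comment> \<open>\<open>U\<close> collects the points of \<open>D\<close> where the recursion is
    already defined. By minimality it contains \<open>c x\<close>, so its values together with one
    more value at \<open>x\<close> form an approximation defined at \<open>x\<close>.\<close>
  define U where "U = Sep D ?R"
  have U: "z \<epsilon> U \<longleftrightarrow> z \<epsilon> D \<and> ?R z" for z unfolding U_def by (rule mem_Sep) (intro dfns rgood_dfn)
  define f where "f = Img (\<lambda>z. Pr z (Rec c H w z)) U"
  have f: "t \<epsilon> f \<longleftrightarrow> (\<exists>z. z \<epsilon> U \<and> t = Pr z (Rec c H w z))" for t unfolding f_def by (rule mem_Img) (intro dfns Rec_dfn)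
  have cx: "z \<epsilon> U" if "z \<epsilon> c x" for z using min[OF that] D[OF x(1)] that U unfolding sub_def by blast
  have xU: "\<not> x \<epsilon> U" using U x(2) by blast
  define f' where "f' = Cup f (Upr (Pr x (H w x (Res f (c x)))) (Pr x (H w x (Res f (c x)))))"
  have f': "Pr z y \<epsilon> f' \<longleftrightarrow> (z \<epsilon> U \<and> y = Rec c H w z) \<or> (z = x \<and> y = H w x (Res f (c x)))" for z y
    unfolding f'_def by (auto simp: f)
  have nx: "\<not> x \<epsilon> c x"
    using wf[of "Upr x x"] by auto
  have "rgood c H w f'"
    unfolding rgood_def
  proof (intro conjI allI impI)
    show "\<exists>x y. t = Pr x y" if "t \<epsilon> f'" for t using that unfolding f'_def by (auto simp: f)
    show "y = y'" if "Pr z y \<epsilon> f'" "Pr z y' \<epsilon> f'" for z y y' using that xU unfolding f' by blast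
    fix z y assume zy: "Pr z y \<epsilon> f'"
    show "sub (c z) (Dom f')"
    proof (cases "z = x")
      case True then show ?thesis using cx f' by (auto simp: sub_def)
    next
      case False
      then have "z \<epsilon> U" using zy f' by blast
      then obtain g y where g: "rgood c H w g" "Pr z y \<epsilon> g" and zD: "z \<epsilon> D" using U by blast
      show ?thesis unfolding sub_def
      proof (intro allI impI)
        fix u assume u: "u \<epsilon> c z"
        then have "u \<epsilon> Dom g" using g unfolding rgood_def sub_def by blast
        then have "u \<epsilon> U" using g(1) D[OF zD] u U unfolding sub_def mem_Dom by blast
        then show "u \<epsilon> Dom f'" using f' by auto
      qed
    qed
    show "y = H w z (Res f' (c z))"
    proof (cases "z = x")
      case True
      have "Res f' (c x) = Res f (c x)" using nx by (intro ext) (auto simp: f'_def)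
      then show ?thesis using True zy f' xU by auto
    next
      case False
      then have zU: "z \<epsilon> U" and y: "y = Rec c H w z" using zy f' by blast+
      then obtain g y' where g: "rgood c H w g" "Pr z y' \<epsilon> g" and zD: "z \<epsilon> D" using U by blast
      have "Pr u v \<epsilon> g \<longleftrightarrow> Pr u v \<epsilon> f'" if u: "u \<epsilon> c z" for u v
      proof -
        have "u \<epsilon> Dom g" using g u unfolding rgood_def sub_def by blast
        then obtain v' where v': "Pr u v' \<epsilon> g" by auto
        then have "u \<epsilon> U" using g(1) D[OF zD] u U unfolding sub_def by blast
        moreover have "Rec c H w u = v'" by (rule Rec_eqI[OF g(1) v'])
        moreover have "v = v'" if "Pr u v \<epsilon> g" using g(1) v' that unfolding rgood_def by blast
        ultimately show ?thesis unfolding f' using xU v' by metis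
      qed
      then have "Res g (c z) = Res f' (c z)" by (intro ext) auto
      moreover have "y' = H w z (Res g (c z))" using g unfolding rgood_def by blast
      ultimately show ?thesis using y Rec_eqI[OF g] by simp
    qed
  qed
  then show False using x(2) f' by blast
qed

lemma Rec_eq:
  assumes D: "\<And>x. x \<epsilon> D \<Longrightarrow> sub (c x) D" and "x \<epsilon> D"
  shows "Rec c H w x = H w x (Img (\<lambda>z. Pr z (Rec c H w z)) (c x))"
proof -
  obtain f y where f: "rgood c H w f" "Pr x y \<epsilon> f" using Rec_ex[OF assms] by blast
  have s: "sub (c x) (Dom f)" and y: "y = H w x (Res f (c x))" using f unfolding rgood_def by blast+
  have m: "t \<epsilon> Img (\<lambda>z. Pr z (Rec c H w z)) (c x) \<longleftrightarrow> (\<exists>z. z \<epsilon> c x \<and> t = Pr z (Rec c H w z))" for t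
    by (rule mem_Img) (intro dfns Rec_dfn)
  have "Res f (c x) = Img (\<lambda>z. Pr z (Rec c H w z)) (c x)"
  proof (rule ext)
    fix t show "t \<epsilon> Res f (c x) \<longleftrightarrow> t \<epsilon> Img (\<lambda>z. Pr z (Rec c H w z)) (c x)"
    proof
      assume "t \<epsilon> Res f (c x)"
      then show "t \<epsilon> Img (\<lambda>z. Pr z (Rec c H w z)) (c x)" using Rec_eqI[OF f(1)] unfolding m by auto
    next
      assume "t \<epsilon> Img (\<lambda>z. Pr z (Rec c H w z)) (c x)"
      then obtain z where z: "z \<epsilon> c x" "t = Pr z (Rec c H w z)" unfolding m by blast
      then obtain v where "Pr z v \<epsilon> f" using s by (auto simp: sub_def)
      then show "t \<epsilon> Res f (c x)" using z Rec_eqI[OF f(1)] by auto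
    qed
  qed
  then show ?thesis using Rec_eqI[OF f] y by simp
qed

end

section \<open>Induction and recursion along membership and along domains\<close>

lemma wf_mem: "\<exists>x. x \<epsilon> B \<Longrightarrow> \<exists>x. x \<epsilon> B \<and> (\<forall>z. z \<epsilon> x \<longrightarrow> \<not> z \<epsilon> B)"
  using found[of B] by blast

text \<open>Iterated unions along \<open>om\<close>. At this point \<open>om\<close> is the
  transitive set at hand, so recursion is available on it; the result then makes recursion available
  everywhere.\<close>

lemma transitive_superset: "\<exists>T. trans_set T \<and> x \<epsilon> T"
proof -
  define H where "H w n f = Cup w (Uni (Uni (Ran f)))" for w n f :: 'a
  have Hd: "dfnt (\<lambda>e. H (e 0) (e 1) (e 2))" unfolding H_def by (intro dfns)
  have cd: "dfnt (\<lambda>e. e 0)" by (intro dfns)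
  let ?F = "Rec (\<lambda>x. x) H x"
  have Fd: "dfnt (\<lambda>e. ?F (e 0))" by (intro Rec_dfn[OF cd Hd wf_mem] dfns)
  have m: "t \<epsilon> Img (\<lambda>z. Pr z (?F z)) n \<longleftrightarrow> (\<exists>z. z \<epsilon> n \<and> t = Pr z (?F z))" for t n
    by (rule mem_Img) (intro dfns Rec_dfn[OF cd Hd wf_mem])
  have F: "?F n = H x n (Img (\<lambda>z. Pr z (?F z)) n)" if "n \<epsilon> om" for n
    by (rule Rec_eq[OF cd Hd wf_mem om_mem_sub that])
  have memF: "z \<epsilon> ?F n \<longleftrightarrow> z \<epsilon> x \<or> (\<exists>k. k \<epsilon> n \<and> (\<exists>y. y \<epsilon> ?F k \<and> z \<epsilon> y))" if "n \<epsilon> om" for z n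
  proof -
    have "z \<epsilon> H w n f \<longleftrightarrow> z \<epsilon> w \<or> (\<exists>k r y. Pr k r \<epsilon> f \<and> y \<epsilon> r \<and> z \<epsilon> y)" for w n f by (auto simp: H_def)
    then show ?thesis by (subst F[OF that]) (auto simp: m)
  qed
  define T where "T = Cup (Uni (Img ?F om)) (Upr x x)"
  have T: "z \<epsilon> T \<longleftrightarrow> z = x \<or> (\<exists>n. n \<epsilon> om \<and> z \<epsilon> ?F n)" for z
    unfolding T_def by (auto simp: mem_Img[OF Fd])
  have "trans_set T"
    unfolding trans_set_def sub_def T
  proof (intro allI impI)
    fix y z assume y: "y = x \<or> (\<exists>n. n \<epsilon> om \<and> y \<epsilon> ?F n)" and z: "z \<epsilon> y"
    have "\<exists>n. n \<epsilon> om \<and> z \<epsilon> ?F n"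
    proof (cases "y = x")
      case True
      then show ?thesis using z memF[of emp] by (intro exI[of _ emp]) simp
    next
      case False
      then obtain n where n: "n \<epsilon> om" "y \<epsilon> ?F n" using y by blast
      then show ?thesis using z memF[of "suc n"] by (intro exI[of _ "suc n"]) auto
    qed
    then show "z = x \<or> (\<exists>n. n \<epsilon> om \<and> z \<epsilon> ?F n)" by blast
  qed
  moreover have "x \<epsilon> T" by (simp add: T)
  ultimately show ?thesis by blast
qed

text \<open>Foundation concerns sets, whereas the induction ranges over the universe; a transitive
  set containing \<open>x\<close> holds all that is relevant for \<open>x\<close>.\<close>

lemma eps_induct:
  assumes d: "dfn (\<lambda>e. \<phi> (e 0))" and step: "\<And>x. (\<And>y. y \<epsilon> x \<Longrightarrow> \<phi> y) \<Longrightarrow> \<phi> x"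
  shows "\<phi> x"
proof (rule ccontr)
  assume "\<not> \<phi> x"
  obtain T where T: "trans_set T" "x \<epsilon> T" using transitive_superset by blast
  have m: "x \<epsilon> Sep T (\<lambda>x. \<not> \<phi> x) \<longleftrightarrow> x \<epsilon> T \<and> \<not> \<phi> x" for x by (rule mem_Sep) (intro dfns d)
  obtain z where z: "z \<epsilon> T" "\<not> \<phi> z" "\<And>y. y \<epsilon> z \<Longrightarrow> y \<epsilon> T \<Longrightarrow> \<phi> y"
    using wf_mem[of "Sep T (\<lambda>x. \<not> \<phi> x)"] unfolding m using T(2) \<open>\<not> \<phi> x\<close> by blast
  then have "\<phi> y" if "y \<epsilon> z" for y using T(1) that unfolding trans_set_def sub_def by blast
  then show False using step z(2) by blast
qed

lemma Rec_mem:
  assumes Hd: "dfnt (\<lambda>e. H (e 0) (e 1) (e 2))"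
  shows "Rec (\<lambda>x. x) H w x = H w x (Img (\<lambda>z. Pr z (Rec (\<lambda>x. x) H w z)) x)"
proof -
  obtain T where T: "trans_set T" "x \<epsilon> T" using transitive_superset by blast
  show ?thesis
  proof (rule Rec_eq[OF dfnt_var Hd _ _ T(2)])
    show "sub x T" if "x \<epsilon> T" for x using T(1) that unfolding trans_set_def by blast
  qed (rule wf_mem)
qed

lemma Rec_mem_dfn:
  assumes Hd: "dfnt (\<lambda>e. H (e 0) (e 1) (e 2))" and "dfnt s" "dfnt t"
  shows "dfnt (\<lambda>e. Rec (\<lambda>x. x) H (s e) (t e))"
  by (rule Rec_dfn[OF dfnt_var Hd wf_mem assms(2,3)])

lemma Dom_trans: "trans_set T \<Longrightarrow> x \<epsilon> T \<Longrightarrow> sub (Dom x) T"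
  unfolding trans_set_def sub_def mem_Dom Pr_def by (metis mem_Upr)

lemma Dom_induct:
  assumes d: "dfn (\<lambda>e. \<phi> (e 0))" and step: "\<And>x. (\<And>y. y \<epsilon> Dom x \<Longrightarrow> \<phi> y) \<Longrightarrow> \<phi> x"
  shows "\<phi> x"
proof -
  \<comment> \<open>A first component of \<open>x\<close> lies three membership steps below
    \<open>x\<close>, through its singleton and the pair. Strengthening the claim by two levels
    makes one step of membership induction reach it.\<close>
  have "\<phi> x \<and> (\<forall>y. y \<epsilon> x \<longrightarrow> \<phi> y \<and> (\<forall>z. z \<epsilon> y \<longrightarrow> \<phi> z))"
  proof (rule eps_induct[of "\<lambda>x. \<phi> x \<and> (\<forall>y. y \<epsilon> x \<longrightarrow> \<phi> y \<and> (\<forall>z. z \<epsilon> y \<longrightarrow> \<phi> z))"])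
    show "dfn (\<lambda>e. \<phi> (e 0) \<and> (\<forall>y. y \<epsilon> e 0 \<longrightarrow> \<phi> y \<and> (\<forall>z. z \<epsilon> y \<longrightarrow> \<phi> z)))"
      by (intro dfns dfn1[of \<phi>, OF d])
    fix x assume IH: "\<And>y. y \<epsilon> x \<Longrightarrow> \<phi> y \<and> (\<forall>z. z \<epsilon> y \<longrightarrow> \<phi> z \<and> (\<forall>u. u \<epsilon> z \<longrightarrow> \<phi> u))"
    have "\<phi> x"
    proof (rule step)
      fix y assume "y \<epsilon> Dom x"
      then obtain p where "Pr y p \<epsilon> x" by auto
      moreover have "Upr y y \<epsilon> Pr y p" "y \<epsilon> Upr y y" by (simp_all add: Pr_def)
      ultimately show "\<phi> y" using IH by blast
    qed
    then show "\<phi> x \<and> (\<forall>y. y \<epsilon> x \<longrightarrow> \<phi> y \<and> (\<forall>z. z \<epsilon> y \<longrightarrow> \<phi> z))" using IH by blast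
  qed
  then show ?thesis by blast
qed

lemma wf_Dom: "\<exists>x. x \<epsilon> B \<Longrightarrow> \<exists>x. x \<epsilon> B \<and> (\<forall>z. z \<epsilon> Dom x \<longrightarrow> \<not> z \<epsilon> B)"
proof (rule ccontr)
  assume B: "\<exists>x. x \<epsilon> B" and n: "\<not> ?thesis"
  have "\<not> x \<epsilon> B" for x
    by (rule Dom_induct[of "\<lambda>x. \<not> x \<epsilon> B"]) (intro dfns, use n in blast)
  then show False using B by blast
qed

lemma Rec_Dom:
  assumes Hd: "dfnt (\<lambda>e. H (e 0) (e 1) (e 2))"
  shows "Rec Dom H w x = H w x (Img (\<lambda>z. Pr z (Rec Dom H w z)) (Dom x))"
proof -
  obtain T where T: "trans_set T" "x \<epsilon> T" using transitive_superset by blast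
  have cd: "dfnt (\<lambda>e. Dom (e 0))" by (intro dfns)
  show ?thesis
    by (rule Rec_eq[OF cd Hd _ _ T(2)]) (erule wf_Dom, rule Dom_trans[OF T(1)])
qed

lemma Rec_Dom_dfn:
  assumes Hd: "dfnt (\<lambda>e. H (e 0) (e 1) (e 2))" and "dfnt s" "dfnt t"
  shows "dfnt (\<lambda>e. Rec Dom H (s e) (t e))"
proof -
  have cd: "dfnt (\<lambda>e. Dom (e 0))" by (intro dfns)
  show ?thesis by (rule Rec_dfn[OF cd Hd wf_Dom assms(2,3)])
qed

text \<open>On a successor, \<open>Uni n\<close> is the predecessor, so iteration is the
  course-of-values recursion that reads the last value only.\<close>

definition nrec :: "('a \<Rightarrow> 'a) \<Rightarrow> 'a \<Rightarrow> 'a \<Rightarrow> 'a" where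
  "nrec G x0 n = Rec (\<lambda>x. x) (\<lambda>w n f. if n = emp then w else G (App f (Uni n))) x0 n"

context
  fixes G assumes Gd: "dfnt (\<lambda>e. G (e 0))"
begin

lemma nrec_H_dfn: "dfnt (\<lambda>e. if e 1 = emp then e 0 else G (App (e 2) (Uni (e 1))))"
  by (intro dfns dfnt_app[OF Gd])

lemma nrec_dfn: "dfnt s \<Longrightarrow> dfnt t \<Longrightarrow> dfnt (\<lambda>e. nrec G (s e) (t e))"
  unfolding nrec_def by (rule Rec_mem_dfn[OF nrec_H_dfn])

lemma nrec_emp: "nrec G x0 emp = x0"
  unfolding nrec_def by (subst Rec_mem[OF nrec_H_dfn]) simp

lemma om_trans_set:
  assumes "n \<epsilon> om" shows "trans_set n"
  by (rule om_induct[OF assms]) (intro dfns, auto simp: trans_set_def sub_def)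

lemma nrec_suc:
  assumes "n \<epsilon> om" shows "nrec G x0 (suc n) = G (nrec G x0 n)"
proof -
  have "Uni (suc n) = n" using om_trans_set[OF assms] by (intro ext) (auto simp: trans_set_def sub_def)
  moreover have "suc n \<noteq> emp" by (metis mem_emp mem_suc)
  moreover have "App (Img (\<lambda>z. Pr z (nrec G x0 z)) (suc n)) n = nrec G x0 n"
  proof -
    have "t \<epsilon> Img (\<lambda>z. Pr z (nrec G x0 z)) (suc n) \<longleftrightarrow> (\<exists>z. z \<epsilon> suc n \<and> t = Pr z (nrec G x0 z))" for t
      by (rule mem_Img) (intro dfns nrec_dfn)
    then show ?thesis by (intro App_eq) auto
  qed
  ultimately show ?thesis
    by (subst nrec_def, subst Rec_mem[OF nrec_H_dfn], fold nrec_def) simp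
qed

end

section \<open>Ordinals, the cumulative hierarchy and Collection\<close>

definition ordn :: "'a \<Rightarrow> bool" where
  "ordn x \<longleftrightarrow> trans_set x \<and> (\<forall>y. y \<epsilon> x \<longrightarrow> trans_set y)"

lemma ordn_dfn [dfns]: "dfnt s \<Longrightarrow> dfn (\<lambda>e. ordn (s e))"
  by (rule dfn1[of ordn]; (assumption | (unfold ordn_def, intro dfns)))

lemma ordn_mem: "ordn a \<Longrightarrow> b \<epsilon> a \<Longrightarrow> ordn b"
  unfolding ordn_def trans_set_def sub_def by blast

lemma ordn_trans: "ordn a \<Longrightarrow> b \<epsilon> a \<Longrightarrow> x \<epsilon> b \<Longrightarrow> x \<epsilon> a"
  unfolding ordn_def trans_set_def sub_def by blast

lemma ordn_linear:
  assumes "ordn a" "ordn b" shows "a \<epsilon> b \<or> a = b \<or> b \<epsilon> a"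
proof -
  have "\<forall>b. ordn a \<longrightarrow> ordn b \<longrightarrow> a \<epsilon> b \<or> a = b \<or> b \<epsilon> a"
  proof (rule eps_induct[of "\<lambda>a. \<forall>b. ordn a \<longrightarrow> ordn b \<longrightarrow> a \<epsilon> b \<or> a = b \<or> b \<epsilon> a"], intro dfns)
    fix a assume IHa: "\<And>x. x \<epsilon> a \<Longrightarrow> \<forall>b. ordn x \<longrightarrow> ordn b \<longrightarrow> x \<epsilon> b \<or> x = b \<or> b \<epsilon> x"
    show "\<forall>b. ordn a \<longrightarrow> ordn b \<longrightarrow> a \<epsilon> b \<or> a = b \<or> b \<epsilon> a"
    proof
      fix b show "ordn a \<longrightarrow> ordn b \<longrightarrow> a \<epsilon> b \<or> a = b \<or> b \<epsilon> a"
      proof (rule eps_induct[of "\<lambda>b. ordn a \<longrightarrow> ordn b \<longrightarrow> a \<epsilon> b \<or> a = b \<or> b \<epsilon> a"], intro dfns)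
        fix b assume IHb: "\<And>y. y \<epsilon> b \<Longrightarrow> ordn a \<longrightarrow> ordn y \<longrightarrow> a \<epsilon> y \<or> a = y \<or> y \<epsilon> a"
        show "ordn a \<longrightarrow> ordn b \<longrightarrow> a \<epsilon> b \<or> a = b \<or> b \<epsilon> a"
        proof (intro impI)
          assume o: "ordn a" "ordn b"
          show "a \<epsilon> b \<or> a = b \<or> b \<epsilon> a"
          proof (rule ccontr)
            assume n: "\<not> ?thesis"
            have 1: "x \<epsilon> b" if "x \<epsilon> a" for x
            proof -
              have "x \<epsilon> b \<or> x = b \<or> b \<epsilon> x" using IHa[OF that] ordn_mem[OF o(1) that] o(2) by blast
              then show ?thesis using n that ordn_trans[OF o(1) that] by blast
            qed
            have 2: "y \<epsilon> a" if "y \<epsilon> b" for y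
            proof -
              have "a \<epsilon> y \<or> a = y \<or> y \<epsilon> a" using IHb[OF that] ordn_mem[OF o(2) that] o(1) by blast
              then show ?thesis using n that ordn_trans[OF o(2) that] by blast
            qed
            have "a = b" by (rule ext) (use 1 2 in blast)
            then show False using n by blast
          qed
        qed
      qed
    qed
  qed
  then show ?thesis using assms by blast
qed

lemma ordn_sub_linear: "ordn a \<Longrightarrow> ordn b \<Longrightarrow> sub a b \<or> sub b a"
  using ordn_linear[of a b] ordn_trans unfolding sub_def by metis

lemma ordn_suc: "ordn a \<Longrightarrow> ordn (suc a)"
  unfolding ordn_def trans_set_def sub_def mem_suc by blast

lemma ordn_Uni:
  assumes "\<And>a. a \<epsilon> A \<Longrightarrow> ordn a" shows "ordn (Uni A)"
  unfolding ordn_def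
proof (intro conjI allI impI)
  show "trans_set (Uni A)" unfolding trans_set_def sub_def mem_Uni using assms ordn_trans by blast
  show "trans_set y" if "y \<epsilon> Uni A" for y using that assms ordn_mem unfolding mem_Uni ordn_def by blast
qed

lemma ordn_least:
  assumes d: "dfn (\<lambda>e. \<phi> (e 0))" and "ordn a" "\<phi> a"
  shows "\<exists>a. ordn a \<and> \<phi> a \<and> (\<forall>b. b \<epsilon> a \<longrightarrow> \<not> \<phi> b)"
proof (rule ccontr)
  assume n: "\<not> ?thesis"
  have "ordn a \<longrightarrow> \<not> \<phi> a"
  proof (rule eps_induct[of "\<lambda>a. ordn a \<longrightarrow> \<not> \<phi> a"])
    show "dfn (\<lambda>e. ordn (e 0) \<longrightarrow> \<not> \<phi> (e 0))" by (intro dfns d)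
  qed (use n ordn_mem in blast)
  then show False using assms by blast
qed

definition Vr :: "'a \<Rightarrow> 'a" where
  "Vr s = Rec (\<lambda>x. x) (\<lambda>w s f. Uni (Img Pow (Ran f))) emp s"

lemma Vr_H_dfn: "dfnt (\<lambda>e. Uni (Img Pow (Ran (e 2))))"
  by (intro Uni_dfn Img_dfn[where F = "\<lambda>x e. Pow x"] dfns)

lemma Vr_dfn [dfns]: "dfnt s \<Longrightarrow> dfnt (\<lambda>e. Vr (s e))"
  unfolding Vr_def by (rule Rec_mem_dfn[OF Vr_H_dfn dfnt_const])

lemma mem_Vr: "x \<epsilon> Vr s \<longleftrightarrow> (\<exists>t. t \<epsilon> s \<and> sub x (Vr t))"
proof -
  have 1: "Vr s = Uni (Img Pow (Ran (Img (\<lambda>z. Pr z (Vr z)) s)))"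
    unfolding Vr_def by (subst Rec_mem[OF Vr_H_dfn]) simp
  have 2: "t \<epsilon> Img (\<lambda>z. Pr z (Vr z)) s \<longleftrightarrow> (\<exists>z. z \<epsilon> s \<and> t = Pr z (Vr z))" for t
    by (rule mem_Img) (intro dfns)
  have 3: "t \<epsilon> Img Pow a \<longleftrightarrow> (\<exists>z. z \<epsilon> a \<and> t = Pow z)" for t a
    by (rule mem_Img) (intro dfns)
  show ?thesis unfolding 1 by (auto simp: 2 3) (metis mem_Pow)
qed

lemma Vr_mono: "sub a b \<Longrightarrow> sub (Vr a) (Vr b)"
  unfolding sub_def[of a] sub_def[of "Vr a"] mem_Vr by blast

lemma Vr_trans: "trans_set (Vr s)"
proof (rule eps_induct[of "\<lambda>s. trans_set (Vr s)"], intro dfns)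
  fix s assume IH: "\<And>t. t \<epsilon> s \<Longrightarrow> trans_set (Vr t)"
  show "trans_set (Vr s)" unfolding trans_set_def
  proof (intro allI impI)
    fix y assume "y \<epsilon> Vr s"
    then obtain t where t: "t \<epsilon> s" "sub y (Vr t)" unfolding mem_Vr by blast
    show "sub y (Vr s)" unfolding sub_def[of y]
    proof (intro allI impI)
      fix z assume "z \<epsilon> y"
      then have "sub z (Vr t)" using t IH[OF t(1)] unfolding sub_def[of y] trans_set_def by blast
      then show "z \<epsilon> Vr s" using t(1) mem_Vr by blast
    qed
  qed
qed

lemma Vr_ex: "\<exists>a. ordn a \<and> x \<epsilon> Vr a"
proof (rule eps_induct[of "\<lambda>x. \<exists>a. ordn a \<and> x \<epsilon> Vr a"], intro dfns)
  fix x assume IH: "\<And>y. y \<epsilon> x \<Longrightarrow> \<exists>a. ordn a \<and> y \<epsilon> Vr a"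
  \<comment> \<open>The least level containing \<open>y\<close> is a functional relation of
    \<open>y\<close>, so replacement can collect these levels.\<close>
  let ?\<psi> = "\<lambda>y a. ordn a \<and> y \<epsilon> Vr a \<and> (\<forall>b. b \<epsilon> a \<longrightarrow> \<not> y \<epsilon> Vr b)"
  have "\<exists>A. \<forall>a. a \<epsilon> A \<longleftrightarrow> (\<exists>y. y \<epsilon> x \<and> ?\<psi> y a)"
    by (rule rep_ex) (intro dfns, metis ordn_linear)
  then obtain A where A: "\<And>a. a \<epsilon> A \<longleftrightarrow> (\<exists>y. y \<epsilon> x \<and> ?\<psi> y a)" by blast
  have oA: "ordn (Uni A)" by (rule ordn_Uni) (use A in blast)
  have "sub x (Vr (Uni A))" unfolding sub_def
  proof (intro allI impI)
    fix y assume y: "y \<epsilon> x"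
    then obtain a where a: "ordn a" "y \<epsilon> Vr a" using IH by blast
    have "\<exists>a. ordn a \<and> y \<epsilon> Vr a \<and> (\<forall>b. b \<epsilon> a \<longrightarrow> \<not> y \<epsilon> Vr b)"
      by (rule ordn_least[of "\<lambda>a. y \<epsilon> Vr a" a]) (intro dfns, use a in simp_all)
    then obtain b where b: "b \<epsilon> A" "y \<epsilon> Vr b" using A y by blast
    have "sub b (Uni A)" using b(1) by (auto simp: sub_def)
    then show "y \<epsilon> Vr (Uni A)" using Vr_mono b(2) unfolding sub_def by blast
  qed
  then have "x \<epsilon> Vr (suc (Uni A))" unfolding mem_Vr by auto
  then show "\<exists>a. ordn a \<and> x \<epsilon> Vr a" using ordn_suc[OF oA] by blast
qed

text \<open>Scott's trick: a witness is not unique, but the least level of the cumulative hierarchy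
  containing a witness is, and replacement applies to it.\<close>

theorem collection:
  assumes d: "dfn (\<lambda>e. \<psi> (e 0) (e 1))"
  shows "\<exists>B. \<forall>x. x \<epsilon> a \<longrightarrow> (\<exists>y. \<psi> x y) \<longrightarrow> (\<exists>y. y \<epsilon> B \<and> \<psi> x y)"
proof -
  let ?\<psi> = "\<lambda>x b. ordn b \<and> (\<exists>y. y \<epsilon> Vr b \<and> \<psi> x y) \<and> (\<forall>b'. b' \<epsilon> b \<longrightarrow> \<not> (\<exists>y. y \<epsilon> Vr b' \<and> \<psi> x y))"
  have "\<exists>A. \<forall>b. b \<epsilon> A \<longleftrightarrow> (\<exists>x. x \<epsilon> a \<and> ?\<psi> x b)"
    by (rule rep_ex) (intro dfns dfn2[of \<psi>, OF d], metis ordn_linear)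
  then obtain A where A: "\<And>b. b \<epsilon> A \<longleftrightarrow> (\<exists>x. x \<epsilon> a \<and> ?\<psi> x b)" by blast
  have m: "t \<epsilon> Img Vr A \<longleftrightarrow> (\<exists>b. b \<epsilon> A \<and> t = Vr b)" for t by (rule mem_Img) (intro dfns)
  have "\<exists>y. y \<epsilon> Uni (Img Vr A) \<and> \<psi> x y" if x: "x \<epsilon> a" and y: "\<psi> x y" for x y
  proof -
    obtain b where b: "ordn b" "y \<epsilon> Vr b" using Vr_ex by blast
    have "\<exists>b. ordn b \<and> (\<exists>y. y \<epsilon> Vr b \<and> \<psi> x y) \<and> (\<forall>b'. b' \<epsilon> b \<longrightarrow> \<not> (\<exists>y. y \<epsilon> Vr b' \<and> \<psi> x y))"
      by (rule ordn_least[of "\<lambda>b. \<exists>y. y \<epsilon> Vr b \<and> \<psi> x y" b]) (intro dfns dfn2[of \<psi>, OF d], (use b y in blast)+)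
    then obtain b' y' where "b' \<epsilon> A" "y' \<epsilon> Vr b'" "\<psi> x y'" using A x by blast
    then show ?thesis using m by auto
  qed
  then show ?thesis by blast
qed

end

section \<open>Names and atomic forcing\<close>

locale forcing = zf +
  fixes P L m :: 'a
  assumes L_P: "Pr q p \<epsilon> L \<Longrightarrow> q \<epsilon> P \<and> p \<epsilon> P"
    and L_refl: "p \<epsilon> P \<Longrightarrow> Pr p p \<epsilon> L"
    and L_trans: "Pr p q \<epsilon> L \<Longrightarrow> Pr q r \<epsilon> L \<Longrightarrow> Pr p r \<epsilon> L"
    and m_P: "m \<epsilon> P" and L_m: "p \<epsilon> P \<Longrightarrow> Pr p m \<epsilon> L"
begin

abbreviation le :: "'a \<Rightarrow> 'a \<Rightarrow> bool" where "le q p \<equiv> Pr q p \<epsilon> L"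

text \<open>\<open>hn S\<close> is the class of names hereditarily satisfying \<open>S\<close>; a name system is a set of such names closed
  under taking the names occurring in its elements.\<close>

definition nsys :: "('a \<Rightarrow> bool) \<Rightarrow> 'a \<Rightarrow> bool" where
  "nsys S T \<longleftrightarrow> (\<forall>x. x \<epsilon> T \<longrightarrow> S x \<and> (\<forall>t. t \<epsilon> x \<longrightarrow> (\<exists>z p. z \<epsilon> T \<and> p \<epsilon> P \<and> t = Pr z p)))"

definition hn :: "('a \<Rightarrow> bool) \<Rightarrow> 'a \<Rightarrow> bool" where
  "hn S x \<longleftrightarrow> (\<exists>T. nsys S T \<and> x \<epsilon> T)"

abbreviation nm :: "'a \<Rightarrow> bool" where "nm \<equiv> hn (\<lambda>_. True)"
abbreviation ns :: "'a \<Rightarrow> bool" where "ns \<equiv> nsys (\<lambda>_. True)"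

lemma hn_S: "hn S x \<Longrightarrow> S x"
  unfolding hn_def nsys_def by blast

lemma hn_nm: "hn S x \<Longrightarrow> nm x"
  unfolding hn_def nsys_def by blast

lemma hn_elem: "hn S x \<Longrightarrow> t \<epsilon> x \<Longrightarrow> \<exists>z p. hn S z \<and> p \<epsilon> P \<and> t = Pr z p"
  unfolding hn_def nsys_def by metis

lemma hn_Pr: "hn S x \<Longrightarrow> Pr z p \<epsilon> x \<Longrightarrow> hn S z \<and> p \<epsilon> P"
  by (drule (1) hn_elem) simp

lemma hn_Dom: "hn S x \<Longrightarrow> z \<epsilon> Dom x \<Longrightarrow> hn S z"
  using hn_Pr by auto

lemma nsys_dfn: "dfn (\<lambda>e. S (e 0)) \<Longrightarrow> dfnt t \<Longrightarrow> dfn (\<lambda>e. nsys S (t e))"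
  by (rule dfn1[of "nsys S"]; (assumption | (unfold nsys_def, intro dfns, erule dfn1, intro dfns)))

lemma hn_dfn: "dfn (\<lambda>e. S (e 0)) \<Longrightarrow> dfnt t \<Longrightarrow> dfn (\<lambda>e. hn S (t e))"
  by (rule dfn1[of "hn S"]; (assumption | (unfold hn_def, rule dfn_ex, rule dfn_and, erule nsys_dfn, intro dfns, intro dfns)))

lemma ns_dfn [dfns]: "dfnt t \<Longrightarrow> dfn (\<lambda>e. ns (t e))"
  by (rule nsys_dfn[OF dfn_const])

lemma nm_dfn [dfns]: "dfnt t \<Longrightarrow> dfn (\<lambda>e. nm (t e))"
  by (rule hn_dfn[OF dfn_const])

text \<open>The name systems of infinitely many elements cannot be picked simultaneously without
  choice. Instead, the hereditary names within one transitive set are taken all together, and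
  \<open>x\<close> is added.\<close>

lemma hn_I:
  assumes d: "dfn (\<lambda>e. S (e 0))" and "S x" and el: "\<And>t. t \<epsilon> x \<Longrightarrow> \<exists>z p. hn S z \<and> p \<epsilon> P \<and> t = Pr z p"
  shows "hn S x"
proof -
  obtain U where U: "trans_set U" "x \<epsilon> U" using transitive_superset by blast
  define T where "T = Cup (Sep U (hn S)) (Upr x x)"
  have T: "z \<epsilon> T \<longleftrightarrow> (z \<epsilon> U \<and> hn S z) \<or> z = x" for z
    unfolding T_def using mem_Sep[of "hn S" z U] hn_dfn[OF d dfnt_var] by simp
  have "nsys S T" unfolding nsys_def
  proof (intro allI impI conjI)
    fix z assume z: "z \<epsilon> T"
    then show "S z" using T assms(2) hn_S by blast
    fix t assume t: "t \<epsilon> z"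
    then obtain u p where u: "hn S u" "p \<epsilon> P" "t = Pr u p" using z T el hn_elem by metis
    have "z \<epsilon> U" using z T U by blast
    moreover have "u \<epsilon> Dom z" using t u by auto
    ultimately have "u \<epsilon> U" using Dom_trans[OF U(1)] unfolding sub_def by blast
    then show "\<exists>u p. u \<epsilon> T \<and> p \<epsilon> P \<and> t = Pr u p" using u T by blast
  qed
  then show ?thesis unfolding hn_def using T by blast
qed

lemma hn_induct:
  assumes d: "dfn (\<lambda>e. S (e 0))" and dp: "dfn (\<lambda>e. \<phi> (e 0))" and x: "hn S x"
    and step: "\<And>x. hn S x \<Longrightarrow> (\<And>z p. Pr z p \<epsilon> x \<Longrightarrow> \<phi> z) \<Longrightarrow> \<phi> x"
  shows "\<phi> x"
proof -
  have "hn S x \<longrightarrow> \<phi> x"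
  proof (rule Dom_induct[of "\<lambda>x. hn S x \<longrightarrow> \<phi> x"])
    show "dfn (\<lambda>e. hn S (e 0) \<longrightarrow> \<phi> (e 0))" by (rule dfn_imp[OF hn_dfn[OF d dfnt_var] dp])
    fix x assume IH: "\<And>y. y \<epsilon> Dom x \<Longrightarrow> hn S y \<longrightarrow> \<phi> y"
    have "\<phi> z" if "hn S x" "Pr z p \<epsilon> x" for z p using IH hn_Pr[OF that] that(2) by auto
    then show "hn S x \<longrightarrow> \<phi> x" using step by blast
  qed
  then show ?thesis using x by blast
qed

section \<open>Forced equality and membership within a name system\<close>

lemma ns_Pr: "ns T \<Longrightarrow> x \<epsilon> T \<Longrightarrow> Pr z p \<epsilon> x \<Longrightarrow> z \<epsilon> T \<and> p \<epsilon> P"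
  unfolding nsys_def by (metis Pr_eq)

lemma ns_Cup: "ns T \<Longrightarrow> ns T' \<Longrightarrow> ns (Cup T T')"
  unfolding nsys_def mem_Cup by metis

definition eq_clause :: "('a \<Rightarrow> 'a \<Rightarrow> 'a \<Rightarrow> bool) \<Rightarrow> 'a \<Rightarrow> 'a \<Rightarrow> 'a \<Rightarrow> bool" where
  "eq_clause R p x y \<longleftrightarrow>
    (\<forall>z s q. Pr z s \<epsilon> x \<longrightarrow> le q p \<longrightarrow> le q s \<longrightarrow> (\<exists>r v t. le r q \<and> Pr v t \<epsilon> y \<and> le r t \<and> R r z v)) \<and>
    (\<forall>v t q. Pr v t \<epsilon> y \<longrightarrow> le q p \<longrightarrow> le q t \<longrightarrow> (\<exists>r z s. le r q \<and> Pr z s \<epsilon> x \<and> le r s \<and> R r z v))"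

lemma eq_clause_mono:
  assumes "eq_clause R p x y" and "\<And>z s v t r. Pr z s \<epsilon> x \<Longrightarrow> Pr v t \<epsilon> y \<Longrightarrow> r \<epsilon> P \<Longrightarrow> R r z v \<Longrightarrow> R' r z v"
  shows "eq_clause R' p x y"
  using assms(1) unfolding eq_clause_def by (meson assms(2) L_P)

lemma eq_clause_cong:
  assumes "\<And>z s v t r. Pr z s \<epsilon> x \<Longrightarrow> Pr v t \<epsilon> y \<Longrightarrow> r \<epsilon> P \<Longrightarrow> R r z v \<longleftrightarrow> R' r z v"
  shows "eq_clause R p x y \<longleftrightarrow> eq_clause R' p x y"
  using assms by (auto elim!: eq_clause_mono)

text \<open>The symmetric clause for equality refers only to smaller first arguments, so that recursion on the
  first argument suffices.\<close>

definition er_step :: "'a \<Rightarrow> 'a \<Rightarrow> 'a \<Rightarrow> 'a" where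
  "er_step T x f = Sep (Times P T) (\<lambda>u. \<exists>p y. u = Pr p y \<and> eq_clause (\<lambda>r z v. Pr r v \<epsilon> App f z) p x y)"

definition er :: "'a \<Rightarrow> 'a \<Rightarrow> 'a \<Rightarrow> 'a \<Rightarrow> bool" where
  "er T p x y \<longleftrightarrow> Pr p y \<epsilon> Rec Dom er_step T x"

definition mr :: "'a \<Rightarrow> 'a \<Rightarrow> 'a \<Rightarrow> 'a \<Rightarrow> bool" where
  "mr T p x y \<longleftrightarrow> (\<forall>q. le q p \<longrightarrow> (\<exists>r. le r q \<and> (\<exists>z s. Pr z s \<epsilon> y \<and> le r s \<and> er T r x z)))"

lemma er_step_dfn: "dfnt (\<lambda>e. er_step (e 0) (e 1) (e 2))"
  unfolding er_step_def eq_clause_def by (intro dfns)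

lemma er_dfn [dfns]: "dfnt s \<Longrightarrow> dfnt t \<Longrightarrow> dfnt u \<Longrightarrow> dfnt v \<Longrightarrow> dfn (\<lambda>e. er (s e) (t e) (u e) (v e))"
  unfolding er_def by (intro dfns Rec_Dom_dfn[OF er_step_dfn])

lemma er_iff: "er T p x y \<longleftrightarrow> p \<epsilon> P \<and> y \<epsilon> T \<and> eq_clause (er T) p x y"
proof -
  let ?f = "Img (\<lambda>z. Pr z (Rec Dom er_step T z)) (Dom x)"
  have f: "t \<epsilon> ?f \<longleftrightarrow> (\<exists>z. z \<epsilon> Dom x \<and> t = Pr z (Rec Dom er_step T z))" for t
    by (rule mem_Img) (intro dfns Rec_Dom_dfn[OF er_step_dfn])
  have App: "App ?f z = Rec Dom er_step T z" if "Pr z s \<epsilon> x" for z s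
    by (rule App_eq) (use that f in auto)
  have "u \<epsilon> er_step T x ?f \<longleftrightarrow> u \<epsilon> Times P T \<and> (\<exists>p y. u = Pr p y \<and> eq_clause (\<lambda>r z v. Pr r v \<epsilon> App ?f z) p x y)" for u
    unfolding er_step_def by (rule mem_Sep) (unfold eq_clause_def, intro dfns)
  then have "er T p x y \<longleftrightarrow> p \<epsilon> P \<and> y \<epsilon> T \<and> eq_clause (\<lambda>r z v. Pr r v \<epsilon> App ?f z) p x y"
    unfolding er_def by (subst Rec_Dom[OF er_step_dfn]) simp
  moreover have "eq_clause (\<lambda>r z v. Pr r v \<epsilon> App ?f z) p x y \<longleftrightarrow> eq_clause (er T) p x y"
    by (rule eq_clause_cong) (use App in \<open>simp add: er_def\<close>)
  ultimately show ?thesis by simp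
qed

lemma er_mono: "er T p x y \<Longrightarrow> le q p \<Longrightarrow> er T q x y"
  unfolding er_iff[of T p] er_iff[of T q] eq_clause_def using L_P L_trans by meson

lemma er_refl:
  assumes T: "ns T" and "x \<epsilon> T" "p \<epsilon> P" shows "er T p x x"
proof -
  have "x \<epsilon> T \<longrightarrow> (\<forall>p. p \<epsilon> P \<longrightarrow> er T p x x)"
  proof (rule Dom_induct[of "\<lambda>x. x \<epsilon> T \<longrightarrow> (\<forall>p. p \<epsilon> P \<longrightarrow> er T p x x)"], intro dfns)
    fix x assume IH: "\<And>y. y \<epsilon> Dom x \<Longrightarrow> y \<epsilon> T \<longrightarrow> (\<forall>p. p \<epsilon> P \<longrightarrow> er T p y y)"
    have "er T q z z" if "x \<epsilon> T" "Pr z s \<epsilon> x" "le q s" for z s q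
      using IH that ns_Pr[OF T that(1,2)] L_P mem_Dom by blast
    then show "x \<epsilon> T \<longrightarrow> (\<forall>p. p \<epsilon> P \<longrightarrow> er T p x x)"
      unfolding er_iff[of T _ x] eq_clause_def using L_P L_refl by meson
  qed
  then show ?thesis using assms by blast
qed

lemma er_sym:
  assumes T: "ns T" and "x \<epsilon> T" "er T p x y" shows "er T p y x"
proof -
  have "x \<epsilon> T \<longrightarrow> (\<forall>y p. er T p x y \<longrightarrow> er T p y x)"
  proof (rule Dom_induct[of "\<lambda>x. x \<epsilon> T \<longrightarrow> (\<forall>y p. er T p x y \<longrightarrow> er T p y x)"], intro dfns)
    fix x assume IH: "\<And>z. z \<epsilon> Dom x \<Longrightarrow> z \<epsilon> T \<longrightarrow> (\<forall>y p. er T p z y \<longrightarrow> er T p y z)"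
    show "x \<epsilon> T \<longrightarrow> (\<forall>y p. er T p x y \<longrightarrow> er T p y x)"
    proof (intro impI allI)
      fix y p assume x: "x \<epsilon> T" and er: "er T p x y"
      have IH': "er T r v z" if "Pr z s \<epsilon> x" "er T r z v" for z s r v
        using IH that ns_Pr[OF T x that(1)] mem_Dom by blast
      show "er T p y x" using er x unfolding er_iff[of T p] eq_clause_def using IH' by meson
    qed
  qed
  then show ?thesis using assms by blast
qed

lemma er_trans:
  assumes T: "ns T" and "x \<epsilon> T" "er T p x y" "er T p y u" shows "er T p x u"
proof -
  have "x \<epsilon> T \<longrightarrow> (\<forall>y u p. er T p x y \<longrightarrow> er T p y u \<longrightarrow> er T p x u)"
  proof (rule Dom_induct[of "\<lambda>x. x \<epsilon> T \<longrightarrow> (\<forall>y u p. er T p x y \<longrightarrow> er T p y u \<longrightarrow> er T p x u)"], intro dfns)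
    fix x assume IH: "\<And>z. z \<epsilon> Dom x \<Longrightarrow> z \<epsilon> T \<longrightarrow> (\<forall>y u p. er T p z y \<longrightarrow> er T p y u \<longrightarrow> er T p z u)"
    show "x \<epsilon> T \<longrightarrow> (\<forall>y u p. er T p x y \<longrightarrow> er T p y u \<longrightarrow> er T p x u)"
    proof (intro impI allI)
      fix y u p assume x: "x \<epsilon> T" and xy: "er T p x y" and yu: "er T p y u"
      have IH': "er T r z w" if "Pr z s \<epsilon> x" "er T r z v" "er T r v w" for z s r v w
        using IH that ns_Pr[OF T x that(1)] mem_Dom by blast
      have c1: "\<exists>r v t. le r q \<and> Pr v t \<epsilon> y \<and> le r t \<and> er T r z v" if "Pr z s \<epsilon> x" "le q p" "le q s" for z s q
        using xy that unfolding er_iff[of T p] eq_clause_def by blast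
      have c2: "\<exists>r z s. le r q \<and> Pr z s \<epsilon> x \<and> le r s \<and> er T r z v" if "Pr v t \<epsilon> y" "le q p" "le q t" for v t q
        using xy that unfolding er_iff[of T p] eq_clause_def by blast
      have d1: "\<exists>r v t. le r q \<and> Pr v t \<epsilon> u \<and> le r t \<and> er T r z v" if "Pr z s \<epsilon> y" "le q p" "le q s" for z s q
        using yu that unfolding er_iff[of T p] eq_clause_def by blast
      have d2: "\<exists>r z s. le r q \<and> Pr z s \<epsilon> y \<and> le r s \<and> er T r z v" if "Pr v t \<epsilon> u" "le q p" "le q t" for v t q
        using yu that unfolding er_iff[of T p] eq_clause_def by blast
      have "\<exists>r w o'. le r q \<and> Pr w o' \<epsilon> u \<and> le r o' \<and> er T r z w" if z: "Pr z s \<epsilon> x" "le q p" "le q s" for z s q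
      proof -
        obtain r v t where r: "le r q" "Pr v t \<epsilon> y" "le r t" "er T r z v" using c1[OF z] by blast
        obtain r' w o' where r': "le r' r" "Pr w o' \<epsilon> u" "le r' o'" "er T r' v w"
          using d1[OF r(2) L_trans[OF r(1) z(2)] r(3)] by blast
        have "er T r' z w" by (rule IH'[OF z(1) er_mono[OF r(4) r'(1)] r'(4)])
        then show ?thesis using r' r(1) L_trans by blast
      qed
      moreover have "\<exists>r z s. le r q \<and> Pr z s \<epsilon> x \<and> le r s \<and> er T r z w" if w: "Pr w o' \<epsilon> u" "le q p" "le q o'" for w o' q
      proof -
        obtain r v t where r: "le r q" "Pr v t \<epsilon> y" "le r t" "er T r v w" using d2[OF w] by blast
        obtain r' z s where r': "le r' r" "Pr z s \<epsilon> x" "le r' s" "er T r' z v"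
          using c2[OF r(2) L_trans[OF r(1) w(2)] r(3)] by blast
        have "er T r' z w" by (rule IH'[OF r'(2) r'(4) er_mono[OF r(4) r'(1)]])
        then show ?thesis using r' r(1) L_trans by blast
      qed
      ultimately show "er T p x u" using yu unfolding er_iff[of T p] eq_clause_def by blast
    qed
  qed
  then show ?thesis using assms by blast
qed

lemma mr_cong2:
  assumes T: "ns T" and "z \<epsilon> T" "x \<epsilon> T" and xy: "er T p x y" and z: "mr T q z x" and q: "le q p"
  shows "mr T q z y"
  unfolding mr_def
proof (intro allI impI)
  fix q' assume q': "le q' q"
  then obtain r w s where r: "le r q'" "Pr w s \<epsilon> x" "le r s" "er T r z w" using z unfolding mr_def by blast
  have "le r p" using r(1) q' q L_trans by blast
  then obtain r' v t where r': "le r' r" "Pr v t \<epsilon> y" "le r' t" "er T r' w v"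
    using xy r unfolding er_iff[of T p] eq_clause_def by blast
  have "er T r' z v" by (rule er_trans[OF T assms(2) er_mono[OF r(4) r'(1)] r'(4)])
  then show "\<exists>r. le r q' \<and> (\<exists>v t. Pr v t \<epsilon> y \<and> le r t \<and> er T r z v)" using r' r(1) L_trans by blast
qed

lemma mr_own: 
  assumes T: "ns T" and "x \<epsilon> T" "Pr z s \<epsilon> x" "le q s" shows "mr T q z x"
  unfolding mr_def
proof (intro allI impI)
  fix q' assume q': "le q' q"
  have "er T q' z z" using er_refl[OF T] ns_Pr[OF T assms(2,3)] L_P[OF q'] by blast
  then show "\<exists>r. le r q' \<and> (\<exists>w s. Pr w s \<epsilon> x \<and> le r s \<and> er T r z w)" 
    using assms(3,4) q' L_refl L_P L_trans by blast
qed

text \<open>Recovers the equality clause of the official recursion. For the reverse direction the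
  clause is tested at the names in \<open>x\<close> and \<open>y\<close> themselves, which are
  forced to be members by \<open>mr_own\<close>.\<close>

lemma er_eq_mr:
  assumes T: "ns T" and x: "x \<epsilon> T" and y: "y \<epsilon> T" and p: "p \<epsilon> P"
  shows "er T p x y \<longleftrightarrow> (\<forall>z q. ((\<exists>s. Pr z s \<epsilon> x) \<or> (\<exists>s. Pr z s \<epsilon> y)) \<and> le q p \<longrightarrow> (mr T q z x \<longleftrightarrow> mr T q z y))"
    (is "_ \<longleftrightarrow> ?R")
proof
  assume er: "er T p x y"
  show ?R
  proof (intro allI impI)
    fix z q assume *: "((\<exists>s. Pr z s \<epsilon> x) \<or> (\<exists>s. Pr z s \<epsilon> y)) \<and> le q p"
    then have "z \<epsilon> T" using ns_Pr[OF T x] ns_Pr[OF T y] by blast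
    then show "mr T q z x \<longleftrightarrow> mr T q z y"
      using mr_cong2[OF T _ x er] mr_cong2[OF T _ y er_sym[OF T x er]] * by blast
  qed
next
  assume R: ?R
  have 1: "\<exists>r v t. le r q \<and> Pr v t \<epsilon> y \<and> le r t \<and> er T r z v" if "Pr z s \<epsilon> x" "le q p" "le q s" for z s q
  proof -
    have "mr T q z y" using R mr_own[OF T x that(1,3)] that by blast
    then show ?thesis unfolding mr_def using L_refl L_P[OF that(2)] by blast
  qed
  have 2: "\<exists>r z s. le r q \<and> Pr z s \<epsilon> x \<and> le r s \<and> er T r z v" if "Pr v t \<epsilon> y" "le q p" "le q t" for v t q
  proof -
    have "mr T q v x" "q \<epsilon> P" using R mr_own[OF T y that(1,3)] that L_P by blast+
    then obtain r z s where r: "le r q" "Pr z s \<epsilon> x" "le r s" "er T r v z"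
      unfolding mr_def using L_refl by blast
    then show ?thesis using er_sym[OF T _ r(4)] ns_Pr[OF T y that(1)] by blast
  qed
  have "eq_clause (er T) p x y" unfolding eq_clause_def using 1 2 by blast
  then show "er T p x y" using er_iff p y by blast
qed

section \<open>Agreement with the systems in the definition of forcing\<close>

abbreviation tri :: "'a \<Rightarrow> 'a \<Rightarrow> 'a \<Rightarrow> 'a \<Rightarrow> bool" where "tri p x y R \<equiv> Pr p (Pr x y) \<epsilon> R"

definition afs :: "'a \<Rightarrow> 'a \<Rightarrow> 'a \<Rightarrow> bool" where
  "afs T E' M \<longleftrightarrow> ns T \<and> (\<forall>p x y. p \<epsilon> P \<and> x \<epsilon> T \<and> y \<epsilon> T \<longrightarrow>
    (tri p x y E' \<longleftrightarrow> (\<forall>z q. ((\<exists>s. Pr z s \<epsilon> x) \<or> (\<exists>s. Pr z s \<epsilon> y)) \<and> le q p \<longrightarrow> (tri q z x M \<longleftrightarrow> tri q z y M))) \<and>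
    (tri p x y M \<longleftrightarrow> (\<forall>q. le q p \<longrightarrow> (\<exists>r. le r q \<and> (\<exists>z s. Pr z s \<epsilon> y \<and> le r s \<and> tri r x z E')))))"

definition feq :: "'a \<Rightarrow> 'a \<Rightarrow> 'a \<Rightarrow> bool" where
  "feq p x y \<longleftrightarrow> (\<exists>T E' M. afs T E' M \<and> x \<epsilon> T \<and> y \<epsilon> T \<and> tri p x y E')"

definition fmem :: "'a \<Rightarrow> 'a \<Rightarrow> 'a \<Rightarrow> bool" where
  "fmem p x y \<longleftrightarrow> (\<exists>T E' M. afs T E' M \<and> x \<epsilon> T \<and> y \<epsilon> T \<and> tri p x y M)"

lemma afs_dfn [dfns]: "dfnt s \<Longrightarrow> dfnt t \<Longrightarrow> dfnt u \<Longrightarrow> dfn (\<lambda>e. afs (s e) (t e) (u e))"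
  by (rule dfn3[of afs]; (assumption | (unfold afs_def, intro dfns)))

lemma feq_dfn [dfns]: "dfnt s \<Longrightarrow> dfnt t \<Longrightarrow> dfnt u \<Longrightarrow> dfn (\<lambda>e. feq (s e) (t e) (u e))"
  by (rule dfn3[of feq]; (assumption | (unfold feq_def, intro dfns)))

lemma fmem_dfn [dfns]: "dfnt s \<Longrightarrow> dfnt t \<Longrightarrow> dfnt u \<Longrightarrow> dfn (\<lambda>e. fmem (s e) (t e) (u e))"
  by (rule dfn3[of fmem]; (assumption | (unfold fmem_def, intro dfns)))

lemma mr_dfn [dfns]: "dfnt s \<Longrightarrow> dfnt t \<Longrightarrow> dfnt u \<Longrightarrow> dfnt v \<Longrightarrow> dfn (\<lambda>e. mr (s e) (t e) (u e) (v e))"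
  by (rule dfn4[of mr]; (assumption | (unfold mr_def, intro dfns)))

lemma afs_ex:
  assumes T: "ns T"
  shows "\<exists>E' M. afs T E' M \<and> (\<forall>p x y. p \<epsilon> P \<longrightarrow> x \<epsilon> T \<longrightarrow> y \<epsilon> T \<longrightarrow> (tri p x y E' \<longleftrightarrow> er T p x y) \<and> (tri p x y M \<longleftrightarrow> mr T p x y))"
proof -
  let ?U = "Times P (Times T T)"
  define E' where "E' = Sep ?U (\<lambda>u. \<exists>p x y. u = Pr p (Pr x y) \<and> er T p x y)"
  define M where "M = Sep ?U (\<lambda>u. \<exists>p x y. u = Pr p (Pr x y) \<and> mr T p x y)"
  have "u \<epsilon> E' \<longleftrightarrow> u \<epsilon> ?U \<and> (\<exists>p x y. u = Pr p (Pr x y) \<and> er T p x y)" for u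
    unfolding E'_def by (rule mem_Sep) (intro dfns)
  then have E': "tri p x y E' \<longleftrightarrow> er T p x y" if "p \<epsilon> P" "x \<epsilon> T" "y \<epsilon> T" for p x y using that by simp
  have "u \<epsilon> M \<longleftrightarrow> u \<epsilon> ?U \<and> (\<exists>p x y. u = Pr p (Pr x y) \<and> mr T p x y)" for u
    unfolding M_def by (rule mem_Sep) (intro dfns)
  then have M: "tri p x y M \<longleftrightarrow> mr T p x y" if "p \<epsilon> P" "x \<epsilon> T" "y \<epsilon> T" for p x y using that by simp
  have "afs T E' M" unfolding afs_def
  proof (intro conjI allI impI T)
    fix p x y assume a: "p \<epsilon> P \<and> x \<epsilon> T \<and> y \<epsilon> T"
    then have pP: "p \<epsilon> P" and xT: "x \<epsilon> T" and yT: "y \<epsilon> T" by blast+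
    have "(tri q z x M \<longleftrightarrow> tri q z y M) \<longleftrightarrow> (mr T q z x \<longleftrightarrow> mr T q z y)"
      if z: "((\<exists>s. Pr z s \<epsilon> x) \<or> (\<exists>s. Pr z s \<epsilon> y)) \<and> le q p" for z q
    proof -
      have "z \<epsilon> T" "q \<epsilon> P" using z ns_Pr[OF T xT] ns_Pr[OF T yT] L_P by blast+
      then show ?thesis using M xT yT by simp
    qed
    then show "tri p x y E' \<longleftrightarrow> (\<forall>z q. ((\<exists>s. Pr z s \<epsilon> x) \<or> (\<exists>s. Pr z s \<epsilon> y)) \<and> le q p \<longrightarrow> (tri q z x M \<longleftrightarrow> tri q z y M))"
      unfolding E'[OF pP xT yT] er_eq_mr[OF T xT yT pP] by blast
    have "tri r x z E' \<longleftrightarrow> er T r x z" if z: "Pr z s \<epsilon> y" "le r s" for z s r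
    proof -
      have "z \<epsilon> T" "r \<epsilon> P" using z ns_Pr[OF T yT] L_P by blast+
      then show ?thesis using E' xT by simp
    qed
    then show "tri p x y M \<longleftrightarrow> (\<forall>q. le q p \<longrightarrow> (\<exists>r. le r q \<and> (\<exists>z s. Pr z s \<epsilon> y \<and> le r s \<and> tri r x z E')))"
      unfolding M[OF pP xT yT] mr_def by blast
  qed
  then show ?thesis using E' M by blast
qed

lemma Vr_Pr: "Pr z s \<epsilon> Vr b \<Longrightarrow> z \<epsilon> Vr b"
  using Vr_trans unfolding trans_set_def sub_def Pr_def by (metis mem_Upr)

text \<open>The official recursion descends alternately in both arguments, so neither alone carries
  the induction. A level of the cumulative hierarchy containing both does: the next comparison
  involves names in a common lower level.\<close>

lemma afs_unique:
  assumes A: "afs T E1 M1" and B: "afs U E2 M2"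
    and "x \<epsilon> T" "y \<epsilon> T" "x \<epsilon> U" "y \<epsilon> U" "p \<epsilon> P"
  shows "tri p x y E1 \<longleftrightarrow> tri p x y E2"
proof -
  have nT: "ns T" and nU: "ns U" using A B unfolding afs_def by blast+
  let ?\<phi> = "\<lambda>a. ordn a \<longrightarrow> (\<forall>x y p. x \<epsilon> Vr a \<and> y \<epsilon> Vr a \<and> x \<epsilon> T \<and> y \<epsilon> T \<and> x \<epsilon> U \<and> y \<epsilon> U \<and> p \<epsilon> P \<longrightarrow>
      (tri p x y E1 \<longleftrightarrow> tri p x y E2))"
  have "?\<phi> a" for a
  proof (rule eps_induct[of ?\<phi>], intro dfns, intro impI allI)
    fix a x y p
    assume IH: "\<And>b. b \<epsilon> a \<Longrightarrow> ?\<phi> b" and o: "ordn a"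
      and h: "x \<epsilon> Vr a \<and> y \<epsilon> Vr a \<and> x \<epsilon> T \<and> y \<epsilon> T \<and> x \<epsilon> U \<and> y \<epsilon> U \<and> p \<epsilon> P"
    obtain b1 b2 where b: "b1 \<epsilon> a" "sub x (Vr b1)" "b2 \<epsilon> a" "sub y (Vr b2)" using h mem_Vr by metis
    obtain b where b: "b \<epsilon> a" "sub x (Vr b)" "sub y (Vr b)"
      using b ordn_sub_linear[OF ordn_mem[OF o b(1)] ordn_mem[OF o b(3)]] Vr_mono unfolding sub_def by metis
    have ob: "ordn b" using ordn_mem[OF o b(1)] .
    have IH': "tri r z w E1 \<longleftrightarrow> tri r z w E2"
      if "z \<epsilon> Vr b" "w \<epsilon> Vr b" "z \<epsilon> T" "w \<epsilon> T" "z \<epsilon> U" "w \<epsilon> U" "r \<epsilon> P" for r z w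
      using IH[OF b(1)] ob that by blast
    have M: "tri q z v M1 \<longleftrightarrow> tri q z v M2"
      if z: "z \<epsilon> Vr b" "z \<epsilon> T" "z \<epsilon> U" and v: "v = x \<or> v = y" and q: "q \<epsilon> P" for q z v
    proof -
      have "tri r z w E1 \<longleftrightarrow> tri r z w E2" if "Pr w s \<epsilon> v" "le r s" for r w s
      proof (rule IH')
        show "w \<epsilon> Vr b" using that(1) v b Vr_Pr unfolding sub_def by blast
      qed (use z that v h ns_Pr[OF nT] ns_Pr[OF nU] L_P in blast)+
      then have "(\<forall>q'. le q' q \<longrightarrow> (\<exists>r. le r q' \<and> (\<exists>w s. Pr w s \<epsilon> v \<and> le r s \<and> tri r z w E1))) \<longleftrightarrow>
          (\<forall>q'. le q' q \<longrightarrow> (\<exists>r. le r q' \<and> (\<exists>w s. Pr w s \<epsilon> v \<and> le r s \<and> tri r z w E2)))" by blast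
      moreover have "q \<epsilon> P \<and> z \<epsilon> T \<and> v \<epsilon> T" "q \<epsilon> P \<and> z \<epsilon> U \<and> v \<epsilon> U" using z v h q by blast+
      ultimately show ?thesis using A B unfolding afs_def by simp
    qed
    have "tri q z x M1 \<longleftrightarrow> tri q z x M2" "tri q z y M1 \<longleftrightarrow> tri q z y M2"
      if "((\<exists>s. Pr z s \<epsilon> x) \<or> (\<exists>s. Pr z s \<epsilon> y)) \<and> le q p" for z q
      by (rule M; (use that b Vr_Pr h ns_Pr[OF nT] ns_Pr[OF nU] L_P in \<open>unfold sub_def, blast\<close>))+
    then have "(\<forall>z q. ((\<exists>s. Pr z s \<epsilon> x) \<or> (\<exists>s. Pr z s \<epsilon> y)) \<and> le q p \<longrightarrow> (tri q z x M1 \<longleftrightarrow> tri q z y M1)) \<longleftrightarrow>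
        (\<forall>z q. ((\<exists>s. Pr z s \<epsilon> x) \<or> (\<exists>s. Pr z s \<epsilon> y)) \<and> le q p \<longrightarrow> (tri q z x M2 \<longleftrightarrow> tri q z y M2))" by blast
    moreover have "p \<epsilon> P \<and> x \<epsilon> T \<and> y \<epsilon> T" "p \<epsilon> P \<and> x \<epsilon> U \<and> y \<epsilon> U" using h by blast+
    ultimately show "tri p x y E1 \<longleftrightarrow> tri p x y E2" using A B unfolding afs_def by simp
  qed
  moreover obtain a where "ordn a" "Upr x y \<epsilon> Vr a" using Vr_ex by blast
  moreover then have "x \<epsilon> Vr a" "y \<epsilon> Vr a" using Vr_trans unfolding trans_set_def sub_def by auto
  ultimately show ?thesis using assms by blast
qed

lemma feq_er:
  assumes T: "ns T" "x \<epsilon> T" "y \<epsilon> T" "p \<epsilon> P" shows "feq p x y \<longleftrightarrow> er T p x y"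
proof -
  obtain E' M where E': "afs T E' M" "\<And>p x y. p \<epsilon> P \<Longrightarrow> x \<epsilon> T \<Longrightarrow> y \<epsilon> T \<Longrightarrow> tri p x y E' \<longleftrightarrow> er T p x y"
    using afs_ex[OF T(1)] by blast
  show ?thesis
  proof
    assume "feq p x y"
    then obtain U E2 M2 where "afs U E2 M2" "x \<epsilon> U" "y \<epsilon> U" "tri p x y E2" unfolding feq_def by blast
    then show "er T p x y" using afs_unique[OF E'(1)] E'(2) T by blast
  next
    assume "er T p x y" then show "feq p x y" unfolding feq_def using E' T by blast
  qed
qed

lemma fmem_mr:
  assumes T: "ns T" "x \<epsilon> T" "y \<epsilon> T" "p \<epsilon> P" shows "fmem p x y \<longleftrightarrow> mr T p x y"
proof -
  obtain E' M where E': "afs T E' M" "\<And>p x y. p \<epsilon> P \<Longrightarrow> x \<epsilon> T \<Longrightarrow> y \<epsilon> T \<Longrightarrow> (tri p x y E' \<longleftrightarrow> er T p x y) \<and> (tri p x y M \<longleftrightarrow> mr T p x y)"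
    using afs_ex[OF T(1)] by blast
  show ?thesis
  proof
    assume "fmem p x y"
    then obtain U E2 M2 where U: "afs U E2 M2" "x \<epsilon> U" "y \<epsilon> U" "tri p x y M2" unfolding fmem_def by blast
    have nU: "ns U" using U(1) unfolding afs_def by blast
    have "tri r x z E2 \<longleftrightarrow> er T r x z" if "Pr z s \<epsilon> y" "le r s" for r z s
      using afs_unique[OF E'(1) U(1)] E'(2) T U ns_Pr[OF T(1) T(3) that(1)] ns_Pr[OF nU U(3) that(1)] L_P[OF that(2)] by blast
    moreover have "\<forall>q. le q p \<longrightarrow> (\<exists>r. le r q \<and> (\<exists>z s. Pr z s \<epsilon> y \<and> le r s \<and> tri r x z E2))"
      using U T(4) unfolding afs_def by blast
    ultimately show "mr T p x y" unfolding mr_def by blast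
  next
    assume "mr T p x y" then show "fmem p x y" unfolding fmem_def using E' T by blast
  qed
qed

section \<open>Rules of atomic forcing for arbitrary names\<close>

lemma nm_ns: "nm x \<Longrightarrow> \<exists>T. ns T \<and> x \<epsilon> T"
  unfolding hn_def .

lemma ns3:
  assumes "nm x" "nm y" "nm z" shows "\<exists>T. ns T \<and> x \<epsilon> T \<and> y \<epsilon> T \<and> z \<epsilon> T"
proof -
  obtain T1 where 1: "ns T1" "x \<epsilon> T1" using nm_ns[OF assms(1)] by (elim exE conjE)
  obtain T2 where 2: "ns T2" "y \<epsilon> T2" using nm_ns[OF assms(2)] by (elim exE conjE)
  obtain T3 where 3: "ns T3" "z \<epsilon> T3" using nm_ns[OF assms(3)] by (elim exE conjE)
  have "ns (Cup T1 (Cup T2 T3))" by (intro ns_Cup 1 2 3)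
  then show ?thesis using 1 2 3 mem_Cup by (intro exI[of _ "Cup T1 (Cup T2 T3)"]) simp
qed

lemma feq_iff:
  assumes "nm x" "nm y" "p \<epsilon> P" shows "feq p x y \<longleftrightarrow> eq_clause feq p x y"
proof -
  obtain T where T: "ns T" "x \<epsilon> T" "y \<epsilon> T" using ns3[OF assms(1,2,2)] by (elim exE conjE)
  have e: "er T r z v \<longleftrightarrow> feq r z v" if "Pr z s \<epsilon> x" "Pr v t \<epsilon> y" "r \<epsilon> P" for r z v s t
    using feq_er[OF T(1)] ns_Pr[OF T(1) T(2) that(1)] ns_Pr[OF T(1) T(3) that(2)] that(3) by blast
  have "feq p x y \<longleftrightarrow> eq_clause (er T) p x y" using feq_er[OF T assms(3)] er_iff[of T] T assms(3) by blast
  also have "\<dots> \<longleftrightarrow> eq_clause feq p x y" by (rule eq_clause_cong) (rule e)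
  finally show ?thesis .
qed

lemma fmem_iff:
  assumes "nm x" "nm y" "p \<epsilon> P"
  shows "fmem p x y \<longleftrightarrow> (\<forall>q. le q p \<longrightarrow> (\<exists>r. le r q \<and> (\<exists>z s. Pr z s \<epsilon> y \<and> le r s \<and> feq r x z)))"
proof -
  obtain T where T: "ns T" "x \<epsilon> T" "y \<epsilon> T" using ns3[OF assms(1,2,2)] by (elim exE conjE)
  have e: "er T r x z \<longleftrightarrow> feq r x z" if "Pr z s \<epsilon> y" "le r s" for r z s
    using feq_er[OF T(1,2)] ns_Pr[OF T(1) T(3) that(1)] L_P[OF that(2)] by blast
  show ?thesis unfolding fmem_mr[OF T assms(3)] mr_def using e by blast
qed

lemma feq_fmem:
  assumes "nm x" "nm y" "p \<epsilon> P"
  shows "feq p x y \<longleftrightarrow> (\<forall>z q. (z \<epsilon> Dom x \<or> z \<epsilon> Dom y) \<longrightarrow> le q p \<longrightarrow> (fmem q z x \<longleftrightarrow> fmem q z y))"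
proof -
  obtain T where T: "ns T" "x \<epsilon> T" "y \<epsilon> T" using ns3[OF assms(1,2,2)] by (elim exE conjE)
  have e: "(mr T q z x \<longleftrightarrow> fmem q z x) \<and> (mr T q z y \<longleftrightarrow> fmem q z y)" if "z \<epsilon> Dom x \<or> z \<epsilon> Dom y" "le q p" for z q
    using fmem_mr[OF T(1)] T ns_Pr[OF T(1)] L_P[OF that(2)] that(1) unfolding mem_Dom by metis
  show ?thesis unfolding feq_er[OF T assms(3)] er_eq_mr[OF T assms(3)] mem_Dom[symmetric] using e by blast
qed

lemma feq_refl: "nm x \<Longrightarrow> p \<epsilon> P \<Longrightarrow> feq p x x"
  using feq_fmem by blast

lemma feq_sym: "nm x \<Longrightarrow> nm y \<Longrightarrow> p \<epsilon> P \<Longrightarrow> feq p x y \<Longrightarrow> feq p y x"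
  unfolding feq_fmem by blast

lemma feq_mono:
  assumes "nm x" "nm y" "le q p" "feq p x y" shows "feq q x y"
proof -
  have P: "q \<epsilon> P" "p \<epsilon> P" using L_P[OF assms(3)] by blast+
  show ?thesis
    unfolding feq_fmem[OF assms(1,2) P(1)]
    using assms(4)[unfolded feq_fmem[OF assms(1,2) P(2)]] L_trans[OF _ assms(3)] by blast
qed

lemma fmem_mono:
  assumes "nm x" "nm y" "le q p" "fmem p x y" shows "fmem q x y"
proof -
  have P: "q \<epsilon> P" "p \<epsilon> P" using L_P[OF assms(3)] by blast+
  show ?thesis
    unfolding fmem_iff[OF assms(1,2) P(1)]
    using assms(4)[unfolded fmem_iff[OF assms(1,2) P(2)]] L_trans[OF _ assms(3)] by blast
qed

lemma feq_trans:
  assumes "nm x" "nm y" "nm z" "p \<epsilon> P" "feq p x y" "feq p y z" shows "feq p x z"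
proof -
  obtain T where T: "ns T" "x \<epsilon> T" "y \<epsilon> T" "z \<epsilon> T" using ns3[OF assms(1,2,3)] by (elim exE conjE)
  have "er T p x z"
    by (rule er_trans[OF T(1,2)]) (use assms(5,6) feq_er[OF T(1) T(2,3) assms(4)] feq_er[OF T(1) T(3,4) assms(4)] in blast)+
  then show ?thesis using feq_er[OF T(1) T(2,4) assms(4)] by blast
qed

lemma fmem_cong1:
  assumes "nm x" "nm x'" "nm y" "p \<epsilon> P" "feq p x x'" "fmem p x y" shows "fmem p x' y"
proof -
  have "\<exists>r. le r q \<and> (\<exists>z s. Pr z s \<epsilon> y \<and> le r s \<and> feq r x' z)" if q: "le q p" for q
  proof -
    obtain r z s where r: "le r q" "Pr z s \<epsilon> y" "le r s" "feq r x z"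
      using assms(6)[unfolded fmem_iff[OF assms(1,3,4)]] q by blast
    have z: "nm z" using hn_Pr[OF assms(3) r(2)] by blast
    have rP: "r \<epsilon> P" using L_P r(1) by blast
    have "feq r x x'" using feq_mono[OF assms(1,2) L_trans[OF r(1) q] assms(5)] .
    then have "feq r x' z" using feq_trans[OF assms(2,1) z rP feq_sym[OF assms(1,2) rP] r(4)] by blast
    then show ?thesis using r by blast
  qed
  then show ?thesis using fmem_iff[OF assms(2,3,4)] by blast
qed

lemma fmem_cong2:
  assumes "nm x" "nm y" "nm y'" "p \<epsilon> P" "feq p y y'" "fmem p x y" shows "fmem p x y'"
proof -
  obtain T where T: "ns T" "x \<epsilon> T" "y \<epsilon> T" "y' \<epsilon> T" using ns3[OF assms(1,2,3)] by (elim exE conjE)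
  have "mr T p x y'"
    by (rule mr_cong2[OF T(1,2,3) _ _ L_refl[OF assms(4)]])
      (use assms(5,6) feq_er[OF T(1) T(3,4) assms(4)] fmem_mr[OF T(1) T(2,3) assms(4)] in blast)+
  then show ?thesis using fmem_mr[OF T(1) T(2,4) assms(4)] by blast
qed

lemma fmem_own:
  assumes "nm x" "Pr z s \<epsilon> x" "le q s" shows "fmem q z x"
proof -
  obtain T where T: "ns T" "x \<epsilon> T" using nm_ns[OF assms(1)] by (elim exE conjE)
  have "z \<epsilon> T" using ns_Pr[OF T assms(2)] by blast
  moreover have "q \<epsilon> P" using L_P[OF assms(3)] by blast
  ultimately show ?thesis using mr_own[OF T assms(2,3)] fmem_mr[OF T(1) _ T(2)] by blast
qed

lemma fmem_dense:
  assumes "nm x" "nm y" "p \<epsilon> P" and d: "\<And>q. le q p \<Longrightarrow> \<exists>r. le r q \<and> fmem r x y" shows "fmem p x y"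
  unfolding fmem_iff[OF assms(1-3)]
proof (intro allI impI)
  fix q assume "le q p"
  then obtain r where r: "le r q" "fmem r x y" using d by blast
  then have "r \<epsilon> P" using L_P by blast
  then show "\<exists>r. le r q \<and> (\<exists>z s. Pr z s \<epsilon> y \<and> le r s \<and> feq r x z)"
    using r(2)[unfolded fmem_iff[OF assms(1,2) \<open>r \<epsilon> P\<close>]] L_refl r(1) L_trans by meson
qed

lemma feq_dense:
  assumes "nm x" "nm y" "p \<epsilon> P" and d: "\<And>q. le q p \<Longrightarrow> \<exists>r. le r q \<and> feq r x y" shows "feq p x y"
  unfolding feq_fmem[OF assms(1-3)]
proof (intro allI impI)
  fix z q assume z: "z \<epsilon> Dom x \<or> z \<epsilon> Dom y" and q: "le q p"
  have nz: "nm z" using z hn_Dom assms(1,2) by blast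
  have qP: "q \<epsilon> P" using q L_P by blast
  have 1: "\<exists>r. le r q' \<and> (fmem r z x \<longleftrightarrow> fmem r z y)" if q': "le q' q" for q'
  proof -
    obtain r where r: "le r q'" "feq r x y" using d L_trans[OF q' q] by blast
    then have "r \<epsilon> P" using L_P by blast
    then show ?thesis using r(1) z r(2)[unfolded feq_fmem[OF assms(1,2) \<open>r \<epsilon> P\<close>]] L_refl by blast
  qed
  show "fmem q z x \<longleftrightarrow> fmem q z y"
  proof
    assume f: "fmem q z x"
    show "fmem q z y"
      by (rule fmem_dense[OF nz assms(2) qP]) (use 1 f fmem_mono[OF nz assms(1)] L_trans in meson)
  next
    assume f: "fmem q z y"
    show "fmem q z x"
      by (rule fmem_dense[OF nz assms(1) qP]) (use 1 f fmem_mono[OF nz assms(2)] L_trans in meson)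
  qed
qed

section \<open>The forcing relation\<close>

text \<open>Quantifiers range over the class \<open>C\<close> of names: all names for the full generic extension, and the
  hereditarily symmetric names for the symmetric submodel.\<close>

primrec fc :: "('a \<Rightarrow> bool) \<Rightarrow> fm \<Rightarrow> 'a \<Rightarrow> (nat \<Rightarrow> 'a) \<Rightarrow> bool" where
  "fc C (Mem i j) p e = fmem p (e i) (e j)"
| "fc C (Eq i j) p e = feq p (e i) (e j)"
| "fc C (Neg A) p e = (\<forall>q. le q p \<longrightarrow> \<not> fc C A q e)"
| "fc C (And A B) p e = (fc C A p e \<and> fc C B p e)"
| "fc C (All A) p e = (\<forall>x. C x \<longrightarrow> fc C A p (case_nat x e))"

lemma fc_dfn:
  assumes C: "dfn (\<lambda>e. C (e 0))" shows "dfn (\<lambda>e. fc C A (e 0) (\<lambda>i. e (Suc i)))"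
proof (induction A)
  case (Neg A)
  have "dfn (\<lambda>e. fc C A (e 0) (\<lambda>i. e (Suc (Suc i))))"
    using dfn_ren[OF Neg, of "case_nat 0 (\<lambda>i. Suc (Suc i))"] by simp
  then show ?case by simp (intro dfns)
next
  case (All A)
  have "(\<lambda>i. e (case_nat 0 (\<lambda>i. Suc (Suc i)) i)) = case_nat (e 0) (\<lambda>i. e (Suc (Suc i)))" for e :: "nat \<Rightarrow> 'a"
    by (auto split: nat.split)
  then have "dfn (\<lambda>e. fc C A (e 1) (case_nat (e 0) (\<lambda>i. e (Suc (Suc i)))))"
    using dfn_ren[OF All, of "case_nat 1 (case_nat 0 (\<lambda>i. Suc (Suc i)))"] by simp
  then show ?case by simp (intro dfns C)
qed (simp; intro dfns; assumption)+

lemma fc_cong: "bounded_by n A \<Longrightarrow> (\<And>i. i < n \<Longrightarrow> e i = e' i) \<Longrightarrow> fc C A p e = fc C A p e'"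
proof (induction A arbitrary: n e e' p)
  case (All A)
  have "fc C A p (case_nat x e) = fc C A p (case_nat x e')" for x
    by (rule All.IH[of "Suc n"]) (use All.prems in \<open>auto split: nat.split\<close>)
  then show ?case by simp
next
  case (Neg A)
  have "fc C A p e = fc C A p e'" for p by (rule Neg.IH[OF _ Neg.prems(2)]) (use Neg.prems(1) in auto)
  then show ?case by simp
next
  case (And A B)
  have "fc C A p e = fc C A p e'" by (rule And.IH(1)[OF _ And.prems(2)]) (use And.prems(1) in auto)
  moreover have "fc C B p e = fc C B p e'" by (rule And.IH(2)[OF _ And.prems(2)]) (use And.prems(1) in auto)
  ultimately show ?case by simp
qed simp_all

lemma fc_mono: 
  assumes C: "\<And>x. C x \<Longrightarrow> nm x"
  shows "(\<forall>i. nm (e i)) \<Longrightarrow> le q p \<Longrightarrow> fc C A p e \<Longrightarrow> fc C A q e"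
proof (induction A arbitrary: e)
  case (Mem i j) then show ?case using fmem_mono by simp
next
  case (Eq i j) then show ?case using feq_mono by simp
next
  case (Neg A)
  have "\<not> fc C A r e" if "le r q" for r using L_trans[OF that Neg.prems(2)] Neg.prems(3) by simp
  then show ?case by simp
next
  case (All A)
  have "fc C A q (case_nat x e)" if x: "C x" for x
  proof (rule All.IH[OF _ All.prems(2)])
    show "\<forall>i. nm (case_nat x e i)" using C[OF x] All.prems(1) by (simp split: nat.split)
    show "fc C A p (case_nat x e)" using All.prems(3) x by simp
  qed
  then show ?case by simp
qed simp_all

lemma fc_dense:
  assumes C: "\<And>x. C x \<Longrightarrow> nm x"
  shows "(\<forall>i. nm (e i)) \<Longrightarrow> p \<epsilon> P \<Longrightarrow> (\<forall>q. le q p \<longrightarrow> (\<exists>r. le r q \<and> fc C A r e)) \<Longrightarrow> fc C A p e"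
proof (induction A arbitrary: e)
  case (Mem i j) then show ?case using fmem_dense by simp
next
  case (Eq i j) then show ?case using feq_dense by simp
next
  case (Neg A)
  show ?case
  proof (simp, intro allI impI notI)
    fix q assume q: "le q p" "fc C A q e"
    obtain r where r: "le r q" "fc C (Neg A) r e" using Neg.prems(3) q(1) by blast
    have "fc C A r e" using fc_mono[OF C Neg.prems(1) r(1) q(2)] .
    moreover have "le r r" using r L_P L_refl by blast
    ultimately show False using r(2) by simp
  qed
next
  case (And A B)
  have "fc C A p e" by (rule And.IH(1)[OF And.prems(1,2)]) (use And.prems(3) in auto)
  moreover have "fc C B p e" by (rule And.IH(2)[OF And.prems(1,2)]) (use And.prems(3) in auto)
  ultimately show ?case by simp
next
  case (All A)
  have "fc C A p (case_nat x e)" if x: "C x" for x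
  proof (rule All.IH[OF _ All.prems(2)])
    show "\<forall>i. nm (case_nat x e i)" using C[OF x] All.prems(1) by (simp split: nat.split)
    show "\<forall>q. le q p \<longrightarrow> (\<exists>r. le r q \<and> fc C A r (case_nat x e))" using All.prems(3) x by auto
  qed
  then show ?case by simp
qed

section \<open>Canonical names\<close>

definition chk :: "'a \<Rightarrow> 'a" where
  "chk x = Rec (\<lambda>x. x) (\<lambda>w x f. Img (\<lambda>v. Pr v m) (Ran f)) emp x"

lemma chk_H_dfn: "dfnt (\<lambda>e. Img (\<lambda>v. Pr v m) (Ran (e 2)))"
  by (intro dfns)

lemma chk_dfn [dfns]: "dfnt s \<Longrightarrow> dfnt (\<lambda>e. chk (s e))"
  unfolding chk_def by (rule Rec_mem_dfn[OF chk_H_dfn dfnt_const])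

lemma mem_chk: "t \<epsilon> chk x \<longleftrightarrow> (\<exists>y. y \<epsilon> x \<and> t = Pr (chk y) m)"
proof -
  have 1: "chk x = Img (\<lambda>v. Pr v m) (Ran (Img (\<lambda>z. Pr z (chk z)) x))"
    unfolding chk_def by (subst Rec_mem[OF chk_H_dfn]) simp
  have 2: "t \<epsilon> Img (\<lambda>z. Pr z (chk z)) x \<longleftrightarrow> (\<exists>z. z \<epsilon> x \<and> t = Pr z (chk z))" for t
    by (rule mem_Img) (intro dfns)
  have 3: "t \<epsilon> Img (\<lambda>v. Pr v m) a \<longleftrightarrow> (\<exists>z. z \<epsilon> a \<and> t = Pr z m)" for t a
    by (rule mem_Img) (intro dfns)
  show ?thesis unfolding 1 3 by (auto simp: 2)
qed

end

section \<open>Generic extensions by hereditarily symmetric names\<close>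

context set_structure
begin

text \<open>A generic extension yields sets that are large enough rather than exact. Separation
  trims them, and together with collection it gives replacement.\<close>

lemma zf_weakI:
  assumes ext: "\<And>x y. (\<And>z. z \<epsilon> x \<longleftrightarrow> z \<epsilon> y) \<Longrightarrow> x = y"
    and found: "\<And>x. \<exists>y. y \<epsilon> x \<Longrightarrow> \<exists>y. y \<epsilon> x \<and> \<not> (\<exists>z. z \<epsilon> x \<and> z \<epsilon> y)"
    and upair: "\<And>x y. \<exists>u. x \<epsilon> u \<and> y \<epsilon> u"
    and union: "\<And>x. \<exists>u. \<forall>z y. y \<epsilon> x \<longrightarrow> z \<epsilon> y \<longrightarrow> z \<epsilon> u"
    and pow: "\<And>x. \<exists>u. \<forall>z. (\<forall>t. t \<epsilon> z \<longrightarrow> t \<epsilon> x) \<longrightarrow> z \<epsilon> u"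
    and inf: "\<exists>I. (\<exists>o'. o' \<epsilon> I \<and> \<not> (\<exists>z. z \<epsilon> o')) \<and> (\<forall>x. x \<epsilon> I \<longrightarrow> (\<exists>s. s \<epsilon> I \<and> (\<forall>z. z \<epsilon> s \<longleftrightarrow> z \<epsilon> x \<or> z = x)))"
    and sep: "\<And>\<phi> a. dfn (\<lambda>e. \<phi> (e 0)) \<Longrightarrow> \<exists>b. \<forall>x. x \<epsilon> b \<longleftrightarrow> x \<epsilon> a \<and> \<phi> x"
    and coll: "\<And>\<psi> a. dfn (\<lambda>e. \<psi> (e 0) (e 1)) \<Longrightarrow> \<exists>B. \<forall>x. x \<epsilon> a \<longrightarrow> (\<exists>y. \<psi> x y) \<longrightarrow> (\<exists>y. y \<epsilon> B \<and> \<psi> x y)"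
  shows "zf E"
proof
  show "\<exists>u. \<forall>z. z \<epsilon> u \<longleftrightarrow> z = x \<or> z = y" for x y
  proof -
    obtain u where u: "x \<epsilon> u" "y \<epsilon> u" using upair by blast
    have "\<exists>b. \<forall>z. z \<epsilon> b \<longleftrightarrow> z \<epsilon> u \<and> (z = x \<or> z = y)" by (rule sep) (intro dfns)
    then obtain b where "\<forall>z. z \<epsilon> b \<longleftrightarrow> z \<epsilon> u \<and> (z = x \<or> z = y)" ..
    then have "\<forall>z. z \<epsilon> b \<longleftrightarrow> z = x \<or> z = y" using u by metis
    then show ?thesis ..
  qed
  show "\<exists>u. \<forall>z. z \<epsilon> u \<longleftrightarrow> (\<exists>y. y \<epsilon> x \<and> z \<epsilon> y)" for x
  proof -
    obtain u where u: "\<forall>z y. y \<epsilon> x \<longrightarrow> z \<epsilon> y \<longrightarrow> z \<epsilon> u" using union by blast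
    have "\<exists>b. \<forall>z. z \<epsilon> b \<longleftrightarrow> z \<epsilon> u \<and> (\<exists>y. y \<epsilon> x \<and> z \<epsilon> y)" by (rule sep) (intro dfns)
    then obtain b where "\<forall>z. z \<epsilon> b \<longleftrightarrow> z \<epsilon> u \<and> (\<exists>y. y \<epsilon> x \<and> z \<epsilon> y)" ..
    then have "\<forall>z. z \<epsilon> b \<longleftrightarrow> (\<exists>y. y \<epsilon> x \<and> z \<epsilon> y)" using u by metis
    then show ?thesis ..
  qed
  show "\<exists>u. \<forall>z. z \<epsilon> u \<longleftrightarrow> (\<forall>t. t \<epsilon> z \<longrightarrow> t \<epsilon> x)" for x
  proof -
    obtain u where u: "\<forall>z. (\<forall>t. t \<epsilon> z \<longrightarrow> t \<epsilon> x) \<longrightarrow> z \<epsilon> u" using pow by blast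
    have "\<exists>b. \<forall>z. z \<epsilon> b \<longleftrightarrow> z \<epsilon> u \<and> (\<forall>t. t \<epsilon> z \<longrightarrow> t \<epsilon> x)" by (rule sep) (intro dfns)
    then obtain b where "\<forall>z. z \<epsilon> b \<longleftrightarrow> z \<epsilon> u \<and> (\<forall>t. t \<epsilon> z \<longrightarrow> t \<epsilon> x)" ..
    then have "\<forall>z. z \<epsilon> b \<longleftrightarrow> (\<forall>t. t \<epsilon> z \<longrightarrow> t \<epsilon> x)" using u by metis
    then show ?thesis ..
  qed
  fix \<psi> a assume d: "dfn (\<lambda>e. \<psi> (e 0) (e 1))" and f: "\<And>x y y'. x \<epsilon> a \<Longrightarrow> \<psi> x y \<Longrightarrow> \<psi> x y' \<Longrightarrow> y = y'"
  obtain B where B: "\<forall>x. x \<epsilon> a \<longrightarrow> (\<exists>y. \<psi> x y) \<longrightarrow> (\<exists>y. y \<epsilon> B \<and> \<psi> x y)" using coll[OF d, of a] by blast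
  have "\<exists>b. \<forall>y. y \<epsilon> b \<longleftrightarrow> y \<epsilon> B \<and> (\<exists>x. x \<epsilon> a \<and> \<psi> x y)"
    by (rule sep) (intro dfns dfn2[of \<psi>, OF d])
  then obtain b where "\<forall>y. y \<epsilon> b \<longleftrightarrow> y \<epsilon> B \<and> (\<exists>x. x \<epsilon> a \<and> \<psi> x y)" ..
  then have "\<forall>y. y \<epsilon> b \<longleftrightarrow> (\<exists>x. x \<epsilon> a \<and> \<psi> x y)" using B f by metis
  then show "\<exists>b. \<forall>y. y \<epsilon> b \<longleftrightarrow> (\<exists>x. x \<epsilon> a \<and> \<psi> x y)" ..
qed (fact ext found inf sep)+

end

context forcing
begin

text \<open>The dense sets to be met are objects \<open>d\<close> of the model. For a countable
  model there are countably many of them, and a generic filter exists.\<close>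

definition generic :: "'a set \<Rightarrow> bool" where
  "generic G \<longleftrightarrow> (\<forall>p\<in>G. p \<epsilon> P) \<and> m \<in> G \<and> (\<forall>p\<in>G. \<forall>q. le p q \<longrightarrow> q \<in> G) \<and>
    (\<forall>p\<in>G. \<forall>q\<in>G. \<exists>r\<in>G. le r p \<and> le r q) \<and>
    (\<forall>d. (\<forall>p. p \<epsilon> P \<longrightarrow> (\<exists>q. q \<epsilon> d \<and> le q p)) \<longrightarrow> (\<exists>p\<in>G. p \<epsilon> d))"

text \<open>Adding all conditions incompatible with \<open>p\<close> turns a set dense below
  \<open>p\<close> into a dense set. As \<open>G\<close> is directed and contains \<open>p\<close>,
  it cannot meet the added part.\<close>

lemma generic_below:
  assumes G: "generic G" and p: "p \<in> G" and d: "dfn (\<lambda>e. \<phi> (e 0))"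
    and dense: "\<And>q. le q p \<Longrightarrow> \<exists>r. le r q \<and> \<phi> r"
  shows "\<exists>r\<in>G. le r p \<and> \<phi> r"
proof -
  define D where "D = Sep P (\<lambda>r. (le r p \<and> \<phi> r) \<or> \<not> (\<exists>u. le u r \<and> le u p))"
  have D: "r \<epsilon> D \<longleftrightarrow> r \<epsilon> P \<and> ((le r p \<and> \<phi> r) \<or> \<not> (\<exists>u. le u r \<and> le u p))" for r
    unfolding D_def by (rule mem_Sep) (intro dfns d)
  have "\<exists>r. r \<epsilon> D \<and> le r q" if q: "q \<epsilon> P" for q
  proof (cases "\<exists>u. le u q \<and> le u p")
    case True
    then obtain u where u: "le u q" "le u p" by blast
    then obtain r where "le r u" "\<phi> r" using dense by blast
    then show ?thesis using D u L_trans L_P by blast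
  next
    case False
    then show ?thesis using D q L_refl by blast
  qed
  then obtain r where r: "r \<in> G" "r \<epsilon> D" using G unfolding generic_def by blast
  moreover obtain u where "le u r" "le u p" using G p r(1) unfolding generic_def by blast
  ultimately show ?thesis using D by blast
qed

text \<open>A name of the set of those \<open>z\<close> that have a name in \<open>Dom B\<close> and satisfy \<open>A\<close>; the conditions attached to
  the elements of \<open>B\<close> play no role, so membership in \<open>B\<close>, where wanted, has to be part of \<open>A\<close>.\<close>

definition compn :: "('a \<Rightarrow> bool) \<Rightarrow> fm \<Rightarrow> (nat \<Rightarrow> 'a) \<Rightarrow> 'a \<Rightarrow> 'a" where
  "compn C A e B = Sep (Times (Dom B) P) (\<lambda>t. \<exists>z p. t = Pr z p \<and> fc C A p (case_nat z e))"

lemma fc_dfn_at: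
  assumes C: "dfn (\<lambda>e. C (e 0))" shows "dfn (\<lambda>v. fc C A (v 1) (case_nat (v 0) e))"
proof -
  have "(\<lambda>i. v (case_nat 0 (\<lambda>i. Suc (Suc i)) i)) = case_nat (v 0) (\<lambda>i. v (Suc (Suc i)))" for v :: "nat \<Rightarrow> 'a"
    by (auto split: nat.split)
  then have "dfn (\<lambda>v. fc C A (v 1) (case_nat (v 0) (\<lambda>i. v (Suc (Suc i)))))"
    using dfn_ren[OF fc_dfn[OF C, of A], of "case_nat 1 (case_nat 0 (\<lambda>i. Suc (Suc i)))"] by simp
  then show ?thesis by (rule dfn_at2[of "\<lambda>x y d. fc C A y (case_nat x d)"])
qed

lemma fc_dfn_p: "dfn (\<lambda>e. C (e 0)) \<Longrightarrow> dfn (\<lambda>v. fc C A (v 0) e)"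
  by (rule dfn_at[of "fc C A", OF fc_dfn])

lemma mem_compn:
  assumes C: "dfn (\<lambda>e. C (e 0))"
  shows "t \<epsilon> compn C A e B \<longleftrightarrow> (\<exists>z p. t = Pr z p \<and> z \<epsilon> Dom B \<and> p \<epsilon> P \<and> fc C A p (case_nat z e))"
proof -
  have "t \<epsilon> compn C A e B \<longleftrightarrow> t \<epsilon> Times (Dom B) P \<and> (\<exists>z p. t = Pr z p \<and> fc C A p (case_nat z e))"
    unfolding compn_def by (rule mem_Sep) (intro dfns dfn2[of "\<lambda>z p. fc C A p (case_nat z e)", OF fc_dfn_at[OF C]])
  then show ?thesis by auto
qed

lemma sub_compn: "dfn (\<lambda>e. C (e 0)) \<Longrightarrow> sub (compn C A e B) (Times (Dom B) P)"
  unfolding sub_def mem_Times mem_compn by blast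

lemma nm_chk: "nm (chk x)"
proof (rule eps_induct[of "\<lambda>x. nm (chk x)"], intro dfns)
  fix x assume IH: "\<And>y. y \<epsilon> x \<Longrightarrow> nm (chk y)"
  show "nm (chk x)" by (rule hn_I) (use IH mem_chk m_P in \<open>blast intro: dfn_const\<close>)+
qed

text \<open>Elements of canonical names carry the condition \<open>m\<close>, so below
  \<open>p\<close> each is matched with the canonical name of an element of the other set, and
  membership induction identifies the two.\<close>

lemma feq_chk: "p \<epsilon> P \<Longrightarrow> feq p (chk x) (chk y) \<Longrightarrow> x = y"
proof -
  have "\<forall>y p. p \<epsilon> P \<longrightarrow> feq p (chk x) (chk y) \<longrightarrow> x = y"
  proof (rule eps_induct[of "\<lambda>x. \<forall>y p. p \<epsilon> P \<longrightarrow> feq p (chk x) (chk y) \<longrightarrow> x = y"], intro dfns, intro allI impI)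
    fix x y p assume IH: "\<And>z. z \<epsilon> x \<Longrightarrow> \<forall>y p. p \<epsilon> P \<longrightarrow> feq p (chk z) (chk y) \<longrightarrow> z = y"
      and p: "p \<epsilon> P" and "feq p (chk x) (chk y)"
    then have cl: "eq_clause feq p (chk x) (chk y)" using feq_iff[OF nm_chk nm_chk p] by blast
    have pm: "le p m" "le p p" using L_m L_refl p by blast+
    have "z \<epsilon> y" if z: "z \<epsilon> x" for z
    proof -
      have "Pr (chk z) m \<epsilon> chk x" using z mem_chk by blast
      then obtain r v t where r: "le r p" "Pr v t \<epsilon> chk y" "feq r (chk z) v"
        using cl pm unfolding eq_clause_def by blast
      then obtain u where "u \<epsilon> y" "v = chk u" using mem_chk by auto
      then show ?thesis using IH[OF z] r L_P by blast
    qed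
    moreover have "z \<epsilon> x" if z: "z \<epsilon> y" for z
    proof -
      have "Pr (chk z) m \<epsilon> chk y" using z mem_chk by blast
      then obtain r v t where r: "le r p" "Pr v t \<epsilon> chk x" "feq r v (chk z)"
        using cl pm unfolding eq_clause_def by blast
      then obtain u where "u \<epsilon> x" "v = chk u" using mem_chk by auto
      then show ?thesis using IH[of u] r L_P by blast
    qed
    ultimately show "x = y" by (intro ext) blast
  qed
  then show "p \<epsilon> P \<Longrightarrow> feq p (chk x) (chk y) \<Longrightarrow> x = y" by blast
qed

end

text \<open>The closure properties of a class of names that make the extension it generates a model of ZF.\<close>

locale sforcing = forcing E P L m for E :: "nat \<Rightarrow> nat \<Rightarrow> bool" (infix "\<epsilon>" 50) and P L m +
  fixes S :: "nat \<Rightarrow> bool"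
  assumes S_dfn: "dfn (\<lambda>e. S (e 0))"
    and comp: "\<And>A e B. (\<And>i. hn S (e i)) \<Longrightarrow> hn S B \<Longrightarrow> S (compn (hn S) A e B)"
    and univ: "\<And>b. (\<And>x. x \<epsilon> b \<Longrightarrow> hn S x) \<Longrightarrow> \<exists>B. hn S B \<and> (\<forall>x. x \<epsilon> b \<longrightarrow> Pr x m \<epsilon> B)"
    and hn_chk: "\<And>x. hn S (chk x)"
begin

abbreviation C :: "nat \<Rightarrow> bool" where "C \<equiv> hn S"

lemma C_dfn [dfns]: "dfnt t \<Longrightarrow> dfn (\<lambda>e. C (t e))"
  by (rule hn_dfn[OF S_dfn])

lemma C_nm: "C x \<Longrightarrow> nm x" by (rule hn_nm)

lemma C_compn:
  assumes "\<And>i. C (e i)" "C B" shows "C (compn C A e B)"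
proof (rule hn_I[OF S_dfn comp[OF assms]])
  fix t assume "t \<epsilon> compn C A e B"
  then obtain z p where "t = Pr z p" "z \<epsilon> Dom B" "p \<epsilon> P" using mem_compn[OF C_dfn[OF dfnt_var]] by blast
  then show "\<exists>z p. C z \<and> p \<epsilon> P \<and> t = Pr z p" using hn_Dom[OF assms(2)] by blast
qed

lemma generic_ex:
  assumes p: "p \<epsilon> P" shows "\<exists>G. generic G \<and> p \<in> G"
proof -
  \<comment> \<open>The objects of the model are the natural numbers, so the number \<open>d\<close>
    of the step is itself the candidate for a dense set. If no extension lies in \<open>d\<close>,
    the condition is kept.\<close>
  define s where "s = rec_nat p (\<lambda>d q. if \<exists>r. r \<epsilon> d \<and> le r q then SOME r. r \<epsilon> d \<and> le r q else q)"
  have s0: "s 0 = p" by (simp add: s_def)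
  have sS: "s (Suc d) = (if \<exists>r. r \<epsilon> d \<and> le r (s d) then SOME r. r \<epsilon> d \<and> le r (s d) else s d)" for d
    by (simp only: s_def old.nat.rec(2))
  have sel: "s (Suc d) \<epsilon> d \<and> le (s (Suc d)) (s d)" if "\<exists>r. r \<epsilon> d \<and> le r (s d)" for d
    unfolding sS using someI_ex[OF that] that by simp
  have sP: "s n \<epsilon> P" for n
  proof (induction n)
    case (Suc n) then show ?case using sel[of n] L_P sS[of n] by metis
  qed (use p s0 in simp)
  have step: "le (s (Suc n)) (s n)" for n using sel[of n] sS[of n] L_refl[OF sP[of n]] by metis
  have mono: "le (s (n + k)) (s n)" for n k
  proof (induction k)
    case (Suc k) then show ?case using step[of "n + k"] L_trans by (metis add_Suc_right)
  qed (use L_refl sP in simp)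
  define G where "G = {q. \<exists>n. le (s n) q}"
  have "generic G" unfolding generic_def
  proof (intro conjI ballI allI impI)
    show "p \<epsilon> P" if "p \<in> G" for p using that L_P unfolding G_def by blast
    show "m \<in> G" using L_m[OF sP[of 0]] unfolding G_def by blast
    show "q \<in> G" if "p \<in> G" "le p q" for p q using that L_trans unfolding G_def by blast
    show "\<exists>r\<in>G. le r p \<and> le r q" if pq: "p \<in> G" "q \<in> G" for p q
    proof -
      obtain a b where ab: "le (s a) p" "le (s b) q" using pq unfolding G_def by blast
      have "le (s (a + b)) p" "le (s (a + b)) q"
        using mono[of a b] mono[of b a] ab L_trans by (blast, metis add.commute)
      moreover have "s (a + b) \<in> G" using L_refl[OF sP] unfolding G_def by blast
      ultimately show ?thesis by blast
    qed
    fix d assume "\<forall>p. p \<epsilon> P \<longrightarrow> (\<exists>q. q \<epsilon> d \<and> le q p)"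
    then have "s (Suc d) \<epsilon> d" using sel sP by blast
    moreover have "s (Suc d) \<in> G" using L_refl[OF sP] unfolding G_def by blast
    ultimately show "\<exists>p\<in>G. p \<epsilon> d" by blast
  qed
  moreover have "le (s 0) p" using s0 L_refl[OF p] by simp
  then have "p \<in> G" unfolding G_def by blast
  ultimately show ?thesis by blast
qed

context
  fixes G assumes G: "generic G"
begin

lemma G_P: "p \<in> G \<Longrightarrow> p \<epsilon> P" and G_m: "m \<in> G" and G_up: "p \<in> G \<Longrightarrow> le p q \<Longrightarrow> q \<in> G"
  and G_dir: "p \<in> G \<Longrightarrow> q \<in> G \<Longrightarrow> \<exists>r\<in>G. le r p \<and> le r q"
  using G unfolding generic_def by blast+

text \<open>The truth lemma, relativised to names in \<open>C\<close>. Negation and quantification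
  rest on definability of forcing: conditions deciding the formula then form a dense set of the
  model, which \<open>G\<close> meets.\<close>

lemma fc_truth:
  "(\<forall>i. C (e i)) \<Longrightarrow> satq {x. C x} (\<lambda>x y. \<exists>p\<in>G. fmem p x y) (\<lambda>x y. \<exists>p\<in>G. feq p x y) e A \<longleftrightarrow> (\<exists>p\<in>G. fc C A p e)"
proof (induction A arbitrary: e)
  case (Neg A)
  have n: "\<forall>i. nm (e i)" using Neg.prems C_nm by blast
  have "(\<exists>p\<in>G. fc C (Neg A) p e) \<longleftrightarrow> \<not> (\<exists>p\<in>G. fc C A p e)"
  proof
    assume "\<exists>p\<in>G. fc C (Neg A) p e"
    then obtain p where p: "p \<in> G" "fc C (Neg A) p e" by blast
    show "\<not> (\<exists>p\<in>G. fc C A p e)"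
    proof
      assume "\<exists>p\<in>G. fc C A p e"
      then obtain q where q: "q \<in> G" "fc C A q e" by blast
      obtain r where r: "le r p" "le r q" using G_dir[OF p(1) q(1)] by blast
      have "fc C A r e" by (rule fc_mono[OF C_nm n r(2) q(2)])
      then show False using p(2) r(1) by simp
    qed
  next
    assume no: "\<not> (\<exists>p\<in>G. fc C A p e)"
    have "\<exists>r\<in>G. le r m \<and> (fc C A r e \<or> fc C (Neg A) r e)"
    proof (rule generic_below[OF G G_m])
      show "dfn (\<lambda>v. fc C A (v 0) e \<or> fc C (Neg A) (v 0) e)"
        by (intro dfn_or fc_dfn_p C_dfn dfns)
      fix q assume q: "le q m"
      show "\<exists>r. le r q \<and> (fc C A r e \<or> fc C (Neg A) r e)"
        using L_refl L_P[OF q] by (cases "\<exists>r. le r q \<and> fc C A r e") (blast, auto)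
    qed
    then show "\<exists>p\<in>G. fc C (Neg A) p e" using no by blast
  qed
  then show ?case using Neg.IH[OF Neg.prems] by simp
next
  case (And A B)
  have n: "\<forall>i. nm (e i)" using And.prems C_nm by blast
  have "(\<exists>p\<in>G. fc C A p e) \<and> (\<exists>p\<in>G. fc C B p e) \<longleftrightarrow> (\<exists>p\<in>G. fc C (And A B) p e)"
  proof
    assume "(\<exists>p\<in>G. fc C A p e) \<and> (\<exists>p\<in>G. fc C B p e)"
    then obtain p q where pq: "p \<in> G" "fc C A p e" "q \<in> G" "fc C B q e" by blast
    obtain r where r: "r \<in> G" "le r p" "le r q" using G_dir[OF pq(1,3)] by blast
    have "fc C A r e" by (rule fc_mono[OF C_nm n r(2) pq(2)])
    moreover have "fc C B r e" by (rule fc_mono[OF C_nm n r(3) pq(4)])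
    ultimately show "\<exists>p\<in>G. fc C (And A B) p e" using r(1) by auto
  qed auto
  then show ?case using And.IH(1)[OF And.prems] And.IH(2)[OF And.prems] by simp
next
  case (All A)
  have n: "\<forall>i. nm (e i)" using All.prems C_nm by blast
  have Ce: "\<forall>i. C (case_nat x e i)" if "C x" for x using that All.prems by (auto split: nat.split)
  have ne: "\<forall>i. nm (case_nat x e i)" if "C x" for x using Ce[OF that] C_nm by blast
  have "(\<forall>x. C x \<longrightarrow> (\<exists>p\<in>G. fc C A p (case_nat x e))) \<longleftrightarrow> (\<exists>p\<in>G. fc C (All A) p e)"
  proof
    assume all: "\<forall>x. C x \<longrightarrow> (\<exists>p\<in>G. fc C A p (case_nat x e))"
    \<comment> \<open>Densely, a condition either forces the universal formula or refutes it at some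
      name. The second alternative in \<open>G\<close> contradicts that each instance is forced by a
      member of \<open>G\<close>.\<close>
    have "\<exists>r\<in>G. le r m \<and> (fc C (All A) r e \<or> (\<exists>x. C x \<and> fc C (Neg A) r (case_nat x e)))"
    proof (rule generic_below[OF G G_m])
      show "dfn (\<lambda>v. fc C (All A) (v 0) e \<or> (\<exists>x. C x \<and> fc C (Neg A) (v 0) (case_nat x e)))"
        by (intro dfn_or dfn_ex dfn_and C_dfn dfnt_var fc_dfn_p 
            dfn2[of "\<lambda>x p. fc C (Neg A) p (case_nat x e)", OF fc_dfn_at])
      fix q assume q: "le q m"
      have qP: "q \<epsilon> P" using L_P q by blast
      show "\<exists>r. le r q \<and> (fc C (All A) r e \<or> (\<exists>x. C x \<and> fc C (Neg A) r (case_nat x e)))"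
      proof (cases "fc C (All A) q e")
        case True then show ?thesis using L_refl qP by blast
      next
        case False
        then obtain x where x: "C x" "\<not> fc C A q (case_nat x e)" by auto
        have "\<exists>q'. le q' q \<and> (\<forall>r. le r q' \<longrightarrow> \<not> fc C A r (case_nat x e))"
          using fc_dense[OF C_nm ne[OF x(1)] qP] x(2) by blast
        then show ?thesis using x(1) by auto
      qed
    qed
    then obtain r where r: "r \<in> G" "fc C (All A) r e \<or> (\<exists>x. C x \<and> fc C (Neg A) r (case_nat x e))" by blast
    have False if x: "C x" "fc C (Neg A) r (case_nat x e)" for x
    proof -
      obtain p where p: "p \<in> G" "fc C A p (case_nat x e)" using all x by blast
      obtain u where u: "le u p" "le u r" using G_dir[OF p(1) r(1)] by blast
      have "fc C A u (case_nat x e)" by (rule fc_mono[OF C_nm ne[OF x(1)] u(1) p(2)])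
      then show False using x(2) u(2) by simp
    qed
    then show "\<exists>p\<in>G. fc C (All A) p e" using r by blast
  qed auto
  then show ?case using All.IH[OF Ce] by simp
qed auto

lemma fmem_G: 
  assumes "C x" "C y" shows "(\<exists>p\<in>G. fmem p x y) \<longleftrightarrow> (\<exists>z s. Pr z s \<epsilon> y \<and> s \<in> G \<and> (\<exists>p\<in>G. feq p x z))"
proof
  note n = C_nm[OF assms(1)] C_nm[OF assms(2)]
  assume "\<exists>p\<in>G. fmem p x y"
  then obtain p where p: "p \<in> G" "fmem p x y" by blast
  have "\<exists>r\<in>G. le r p \<and> (\<exists>z s. Pr z s \<epsilon> y \<and> le r s \<and> feq r x z)"
  proof (rule generic_below[OF G p(1)], intro dfns)
    fix q assume "le q p"
    then show "\<exists>r. le r q \<and> (\<exists>z s. Pr z s \<epsilon> y \<and> le r s \<and> feq r x z)"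
      using p(2)[unfolded fmem_iff[OF n G_P[OF p(1)]]] by blast
  qed
  then show "\<exists>z s. Pr z s \<epsilon> y \<and> s \<in> G \<and> (\<exists>p\<in>G. feq p x z)" using G_up by blast
next
  note n = C_nm[OF assms(1)] C_nm[OF assms(2)]
  assume "\<exists>z s. Pr z s \<epsilon> y \<and> s \<in> G \<and> (\<exists>p\<in>G. feq p x z)"
  then obtain z s p where z: "Pr z s \<epsilon> y" "s \<in> G" "p \<in> G" "feq p x z" by blast
  obtain r where r: "r \<in> G" "le r s" "le r p" using G_dir[OF z(2,3)] by blast
  have nz: "nm z" and rP: "r \<epsilon> P" using hn_Pr[OF n(2) z(1)] G_P[OF r(1)] by blast+
  have "feq r x z" by (rule feq_mono[OF n(1) nz r(3) z(4)])
  then have "feq r z x" by (rule feq_sym[OF n(1) nz rP])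
  then have "fmem r x y" by (rule fmem_cong1[OF nz n(1) n(2) rP _ fmem_own[OF n(2) z(1) r(2)]])
  then show "\<exists>p\<in>G. fmem p x y" using r(1) by blast
qed

lemma feq_G_trans:
  assumes "C x" "C y" "C z" "\<exists>p\<in>G. feq p x y" "\<exists>p\<in>G. feq p y z" shows "\<exists>p\<in>G. feq p x z"
proof -
  note n = C_nm[OF assms(1)] C_nm[OF assms(2)] C_nm[OF assms(3)]
  obtain p q where p: "p \<in> G" "feq p x y" and q: "q \<in> G" "feq q y z" using assms(4,5) by blast
  obtain r where r: "r \<in> G" "le r p" "le r q" using G_dir[OF p(1) q(1)] by blast
  have "feq r x z" by (rule feq_trans[OF n G_P[OF r(1)] feq_mono[OF n(1,2) r(2) p(2)] feq_mono[OF n(2,3) r(3) q(2)]])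
  then show ?thesis using r(1) by blast
qed

lemma feq_G_sym:
  assumes "C x" "C y" "\<exists>p\<in>G. feq p x y" shows "\<exists>p\<in>G. feq p y x"
  using feq_sym[OF C_nm[OF assms(1)] C_nm[OF assms(2)] G_P] assms(3) by blast

lemma fmem_G_cong:
  assumes "C x" "C x'" "C y" "C y'" "\<exists>p\<in>G. feq p x x'" "\<exists>p\<in>G. feq p y y'" "\<exists>p\<in>G. fmem p x y"
  shows "\<exists>p\<in>G. fmem p x' y'"
proof -
  note n = C_nm[OF assms(1)] C_nm[OF assms(2)] C_nm[OF assms(3)] C_nm[OF assms(4)]
  obtain p q r where p: "p \<in> G" "feq p x x'" and q: "q \<in> G" "feq q y y'" and r: "r \<in> G" "fmem r x y"
    using assms(5-7) by blast
  obtain u where u: "u \<in> G" "le u p" "le u q" using G_dir[OF p(1) q(1)] by blast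
  obtain v where v: "v \<in> G" "le v u" "le v r" using G_dir[OF u(1) r(1)] by blast
  have vP: "v \<epsilon> P" using G_P[OF v(1)] .
  have 1: "feq v x x'" by (rule feq_mono[OF n(1,2) L_trans[OF v(2) u(2)] p(2)])
  have 2: "feq v y y'" by (rule feq_mono[OF n(3,4) L_trans[OF v(2) u(3)] q(2)])
  have "fmem v x y" by (rule fmem_mono[OF n(1,3) v(3) r(2)])
  then have "fmem v x' y" by (rule fmem_cong1[OF n(1,2,3) vP 1])
  then have "fmem v x' y'" by (rule fmem_cong2[OF n(2,3,4) vP 2])
  then show ?thesis using v(1) by blast
qed

text \<open>Supplies the singletons required by \<open>quotient_model\<close>: comprehension with
  the formula \<open>Eq 0 1\<close> from a name having \<open>x\<close> as an element.\<close>

lemma single_ex: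
  assumes "C x" shows "\<exists>u. C u \<and> (\<forall>z. C z \<longrightarrow> ((\<exists>p\<in>G. fmem p z u) \<longleftrightarrow> (\<exists>p\<in>G. feq p z x)))"
proof -
  obtain B where B: "C B" "Pr x m \<epsilon> B" using univ[of "Upr x x"] assms by auto
  define u where "u = compn C (Eq 0 1) (\<lambda>_. x) B"
  have u: "Pr z p \<epsilon> u \<longleftrightarrow> z \<epsilon> Dom B \<and> p \<epsilon> P \<and> feq p z x" for z p
    unfolding u_def mem_compn[OF C_dfn[OF dfnt_var]] by auto
  have Cu: "C u" unfolding u_def by (rule C_compn[OF assms B(1)])
  have "(\<exists>p\<in>G. fmem p z u) \<longleftrightarrow> (\<exists>p\<in>G. feq p z x)" if z: "C z" for z
  proof
    assume "\<exists>p\<in>G. fmem p z u"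
    then obtain w s where w: "Pr w s \<epsilon> u" "s \<in> G" "\<exists>p\<in>G. feq p z w" using fmem_G[OF z Cu] by blast
    have "C w" using hn_Pr[OF Cu w(1)] by blast
    moreover have "\<exists>p\<in>G. feq p w x" using w(1,2) u by blast
    ultimately show "\<exists>p\<in>G. feq p z x" using feq_G_trans[OF z _ assms w(3)] by blast
  next
    assume "\<exists>p\<in>G. feq p z x"
    moreover have "Pr x m \<epsilon> u" using u B(2) m_P feq_refl[OF C_nm[OF assms] m_P] by auto
    ultimately show "\<exists>p\<in>G. fmem p z u" using fmem_G[OF z Cu] G_m by blast
  qed
  then show ?thesis using Cu by blast
qed

end

end

text \<open>A generic extension with carrier the natural numbers: \<open>h\<close> evaluates names,
  identifying those that \<open>G\<close> forces equal, so that equality of the extension is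
  identity.\<close>

locale gext = sforcing E P L m S for E (infix "\<epsilon>" 50) and P L m S +
  fixes G :: "nat set" and E' :: "nat \<Rightarrow> nat \<Rightarrow> bool" and h :: "nat \<Rightarrow> nat"
  assumes G: "generic G"
    and h_onto: "\<And>a. \<exists>x. C x \<and> h x = a"
    and h_eq: "\<And>x y. C x \<Longrightarrow> C y \<Longrightarrow> h x = h y \<longleftrightarrow> (\<exists>p\<in>G. feq p x y)"
    and h_mem: "\<And>x y. C x \<Longrightarrow> C y \<Longrightarrow> E' (h x) (h y) \<longleftrightarrow> (\<exists>p\<in>G. fmem p x y)"
    and truth: "\<And>e A. (\<And>i. C (e i)) \<Longrightarrow> sat E' (\<lambda>i. h (e i)) A \<longleftrightarrow> (\<exists>p\<in>G. fc C A p e)"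

context sforcing
begin

theorem gext_ex:
  assumes G: "generic G" shows "\<exists>E' h. gext E P L m S G E' h"
proof -
  let ?C = "{x. C x}"
  \<comment> \<open>\<open>quotient_model\<close> asks for symmetry, transitivity and congruence
    without restriction to the carrier, so membership in \<open>C\<close> is made part of the
    relations.\<close>
  define R where "R = (\<lambda>x y. C x \<and> C y \<and> (\<exists>p\<in>G. fmem p x y))"
  define Q where "Q = (\<lambda>x y. C x \<and> C y \<and> (\<exists>p\<in>G. feq p x y))"
  have same: "satq ?C R Q e A \<longleftrightarrow> satq ?C (\<lambda>x y. \<exists>p\<in>G. fmem p x y) (\<lambda>x y. \<exists>p\<in>G. feq p x y) e A"
    if "\<forall>i. C (e i)" for e A
    using that
  proof (induction A arbitrary: e)
    case (All A)
    have "\<forall>i. C (case_nat x e i)" if "C x" for x using that All.prems by (auto split: nat.split)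
    then show ?case using All.IH by simp
  qed (auto simp: R_def Q_def)
  have "\<exists>(E' :: nat \<Rightarrow> nat \<Rightarrow> bool) h. h ` ?C = UNIV \<and> (\<forall>x\<in>?C. \<forall>y\<in>?C. h x = h y \<longleftrightarrow> Q x y)
    \<and> (\<forall>x\<in>?C. \<forall>y\<in>?C. E' (h x) (h y) \<longleftrightarrow> R x y)
    \<and> (\<forall>A e. (\<forall>i. e i \<in> ?C) \<longrightarrow> (sat E' (\<lambda>i. h (e i)) A \<longleftrightarrow> satq ?C R Q e A))"
  proof (rule quotient_model)
    show "Q x x" if "x \<in> ?C" for x using that feq_refl[OF C_nm m_P] G_m[OF G] unfolding Q_def by blast
    show "Q y x" if "Q x y" for x y using that feq_G_sym[OF G] unfolding Q_def by blast
    show "Q x z" if "Q x y" "Q y z" for x y z using that feq_G_trans[OF G, of x y z] unfolding Q_def by blast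
    show "R x' y'" if "Q x x'" "Q y y'" "R x y" for x x' y y'
      using that fmem_G_cong[OF G, of x x' y y'] unfolding Q_def R_def by blast
    show "\<exists>v\<in>?C. \<forall>z\<in>?C. \<not> R z v"
    proof
      show "chk emp \<in> ?C" using hn_chk by blast
      show "\<forall>z\<in>?C. \<not> R z (chk emp)" using fmem_G[OF G _ hn_chk[of emp]] mem_chk unfolding R_def by auto
    qed
    show "\<exists>u\<in>?C. \<forall>z\<in>?C. R z u \<longleftrightarrow> Q z x" if "x \<in> ?C" for x
      using single_ex[OF G, of x] that unfolding R_def Q_def by blast
  qed
  then show ?thesis
  proof (elim exE conjE)
  fix E' :: "nat \<Rightarrow> nat \<Rightarrow> bool" and h :: "nat \<Rightarrow> nat"
  assume h: "h ` ?C = UNIV" "\<forall>x\<in>?C. \<forall>y\<in>?C. h x = h y \<longleftrightarrow> Q x y"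
    "\<forall>x\<in>?C. \<forall>y\<in>?C. E' (h x) (h y) \<longleftrightarrow> R x y"
    "\<forall>A e. (\<forall>i. e i \<in> ?C) \<longrightarrow> (sat E' (\<lambda>i. h (e i)) A \<longleftrightarrow> satq ?C R Q e A)"
  have "gext E P L m S G E' h"
  proof
    show "\<exists>x. C x \<and> h x = a" for a
    proof -
      have "a \<in> h ` ?C" using h(1) by simp
      then show ?thesis by blast
    qed
    show "h x = h y \<longleftrightarrow> (\<exists>p\<in>G. feq p x y)" if "C x" "C y" for x y using h(2) that unfolding Q_def by blast
    show "E' (h x) (h y) \<longleftrightarrow> (\<exists>p\<in>G. fmem p x y)" if "C x" "C y" for x y using h(3) that unfolding R_def by blast
    show "sat E' (\<lambda>i. h (e i)) A \<longleftrightarrow> (\<exists>p\<in>G. fc C A p e)" if "\<And>i. C (e i)" for e A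
      using h(4) that same[of e A] fc_truth[OF G, of e A] by simp
  qed (rule G)
  then show "\<exists>E' h. gext E P L m S G E' h" by (intro exI)
  qed
qed

text \<open>The converse of the truth lemma. Every \<open>q\<close> below \<open>p\<close> lies in a
  generic filter, which contains a condition forcing \<open>A\<close>, and a common extension with
  \<open>q\<close> exists; so \<open>A\<close> is forced densely below \<open>p\<close>.\<close>

lemma fc_if_generic:
  assumes e: "\<And>i. C (e i)" and p: "p \<epsilon> P"
    and all: "\<And>G E' h. gext E P L m S G E' h \<Longrightarrow> p \<in> G \<Longrightarrow> sat E' (\<lambda>i. h (e i)) A"
  shows "fc C A p e"
proof (rule fc_dense[OF C_nm _ p])
  show "\<forall>i. nm (e i)" using e C_nm by blast
  have n: "\<forall>i. nm (e i)" using e C_nm by blast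
  show "\<forall>q. le q p \<longrightarrow> (\<exists>r. le r q \<and> fc C A r e)"
  proof (intro allI impI)
    fix q assume q: "le q p"
    then have "q \<epsilon> P" using L_P by blast
    then obtain G where G: "generic G" "q \<in> G" using generic_ex by blast
    then obtain E' h where N: "gext E P L m S G E' h" using gext_ex by blast
    have "p \<in> G" using G q G_up by blast
    then have "sat E' (\<lambda>i. h (e i)) A" using all N by blast
    then obtain u where u: "u \<in> G" "fc C A u e" using gext.truth[OF N, of e A] e by blast
    obtain r where r: "le r q" "le r u" using G_dir[OF G(1) G(2) u(1)] by blast
    have "fc C A r e" by (rule fc_mono[OF C_nm n r(2) u(2)])
    then show "\<exists>r. le r q \<and> fc C A r e" using r by blast
  qed
qed

end

context gext
begin

lemmas G_P = G_P[OF G] and G_m = G_m[OF G] and G_up = G_up[OF G] and G_dir = G_dir[OF G]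

lemma mem_h: 
  assumes "C x" shows "E' a (h x) \<longleftrightarrow> (\<exists>w s. Pr w s \<epsilon> x \<and> s \<in> G \<and> a = h w)"
proof -
  obtain z where z: "C z" "h z = a" using h_onto by blast
  have "E' (h z) (h x) \<longleftrightarrow> (\<exists>w s. Pr w s \<epsilon> x \<and> s \<in> G \<and> h z = h w)"
    using h_mem[OF z(1) assms] fmem_G[OF G z(1) assms] h_eq[OF z(1)] hn_Pr[OF assms] by blast
  then show ?thesis using z by simp
qed

lemma h_envs: "\<exists>e. (\<forall>i. C (e i)) \<and> c = (\<lambda>i. h (e i))"
proof -
  have "\<forall>i. \<exists>x. C x \<and> h x = c i" using h_onto by blast
  then obtain e where "\<forall>i. C (e i) \<and> h (e i) = c i" by metis
  then show ?thesis by (intro exI[of _ e]) auto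
qed

lemma h_ext:
  assumes "\<And>c. E' c a \<longleftrightarrow> E' c b" shows "a = b"
proof -
  obtain x y where x: "C x" "h x = a" and y: "C y" "h y = b" using h_onto by metis
  note n = C_nm[OF x(1)] C_nm[OF y(1)]
  \<comment> \<open>Densely, a condition forces the two names equal or forces some name into one of
    them while no extension forces it into the other. The second kind, in \<open>G\<close>, would
    yield an element separating \<open>a\<close> and \<open>b\<close>.\<close>
  let ?\<phi> = "\<lambda>p. feq p x y \<or> (\<exists>z. C z \<and> ((fmem p z x \<and> (\<forall>s. le s p \<longrightarrow> \<not> fmem s z y)) \<or> (fmem p z y \<and> (\<forall>s. le s p \<longrightarrow> \<not> fmem s z x))))"
  have "\<exists>r\<in>G. le r m \<and> ?\<phi> r"
  proof (rule generic_below[OF G G_m], intro dfns)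
    fix q assume "le q m"
    then have qP: "q \<epsilon> P" using L_P by blast
    show "\<exists>r. le r q \<and> ?\<phi> r"
    proof (cases "feq q x y")
      case True then show ?thesis using L_refl qP by blast
    next
      case False
      then obtain z q' where z: "z \<epsilon> Dom x \<or> z \<epsilon> Dom y" "le q' q" "fmem q' z x \<noteq> fmem q' z y"
        using feq_fmem[OF n qP] by blast
      have Cz: "C z" using z(1) hn_Dom x(1) y(1) by blast
      have q'P: "q' \<epsilon> P" using z(2) L_P by blast
      have *: "\<exists>r. le r q' \<and> (fmem r z x' \<and> (\<forall>s. le s r \<longrightarrow> \<not> fmem s z y'))"
        if x': "nm x'" "nm y'" "fmem q' z x'" "\<not> fmem q' z y'" for x' y'
      proof -
        obtain r where r: "le r q'" "\<forall>s. le s r \<longrightarrow> \<not> fmem s z y'"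
          using fmem_dense[OF C_nm[OF Cz] x'(2) q'P] x'(4) by blast
        have "fmem r z x'" by (rule fmem_mono[OF C_nm[OF Cz] x'(1) r(1) x'(3)])
        then show ?thesis using r by blast
      qed
      have "\<exists>r. le r q' \<and> ?\<phi> r" using *[OF n] *[OF n(2,1)] z(3) Cz by blast
      then show ?thesis using z(2) L_trans by blast
    qed
  qed
  then obtain r where r: "r \<in> G" "?\<phi> r" by blast
  have no: False if z: "C z" and f: "fmem r z x'" "\<forall>s. le s r \<longrightarrow> \<not> fmem s z y'" and C': "C x'" "C y'"
    and same: "E' (h z) (h x') \<Longrightarrow> E' (h z) (h y')" for z x' y'
  proof -
    have "E' (h z) (h x')" using h_mem[OF z C'(1)] r(1) f(1) by blast
    then obtain p where p: "p \<in> G" "fmem p z y'" using same h_mem[OF z C'(2)] by blast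
    obtain u where u: "le u p" "le u r" using G_dir[OF p(1) r(1)] by blast
    have "fmem u z y'" by (rule fmem_mono[OF C_nm[OF z] C_nm[OF C'(2)] u(1) p(2)])
    then show False using f(2) u(2) by blast
  qed
  have "feq r x y" using r(2) no[OF _ _ _ x(1) y(1)] no[OF _ _ _ y(1) x(1)] assms x(2) y(2) by blast
  then show ?thesis using h_eq[OF x(1) y(1)] r(1) x(2) y(2) by blast
qed

lemma h_found:
  assumes "E' b a" shows "\<exists>b. E' b a \<and> \<not> (\<exists>c. E' c a \<and> E' c b)"
proof -
  obtain x where x: "C x" "h x = a" using h_onto by blast
  obtain z0 where z0: "C z0" "h z0 = b" using h_onto by blast
  note nx = C_nm[OF x(1)]
  obtain p where p: "p \<in> G" "fmem p z0 x" using h_mem[OF z0(1) x(1)] x z0 assms by blast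
  let ?\<phi> = "\<lambda>q. \<exists>z. C z \<and> fmem q z x \<and> (\<forall>y r. C y \<longrightarrow> le r q \<longrightarrow> \<not> (fmem r y z \<and> fmem r y x))"
  have "\<exists>r\<in>G. le r p \<and> ?\<phi> r"
  proof (rule generic_below[OF G p(1)], intro dfns)
    fix q assume q: "le q p"
    \<comment> \<open>The extension has no rank function at this stage, so minimality is obtained
      from names: among those that some extension of \<open>q\<close> forces into \<open>x\<close>,
      one is minimal along \<open>Dom\<close>.\<close>
    have "\<not> (\<forall>z. \<not> (C z \<and> (\<exists>q'. le q' q \<and> fmem q' z x)))"
      using z0(1) fmem_mono[OF C_nm[OF z0(1)] nx q p(2)] q L_P L_refl by blast
    moreover have "dfn (\<lambda>e. \<not> (C (e 0) \<and> (\<exists>q'. le q' q \<and> fmem q' (e 0) x)))" by (intro dfns)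
    ultimately obtain z where z: "C z" "\<exists>q'. le q' q \<and> fmem q' z x"
      and min: "\<And>y. y \<epsilon> Dom z \<Longrightarrow> \<not> (C y \<and> (\<exists>q'. le q' q \<and> fmem q' y x))"
      using Dom_induct[of "\<lambda>z. \<not> (C z \<and> (\<exists>q'. le q' q \<and> fmem q' z x))"] by blast
    then obtain q' where q': "le q' q" "fmem q' z x" by blast
    have "\<not> (fmem r y z \<and> fmem r y x)" if y: "C y" and r: "le r q'" for y r
    proof
      assume f: "fmem r y z \<and> fmem r y x"
      have rP: "r \<epsilon> P" using r L_P by blast
      then obtain r' w s where r': "le r' r" "Pr w s \<epsilon> z" "feq r' y w"
        using f fmem_iff[OF C_nm[OF y] C_nm[OF z(1)] rP] L_refl by blast
      have Cw: "C w" using hn_Pr[OF z(1) r'(2)] by blast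
      have r'P: "r' \<epsilon> P" using r' L_P by blast
      have "fmem r' y x" using fmem_mono[OF C_nm[OF y] nx r'(1)] f by blast
      then have "fmem r' w x" by (rule fmem_cong1[OF C_nm[OF y] C_nm[OF Cw] nx r'P r'(3)])
      moreover have "w \<epsilon> Dom z" using r'(2) by auto
      moreover have "le r' q" using r'(1) r q'(1) L_trans by blast
      ultimately show False using min Cw by blast
    qed
    then show "\<exists>r. le r q \<and> ?\<phi> r" using q' z(1) by blast
  qed
  then obtain r z where r: "r \<in> G" and z: "C z" "fmem r z x"
    and no: "\<And>y r'. C y \<Longrightarrow> le r' r \<Longrightarrow> \<not> (fmem r' y z \<and> fmem r' y x)" by blast
  have "E' (h z) a" using h_mem[OF z(1) x(1)] x(2) z(2) r by blast
  moreover have "\<not> (E' c a \<and> E' c (h z))" for c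
  proof
    assume c: "E' c a \<and> E' c (h z)"
    obtain y where y: "C y" "h y = c" using h_onto by blast
    obtain p1 p2 where p: "p1 \<in> G" "fmem p1 y x" "p2 \<in> G" "fmem p2 y z"
      using c h_mem[OF y(1) x(1)] h_mem[OF y(1) z(1)] x(2) y(2) by blast
    obtain u where u: "u \<in> G" "le u p1" "le u p2" using G_dir[OF p(1,3)] by blast
    obtain v where v: "v \<in> G" "le v u" "le v r" using G_dir[OF u(1) r] by blast
    have "fmem v y x" by (rule fmem_mono[OF C_nm[OF y(1)] nx L_trans[OF v(2) u(2)] p(2)])
    moreover have "fmem v y z" by (rule fmem_mono[OF C_nm[OF y(1)] C_nm[OF z(1)] L_trans[OF v(2) u(3)] p(4)])
    ultimately show False using no[OF y(1) v(3)] by blast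
  qed
  ultimately show ?thesis by blast
qed

definition j :: "nat \<Rightarrow> nat" where "j x = h (chk x)"

lemma j_mem: "E' a (j x) \<longleftrightarrow> (\<exists>y. y \<epsilon> x \<and> a = j y)"
  unfolding j_def mem_h[OF hn_chk] mem_chk using G_m by auto

lemma j_inj: "j x = j y \<longleftrightarrow> x = y"
  unfolding j_def using h_eq[OF hn_chk hn_chk] feq_chk G_P G_m feq_refl[OF nm_chk m_P] by metis

text \<open>In the comprehension formula, index 0 is the element, index 1 is \<open>x\<close>, and
  the parameters of \<open>A\<close> follow; the renaming makes \<open>A\<close> skip index
  1.\<close>

lemma h_sep:
  assumes e: "\<And>i. C (e i)" and x: "C x"
    and b_def: "b = compn C (And (Mem 0 1) (rename (case_nat 0 (\<lambda>i. Suc (Suc i))) A)) (case_nat x e) x"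
  shows "C b" "E' a (h b) \<longleftrightarrow> E' a (h x) \<and> sat E' (case_nat a (\<lambda>i. h (e i))) A"
proof -
  let ?F = "And (Mem 0 1) (rename (case_nat 0 (\<lambda>i. Suc (Suc i))) A)"
  have Ce: "C (case_nat x e i)" for i using e x by (simp split: nat.split)
  show Cb: "C b" unfolding b_def by (rule C_compn[OF Ce x])
  have F: "(\<exists>p\<in>G. fc C ?F p (case_nat z (case_nat x e))) \<longleftrightarrow> E' (h z) (h x) \<and> sat E' (case_nat (h z) (\<lambda>i. h (e i))) A"
    if z: "C z" for z
  proof -
    have C2: "C (case_nat z (case_nat x e) i)" for i using z Ce by (simp split: nat.split)
    have "(\<lambda>i. h (case_nat z (case_nat x e) (case_nat 0 (\<lambda>i. Suc (Suc i)) i))) = case_nat (h z) (\<lambda>i. h (e i))"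
      by (auto split: nat.split)
    then have "sat E' (\<lambda>i. h (case_nat z (case_nat x e) i)) ?F \<longleftrightarrow> E' (h z) (h x) \<and> sat E' (case_nat (h z) (\<lambda>i. h (e i))) A"
      by (simp add: satq_rename)
    then show ?thesis using truth[where e = "case_nat z (case_nat x e)" and A = ?F, OF C2] by blast
  qed
  have b: "Pr z p \<epsilon> b \<longleftrightarrow> z \<epsilon> Dom x \<and> p \<epsilon> P \<and> fc C ?F p (case_nat z (case_nat x e))" for z p
    unfolding b_def mem_compn[OF C_dfn[OF dfnt_var]] by auto
  show "E' a (h b) \<longleftrightarrow> E' a (h x) \<and> sat E' (case_nat a (\<lambda>i. h (e i))) A"
  proof
    assume "E' a (h b)"
    then obtain z p where z: "Pr z p \<epsilon> b" "p \<in> G" "a = h z" unfolding mem_h[OF Cb] by blast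
    have "C z" using hn_Pr[OF Cb z(1)] by blast
    moreover have "fc C ?F p (case_nat z (case_nat x e))" using z(1) unfolding b by blast
    ultimately show "E' a (h x) \<and> sat E' (case_nat a (\<lambda>i. h (e i))) A" using F z(2,3) by blast
  next
    assume a: "E' a (h x) \<and> sat E' (case_nat a (\<lambda>i. h (e i))) A"
    then obtain z s where z: "Pr z s \<epsilon> x" "a = h z" unfolding mem_h[OF x] by blast
    have "C z" using hn_Pr[OF x z(1)] by blast
    then obtain p where p: "p \<in> G" "fc C ?F p (case_nat z (case_nat x e))" using F a z(2) by blast
    then have "Pr z p \<epsilon> b" unfolding b using z(1) G_P by auto
    then show "E' a (h b)" unfolding mem_h[OF Cb] using p(1) z(2) by blast
  qed
qed

theorem zf_ext: "zf E'"
proof -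
  interpret N: set_structure E' .
  show ?thesis
  proof (rule N.zf_weakI)
    show "a = b" if "\<And>c. E' c a \<longleftrightarrow> E' c b" for a b by (rule h_ext[OF that])
    show "\<exists>b. E' b a \<and> \<not> (\<exists>c. E' c a \<and> E' c b)" if "\<exists>b. E' b a" for a using h_found that by blast
    show "\<exists>u. E' a u \<and> E' b u" for a b
    proof -
      obtain x y where x: "C x" "h x = a" and y: "C y" "h y = b" using h_onto by metis
      obtain B where B: "C B" "\<forall>z. z \<epsilon> Upr x y \<longrightarrow> Pr z m \<epsilon> B" using univ[of "Upr x y"] x y by auto
      then have "E' a (h B)" "E' b (h B)" unfolding mem_h[OF B(1)] using x y G_m by auto
      then show ?thesis by blast
    qed
    show "\<exists>u. \<forall>c b. E' b a \<longrightarrow> E' c b \<longrightarrow> E' c u" for a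
    proof -
      obtain x where x: "C x" "h x = a" using h_onto by blast
      define b where "b = Uni (Img Dom (Dom x))"
      have im: "t \<epsilon> Img Dom (Dom x) \<longleftrightarrow> (\<exists>z. z \<epsilon> Dom x \<and> t = Dom z)" for t by (rule mem_Img) (intro dfns)
      have b: "y \<epsilon> b \<longleftrightarrow> (\<exists>w. w \<epsilon> Dom x \<and> y \<epsilon> Dom w)" for y unfolding b_def mem_Uni im by blast
      have "C y" if "y \<epsilon> b" for y using that b hn_Dom[OF hn_Dom[OF x(1)]] by blast
      then obtain B where B: "C B" "\<forall>z. z \<epsilon> b \<longrightarrow> Pr z m \<epsilon> B" using univ[of b] by blast
      have "E' c (h B)" if d: "E' d a" "E' c d" for c d
      proof -
        obtain w s where w: "Pr w s \<epsilon> x" "d = h w" using d(1) x mem_h by blast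
        have Cw: "C w" using hn_Pr[OF x(1) w(1)] by blast
        obtain y t where y: "Pr y t \<epsilon> w" "c = h y" using d(2) w(2) mem_h[OF Cw] by blast
        have "y \<epsilon> b" using b w y by auto
        then show ?thesis unfolding mem_h[OF B(1)] using B(2) y(2) G_m by blast
      qed
      then show ?thesis by blast
    qed
    show "\<exists>u. \<forall>c. (\<forall>t. E' t c \<longrightarrow> E' t a) \<longrightarrow> E' c u" for a
    proof -
      obtain x where x: "C x" "h x = a" using h_onto by blast
      \<comment> \<open>By comprehension from \<open>x\<close>, every subset of \<open>a\<close> has
        a name that is a subset of \<open>Times (Dom x) P\<close>. All such names in
        \<open>C\<close> form a set.\<close>
      define b where "b = Sep (Pow (Times (Dom x) P)) C"
      have b: "u \<epsilon> b \<longleftrightarrow> sub u (Times (Dom x) P) \<and> C u" for u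
        unfolding b_def using mem_Sep[OF C_dfn[OF dfnt_var]] by simp
      obtain B where B: "C B" "\<forall>z. z \<epsilon> b \<longrightarrow> Pr z m \<epsilon> B" using univ[of b] b by blast
      have "E' c (h B)" if c: "\<forall>t. E' t c \<longrightarrow> E' t a" for c
      proof -
        obtain y where y: "C y" "h y = c" using h_onto by blast
        let ?A = "Mem 0 1"
        define u where "u = compn C (And (Mem 0 1) (rename (case_nat 0 (\<lambda>i. Suc (Suc i))) ?A)) (case_nat x (\<lambda>_. y)) x"
        have u: "C u" "\<And>t. E' t (h u) \<longleftrightarrow> E' t (h x) \<and> sat E' (case_nat t (\<lambda>i. h y)) ?A"
          by (rule h_sep[where e = "\<lambda>_. y" and A = ?A, OF y(1) x(1) u_def])+
        have "h u = c" by (rule h_ext) (use u(2) c x y in auto)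
        moreover have "sub u (Times (Dom x) P)" unfolding u_def by (rule sub_compn[OF C_dfn[OF dfnt_var]])
        ultimately show ?thesis unfolding mem_h[OF B(1)] using B(2) b u(1) G_m by blast
      qed
      then show ?thesis by blast
    qed
    show "\<exists>I. (\<exists>o'. E' o' I \<and> \<not> (\<exists>z. E' z o')) \<and> (\<forall>x. E' x I \<longrightarrow> (\<exists>s. E' s I \<and> (\<forall>z. E' z s \<longleftrightarrow> E' z x \<or> z = x)))"
    proof -
      have "E' (j emp) (j om)" "\<not> (\<exists>z. E' z (j emp))" unfolding j_mem using emp_om mem_emp by blast+
      moreover have "\<exists>s. E' s (j om) \<and> (\<forall>z. E' z s \<longleftrightarrow> E' z a \<or> z = a)" if a: "E' a (j om)" for a
      proof -
        obtain n where n: "n \<epsilon> om" "a = j n" using a unfolding j_mem by blast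
        have "E' (j (suc n)) (j om)" unfolding j_mem using suc_om[OF n(1)] by blast
        moreover have "E' z (j (suc n)) \<longleftrightarrow> E' z a \<or> z = a" for z unfolding n(2) j_mem mem_suc by blast
        ultimately show ?thesis by blast
      qed
      ultimately show ?thesis by blast
    qed
  next
    fix \<phi> a assume "N.dfn (\<lambda>e. \<phi> (e 0))"
    then obtain A c where A: "\<And>x. \<phi> x \<longleftrightarrow> sat E' (case_nat x c) A" using N.dfn_unary by blast
    obtain e where e: "\<And>i. C (e i)" "c = (\<lambda>i. h (e i))" using h_envs by blast
    obtain x where x: "C x" "h x = a" using h_onto by blast
    show "\<exists>b. \<forall>z. E' z b \<longleftrightarrow> E' z a \<and> \<phi> z" using h_sep(2)[where e = e and A = A, OF e(1) x(1) refl] A e(2) x(2) by auto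
  next
    fix \<psi> a assume "N.dfn (\<lambda>e. \<psi> (e 0) (e 1))"
    then obtain A c where A: "\<And>x y. \<psi> x y \<longleftrightarrow> sat E' (case_nat x (case_nat y c)) A" using N.dfn_binary by blast
    obtain e where e: "\<And>i. C (e i)" "c = (\<lambda>i. h (e i))" using h_envs by blast
    obtain x where x: "C x" "h x = a" using h_onto by blast
    \<comment> \<open>Collection is applied in the ground model to pairs of a name in
      \<open>Dom x\<close> and a condition, asking for a name that this condition forces to be a
      suitable value.\<close>
    let ?\<psi> = "\<lambda>t y. C y \<and> (\<exists>z p. t = Pr z p \<and> fc C A p (case_nat z (case_nat y e)))"
    have dA: "dfn (\<lambda>v. fc C A (v 1) (case_nat (v 0) (case_nat (v 2) e)))"
    proof -
      let ?r = "case_nat 1 (case_nat 0 (case_nat 2 (\<lambda>i. Suc (Suc (Suc i)))))"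
      have "(\<lambda>i. v (?r (Suc i))) = case_nat (v 0) (case_nat (v 2) (\<lambda>i. v (Suc (Suc (Suc i)))))" for v :: "nat \<Rightarrow> nat"
        by (auto split: nat.split)
      then have "dfn (\<lambda>v. fc C A (v 1) (case_nat (v 0) (case_nat (v 2) (\<lambda>i. v (Suc (Suc (Suc i)))))))"
        using dfn_ren[OF fc_dfn[OF C_dfn[OF dfnt_var], of A], of ?r] by simp
      from dfn_fix[OF this, of 3 "\<lambda>i. e (i - 3)"] show ?thesis by simp
    qed
    have d: "dfn (\<lambda>v. ?\<psi> (v 0) (v 1))"
      by (intro dfns dfn3[of "\<lambda>z p y. fc C A p (case_nat z (case_nat y e))", OF dA])
    obtain b0 where b0: "\<And>t. t \<epsilon> Times (Dom x) P \<Longrightarrow> \<exists>y. ?\<psi> t y \<Longrightarrow> \<exists>y. y \<epsilon> b0 \<and> ?\<psi> t y"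
      using collection[OF d, of "Times (Dom x) P"] by blast
    have "y \<epsilon> Sep b0 C \<longleftrightarrow> y \<epsilon> b0 \<and> C y" for y by (rule mem_Sep) (intro dfns)
    then obtain B where B: "C B" "\<forall>y. y \<epsilon> b0 \<and> C y \<longrightarrow> Pr y m \<epsilon> B" using univ[of "Sep b0 C"] by auto
    have tr: "(\<exists>p\<in>G. fc C A p (case_nat z (case_nat y e))) \<longleftrightarrow> \<psi> (h z) (h y)" if "C z" "C y" for z y
    proof -
      have "C (case_nat z (case_nat y e) i)" for i using that e(1) by (simp split: nat.split)
      from truth[where e = "case_nat z (case_nat y e)" and A = A, OF this] have "(\<exists>p\<in>G. fc C A p (case_nat z (case_nat y e))) \<longleftrightarrow> sat E' (\<lambda>i. h (case_nat z (case_nat y e) i)) A" by blast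
      also have "(\<lambda>i. h (case_nat z (case_nat y e) i)) = case_nat (h z) (case_nat (h y) c)"
        unfolding e(2) by (auto split: nat.split)
      finally show ?thesis using A by simp
    qed
    have "\<exists>d. E' d (h B) \<and> \<psi> c' d" if c': "E' c' a" "\<psi> c' d" for c' d
    proof -
      obtain z s where z: "Pr z s \<epsilon> x" "c' = h z" using c'(1) x mem_h by blast
      obtain y where y: "C y" "h y = d" using h_onto by blast
      have Cz: "C z" using hn_Pr[OF x(1) z(1)] by blast
      obtain p where p: "p \<in> G" "fc C A p (case_nat z (case_nat y e))" using tr[OF Cz y(1)] c'(2) z(2) y(2) by blast
      have "Pr z p \<epsilon> Times (Dom x) P" using z(1) G_P[OF p(1)] by auto
      then obtain y' where "y' \<epsilon> b0" "?\<psi> (Pr z p) y'" using b0[of "Pr z p"] p(2) y(1) by blast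
      then have y': "y' \<epsilon> b0" "C y'" "fc C A p (case_nat z (case_nat y' e))" by auto
      have "E' (h y') (h B)" unfolding mem_h[OF B(1)] using B(2) y' G_m by blast
      moreover have "\<psi> c' (h y')" using tr[OF Cz y'(2)] y'(3) p(1) z(2) by blast
      ultimately show ?thesis by blast
    qed
    then show "\<exists>B. \<forall>x. E' x a \<longrightarrow> (\<exists>y. \<psi> x y) \<longrightarrow> (\<exists>y. E' y B \<and> \<psi> x y)" by blast
  qed
qed

sublocale N: zf E'
  by (rule zf_ext)

end

section \<open>Countable sets and the first uncountable ordinal\<close>

context zf
begin

definition fun1 :: "'a \<Rightarrow> bool" where
  "fun1 f \<longleftrightarrow> (\<forall>n x y. Pr n x \<epsilon> f \<longrightarrow> Pr n y \<epsilon> f \<longrightarrow> x = y)"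

text \<open>\<open>small\<close> means at most countable, including the empty set.\<close>

definition small :: "'a \<Rightarrow> bool" where
  "small a \<longleftrightarrow> (\<exists>f. fun1 f \<and> (\<forall>x. x \<epsilon> a \<longrightarrow> (\<exists>n. n \<epsilon> om \<and> Pr n x \<epsilon> f)))"

lemma fun1_dfn [dfns]: "dfnt s \<Longrightarrow> dfn (\<lambda>e. fun1 (s e))"
  by (rule dfn1[of fun1]; (assumption | (unfold fun1_def, intro dfns)))

lemma small_dfn [dfns]: "dfnt s \<Longrightarrow> dfn (\<lambda>e. small (s e))"
  by (rule dfn1[of small]; (assumption | (unfold small_def, intro dfns)))

lemma small_sub: "small b \<Longrightarrow> sub a b \<Longrightarrow> small a"
  unfolding small_def sub_def by blast

lemma om_ordn:
  assumes "n \<epsilon> om" shows "ordn n"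
proof (rule om_induct[OF assms, of ordn])
  show "dfn (\<lambda>e. ordn (e 0))" by (intro dfns)
  show "ordn emp" unfolding ordn_def trans_set_def by simp
qed (rule ordn_suc)

lemma ordn_om: "ordn om"
  unfolding ordn_def using trans_om om_ordn ordn_def by blast

lemma om_max: "a \<epsilon> om \<Longrightarrow> b \<epsilon> om \<Longrightarrow> \<exists>c. c \<epsilon> om \<and> sub a c \<and> sub b c"
  using ordn_sub_linear[OF om_ordn om_ordn] sub_refl by blast

lemma small_om: "small om"
proof -
  have "t \<epsilon> Img (\<lambda>n. Pr n n) om \<longleftrightarrow> (\<exists>n. n \<epsilon> om \<and> t = Pr n n)" for t by (rule mem_Img) (intro dfns)
  then show ?thesis unfolding small_def fun1_def by (intro exI[of _ "Img (\<lambda>n. Pr n n) om"]) auto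
qed

lemma small_emp: "small emp"
  by (rule small_sub[OF small_om]) (simp add: sub_def)

lemma small_rel_image:
  assumes g: "fun1 g" and a: "small a" and ex: "\<And>y. y \<epsilon> b \<Longrightarrow> \<exists>x. x \<epsilon> a \<and> Pr x y \<epsilon> g"
  shows "small b"
proof -
  obtain f where f: "fun1 f" "\<And>x. x \<epsilon> a \<Longrightarrow> \<exists>n. n \<epsilon> om \<and> Pr n x \<epsilon> f" using a unfolding small_def by blast
  let ?\<phi> = "\<lambda>t. \<exists>n x y. t = Pr n y \<and> Pr n x \<epsilon> f \<and> Pr x y \<epsilon> g"
  define k where "k = Sep (Times om b) ?\<phi>"
  have "t \<epsilon> k \<longleftrightarrow> t \<epsilon> Times om b \<and> ?\<phi> t" for t unfolding k_def by (rule mem_Sep) (intro dfns)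
  then have k: "Pr n y \<epsilon> k \<longleftrightarrow> n \<epsilon> om \<and> y \<epsilon> b \<and> (\<exists>x. Pr n x \<epsilon> f \<and> Pr x y \<epsilon> g)" for n y by auto
  have "fun1 k" using f(1) g unfolding fun1_def k by blast
  moreover have "\<exists>n. n \<epsilon> om \<and> Pr n y \<epsilon> k" if "y \<epsilon> b" for y using ex[OF that] f(2) k that by blast
  ultimately show ?thesis unfolding small_def by blast
qed

lemma small_Img:
  assumes d: "dfnt (\<lambda>e. F (e 0))" and a: "small a" shows "small (Img F a)"
proof (rule small_rel_image[of "Img (\<lambda>x. Pr x (F x)) a", OF _ a])
  have m: "t \<epsilon> Img (\<lambda>x. Pr x (F x)) a \<longleftrightarrow> (\<exists>x. x \<epsilon> a \<and> t = Pr x (F x))" for t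
    by (rule mem_Img) (intro dfns dfnt_app[of F, OF d])
  show "fun1 (Img (\<lambda>x. Pr x (F x)) a)" unfolding fun1_def m by auto
  show "\<exists>x. x \<epsilon> a \<and> Pr x y \<epsilon> Img (\<lambda>x. Pr x (F x)) a" if "y \<epsilon> Img F a" for y
    using that unfolding m mem_Img[OF d] by auto
qed

text \<open>The walk \<open>(0,d), \<dots>, (d,d), (d,d-1), \<dots>, (d,0), (0,d+1)\<close> enumerates \<open>om \<times> om\<close>.\<close>

definition fs :: "'a \<Rightarrow> 'a" where "fs t = Uni (Dom (Upr t t))"
definition sn :: "'a \<Rightarrow> 'a" where "sn t = Uni (Ran (Upr t t))"

lemma fs_Pr [simp]: "fs (Pr a b) = a" and sn_Pr [simp]: "sn (Pr a b) = b"
  by (rule ext, simp add: fs_def sn_def)+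

lemma fs_dfn [dfns]: "dfnt s \<Longrightarrow> dfnt (\<lambda>e. fs (s e))"
  unfolding fs_def by (intro dfns)

lemma sn_dfn [dfns]: "dfnt s \<Longrightarrow> dfnt (\<lambda>e. sn (s e))"
  unfolding sn_def by (intro dfns)

definition walk :: "'a \<Rightarrow> 'a" where
  "walk t = (if fs t \<epsilon> sn t then Pr (suc (fs t)) (sn t) else if sn t = emp then Pr emp (suc (fs t)) else Pr (fs t) (Uni (sn t)))"

lemma walk_dfn: "dfnt (\<lambda>e. walk (e 0))"
  unfolding walk_def by (intro dfns)

lemma walk: "walk (Pr a b) = (if a \<epsilon> b then Pr (suc a) b else if b = emp then Pr emp (suc a) else Pr a (Uni b))"
  by (simp add: walk_def)

lemma small_om_om: "small (Times om om)"
proof -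
  let ?s = "nrec walk (Pr emp emp)"
  let ?r = "\<lambda>t. \<exists>n. n \<epsilon> om \<and> ?s n = t"
  have sd: "dfnt t \<Longrightarrow> dfnt (\<lambda>e. ?s (t e))" for t by (rule nrec_dfn[OF walk_dfn dfnt_const])
  have step: "?r (walk t)" if "?r t" for t using that nrec_suc[OF walk_dfn] suc_om by metis
  have r0: "?r (Pr emp emp)" using nrec_emp[OF walk_dfn] emp_om by blast
  \<comment> \<open>The ascending part of the walk, from \<open>(0, d)\<close> up to
    \<open>(d, d)\<close>.\<close>
  have up: "a = d \<or> a \<epsilon> d \<longrightarrow> ?r (Pr a d)" if d: "d \<epsilon> om" "?r (Pr emp d)" and a: "a \<epsilon> om" for a d
  proof (rule om_induct[OF a, of "\<lambda>a. a = d \<or> a \<epsilon> d \<longrightarrow> ?r (Pr a d)"])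
    show "dfn (\<lambda>e. e 0 = d \<or> e 0 \<epsilon> d \<longrightarrow> ?r (Pr (e 0) d))" by (intro dfns sd)
    fix a assume IH: "a = d \<or> a \<epsilon> d \<longrightarrow> ?r (Pr a d)"
    show "suc a = d \<or> suc a \<epsilon> d \<longrightarrow> ?r (Pr (suc a) d)"
    proof
      assume "suc a = d \<or> suc a \<epsilon> d"
      then have "a \<epsilon> d" using ordn_trans[OF om_ordn[OF d(1)]] by auto
      then show "?r (Pr (suc a) d)" using IH step[of "Pr a d"] walk[of a d] by simp
    qed
  qed (use d in simp)
  \<comment> \<open>The descending part. If \<open>(d, b)\<close> were missed, then so would be
    every \<open>(d, b')\<close> with \<open>b'\<close> between \<open>b\<close> and
    \<open>d\<close>, by upward induction on \<open>b'\<close>; but \<open>(d, d)\<close> is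
    reached.\<close>
  have down: "?r (Pr d b)" if d: "d \<epsilon> om" "?r (Pr d d)" and b: "b \<epsilon> om" "b = d \<or> b \<epsilon> d" for b d
  proof (rule ccontr)
    assume n: "\<not> ?r (Pr d b)"
    have "\<not> (b' = d \<or> b' \<epsilon> d) \<or> (b \<epsilon> b' \<or> b = b' \<longrightarrow> \<not> ?r (Pr d b'))" if b': "b' \<epsilon> om" for b'
    proof (rule om_induct[OF b', of "\<lambda>b'. \<not> (b' = d \<or> b' \<epsilon> d) \<or> (b \<epsilon> b' \<or> b = b' \<longrightarrow> \<not> ?r (Pr d b'))"])
      show "dfn (\<lambda>e. \<not> (e 0 = d \<or> e 0 \<epsilon> d) \<or> (b \<epsilon> e 0 \<or> b = e 0 \<longrightarrow> \<not> ?r (Pr d (e 0))))" by (intro dfns sd)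
      show "\<not> (emp = d \<or> emp \<epsilon> d) \<or> (b \<epsilon> emp \<or> b = emp \<longrightarrow> \<not> ?r (Pr d emp))" using n by auto
      fix c assume c: "c \<epsilon> om" and IH: "\<not> (c = d \<or> c \<epsilon> d) \<or> (b \<epsilon> c \<or> b = c \<longrightarrow> \<not> ?r (Pr d c))"
      show "\<not> (suc c = d \<or> suc c \<epsilon> d) \<or> (b \<epsilon> suc c \<or> b = suc c \<longrightarrow> \<not> ?r (Pr d (suc c)))"
      proof (rule ccontr)
        assume "\<not> ?thesis"
        then have s: "suc c = d \<or> suc c \<epsilon> d" "b \<epsilon> suc c \<or> b = suc c" "?r (Pr d (suc c))" by blast+
        have "c \<epsilon> d" using s(1) ordn_trans[OF om_ordn[OF d(1)]] by auto
        have "b \<noteq> suc c" using s(3) n by blast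
        then have bc: "b \<epsilon> c \<or> b = c" using s(2) by simp
        have "\<not> d \<epsilon> suc c" using s(1) no_2cycle[of d "suc c"] irrefl[of d] by metis
        moreover have "suc c \<noteq> emp" by (metis mem_emp mem_suc)
        moreover have "Uni (suc c) = c" using om_ordn[OF c] by (intro ext) (auto simp: ordn_def trans_set_def sub_def)
        ultimately have "walk (Pr d (suc c)) = Pr d c" using walk by simp
        then have "?r (Pr d c)" using step[OF s(3)] by simp
        then show False using IH \<open>c \<epsilon> d\<close> bc by blast
      qed
    qed
    from this[OF d(1)] show False using b(2) d(2) by blast
  qed
  have diag: "?r (Pr emp d)" if "d \<epsilon> om" for d
  proof (rule om_induct[OF that, of "\<lambda>d. ?r (Pr emp d)"])
    show "dfn (\<lambda>e. ?r (Pr emp (e 0)))" by (intro dfns sd)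
    show "?r (Pr emp emp)" by (rule r0)
    fix d assume d: "d \<epsilon> om" "?r (Pr emp d)"
    have 1: "?r (Pr d d)" using up[OF d d(1)] by blast
    have "emp = d \<or> emp \<epsilon> d" using ordn_linear[OF om_ordn[OF emp_om] om_ordn[OF d(1)]] mem_emp by blast
    then have "?r (Pr d emp)" using down[OF d(1) 1 emp_om] by blast
    then show "?r (Pr emp (suc d))" using step[of "Pr d emp"] walk[of d emp] by simp
  qed
  have all: "?r (Pr a b)" if a: "a \<epsilon> om" and b: "b \<epsilon> om" for a b
  proof -
    have "a \<epsilon> b \<or> a = b \<or> b \<epsilon> a" using ordn_linear om_ordn a b by blast
    moreover have "?r (Pr a b)" if "a \<epsilon> b \<or> a = b" using up[OF b diag[OF b] a] that by blast
    moreover have "?r (Pr a b)" if "b \<epsilon> a"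
      using down[OF a _ b] up[OF a diag[OF a] a] that by blast
    ultimately show ?thesis by blast
  qed
  have sd0: "dfnt (\<lambda>e. ?s (e 0))" by (intro sd dfns)
  show ?thesis
  proof (rule small_sub[OF small_Img[OF sd0 small_om]])
    show "sub (Times om om) (Img ?s om)" unfolding sub_def mem_Times mem_Img[OF sd0] using all by metis
  qed
qed

text \<open>The least index at which an element is enumerated is a canonical value, so the passage
  from an enumeration to an injection works without choice.\<close>

lemma small_injection:
  assumes "small a"
  shows "\<exists>f. (\<forall>t. t \<epsilon> f \<longrightarrow> (\<exists>x n. x \<epsilon> a \<and> n \<epsilon> om \<and> t = Pr x n)) \<and> (\<forall>x. x \<epsilon> a \<longrightarrow> (\<exists>n. Pr x n \<epsilon> f)) \<and>
    fun1 f \<and> (\<forall>x y n. Pr x n \<epsilon> f \<longrightarrow> Pr y n \<epsilon> f \<longrightarrow> x = y)"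
proof -
  obtain g where g: "fun1 g" "\<And>x. x \<epsilon> a \<Longrightarrow> \<exists>n. n \<epsilon> om \<and> Pr n x \<epsilon> g" using assms unfolding small_def by blast
  let ?\<phi> = "\<lambda>t. \<exists>x n. t = Pr x n \<and> Pr n x \<epsilon> g \<and> (\<forall>l. l \<epsilon> n \<longrightarrow> \<not> Pr l x \<epsilon> g)"
  define f where "f = Sep (Times a om) ?\<phi>"
  have f: "t \<epsilon> f \<longleftrightarrow> t \<epsilon> Times a om \<and> ?\<phi> t" for t unfolding f_def by (rule mem_Sep) (intro dfns)
  have fP: "Pr x n \<epsilon> f \<longleftrightarrow> x \<epsilon> a \<and> n \<epsilon> om \<and> Pr n x \<epsilon> g \<and> (\<forall>l. l \<epsilon> n \<longrightarrow> \<not> Pr l x \<epsilon> g)" for x n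
    unfolding f by auto
  have "\<exists>n. Pr x n \<epsilon> f" if x: "x \<epsilon> a" for x
  proof -
    have m: "n \<epsilon> Sep om (\<lambda>n. Pr n x \<epsilon> g) \<longleftrightarrow> n \<epsilon> om \<and> Pr n x \<epsilon> g" for n by (rule mem_Sep) (intro dfns)
    obtain n where "n \<epsilon> om" "Pr n x \<epsilon> g" "\<And>l. l \<epsilon> n \<Longrightarrow> \<not> (l \<epsilon> om \<and> Pr l x \<epsilon> g)"
      using wf_mem[of "Sep om (\<lambda>n. Pr n x \<epsilon> g)"] g(2)[OF x] unfolding m by blast
    then show ?thesis unfolding fP using x om_mem_trans by blast
  qed
  moreover have "fun1 f" unfolding fun1_def fP using ordn_linear om_ordn by blast
  moreover have "x = y" if "Pr x n \<epsilon> f" "Pr y n \<epsilon> f" for x y n using that g(1) unfolding fun1_def fP by blast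
  moreover have "\<exists>x n. x \<epsilon> a \<and> n \<epsilon> om \<and> t = Pr x n" if "t \<epsilon> f" for t using that unfolding f mem_Times by blast
  ultimately show ?thesis by blast
qed

section \<open>Codes of countable ordinals and the first uncountable ordinal\<close>

definition order_rel :: "'a \<Rightarrow> 'a" where
  "order_rel f = Sep (Times om om) (\<lambda>t. \<exists>l n x y. t = Pr l n \<and> Pr l x \<epsilon> f \<and> Pr n y \<epsilon> f \<and> x \<epsilon> y)"

lemma mem_order_rel: "Pr l n \<epsilon> order_rel f \<longleftrightarrow> l \<epsilon> om \<and> n \<epsilon> om \<and> (\<exists>x y. Pr l x \<epsilon> f \<and> Pr n y \<epsilon> f \<and> x \<epsilon> y)"
proof -
  have "t \<epsilon> order_rel f \<longleftrightarrow> t \<epsilon> Times om om \<and> (\<exists>l n x y. t = Pr l n \<and> Pr l x \<epsilon> f \<and> Pr n y \<epsilon> f \<and> x \<epsilon> y)" for t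
    unfolding order_rel_def by (rule mem_Sep) (intro dfns)
  then show ?thesis by auto
qed

lemma order_rel_dfn: "dfnt s \<Longrightarrow> dfnt (\<lambda>e. order_rel (s e))"
  by (rule dfnt_app[of order_rel]; (assumption | (unfold order_rel_def, intro dfns)))

definition enumerates :: "'a \<Rightarrow> 'a \<Rightarrow> bool" where
  "enumerates f a \<longleftrightarrow> fun1 f \<and> sub f (Times om a) \<and> (\<forall>x. x \<epsilon> a \<longrightarrow> (\<exists>n. Pr n x \<epsilon> f))"

text \<open>Enumerations inducing the same order on the same indices give an isomorphism of
  ordinals. By membership induction this is the identity.\<close>

lemma enumerates_sub:
  assumes a: "ordn a" and b: "ordn b" and f: "enumerates f a" and g: "enumerates g b"
    and dom: "Dom f = Dom g" and rel: "order_rel f = order_rel g"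
  shows "sub a b"
proof -
  have fa: "Pr n x \<epsilon> f \<Longrightarrow> n \<epsilon> om \<and> x \<epsilon> a" for n x using f unfolding enumerates_def sub_def by fastforce
  have gb: "Pr n x \<epsilon> g \<Longrightarrow> n \<epsilon> om \<and> x \<epsilon> b" for n x using g unfolding enumerates_def sub_def by fastforce
  have ff: "Pr n x \<epsilon> f \<Longrightarrow> Pr n y \<epsilon> f \<Longrightarrow> x = y" for n x y using f unfolding enumerates_def fun1_def by blast
  have gf: "Pr n x \<epsilon> g \<Longrightarrow> Pr n y \<epsilon> g \<Longrightarrow> x = y" for n x y using g unfolding enumerates_def fun1_def by blast
  have fo: "x \<epsilon> a \<Longrightarrow> \<exists>n. Pr n x \<epsilon> f" for x using f unfolding enumerates_def by blast
  have go: "x \<epsilon> b \<Longrightarrow> \<exists>n. Pr n x \<epsilon> g" for x using g unfolding enumerates_def by blast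
  have "\<forall>n. Pr n x \<epsilon> f \<longrightarrow> Pr n x \<epsilon> g" for x
  proof (rule eps_induct[of "\<lambda>x. \<forall>n. Pr n x \<epsilon> f \<longrightarrow> Pr n x \<epsilon> g"], intro dfns, intro allI impI)
    fix x n assume IH: "\<And>z. z \<epsilon> x \<Longrightarrow> \<forall>n. Pr n z \<epsilon> f \<longrightarrow> Pr n z \<epsilon> g" and n: "Pr n x \<epsilon> f"
    have "n \<epsilon> Dom g" using n dom[symmetric] by auto
    then obtain x' where x': "Pr n x' \<epsilon> g" by auto
    have "z \<epsilon> x'" if z: "z \<epsilon> x" for z
    proof -
      have "z \<epsilon> a" using ordn_trans[OF a] fa[OF n] z by blast
      then obtain l where l: "Pr l z \<epsilon> f" using fo by blast
      then have "Pr l n \<epsilon> order_rel f" unfolding mem_order_rel using fa n z by blast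
      then obtain z1 x1 where "Pr l z1 \<epsilon> g" "Pr n x1 \<epsilon> g" "z1 \<epsilon> x1" unfolding rel mem_order_rel by blast
      then show ?thesis using gf x' IH[OF z] l by metis
    qed
    moreover have "z \<epsilon> x" if z: "z \<epsilon> x'" for z
    proof -
      have "z \<epsilon> b" using ordn_trans[OF b] gb[OF x'] z by blast
      then obtain l where l: "Pr l z \<epsilon> g" using go by blast
      then have "Pr l n \<epsilon> order_rel g" unfolding mem_order_rel using gb x' z by blast
      then obtain z1 x1 where z1: "Pr l z1 \<epsilon> f" "Pr n x1 \<epsilon> f" "z1 \<epsilon> x1" unfolding rel[symmetric] mem_order_rel by blast
      then have "z1 \<epsilon> x" using ff n by metis
      then show ?thesis using IH z1(1) l gf by metis
    qed
    ultimately have "x = x'" by (intro ext) blast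
    then show "Pr n x \<epsilon> g" using x' by simp
  qed
  then show ?thesis unfolding sub_def using fo gb by blast
qed

definition w1 :: 'a where "w1 = setof (\<lambda>a. ordn a \<and> small a)"

text \<open>Hartogs' argument: a countable ordinal is determined by the domain of an enumeration and
  the order induced on it. Such codes lie in a set, and replacement turns them into the set of all
  countable ordinals.\<close>

lemma mem_w1: "a \<epsilon> w1 \<longleftrightarrow> ordn a \<and> small a"
proof -
  let ?\<psi> = "\<lambda>u a. ordn a \<and> (\<exists>f. fun1 f \<and> sub f (Times om a) \<and> (\<forall>x. x \<epsilon> a \<longrightarrow> (\<exists>n. Pr n x \<epsilon> f)) \<and> u = Pr (Dom f) (order_rel f))"
  let ?U = "Times (Pow om) (Pow (Times om om))"
  have "\<exists>b. \<forall>a. a \<epsilon> b \<longleftrightarrow> (\<exists>u. u \<epsilon> ?U \<and> ?\<psi> u a)"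
  proof (rule rep_ex)
    show "dfn (\<lambda>e. ?\<psi> (e 0) (e 1))" by (intro dfns order_rel_dfn)
    fix u a b assume "?\<psi> u a" "?\<psi> u b"
    then obtain f g where "ordn a" "ordn b" "enumerates f a" "enumerates g b" "Dom f = Dom g" "order_rel f = order_rel g"
      unfolding enumerates_def by auto
    then show "a = b" using enumerates_sub sub_antisym by metis
  qed
  then obtain k where k: "\<And>a. a \<epsilon> k \<longleftrightarrow> (\<exists>u. u \<epsilon> ?U \<and> ?\<psi> u a)" by blast
  have "a \<epsilon> k \<longleftrightarrow> ordn a \<and> small a" for a
  proof
    assume "a \<epsilon> k"
    then obtain f where f: "ordn a" "fun1 f" "sub f (Times om a)" "\<forall>x. x \<epsilon> a \<longrightarrow> (\<exists>n. Pr n x \<epsilon> f)" unfolding k by blast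
    then have "\<forall>x. x \<epsilon> a \<longrightarrow> (\<exists>n. n \<epsilon> om \<and> Pr n x \<epsilon> f)" unfolding sub_def by fastforce
    then show "ordn a \<and> small a" unfolding small_def using f by blast
  next
    assume a: "ordn a \<and> small a"
    then obtain g where g: "fun1 g" "\<And>x. x \<epsilon> a \<Longrightarrow> \<exists>n. n \<epsilon> om \<and> Pr n x \<epsilon> g" unfolding small_def by blast
    define f where "f = Itr g (Times om a)"
    have f: "Pr n x \<epsilon> f \<longleftrightarrow> Pr n x \<epsilon> g \<and> n \<epsilon> om \<and> x \<epsilon> a" for n x unfolding f_def by auto
    have "fun1 f" using g(1) f unfolding fun1_def by blast
    moreover have "sub f (Times om a)" unfolding f_def sub_def by simp
    moreover have "\<forall>x. x \<epsilon> a \<longrightarrow> (\<exists>n. Pr n x \<epsilon> f)" using g(2) f by blast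
    ultimately have "?\<psi> (Pr (Dom f) (order_rel f)) a" using a by blast
    moreover have "Pr (Dom f) (order_rel f) \<epsilon> ?U"
    proof -
      have "sub (order_rel f) (Times om om)" unfolding sub_def order_rel_def
        by (subst mem_Sep) (intro dfns, blast)
      moreover have "sub (Dom f) om" unfolding sub_def using f by auto
      ultimately show ?thesis by simp
    qed
    ultimately show "a \<epsilon> k" unfolding k by blast
  qed
  then show ?thesis unfolding w1_def by (intro mem_setof) blast
qed

lemma ordn_w1: "ordn w1"
proof -
  have 1: "sub y w1" if "y \<epsilon> w1" for y
    unfolding sub_def
  proof (intro allI impI)
    fix z assume z: "z \<epsilon> y"
    have y: "ordn y" "small y" using that mem_w1 by blast+
    have "sub z y" using ordn_trans[OF y(1) z] by (simp add: sub_def)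
    then show "z \<epsilon> w1" unfolding mem_w1 using ordn_mem[OF y(1) z] small_sub[OF y(2)] by blast
  qed
  then show ?thesis unfolding ordn_def trans_set_def[of w1] using mem_w1 ordn_def by blast
qed

lemma not_small_w1: "\<not> small w1"
  using ordn_w1 mem_w1[of w1] by auto

lemma om_w1: "om \<epsilon> w1"
  unfolding mem_w1 using ordn_om small_om by blast

definition inj1 :: "'a \<Rightarrow> bool" where
  "inj1 f \<longleftrightarrow> (\<forall>n l x. Pr n x \<epsilon> f \<longrightarrow> Pr l x \<epsilon> f \<longrightarrow> n = l)"

lemma inj1_dfn [dfns]: "dfnt s \<Longrightarrow> dfn (\<lambda>e. inj1 (s e))"
  by (rule dfn1[of inj1]; (assumption | (unfold inj1_def, intro dfns)))

text \<open>The finite partial injections from \<open>om\<close> to \<open>w1\<close>; a subset of \<open>om\<close> is finite iff it is bounded.\<close>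

definition Qc :: 'a where
  "Qc = Sep (Pow (Times om w1)) (\<lambda>q. fun1 q \<and> inj1 q \<and> (\<exists>l. l \<epsilon> om \<and> sub (Dom q) l))"

lemma mem_Qc: "q \<epsilon> Qc \<longleftrightarrow> sub q (Times om w1) \<and> fun1 q \<and> inj1 q \<and> (\<exists>l. l \<epsilon> om \<and> sub (Dom q) l)"
proof -
  have "q \<epsilon> Qc \<longleftrightarrow> q \<epsilon> Pow (Times om w1) \<and> (fun1 q \<and> inj1 q \<and> (\<exists>l. l \<epsilon> om \<and> sub (Dom q) l))"
    unfolding Qc_def by (rule mem_Sep) (intro dfns)
  then show ?thesis by simp
qed

lemma emp_Qc: "emp \<epsilon> Qc"
  unfolding mem_Qc fun1_def inj1_def sub_def by (auto intro: emp_om)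

lemma Qc_add:
  assumes q: "q \<epsilon> Qc" and n: "n \<epsilon> om" "\<not> n \<epsilon> Dom q" and a: "a \<epsilon> w1" "\<not> a \<epsilon> Ran q"
  shows "Cup q (Upr (Pr n a) (Pr n a)) \<epsilon> Qc"
proof -
  let ?q = "Cup q (Upr (Pr n a) (Pr n a))"
  have m: "Pr l x \<epsilon> ?q \<longleftrightarrow> Pr l x \<epsilon> q \<or> (l = n \<and> x = a)" for l x by simp
  obtain l where l: "l \<epsilon> om" "sub (Dom q) l" using q mem_Qc by blast
  obtain c where c: "c \<epsilon> om" "sub l c" "sub (suc n) c" using om_max[OF l(1) suc_om[OF n(1)]] by blast
  have "sub (Dom ?q) c"
    unfolding sub_def
  proof (intro allI impI)
    fix x assume "x \<epsilon> Dom ?q"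
    then have "x \<epsilon> Dom q \<or> x = n" unfolding mem_Dom m by blast
    then show "x \<epsilon> c" using l(2) c(2,3) unfolding sub_def by auto
  qed
  moreover have "sub ?q (Times om w1)" using q n(1) a(1) unfolding mem_Qc sub_def by auto
  moreover have "fun1 ?q" using q n(2) unfolding mem_Qc fun1_def m mem_Dom by blast
  moreover have "inj1 ?q" using q a(2) unfolding mem_Qc inj1_def m mem_Ran by blast
  ultimately show ?thesis unfolding mem_Qc[of ?q] using c(1) by blast
qed

lemma Qc_Dom:
  assumes q: "q \<epsilon> Qc" and n: "n \<epsilon> om" shows "\<exists>q'. q' \<epsilon> Qc \<and> sub q q' \<and> n \<epsilon> Dom q'"
proof (cases "n \<epsilon> Dom q")
  case False
  \<comment> \<open>A fresh value exists because \<open>q\<close> itself would otherwise enumerate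
    \<open>w1\<close>.\<close>
  have "\<exists>a. a \<epsilon> w1 \<and> \<not> a \<epsilon> Ran q"
  proof (rule ccontr)
    assume "\<not> ?thesis"
    then have "\<forall>x. x \<epsilon> w1 \<longrightarrow> (\<exists>n. n \<epsilon> om \<and> Pr n x \<epsilon> q)"
      using q unfolding mem_Qc sub_def by fastforce
    then have "small w1" using q unfolding mem_Qc small_def by blast
    then show False using not_small_w1 by blast
  qed
  then obtain a where "a \<epsilon> w1" "\<not> a \<epsilon> Ran q" by blast
  then have "Cup q (Upr (Pr n a) (Pr n a)) \<epsilon> Qc" using Qc_add[OF q n False] by blast
  then show ?thesis by (intro exI[of _ "Cup q (Upr (Pr n a) (Pr n a))"]) (auto simp: sub_def)
qed (use q sub_refl in blast)

lemma Qc_Ran: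
  assumes q: "q \<epsilon> Qc" and a: "a \<epsilon> w1" shows "\<exists>q'. q' \<epsilon> Qc \<and> sub q q' \<and> a \<epsilon> Ran q'"
proof (cases "a \<epsilon> Ran q")
  case False
  obtain l where l: "l \<epsilon> om" "sub (Dom q) l" using q mem_Qc by blast
  \<comment> \<open>The bound \<open>l\<close> of the domain is a fresh argument, since it is not an
    element of itself.\<close>
  have "\<not> l \<epsilon> Dom q" using l(2) irrefl unfolding sub_def by blast
  then have "Cup q (Upr (Pr l a) (Pr l a)) \<epsilon> Qc" using Qc_add[OF q l(1) _ a False] by blast
  then show ?thesis by (intro exI[of _ "Cup q (Upr (Pr l a) (Pr l a))"]) (auto simp: sub_def)
qed (use q sub_refl in blast)

end

section \<open>Consequences of Choice\<close>

locale zfc = zf +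
  assumes choice: "\<And>A. (\<And>a. a \<epsilon> A \<Longrightarrow> \<exists>y. y \<epsilon> a) \<Longrightarrow>
    \<exists>f. (\<forall>a y. Pr a y \<epsilon> f \<longrightarrow> y \<epsilon> a) \<and> (\<forall>a. a \<epsilon> A \<longrightarrow> (\<exists>y. Pr a y \<epsilon> f \<and> (\<forall>z. Pr a z \<epsilon> f \<longrightarrow> z = y)))"
begin

lemma choice_App:
  assumes d: "dfnt (\<lambda>e. W (e 0))" and ne: "\<And>x. x \<epsilon> X \<Longrightarrow> \<exists>y. y \<epsilon> W x"
  shows "\<exists>c. \<forall>x. x \<epsilon> X \<longrightarrow> App c (W x) \<epsilon> W x"
proof -
  have "\<exists>f. (\<forall>a y. Pr a y \<epsilon> f \<longrightarrow> y \<epsilon> a) \<and> (\<forall>a. a \<epsilon> Img W X \<longrightarrow> (\<exists>y. Pr a y \<epsilon> f \<and> (\<forall>z. Pr a z \<epsilon> f \<longrightarrow> z = y)))"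
    by (rule choice) (use ne mem_Img[OF d] in auto)
  then obtain f where f: "\<And>a y. Pr a y \<epsilon> f \<Longrightarrow> y \<epsilon> a" "\<And>a. a \<epsilon> Img W X \<Longrightarrow> \<exists>y. Pr a y \<epsilon> f \<and> (\<forall>z. Pr a z \<epsilon> f \<longrightarrow> z = y)"
    by blast
  have "App f (W x) \<epsilon> W x" if "x \<epsilon> X" for x
  proof -
    have "W x \<epsilon> Img W X" using that mem_Img[OF d] by blast
    then obtain y where y: "Pr (W x) y \<epsilon> f" "\<forall>z. Pr (W x) z \<epsilon> f \<longrightarrow> z = y" using f(2) by blast
    have "App f (W x) = y" by (rule App_eq) (use y in blast)+
    then show ?thesis using f(1) y(1) by simp
  qed
  then show ?thesis by blast
qed

text \<open>The sequence is delivered as a definable operation rather than as a set of pairs, so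
  that unions and names built from it can be formed with \<open>Img\<close>.\<close>

lemma dc:
  assumes R: "dfn (\<lambda>e. R (e 0) (e 1))" and x0: "x0 \<epsilon> X" and ex: "\<And>x. x \<epsilon> X \<Longrightarrow> \<exists>y. y \<epsilon> X \<and> R x y"
  shows "\<exists>s. dfnt (\<lambda>e. s (e 0)) \<and> s emp = x0 \<and> (\<forall>n. n \<epsilon> om \<longrightarrow> s n \<epsilon> X \<and> R (s n) (s (suc n)))"
proof -
  have d: "dfnt (\<lambda>e. Sep X (R (e 0)))"
    by (intro Sep_dfn[of "\<lambda>_. X" "\<lambda>x e. R (e 0) x"] dfn2[of R, OF R] dfns)
  have m: "y \<epsilon> Sep X (R x) \<longleftrightarrow> y \<epsilon> X \<and> R x y" for x y
    by (rule mem_Sep) (intro dfn2[of R, OF R] dfns)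
  obtain c where c: "\<And>x. x \<epsilon> X \<Longrightarrow> App c (Sep X (R x)) \<epsilon> Sep X (R x)"
    using choice_App[OF d, of X] ex unfolding m by blast
  define g where "g x = App c (Sep X (R x))" for x
  have g: "g x \<epsilon> X \<and> R x (g x)" if "x \<epsilon> X" for x using c[OF that] unfolding m g_def .
  have gd: "dfnt (\<lambda>e. g (e 0))" unfolding g_def by (intro dfns d)
  let ?s = "nrec g x0"
  have sX: "?s n \<epsilon> X" if "n \<epsilon> om" for n
  proof (rule om_induct[OF that, of "\<lambda>n. ?s n \<epsilon> X"])
    show "dfn (\<lambda>e. ?s (e 0) \<epsilon> X)" by (intro dfns nrec_dfn[OF gd])
    show "?s emp \<epsilon> X" using x0 nrec_emp[OF gd] by simp
    show "?s (suc n) \<epsilon> X" if "n \<epsilon> om" "?s n \<epsilon> X" for n using nrec_suc[OF gd that(1)] g[OF that(2)] by simp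
  qed
  have "dfnt (\<lambda>e. ?s (e 0))" by (intro nrec_dfn[OF gd] dfns)
  moreover have "?s n \<epsilon> X \<and> R (?s n) (?s (suc n))" if "n \<epsilon> om" for n
    using sX[OF that] g nrec_suc[OF gd that] by simp
  ultimately show ?thesis using nrec_emp[OF gd] by blast
qed

lemma small_UN:
  assumes d: "dfnt (\<lambda>e. F (e 0))" and sm: "\<And>n. n \<epsilon> om \<Longrightarrow> small (F n)"
  shows "small (Uni (Img F om))"
proof -
  note dF = dfnt_app[of F, OF d]
  let ?w = "\<lambda>f n. fun1 f \<and> (\<forall>x. x \<epsilon> F n \<longrightarrow> (\<exists>l. l \<epsilon> om \<and> Pr l x \<epsilon> f))"
  \<comment> \<open>The enumerations of \<open>F n\<close> are restricted to subsets of
    \<open>Times om (F n)\<close> so that they form a set from which one can be chosen.\<close>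
  define W where "W n = Sep (Pow (Times om (F n))) (\<lambda>f. ?w f n)" for n
  have Wd: "dfnt (\<lambda>e. W (e 0))" unfolding W_def
    by (intro dfns dF)
  have "f \<epsilon> W n \<longleftrightarrow> f \<epsilon> Pow (Times om (F n)) \<and> ?w f n" for f n
    unfolding W_def by (rule mem_Sep) (intro dfns dF)
  then have W: "f \<epsilon> W n \<longleftrightarrow> sub f (Times om (F n)) \<and> ?w f n" for f n by simp
  have "\<exists>f. f \<epsilon> W n" if n: "n \<epsilon> om" for n
  proof -
    obtain f where f: "fun1 f" "\<forall>x. x \<epsilon> F n \<longrightarrow> (\<exists>l. l \<epsilon> om \<and> Pr l x \<epsilon> f)" using sm[OF n] unfolding small_def by blast
    have "Itr f (Times om (F n)) \<epsilon> W n" unfolding W using f unfolding fun1_def sub_def by auto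
    then show ?thesis by blast
  qed
  then obtain c where c: "\<And>n. n \<epsilon> om \<Longrightarrow> App c (W n) \<epsilon> W n" using choice_App[OF Wd, of om] by blast
  let ?\<phi> = "\<lambda>t. \<exists>a b x. t = Pr (Pr a b) x \<and> a \<epsilon> om \<and> Pr b x \<epsilon> App c (W a)"
  define g where "g = Sep (Times (Times om om) (Uni (Img F om))) ?\<phi>"
  have "t \<epsilon> g \<longleftrightarrow> t \<epsilon> Times (Times om om) (Uni (Img F om)) \<and> ?\<phi> t" for t
    unfolding g_def by (rule mem_Sep) (intro dfns dfnt_app[of W, OF Wd])
  then have g: "Pr u x \<epsilon> g \<longleftrightarrow> u \<epsilon> Times om om \<and> x \<epsilon> Uni (Img F om) \<and> (\<exists>a b. u = Pr a b \<and> a \<epsilon> om \<and> Pr b x \<epsilon> App c (W a))" for u x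
    by auto
  show ?thesis
  proof (rule small_rel_image[OF _ small_om_om])
    show "fun1 g" unfolding fun1_def g using c W unfolding fun1_def by (metis Pr_eq)
    show "\<exists>u. u \<epsilon> Times om om \<and> Pr u x \<epsilon> g" if x: "x \<epsilon> Uni (Img F om)" for x
    proof -
      obtain n where n: "n \<epsilon> om" "x \<epsilon> F n" using x mem_Img[OF d] by auto
      then obtain l where l: "l \<epsilon> om" "Pr l x \<epsilon> App c (W n)" using c[OF n(1)] W by blast
      have "Pr n l \<epsilon> Times om om" using n l by simp
      then show ?thesis unfolding g using x n l by blast
    qed
  qed
qed

lemma small_Cup:
  assumes "small a" "small b" shows "small (Cup a b)"
proof -
  let ?F = "\<lambda>n. if n = emp then a else b"
  have d: "dfnt (\<lambda>e. ?F (e 0))" by (intro dfns)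
  have "sub (Cup a b) (Uni (Img ?F om))"
    unfolding sub_def mem_Uni mem_Img[OF d] mem_Cup
  proof (intro allI impI)
    fix z assume z: "z \<epsilon> a \<or> z \<epsilon> b"
    have "suc emp \<noteq> emp" by (metis mem_emp mem_suc)
    then show "\<exists>y. (\<exists>x. x \<epsilon> om \<and> y = ?F x) \<and> z \<epsilon> y" using z emp_om suc_om by metis
  qed
  moreover have "small (Uni (Img ?F om))" by (rule small_UN[OF d]) (use assms in simp)
  ultimately show ?thesis using small_sub by blast
qed

end

section \<open>The symmetric system\<close>

context forcing
begin

definition mkn :: "'a \<Rightarrow> 'a" where "mkn b = Img (\<lambda>z. Pr z m) b"

lemma mem_mkn: "t \<epsilon> mkn b \<longleftrightarrow> (\<exists>z. z \<epsilon> b \<and> t = Pr z m)"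
  unfolding mkn_def by (rule mem_Img) (intro dfns)

lemma mkn_dfn [dfns]: "dfnt s \<Longrightarrow> dfnt (\<lambda>e. mkn (s e))"
  unfolding mkn_def by (intro dfns)

text \<open>The standard name of an ordered pair: Kuratowski's \<open>Pr\<close> with every element
  attached to the maximum.\<close>

definition op :: "'a \<Rightarrow> 'a \<Rightarrow> 'a" where
  "op x y = mkn (Upr (mkn (Upr x x)) (mkn (Upr x y)))"

lemma op_dfn [dfns]: "dfnt s \<Longrightarrow> dfnt t \<Longrightarrow> dfnt (\<lambda>e. op (s e) (t e))"
  unfolding op_def by (intro dfns)

lemma hn_mkn:
  assumes "dfn (\<lambda>e. S (e 0))" "S (mkn b)" "\<And>z. z \<epsilon> b \<Longrightarrow> hn S z" shows "hn S (mkn b)"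
  by (rule hn_I) (use assms mem_mkn m_P in blast)+

lemma nm_mkn: "(\<And>z. z \<epsilon> b \<Longrightarrow> nm z) \<Longrightarrow> nm (mkn b)"
  by (rule hn_mkn[OF dfn_const]) simp_all

lemma nm_op: "nm x \<Longrightarrow> nm y \<Longrightarrow> nm (op x y)"
  unfolding op_def by (intro nm_mkn) (auto intro!: nm_mkn)

lemma chk_mkn: "chk x = mkn (Img chk x)"
proof -
  have "t \<epsilon> Img chk x \<longleftrightarrow> (\<exists>z. z \<epsilon> x \<and> t = chk z)" for t by (rule mem_Img) (intro dfns)
  then show ?thesis by (intro ext) (auto simp: mem_chk mem_mkn)
qed

end

locale zfc_nat = zfc E for E :: "nat \<Rightarrow> nat \<Rightarrow> bool" (infix "\<epsilon>" 50)
begin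

abbreviation IK :: nat where "IK \<equiv> Times Qc w1"

text \<open>A condition \<open>Pr a b\<close> decides countably many bits of a function on \<open>IK\<close>: those in \<open>a\<close> are 0,
  those in \<open>b\<close> are 1.\<close>

definition isc :: "nat \<Rightarrow> nat \<Rightarrow> bool" where
  "isc a b \<longleftrightarrow> sub a IK \<and> sub b IK \<and> small a \<and> small b \<and> (\<forall>x. x \<epsilon> a \<longrightarrow> \<not> x \<epsilon> b)"

definition CP :: nat where
  "CP = Sep (Times (Pow IK) (Pow IK)) (\<lambda>t. \<exists>a b. t = Pr a b \<and> isc a b)"

definition CL :: nat where
  "CL = Sep (Times CP CP) (\<lambda>t. \<exists>a b a' b'. t = Pr (Pr a b) (Pr a' b') \<and> sub a' a \<and> sub b' b)"

definition cm :: nat where "cm = Pr emp emp"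

lemma isc_dfn [dfns]: "dfnt s \<Longrightarrow> dfnt t \<Longrightarrow> dfn (\<lambda>e. isc (s e) (t e))"
  by (rule dfn2[of isc]; (assumption | (unfold isc_def, intro dfns)))

lemma mem_CP: "t \<epsilon> CP \<longleftrightarrow> (\<exists>a b. t = Pr a b \<and> isc a b)"
proof -
  have "t \<epsilon> CP \<longleftrightarrow> t \<epsilon> Times (Pow IK) (Pow IK) \<and> (\<exists>a b. t = Pr a b \<and> isc a b)"
    unfolding CP_def by (rule mem_Sep) (intro dfns)
  then show ?thesis unfolding isc_def mem_Times mem_Pow by blast
qed

lemma CP_Pr: "Pr a b \<epsilon> CP \<longleftrightarrow> isc a b"
  unfolding mem_CP by simp

lemma mem_CL: "Pr p q \<epsilon> CL \<longleftrightarrow> p \<epsilon> CP \<and> q \<epsilon> CP \<and> (\<exists>a b a' b'. p = Pr a b \<and> q = Pr a' b' \<and> sub a' a \<and> sub b' b)"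
proof -
  have "t \<epsilon> CL \<longleftrightarrow> t \<epsilon> Times CP CP \<and> (\<exists>a b a' b'. t = Pr (Pr a b) (Pr a' b') \<and> sub a' a \<and> sub b' b)" for t
    unfolding CL_def by (rule mem_Sep) (intro dfns)
  then show ?thesis unfolding mem_Times by auto
qed

lemma sub_trans: "sub a b \<Longrightarrow> sub b c \<Longrightarrow> sub a c"
  by (simp add: sub_def)

lemma emp_sub: "sub emp a"
  by (simp add: sub_def)

sublocale forcing E CP CL cm
proof
  show "q \<epsilon> CP \<and> p \<epsilon> CP" if "Pr q p \<epsilon> CL" for p q using that mem_CL by blast
  show "Pr p p \<epsilon> CL" if "p \<epsilon> CP" for p using that mem_CL mem_CP sub_refl by metis
  show "Pr p r \<epsilon> CL" if "Pr p q \<epsilon> CL" "Pr q r \<epsilon> CL" for p q r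
    using that sub_trans unfolding mem_CL by (metis Pr_eq)
  show cm: "cm \<epsilon> CP" unfolding cm_def CP_Pr isc_def using small_emp emp_sub by simp
  show "Pr p cm \<epsilon> CL" if "p \<epsilon> CP" for p using that cm unfolding mem_CL mem_CP[of p] cm_def using emp_sub by blast
qed

section \<open>Bit flips as automorphisms of conditions and names\<close>

definition sd :: "nat \<Rightarrow> nat \<Rightarrow> nat" where "sd D D' = Cup (Dif D D') (Dif D' D)"

lemma mem_sd [simp]: "x \<epsilon> sd D D' \<longleftrightarrow> (x \<epsilon> D) \<noteq> (x \<epsilon> D')"
  unfolding sd_def by auto

lemma sd_comm: "sd D D' = sd D' D" by (rule ext) auto
lemma sd_self: "sd D D = emp" by (rule ext) auto

text \<open>The subsets of \<open>IK\<close>, with symmetric difference \<open>sd\<close>, act on conditions (\<open>flip\<close>) and on names (\<open>act\<close>)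
  by interchanging the bit values 0 and 1 on \<open>D\<close>.\<close>

definition flip :: "nat \<Rightarrow> nat \<Rightarrow> nat" where
  "flip D p = Pr (Cup (Dif (fs p) D) (Itr (sn p) D)) (Cup (Dif (sn p) D) (Itr (fs p) D))"

lemma flip_dfn [dfns]: "dfnt s \<Longrightarrow> dfnt t \<Longrightarrow> dfnt (\<lambda>e. flip (s e) (t e))"
  unfolding flip_def by (intro dfns)

lemma flip_flip: 
  assumes "p \<epsilon> CP" shows "flip D (flip D' p) = flip (sd D D') p"
proof -
  obtain a b where p: "p = Pr a b" using assms mem_CP by blast
  show ?thesis unfolding flip_def p fs_Pr sn_Pr Pr_eq by (intro conjI ext) auto
qed

lemma flip_emp: 
  assumes "p \<epsilon> CP" shows "flip emp p = p"
proof -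
  obtain a b where p: "p = Pr a b" using assms mem_CP by blast
  show ?thesis unfolding flip_def p fs_Pr sn_Pr Pr_eq by (intro conjI ext) auto
qed

lemma flip_inv: "p \<epsilon> CP \<Longrightarrow> flip D (flip D p) = p"
  by (simp add: flip_flip sd_self flip_emp)

lemma flip_cm: "flip D cm = cm"
  unfolding flip_def cm_def fs_Pr sn_Pr Pr_eq by (intro conjI ext) auto

lemma flip_CP:
  assumes "p \<epsilon> CP" shows "flip D p \<epsilon> CP"
proof -
  obtain a b where p: "p = Pr a b" "isc a b" using assms mem_CP by blast
  have "small (Cup a b)" using p(2) small_Cup isc_def by blast
  moreover have "sub (Cup (Dif a D) (Itr b D)) (Cup a b)" "sub (Cup (Dif b D) (Itr a D)) (Cup a b)"
    by (auto simp: sub_def)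
  ultimately have "small (Cup (Dif a D) (Itr b D))" "small (Cup (Dif b D) (Itr a D))" using small_sub by blast+
  moreover have "sub (Cup (Dif a D) (Itr b D)) IK" "sub (Cup (Dif b D) (Itr a D)) IK"
    using p(2) unfolding isc_def sub_def mem_Cup mem_Dif mem_Itr by blast+
  moreover have "\<forall>x. x \<epsilon> Cup (Dif a D) (Itr b D) \<longrightarrow> \<not> x \<epsilon> Cup (Dif b D) (Itr a D)"
    using p(2) unfolding isc_def by auto
  ultimately show ?thesis unfolding flip_def p(1) fs_Pr sn_Pr CP_Pr isc_def by blast
qed

lemma flip_le:
  assumes "le p q" shows "le (flip D p) (flip D q)"
proof -
  obtain a b a' b' where p: "p = Pr a b" "q = Pr a' b'" "sub a' a" "sub b' b" using assms mem_CL by blast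
  have "sub (Cup (Dif a' D) (Itr b' D)) (Cup (Dif a D) (Itr b D))" "sub (Cup (Dif b' D) (Itr a' D)) (Cup (Dif b D) (Itr a D))"
    using p(3,4) unfolding sub_def mem_Cup mem_Dif mem_Itr by blast+
  moreover have "flip D p \<epsilon> CP" "flip D q \<epsilon> CP" using assms L_P flip_CP by blast+
  ultimately show ?thesis unfolding mem_CL unfolding flip_def p(1,2) fs_Pr sn_Pr by blast
qed

lemma flip_le2: "p \<epsilon> CP \<Longrightarrow> le q (flip D p) \<Longrightarrow> le (flip D q) p"
  using flip_le[of q "flip D p" D] by (simp add: flip_inv)

definition act :: "nat \<Rightarrow> nat \<Rightarrow> nat" where
  "act D x = Rec Dom (\<lambda>D x f. Img (\<lambda>t. Pr (App f (fs t)) (flip D (sn t))) x) D x"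

lemma act_H_dfn: "dfnt (\<lambda>e. Img (\<lambda>t. Pr (App (e 2) (fs t)) (flip (e 0) (sn t))) (e 1))"
  by (intro dfns)

lemma act_dfn [dfns]: "dfnt s \<Longrightarrow> dfnt t \<Longrightarrow> dfnt (\<lambda>e. act (s e) (t e))"
  unfolding act_def by (rule Rec_Dom_dfn[OF act_H_dfn])

lemma mem_act:
  assumes "nm x" shows "t \<epsilon> act D x \<longleftrightarrow> (\<exists>z p. Pr z p \<epsilon> x \<and> t = Pr (act D z) (flip D p))"
proof -
  define f where "f = Img (\<lambda>z. Pr z (act D z)) (Dom x)"
  have f: "t \<epsilon> f \<longleftrightarrow> (\<exists>z. z \<epsilon> Dom x \<and> t = Pr z (act D z))" for t
    unfolding f_def by (rule mem_Img) (intro dfns)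
  have App: "App f z = act D z" if "Pr z s \<epsilon> x" for z s
    by (rule App_eq) (use that f in auto)
  have 1: "act D x = Img (\<lambda>t. Pr (App f (fs t)) (flip D (sn t))) x"
    unfolding act_def f_def by (rule Rec_Dom[OF act_H_dfn])
  have 2: "t \<epsilon> act D x \<longleftrightarrow> (\<exists>u. u \<epsilon> x \<and> t = Pr (App f (fs u)) (flip D (sn u)))"
    unfolding 1 by (rule mem_Img) (intro dfns)
  show ?thesis
  proof
    assume "t \<epsilon> act D x"
    then obtain u where u: "u \<epsilon> x" "t = Pr (App f (fs u)) (flip D (sn u))" unfolding 2 by blast
    obtain z p where "u = Pr z p" using hn_elem[OF assms u(1)] by blast
    then show "\<exists>z p. Pr z p \<epsilon> x \<and> t = Pr (act D z) (flip D p)" using u App by auto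
  next
    assume "\<exists>z p. Pr z p \<epsilon> x \<and> t = Pr (act D z) (flip D p)"
    then obtain z p where z: "Pr z p \<epsilon> x" "t = Pr (act D z) (flip D p)" by blast
    then show "t \<epsilon> act D x" unfolding 2 using App[OF z(1)] by (intro exI[of _ "Pr z p"]) simp
  qed
qed

lemma nm_induct:
  assumes "dfn (\<lambda>e. \<phi> (e 0))" "nm x" "\<And>x. nm x \<Longrightarrow> (\<And>z p. Pr z p \<epsilon> x \<Longrightarrow> \<phi> z) \<Longrightarrow> \<phi> x"
  shows "\<phi> x"
  by (rule hn_induct[OF dfn_const assms(1,2)]) (rule assms(3))

lemma nm_act:
  assumes "nm x" shows "nm (act D x)"
proof (rule nm_induct[OF _ assms, of "\<lambda>x. nm (act D x)"])
  fix x assume x: "nm x" and IH: "\<And>z p. Pr z p \<epsilon> x \<Longrightarrow> nm (act D z)"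
  show "nm (act D x)"
  proof (rule hn_I)
    fix t assume "t \<epsilon> act D x"
    then obtain z p where z: "Pr z p \<epsilon> x" "t = Pr (act D z) (flip D p)" using mem_act[OF x] by blast
    then have "p \<epsilon> CP" using hn_Pr[OF x] by blast
    then show "\<exists>z p. nm z \<and> p \<epsilon> CP \<and> t = Pr z p" using IH[OF z(1)] z(2) flip_CP by blast
  qed (auto intro: dfns)
qed (intro dfns)

text \<open>Shows that the acting group is the power set of \<open>IK\<close> under symmetric
  difference. It is commutative and each element is its own inverse.\<close>

lemma act_act:
  assumes "nm x" shows "act D (act D' x) = act (sd D D') x"
proof (rule nm_induct[OF _ assms, of "\<lambda>x. act D (act D' x) = act (sd D D') x"])
  fix x assume x: "nm x" and IH: "\<And>z p. Pr z p \<epsilon> x \<Longrightarrow> act D (act D' z) = act (sd D D') z"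
  show "act D (act D' x) = act (sd D D') x"
  proof (rule ext)
    fix t
    have e: "Pr (act D (act D' z)) (flip D (flip D' p)) = Pr (act (sd D D') z) (flip (sd D D') p)" if "Pr z p \<epsilon> x" for z p
      using IH[OF that] flip_flip hn_Pr[OF x that] by simp
    have "t \<epsilon> act D (act D' x) \<longleftrightarrow> (\<exists>z p. Pr z p \<epsilon> x \<and> t = Pr (act D (act D' z)) (flip D (flip D' p)))"
      unfolding mem_act[OF nm_act[OF x]] mem_act[OF x] by (metis Pr_eq)
    also have "\<dots> \<longleftrightarrow> t \<epsilon> act (sd D D') x" unfolding mem_act[OF x] using e by metis
    finally show "t \<epsilon> act D (act D' x) \<longleftrightarrow> t \<epsilon> act (sd D D') x" .
  qed
qed (intro dfns)

lemma act_emp: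
  assumes "nm x" shows "act emp x = x"
proof (rule nm_induct[OF _ assms, of "\<lambda>x. act emp x = x"])
  fix x assume x: "nm x" and IH: "\<And>z p. Pr z p \<epsilon> x \<Longrightarrow> act emp z = z"
  have e: "Pr (act emp z) (flip emp p) = Pr z p" if "Pr z p \<epsilon> x" for z p
    using IH[OF that] flip_emp hn_Pr[OF x that] by simp
  show "act emp x = x" by (rule ext) (use mem_act[OF x] e hn_elem[OF x] in metis)
qed (intro dfns)

lemma act_inv: "nm x \<Longrightarrow> act D (act D x) = x"
  by (simp add: act_act sd_self act_emp)

lemma act_comm: "nm x \<Longrightarrow> act D (act D' x) = act D' (act D x)"
  by (simp add: act_act sd_comm)

lemma act_mkn:
  assumes "\<And>z. z \<epsilon> b \<Longrightarrow> nm z" shows "act D (mkn b) = mkn (Img (act D) b)"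
proof (rule ext)
  fix t
  have n: "nm (mkn b)" by (rule hn_mkn) (use assms in \<open>auto intro: dfns\<close>)
  have "u \<epsilon> Img (act D) b \<longleftrightarrow> (\<exists>z. z \<epsilon> b \<and> u = act D z)" for u by (rule mem_Img) (intro dfns)
  then show "t \<epsilon> act D (mkn b) \<longleftrightarrow> t \<epsilon> mkn (Img (act D) b)"
    unfolding mem_act[OF n] mem_mkn by (auto simp: flip_cm)
qed

lemma act_chk: "act D (chk x) = chk x"
proof (rule eps_induct[of "\<lambda>x. act D (chk x) = chk x"], intro dfns)
  fix x assume IH: "\<And>y. y \<epsilon> x \<Longrightarrow> act D (chk y) = chk y"
  show "act D (chk x) = chk x"
  proof (rule ext)
    fix t
    have "t \<epsilon> act D (chk x) \<longleftrightarrow> (\<exists>y. y \<epsilon> x \<and> t = Pr (act D (chk y)) (flip D cm))"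
      unfolding mem_act[OF nm_chk] mem_chk Pr_eq by blast
    then show "t \<epsilon> act D (chk x) \<longleftrightarrow> t \<epsilon> chk x" unfolding flip_cm mem_chk using IH by metis
  qed
qed

text \<open>Flips preserve the order of conditions, so the symmetric clause for equality is carried
  along. Conditions below \<open>flip D p\<close> are pulled back below \<open>p\<close> by
  \<open>flip_le2\<close>.\<close>

lemma feq_act:
  assumes "nm x" "nm y" "p \<epsilon> CP" "feq p x y" shows "feq (flip D p) (act D x) (act D y)"
proof -
  have "\<forall>y p. nm y \<longrightarrow> p \<epsilon> CP \<longrightarrow> feq p x y \<longrightarrow> feq (flip D p) (act D x) (act D y)"
  proof (rule nm_induct[OF _ assms(1), of "\<lambda>x. \<forall>y p. nm y \<longrightarrow> p \<epsilon> CP \<longrightarrow> feq p x y \<longrightarrow> feq (flip D p) (act D x) (act D y)"])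
    fix x assume x: "nm x"
      and IH: "\<And>z s. Pr z s \<epsilon> x \<Longrightarrow> \<forall>y p. nm y \<longrightarrow> p \<epsilon> CP \<longrightarrow> feq p z y \<longrightarrow> feq (flip D p) (act D z) (act D y)"
    show "\<forall>y p. nm y \<longrightarrow> p \<epsilon> CP \<longrightarrow> feq p x y \<longrightarrow> feq (flip D p) (act D x) (act D y)"
    proof (intro allI impI)
      fix y p assume y: "nm y" and p: "p \<epsilon> CP" and "feq p x y"
      then have cl: "eq_clause feq p x y" using feq_iff[OF x] by blast
      have IH': "feq (flip D r) (act D z) (act D v)" if "Pr z s \<epsilon> x" "Pr v t \<epsilon> y" "le r u" "feq r z v" for z s v t r u
        using IH[OF that(1)] hn_Pr[OF y that(2)] L_P[OF that(3)] that(4) by blast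
      have "eq_clause feq (flip D p) (act D x) (act D y)"
        unfolding eq_clause_def
      proof (intro conjI allI impI)
        fix z' s' q assume z': "Pr z' s' \<epsilon> act D x" and q: "le q (flip D p)" "le q s'"
        obtain z s where z: "Pr z s \<epsilon> x" "z' = act D z" "s' = flip D s" using z' mem_act[OF x] by auto
        have sP: "s \<epsilon> CP" using hn_Pr[OF x z(1)] by blast
        have "le (flip D q) p" "le (flip D q) s" using flip_le2 p sP q z(3) by blast+
        then obtain r v t where r: "le r (flip D q)" "Pr v t \<epsilon> y" "le r t" "feq r z v"
          using cl z(1) unfolding eq_clause_def by blast
        have "le (flip D r) q" using flip_le2[OF _ r(1)] q(1) L_P by blast
        moreover have "Pr (act D v) (flip D t) \<epsilon> act D y" using r(2) mem_act[OF y] by blast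
        ultimately show "\<exists>r v t. le r q \<and> Pr v t \<epsilon> act D y \<and> le r t \<and> feq r z' v"
          using IH'[OF z(1) r(2,3,4)] flip_le[OF r(3)] z(2) by blast
      next
        fix v' t' q assume v': "Pr v' t' \<epsilon> act D y" and q: "le q (flip D p)" "le q t'"
        obtain v t where v: "Pr v t \<epsilon> y" "v' = act D v" "t' = flip D t" using v' mem_act[OF y] by auto
        have tP: "t \<epsilon> CP" using hn_Pr[OF y v(1)] by blast
        have "le (flip D q) p" "le (flip D q) t" using flip_le2 p tP q v(3) by blast+
        then obtain r z s where r: "le r (flip D q)" "Pr z s \<epsilon> x" "le r s" "feq r z v"
          using cl v(1) unfolding eq_clause_def by blast
        have "le (flip D r) q" using flip_le2[OF _ r(1)] q(1) L_P by blast
        moreover have "Pr (act D z) (flip D s) \<epsilon> act D x" using r(2) mem_act[OF x] by blast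
        ultimately show "\<exists>r z s. le r q \<and> Pr z s \<epsilon> act D x \<and> le r s \<and> feq r z v'"
          using IH'[OF r(2) v(1) r(1) r(4)] flip_le[OF r(3)] v(2) by blast
      qed
      then show "feq (flip D p) (act D x) (act D y)"
        using feq_iff[OF nm_act[OF x] nm_act[OF y] flip_CP[OF p]] by blast
    qed
  qed (intro dfns)
  then show ?thesis using assms by blast
qed

lemma fmem_act:
  assumes "nm x" "nm y" "p \<epsilon> CP" "fmem p x y" shows "fmem (flip D p) (act D x) (act D y)"
  unfolding fmem_iff[OF nm_act[OF assms(1)] nm_act[OF assms(2)] flip_CP[OF assms(3)]]
proof (intro allI impI)
  fix q assume q: "le q (flip D p)"
  have "le (flip D q) p" by (rule flip_le2[OF assms(3) q])
  then obtain r z s where r: "le r (flip D q)" "Pr z s \<epsilon> y" "le r s" "feq r x z"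
    using assms(4) unfolding fmem_iff[OF assms(1-3)] by blast
  have "le (flip D r) q" using flip_le2[OF _ r(1)] q L_P by blast
  moreover have "Pr (act D z) (flip D s) \<epsilon> act D y" using r(2) mem_act[OF assms(2)] by blast
  moreover have "feq (flip D r) (act D x) (act D z)"
    by (rule feq_act[OF assms(1) _ _ r(4)]) (use hn_Pr[OF assms(2) r(2)] L_P[OF r(1)] in blast)+
  ultimately show "\<exists>r. le r q \<and> (\<exists>z s. Pr z s \<epsilon> act D y \<and> le r s \<and> feq r (act D x) z)"
    using flip_le[OF r(3)] by blast
qed

text \<open>\<open>supp e x\<close>: the countable set \<open>e\<close> of columns supports the name \<open>x\<close>.\<close>

definition supp :: "nat \<Rightarrow> nat \<Rightarrow> bool" where
  "supp e x \<longleftrightarrow> (\<forall>D. sub D IK \<longrightarrow> (\<forall>i y. i \<epsilon> e \<longrightarrow> \<not> Pr i y \<epsilon> D) \<longrightarrow> act D x = x)"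

definition S :: "nat \<Rightarrow> bool" where
  "S x \<longleftrightarrow> (\<exists>e. sub e Qc \<and> small e \<and> supp e x)"

lemma supp_dfn [dfns]: "dfnt s \<Longrightarrow> dfnt t \<Longrightarrow> dfn (\<lambda>e. supp (s e) (t e))"
  by (rule dfn2[of supp]; (assumption | (unfold supp_def, intro dfns)))

lemma S_dfn0: "dfn (\<lambda>e. S (e 0))"
  unfolding S_def by (intro dfns)

lemma supp_mono: "supp e x \<Longrightarrow> sub e e' \<Longrightarrow> supp e' x"
  unfolding supp_def sub_def[of e] by blast

section \<open>Closure properties of the hereditarily symmetric names\<close>

lemma supp_mkn:
  assumes n: "\<And>z. z \<epsilon> b \<Longrightarrow> nm z" and s: "\<And>z. z \<epsilon> b \<Longrightarrow> supp e z" shows "supp e (mkn b)"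
  unfolding supp_def
proof (intro allI impI)
  fix D assume D: "sub D IK" "\<forall>i y. i \<epsilon> e \<longrightarrow> \<not> Pr i y \<epsilon> D"
  have a: "act D z = z" if "z \<epsilon> b" for z using s[OF that] D unfolding supp_def by blast
  have "u \<epsilon> Img (act D) b \<longleftrightarrow> (\<exists>z. z \<epsilon> b \<and> u = act D z)" for u by (rule mem_Img) (intro dfns)
  then have "Img (act D) b = b" by (intro ext) (metis a)
  then show "act D (mkn b) = mkn b" using act_mkn[OF n] by simp
qed

lemma hn_S_mkn:
  assumes n: "\<And>z. z \<epsilon> b \<Longrightarrow> hn S z" and e: "sub e Qc" "small e" and s: "\<And>z. z \<epsilon> b \<Longrightarrow> supp e z"
  shows "hn S (mkn b)"
  by (rule hn_mkn[OF S_dfn0 _ n]) (use supp_mkn[OF hn_nm[OF n] s] e S_def in blast)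

lemma supp_chk: "supp e (chk x)"
  unfolding supp_def using act_chk by blast

lemma hn_S_chk: "hn S (chk x)"
proof (rule eps_induct[of "\<lambda>x. hn S (chk x)"])
  show "dfn (\<lambda>e. hn S (chk (e 0)))" by (rule hn_dfn[OF S_dfn0]) (intro dfns)
  fix x assume IH: "\<And>y. y \<epsilon> x \<Longrightarrow> hn S (chk y)"
  have m: "u \<epsilon> Img chk x \<longleftrightarrow> (\<exists>z. z \<epsilon> x \<and> u = chk z)" for u by (rule mem_Img) (intro dfns)
  show "hn S (chk x)" unfolding chk_mkn[of x]
  proof (rule hn_S_mkn[where e = emp])
    show "hn S z" if "z \<epsilon> Img chk x" for z using that IH unfolding m by blast
    show "supp emp z" if "z \<epsilon> Img chk x" for z using that supp_chk unfolding m by blast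
  qed (rule emp_sub, rule small_emp)
qed

text \<open>By commutativity a support of \<open>x\<close> supports \<open>act D x\<close> as well.
  In a general symmetric system this is where normality of the filter would enter.\<close>

lemma hn_S_act:
  assumes "hn S x" shows "hn S (act D x)"
proof (rule hn_induct[OF S_dfn0 _ assms, of "\<lambda>x. hn S (act D x)"])
  show "dfn (\<lambda>e. hn S (act D (e 0)))" by (rule hn_dfn[OF S_dfn0]) (intro dfns)
  fix x assume x: "hn S x" and IH: "\<And>z p. Pr z p \<epsilon> x \<Longrightarrow> hn S (act D z)"
  note n = hn_nm[OF x]
  show "hn S (act D x)"
  proof (rule hn_I[OF S_dfn0])
    obtain e where e: "sub e Qc" "small e" "supp e x" using hn_S[OF x] S_def by blast
    have "supp e (act D x)" unfolding supp_def using e(3) act_comm[OF n] unfolding supp_def by metis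
    then show "S (act D x)" unfolding S_def using e by blast
    fix t assume "t \<epsilon> act D x"
    then obtain z p where z: "Pr z p \<epsilon> x" "t = Pr (act D z) (flip D p)" using mem_act[OF n] by blast
    then show "\<exists>z p. hn S z \<and> p \<epsilon> CP \<and> t = Pr z p" using IH[OF z(1)] flip_CP hn_Pr[OF x z(1)] by blast
  qed
qed

text \<open>The symmetry lemma. Flips are involutions, so the atomic implications
  \<open>feq_act\<close> and \<open>fmem_act\<close> give equivalences, and the class of symmetric
  names over which quantifiers range is invariant by \<open>hn_S_act\<close>.\<close>

lemma fc_act1:
  "(\<forall>i. hn S (e i)) \<Longrightarrow> p \<epsilon> CP \<Longrightarrow> fc (hn S) A p e \<longleftrightarrow> fc (hn S) A (flip D p) (\<lambda>i. act D (e i))"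
proof (induction A arbitrary: e p)
  case (Mem i j)
  have n: "nm (e i)" "nm (e j)" using Mem.prems(1) hn_nm by blast+
  show ?case using fmem_act[OF n Mem.prems(2), of D] fmem_act[OF nm_act[OF n(1), of D] nm_act[OF n(2), of D] flip_CP[OF Mem.prems(2), of D], of D]
    by (auto simp: act_inv[OF n(1)] act_inv[OF n(2)] flip_inv[OF Mem.prems(2)])
next
  case (Eq i j)
  have n: "nm (e i)" "nm (e j)" using Eq.prems(1) hn_nm by blast+
  show ?case using feq_act[OF n Eq.prems(2), of D] feq_act[OF nm_act[OF n(1), of D] nm_act[OF n(2), of D] flip_CP[OF Eq.prems(2), of D], of D]
    by (auto simp: act_inv[OF n(1)] act_inv[OF n(2)] flip_inv[OF Eq.prems(2)])
next
  case (Neg A)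
  have IH: "fc (hn S) A q e \<longleftrightarrow> fc (hn S) A (flip D q) (\<lambda>i. act D (e i))" if "q \<epsilon> CP" for q
    by (rule Neg.IH[OF Neg.prems(1) that])
  show ?case
  proof
    assume f: "fc (hn S) (Neg A) p e"
    have "\<not> fc (hn S) A q (\<lambda>i. act D (e i))" if q: "le q (flip D p)" for q
    proof -
      have qP: "q \<epsilon> CP" using q L_P by blast
      have "\<not> fc (hn S) A (flip D q) e" using f flip_le2[OF Neg.prems(2) q] by simp
      then show ?thesis using IH[OF flip_CP[OF qP, of D]] flip_inv[OF qP] by simp
    qed
    then show "fc (hn S) (Neg A) (flip D p) (\<lambda>i. act D (e i))" by simp
  next
    assume f: "fc (hn S) (Neg A) (flip D p) (\<lambda>i. act D (e i))"
    have "\<not> fc (hn S) A q e" if q: "le q p" for q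
      using f flip_le[OF q, of D] IH[of q] q L_P by auto
    then show "fc (hn S) (Neg A) p e" by simp
  qed
next
  case (And A B)
  then show ?case using And.IH(1)[OF And.prems] And.IH(2)[OF And.prems] by simp
next
  case (All A)
  have IH: "fc (hn S) A p (case_nat x e) \<longleftrightarrow> fc (hn S) A (flip D p) (case_nat (act D x) (\<lambda>i. act D (e i)))"
    if x: "hn S x" for x
  proof -
    have "(\<lambda>i. act D (case_nat x e i)) = case_nat (act D x) (\<lambda>i. act D (e i))" by (auto split: nat.split)
    moreover have "\<forall>i. hn S (case_nat x e i)" using All.prems(1) x by (simp split: nat.split)
    ultimately show ?thesis using All.IH[of "case_nat x e", OF _ All.prems(2)] by metis
  qed
  show ?case
  proof
    assume f: "fc (hn S) (All A) p e"
    have "fc (hn S) A (flip D p) (case_nat x (\<lambda>i. act D (e i)))" if x: "hn S x" for x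
      using IH[OF hn_S_act[OF x, of D]] f hn_S_act[OF x, of D] act_inv[OF hn_nm[OF x]] by simp
    then show "fc (hn S) (All A) (flip D p) (\<lambda>i. act D (e i))" by simp
  next
    assume f: "fc (hn S) (All A) (flip D p) (\<lambda>i. act D (e i))"
    have "fc (hn S) A p (case_nat x e)" if x: "hn S x" for x
      using IH[OF x] f hn_S_act[OF x, of D] by simp
    then show "fc (hn S) (All A) p e" by simp
  qed
qed

lemma S_common:
  fixes n :: nat
  assumes "\<And>i. hn S (f i)" shows "\<exists>e. sub e Qc \<and> small e \<and> (\<forall>i<n. supp e (f i))"
proof (induction n)
  case 0 show ?case using small_emp emp_sub by (intro exI[of _ emp]) simp
next
  case (Suc n)
  then obtain e where e: "sub e Qc" "small e" "\<forall>i<n. supp e (f i)" by blast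
  obtain e' where e': "sub e' Qc" "small e'" "supp e' (f n)" using hn_S[OF assms[of n]] S_def by blast
  have s: "sub e (Cup e e')" "sub e' (Cup e e')" by (auto simp: sub_def)
  have "sub (Cup e e') Qc" using e(1) e'(1) by (simp add: sub_def)
  moreover have "\<forall>i<Suc n. supp (Cup e e') (f i)"
    using e(3) e'(3) supp_mono[OF _ s(1)] supp_mono[OF _ s(2)] by (auto simp: less_Suc_eq)
  ultimately show ?case using small_Cup[OF e(2) e'(2)] by blast
qed

text \<open>The formula has finitely many parameters. A common countable support of these and of
  \<open>B\<close> supports the comprehension, because by the symmetry lemma the flips concerned
  permute its elements.\<close>

lemma S_compn:
  assumes f: "\<And>i. hn S (f i)" and B: "hn S B" shows "S (compn (hn S) A f B)"
proof -
  have hd: "dfn (\<lambda>e. hn S (e 0))" by (rule hn_dfn[OF S_dfn0 dfnt_var])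
  obtain n where n: "bounded_by n A" using bounded_by_ex by blast
  then have n: "bounded_by (Suc n) A" using bounded_by_mono by simp
  \<comment> \<open>The first \<open>Suc n\<close> entries of \<open>case_nat B f\<close> are
    \<open>B\<close> and the parameters below \<open>n\<close>.\<close>
  obtain e where e: "sub e Qc" "small e" "\<forall>i<Suc n. supp e (case_nat B f i)"
  proof -
    define g where "g = case_nat B f"
    have "hn S (g i)" for i using f B unfolding g_def by (cases i) auto
    then have "\<exists>e. sub e Qc \<and> small e \<and> (\<forall>i<Suc n. supp e (g i))" by (rule S_common)
    then show thesis unfolding g_def by (elim exE conjE) (rule that)
  qed
  let ?b = "compn (hn S) A f B"
  have b: "t \<epsilon> ?b \<longleftrightarrow> (\<exists>z p. t = Pr z p \<and> z \<epsilon> Dom B \<and> p \<epsilon> CP \<and> fc (hn S) A p (case_nat z f))" for t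
    by (rule mem_compn[OF hd])
  have nb: "nm ?b"
  proof (rule hn_I[OF dfn_const])
    show "\<exists>z p. nm z \<and> p \<epsilon> CP \<and> t = Pr z p" if "t \<epsilon> ?b" for t using that b hn_Dom[OF hn_nm[OF B]] by blast
  qed simp
  have "act D ?b = ?b" if D: "sub D IK" "\<forall>i y. i \<epsilon> e \<longrightarrow> \<not> Pr i y \<epsilon> D" for D
  proof -
    have fix1: "act D B = B" "\<And>i. i < n \<Longrightarrow> act D (f i) = f i" using e(3) D unfolding supp_def by force+
    have 1: "Pr (act D z) (flip D p) \<epsilon> ?b" if zp: "Pr z p \<epsilon> ?b" for z p
    proof -
      have z: "z \<epsilon> Dom B" "p \<epsilon> CP" "fc (hn S) A p (case_nat z f)" using zp b by auto
      then obtain s where "Pr z s \<epsilon> B" by auto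
      then have "Pr (act D z) (flip D s) \<epsilon> act D B" using mem_act[OF hn_nm[OF B]] by blast
      then have dz: "act D z \<epsilon> Dom B" unfolding fix1(1) by auto
      have "\<forall>i. hn S (case_nat z f i)" using f hn_Dom[OF B z(1)] by (simp split: nat.split)
      then have "fc (hn S) A (flip D p) (\<lambda>i. act D (case_nat z f i))" using fc_act1 z(2,3) by blast
      moreover have "fc (hn S) A (flip D p) (\<lambda>i. act D (case_nat z f i)) = fc (hn S) A (flip D p) (case_nat (act D z) f)"
        by (rule fc_cong[OF n]) (use fix1(2) in \<open>auto split: nat.split\<close>)
      ultimately show ?thesis using b dz flip_CP[OF z(2)] by blast
    qed
    have 2: "Pr z p = Pr (act D (act D z)) (flip D (flip D p))" if "Pr z p \<epsilon> ?b" for z p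
      using act_inv flip_inv hn_Pr[OF nb that] by simp
    show ?thesis
    proof (rule ext)
      fix t
      show "t \<epsilon> act D ?b \<longleftrightarrow> t \<epsilon> ?b"
      proof
        assume "t \<epsilon> act D ?b" then show "t \<epsilon> ?b" unfolding mem_act[OF nb] using 1 by blast
      next
        assume "t \<epsilon> ?b"
        then obtain z p where t: "Pr z p \<epsilon> ?b" "t = Pr z p" using b by blast
        then show "t \<epsilon> act D ?b" unfolding mem_act[OF nb] using 1[OF t(1)] 2[OF t(1)] by blast
      qed
    qed
  qed
  then show ?thesis unfolding S_def supp_def using e(1,2) by blast
qed

text \<open>A set of symmetric names need not have a common countable support. Closing it under the
  whole group produces a set fixed by every flip, hence a name with empty support.\<close>

lemma S_univ:
  assumes b: "\<And>x. x \<epsilon> b \<Longrightarrow> hn S x" shows "\<exists>B. hn S B \<and> (\<forall>x. x \<epsilon> b \<longrightarrow> Pr x cm \<epsilon> B)"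
proof -
  define c where "c = Img (\<lambda>t. act (fs t) (sn t)) (Times (Pow IK) b)"
  have c0: "z \<epsilon> c \<longleftrightarrow> (\<exists>t. t \<epsilon> Times (Pow IK) b \<and> z = act (fs t) (sn t))" for z
    unfolding c_def by (rule mem_Img) (intro dfns)
  have c: "z \<epsilon> c \<longleftrightarrow> (\<exists>D x. sub D IK \<and> x \<epsilon> b \<and> z = act D x)" for z
  proof
    assume "z \<epsilon> c"
    then obtain D x where "sub D IK" "x \<epsilon> b" "z = act (fs (Pr D x)) (sn (Pr D x))" unfolding c0 mem_Times mem_Pow by blast
    then show "\<exists>D x. sub D IK \<and> x \<epsilon> b \<and> z = act D x" by auto
  next
    assume "\<exists>D x. sub D IK \<and> x \<epsilon> b \<and> z = act D x"
    then obtain D x where x: "sub D IK" "x \<epsilon> b" "z = act D x" by blast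
    have "Pr D x \<epsilon> Times (Pow IK) b \<and> z = act (fs (Pr D x)) (sn (Pr D x))" using x by simp
    then show "z \<epsilon> c" unfolding c0 by blast
  qed
  have cS: "hn S z" if z: "z \<epsilon> c" for z
  proof -
    obtain D x where "x \<epsilon> b" "z = act D x" using z c by blast
    then show ?thesis using hn_S_act[OF b] by simp
  qed
  have "S (mkn c)"
  proof -
    have "act D (mkn c) = mkn c" if D: "sub D IK" for D
    proof -
      have m: "u \<epsilon> Img (act D) c \<longleftrightarrow> (\<exists>z. z \<epsilon> c \<and> u = act D z)" for u by (rule mem_Img) (intro dfns)
      have 1: "act D z \<epsilon> c" if z: "z \<epsilon> c" for z
      proof -
        obtain D' x where x: "sub D' IK" "x \<epsilon> b" "z = act D' x" using z c by blast
        have "act D z = act (sd D D') x" using x(3) act_act hn_nm[OF b[OF x(2)]] by simp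
        moreover have "sub (sd D D') IK" using D x(1) unfolding sub_def mem_sd by blast
        ultimately show ?thesis using c x(2) by blast
      qed
      have "Img (act D) c = c"
      proof (rule ext)
        fix u show "u \<epsilon> Img (act D) c \<longleftrightarrow> u \<epsilon> c"
          unfolding m using 1 act_inv[OF hn_nm[OF cS]] by metis
      qed
      then show ?thesis using act_mkn[OF hn_nm[OF cS]] by simp
    qed
    then show ?thesis unfolding S_def supp_def using small_emp emp_sub by blast
  qed
  then have "hn S (mkn c)" using hn_mkn[OF S_dfn0 _ cS] by blast
  moreover have "Pr x cm \<epsilon> mkn c" if x: "x \<epsilon> b" for x
  proof -
    have "x = act emp x" using act_emp[OF hn_nm[OF b[OF x]]] by simp
    then have "x \<epsilon> c" using c emp_sub x by blast
    then show ?thesis using mem_mkn by blast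
  qed
  ultimately show ?thesis by blast
qed

sublocale sforcing E CP CL cm S
  by standard (use S_dfn0 S_compn S_univ hn_S_chk in blast)+

end

section \<open>Meaning of the set-theoretic formulas\<close>

context zf
begin

lemma Upr_iff: "(\<forall>z. z \<epsilon> u \<longleftrightarrow> z = x \<or> z = y) \<longleftrightarrow> u = Upr x y"
  using ext[of u "Upr x y"] mem_Upr by metis

lemma emp_iff: "(\<forall>z. \<not> z \<epsilon> x) \<longleftrightarrow> x = emp"
  using empI mem_emp by metis

lemma suc_iff: "(\<forall>z. z \<epsilon> s \<longleftrightarrow> z \<epsilon> x \<or> z = x) \<longleftrightarrow> s = suc x"
  using ext[of s "suc x"] mem_suc by metis

text \<open>Used to recognise the image of the ground model's \<open>om\<close> in an extension. A
  minimal element outside \<open>om\<close> would be the successor of an element of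
  \<open>om\<close>.\<close>

lemma om_char:
  assumes "inductv w" "\<And>x. x \<epsilon> w \<Longrightarrow> x = emp \<or> (\<exists>y. y \<epsilon> w \<and> x = suc y)" shows "w = om"
proof (rule ext)
  fix x
  have "\<not> (\<exists>x. x \<epsilon> Dif w om)"
  proof
    assume "\<exists>x. x \<epsilon> Dif w om"
    then obtain x where x: "x \<epsilon> w" "\<not> x \<epsilon> om" and min: "\<And>z. z \<epsilon> x \<Longrightarrow> \<not> (z \<epsilon> w \<and> \<not> z \<epsilon> om)"
      using wf_mem[of "Dif w om"] unfolding mem_Dif by blast
    then obtain y where y: "y \<epsilon> w" "x = suc y" using assms(2) emp_om by metis
    then have "y \<epsilon> om" using min by simp
    then show False using x(2) y(2) by simp
  qed
  then show "x \<epsilon> w \<longleftrightarrow> x \<epsilon> om" using assms(1) mem_om by auto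
qed

definition isrel :: "'a \<Rightarrow> 'a \<Rightarrow> 'a \<Rightarrow> bool" where
  "isrel R A B \<longleftrightarrow> (\<forall>t. t \<epsilon> R \<longrightarrow> (\<exists>x y. x \<epsilon> A \<and> y \<epsilon> B \<and> t = Pr x y))"
definition isfun :: "'a \<Rightarrow> 'a \<Rightarrow> 'a \<Rightarrow> bool" where
  "isfun f A B \<longleftrightarrow> isrel f A B \<and> (\<forall>x. x \<epsilon> A \<longrightarrow> (\<exists>y. Pr x y \<epsilon> f \<and> (\<forall>z. Pr x z \<epsilon> f \<longrightarrow> z = y)))"
definition isinj :: "'a \<Rightarrow> 'a \<Rightarrow> 'a \<Rightarrow> bool" where
  "isinj f A B \<longleftrightarrow> isfun f A B \<and> (\<forall>x y z. Pr x z \<epsilon> f \<and> Pr y z \<epsilon> f \<longrightarrow> x = y)"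
definition isbij :: "'a \<Rightarrow> 'a \<Rightarrow> 'a \<Rightarrow> bool" where
  "isbij f A B \<longleftrightarrow> isinj f A B \<and> (\<forall>y. y \<epsilon> B \<longrightarrow> (\<exists>x. Pr x y \<epsilon> f))"
definition iscard :: "'a \<Rightarrow> bool" where
  "iscard k \<longleftrightarrow> ordn k \<and> (\<forall>a. a \<epsilon> k \<longrightarrow> \<not> (\<exists>f. isbij f a k))"

lemma tv_subset [simp]: "x < d \<Longrightarrow> y < d \<Longrightarrow> tv E z v d (x \<^bold>\<subseteq> y) \<longleftrightarrow> sub (v x) (v y)"
  by (simp add: subset_def sub_def)
lemma tv_is_empty [simp]: "x < d \<Longrightarrow> tv E z v d (is_empty x) \<longleftrightarrow> v x = emp"
  by (simp add: is_empty_def emp_iff)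
lemma tv_is_succ [simp]: "x < d \<Longrightarrow> s < d \<Longrightarrow> tv E z v d (is_succ s x) \<longleftrightarrow> v s = suc (v x)"
  by (simp add: is_succ_def suc_iff)
lemma tv_is_upair [simp]: "u < d \<Longrightarrow> x < d \<Longrightarrow> y < d \<Longrightarrow> tv E z v d (is_upair u x y) \<longleftrightarrow> v u = Upr (v x) (v y)"
  by (simp add: is_upair_def Upr_iff)
lemma tv_is_pair [simp]: "t < d \<Longrightarrow> x < d \<Longrightarrow> y < d \<Longrightarrow> tv E z v d (is_pair t x y) \<longleftrightarrow> v t = Pr (v x) (v y)"
  by (simp add: is_pair_def Pr_def)
lemma tv_pair_in [simp]: "x < d \<Longrightarrow> y < d \<Longrightarrow> R < d \<Longrightarrow> tv E z v d (pair_in x y R) \<longleftrightarrow> Pr (v x) (v y) \<epsilon> v R"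
  by (simp add: pair_in_def)
lemma tv_triple_in [simp]: "x < d \<Longrightarrow> y < d \<Longrightarrow> u < d \<Longrightarrow> R < d \<Longrightarrow>
  tv E z v d (triple_in x y u R) \<longleftrightarrow> Pr (v x) (Pr (v y) (v u)) \<epsilon> v R"
  by (simp add: triple_in_def)
lemma tv_is_relation [simp]: "R < d \<Longrightarrow> A < d \<Longrightarrow> B < d \<Longrightarrow> tv E z v d (is_relation R A B) \<longleftrightarrow> isrel (v R) (v A) (v B)"
  by (simp add: is_relation_def isrel_def)
lemma tv_is_function [simp]: "f < d \<Longrightarrow> A < d \<Longrightarrow> B < d \<Longrightarrow> tv E z v d (is_function f A B) \<longleftrightarrow> isfun (v f) (v A) (v B)"
  by (simp add: is_function_def isfun_def)
lemma tv_is_injection [simp]: "f < d \<Longrightarrow> A < d \<Longrightarrow> B < d \<Longrightarrow> tv E z v d (is_injection f A B) \<longleftrightarrow> isinj (v f) (v A) (v B)"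
  by (simp add: is_injection_def isinj_def)
lemma tv_is_bijection [simp]: "f < d \<Longrightarrow> A < d \<Longrightarrow> B < d \<Longrightarrow> tv E z v d (is_bijection f A B) \<longleftrightarrow> isbij (v f) (v A) (v B)"
  by (simp add: is_bijection_def isbij_def)
lemma tv_is_inductive [simp]: "I < d \<Longrightarrow> tv E z v d (is_inductive I) \<longleftrightarrow> inductv (v I)"
  by (simp add: is_inductive_def inductv_def)
lemma tv_is_omega [simp]: "w < d \<Longrightarrow> tv E z v d (is_omega w) \<longleftrightarrow> v w = om"
proof -
  assume "w < d"
  then have "tv E z v d (is_omega w) \<longleftrightarrow> (\<forall>x. x \<epsilon> v w \<longleftrightarrow> x \<epsilon> om)"
    by (simp add: is_omega_def mem_om)
  then show ?thesis using ext[of "v w" om] by auto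
qed
lemma tv_countable_set [simp]: "A < d \<Longrightarrow> tv E z v d (countable_set A) \<longleftrightarrow> (\<exists>f. isinj f (v A) om)"
  by (simp add: countable_set_def)
lemma tv_transitive_set [simp]: "x < d \<Longrightarrow> tv E z v d (transitive_set x) \<longleftrightarrow> trans_set (v x)"
  by (simp add: transitive_set_def trans_set_def)
lemma tv_ordinal [simp]: "x < d \<Longrightarrow> tv E z v d (ordinal x) \<longleftrightarrow> ordn (v x)"
  by (simp add: ordinal_def ordn_def)
lemma tv_cardinal [simp]: "k < d \<Longrightarrow> tv E z v d (cardinal k) \<longleftrightarrow> iscard (v k)"
  by (simp add: cardinal_def iscard_def)
lemma tv_aleph [simp]: "k < d \<Longrightarrow> tv E z v d (aleph k) \<longleftrightarrow> iscard (v k) \<and> sub om (v k)"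
  by (simp add: aleph_def)

section \<open>Choice and dependent choice as properties of a model\<close>

lemma zfc_if_choice:
  assumes "sat E z choice" shows "zfc E"
proof
  fix A assume ne: "\<And>a. a \<epsilon> A \<Longrightarrow> \<exists>y. y \<epsilon> a"
  have c: "\<forall>A. (\<forall>a. a \<epsilon> A \<longrightarrow> a \<noteq> emp) \<longrightarrow> (\<exists>U f. isfun f A U \<and> (\<forall>a y. Pr a y \<epsilon> f \<longrightarrow> y \<epsilon> a))"
    using assms unfolding choice_def sat_0[where v = z] by simp
  have "\<forall>a. a \<epsilon> A \<longrightarrow> a \<noteq> emp" using ne mem_emp by metis
  then obtain U f where "isfun f A U" "\<forall>a y. Pr a y \<epsilon> f \<longrightarrow> y \<epsilon> a" using c by blast
  then show "\<exists>f. (\<forall>a y. Pr a y \<epsilon> f \<longrightarrow> y \<epsilon> a) \<and> (\<forall>a. a \<epsilon> A \<longrightarrow> (\<exists>y. Pr a y \<epsilon> f \<and> (\<forall>z. Pr a z \<epsilon> f \<longrightarrow> z = y)))"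
    unfolding isfun_def by blast
qed

definition dc_seq :: "'a \<Rightarrow> 'a \<Rightarrow> bool" where
  "dc_seq X R \<longleftrightarrow> (\<exists>f. isfun f om X \<and> (\<forall>n x y. Pr n x \<epsilon> f \<and> Pr (suc n) y \<epsilon> f \<longrightarrow> Pr x y \<epsilon> R))"

text \<open>The conclusion of dependent choice with free variables: level 0, of index 1, is the set
  and level 1, of index 0, the relation. It is kept as a formula so that it can be forced.\<close>

definition dc_fm :: fm where
  "dc_fm = (\<^bold>\<exists>w. \<^bold>\<exists>f. is_omega w \<^bold>\<and> is_function f w 0 \<^bold>\<and>
     (\<^bold>\<forall>n. \<^bold>\<forall>s. \<^bold>\<forall>x. \<^bold>\<forall>y. is_succ s n \<^bold>\<and> pair_in n x f \<^bold>\<and> pair_in s y f \<^bold>\<longrightarrow> pair_in x y 1)) 2"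

lemma sat_2: "sat E e (F 2) \<longleftrightarrow> tv E (\<lambda>i. e (Suc (Suc i))) (\<lambda>i. if i = 0 then e 1 else e 0) 2 F"
proof -
  have "env (\<lambda>i. e (Suc (Suc i))) (\<lambda>i. if i = 0 then e 1 else e 0) 2 = e"
  proof
    fix i show "env (\<lambda>i. e (Suc (Suc i))) (\<lambda>i. if i = 0 then e 1 else e 0) 2 i = e i"
      by (cases i; cases "i - 1") (auto simp: env_def)
  qed
  then show ?thesis by (simp add: tv_def)
qed

lemma sat_dc_fm: "sat E e dc_fm \<longleftrightarrow> dc_seq (e 1) (e 0)"
  unfolding dc_fm_def sat_2 dc_seq_def by simp

lemma sat_dependent_choice:
  "sat E z dependent_choice \<longleftrightarrow> (\<forall>X R. X \<noteq> emp \<and> (\<forall>x. x \<epsilon> X \<longrightarrow> (\<exists>y. y \<epsilon> X \<and> Pr x y \<epsilon> R)) \<longrightarrow> dc_seq X R)"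
  unfolding dependent_choice_def sat_0[where v = z] dc_seq_def by simp

end

context forcing
begin

lemma tv_name_system [simp]: "P' < d \<Longrightarrow> T < d \<Longrightarrow> v P' = P \<Longrightarrow> tv E z v d (name_system P' T) \<longleftrightarrow> ns (v T)"
  by (simp add: name_system_def nsys_def isrel_def)

lemma tv_is_name [simp]: "P' < d \<Longrightarrow> x < d \<Longrightarrow> v P' = P \<Longrightarrow> tv E z v d (is_name P' x) \<longleftrightarrow> nm (v x)"
  by (simp add: is_name_def hn_def)

lemma tv_in_dom [simp]: "u < d \<Longrightarrow> x < d \<Longrightarrow> tv E z v d (in_dom u x) \<longleftrightarrow> (\<exists>s. Pr (v u) s \<epsilon> v x)"
  by (simp add: in_dom_def)

lemma tv_afs [simp]: "P' < d \<Longrightarrow> L' < d \<Longrightarrow> T < d \<Longrightarrow> E' < d \<Longrightarrow> M < d \<Longrightarrow> v P' = P \<Longrightarrow> v L' = L \<Longrightarrow>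
  tv E z v d (atomic_forcing_system P' L' T E' M) \<longleftrightarrow> afs (v T) (v E') (v M)"
  by (simp add: atomic_forcing_system_def afs_def)

lemma tv_forces_eq [simp]: "P' < d \<Longrightarrow> L' < d \<Longrightarrow> p < d \<Longrightarrow> x < d \<Longrightarrow> y < d \<Longrightarrow> v P' = P \<Longrightarrow> v L' = L \<Longrightarrow>
  tv E z v d (forces_eq P' L' p x y) \<longleftrightarrow> feq (v p) (v x) (v y)"
  by (simp add: forces_eq_def feq_def)

lemma tv_forces_mem [simp]: "P' < d \<Longrightarrow> L' < d \<Longrightarrow> p < d \<Longrightarrow> x < d \<Longrightarrow> y < d \<Longrightarrow> v P' = P \<Longrightarrow> v L' = L \<Longrightarrow>
  tv E z v d (forces_mem P' L' p x y) \<longleftrightarrow> fmem (v p) (v x) (v y)"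
  by (simp add: forces_mem_def fmem_def)

text \<open>Carries the results on \<open>fc\<close> back to the formula in the definition of
  collapsing. The class is \<open>nm\<close>, since the official quantifier clause ranges over all
  names.\<close>

lemma tv_forces:
  "P' < d \<Longrightarrow> L' < d \<Longrightarrow> p < d \<Longrightarrow> (\<forall>i. \<rho> i < d) \<Longrightarrow> v P' = P \<Longrightarrow> v L' = L \<Longrightarrow>
   tv E z v d (forces A P' L' p \<rho>) \<longleftrightarrow> fc nm A (v p) (\<lambda>i. v (\<rho> i))"
proof (induction A arbitrary: d v p \<rho>)
  case (Neg A)
  have e: "(\<lambda>i. (v(d := a)) (\<rho> i)) = (\<lambda>i. v (\<rho> i))" for a
    using Neg.prems(4) by (intro HOL.ext) (metis fun_upd_other less_irrefl)
  have "tv E z (v(d := a)) (Suc d) (forces A P' L' d \<rho>) \<longleftrightarrow> fc nm A a (\<lambda>i. v (\<rho> i))" for a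
  proof -
    have "tv E z (v(d := a)) (Suc d) (forces A P' L' d \<rho>) \<longleftrightarrow> fc nm A ((v(d := a)) d) (\<lambda>i. (v(d := a)) (\<rho> i))"
      by (rule Neg.IH) (use Neg.prems in \<open>simp_all add: less_SucI\<close>)
    then show ?thesis unfolding e by simp
  qed
  then show ?case using Neg.prems by simp
next
  case (And A B)
  have "tv E z v d (forces A P' L' p \<rho>) \<longleftrightarrow> fc nm A (v p) (\<lambda>i. v (\<rho> i))" by (rule And.IH(1)) (fact And.prems)+
  moreover have "tv E z v d (forces B P' L' p \<rho>) \<longleftrightarrow> fc nm B (v p) (\<lambda>i. v (\<rho> i))" by (rule And.IH(2)) (fact And.prems)+
  ultimately show ?case by simp
next
  case (All A)
  have e: "(\<lambda>i. (v(d := a)) (case_nat d \<rho> i)) = case_nat a (\<lambda>i. v (\<rho> i))" for a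
  proof
    fix i show "(v(d := a)) (case_nat d \<rho> i) = case_nat a (\<lambda>i. v (\<rho> i)) i"
      using All.prems(4) by (cases i) (auto simp: less_imp_neq)
  qed
  have r: "\<forall>i. case_nat d \<rho> i < Suc d" using All.prems(4) by (auto simp: less_SucI split: nat.split)
  have "tv E z (v(d := a)) (Suc d) (forces A P' L' p (case_nat d \<rho>)) \<longleftrightarrow> fc nm A (v p) (case_nat a (\<lambda>i. v (\<rho> i)))" for a
  proof -
    have "tv E z (v(d := a)) (Suc d) (forces A P' L' p (case_nat d \<rho>)) \<longleftrightarrow>
        fc nm A ((v(d := a)) p) (\<lambda>i. (v(d := a)) (case_nat d \<rho> i))"
      by (rule All.IH[OF _ _ _ r]) (use All.prems in \<open>simp_all add: less_SucI\<close>)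
    then show ?thesis unfolding e using All.prems(3) by simp
  qed
  then show ?case using All.prems by simp
qed simp_all

lemma check_name_ex:
  "\<exists>D R F. trans_set D \<and> k \<epsilon> D \<and> isfun F D R \<and>
    (\<forall>y d. Pr y d \<epsilon> F \<longrightarrow> (\<forall>t. t \<epsilon> d \<longleftrightarrow> (\<exists>z e. z \<epsilon> y \<and> Pr z e \<epsilon> F \<and> t = Pr e m))) \<and> Pr k (chk k) \<epsilon> F"
proof -
  obtain D where D: "trans_set D" "k \<epsilon> D" using transitive_superset by blast
  define F where "F = Img (\<lambda>y. Pr y (chk y)) D"
  have F: "t \<epsilon> F \<longleftrightarrow> (\<exists>y. y \<epsilon> D \<and> t = Pr y (chk y))" for t unfolding F_def by (rule mem_Img) (intro dfns)
  have R: "u \<epsilon> Img chk D \<longleftrightarrow> (\<exists>y. y \<epsilon> D \<and> u = chk y)" for u by (rule mem_Img) (intro dfns)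
  have "isfun F D (Img chk D)" unfolding isfun_def isrel_def F R by auto
  moreover have "t \<epsilon> d \<longleftrightarrow> (\<exists>z e. z \<epsilon> y \<and> Pr z e \<epsilon> F \<and> t = Pr e m)" if "Pr y d \<epsilon> F" for y d t
  proof -
    have y: "y \<epsilon> D" "d = chk y" using that F by auto
    have "z \<epsilon> D" if "z \<epsilon> y" for z using D(1) y(1) that unfolding trans_set_def sub_def by blast
    then show ?thesis unfolding y(2) mem_chk F by auto
  qed
  moreover have "Pr k (chk k) \<epsilon> F" using F D(2) by blast
  ultimately show ?thesis using D by blast
qed

end

lemma sat_1: "sat E (\<lambda>_. a) (F 1) \<longleftrightarrow> tv E (\<lambda>_. a) (\<lambda>_. a) 1 F"
proof -
  have "env (\<lambda>_. a) (\<lambda>_. a) 1 = (\<lambda>_. a)" by (auto simp: env_def)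
  then show ?thesis by (simp add: tv_def)
qed

context gext
begin

section \<open>Pairs, canonical names and countability in a generic extension\<close>

lemma h_mkn: "C (mkn b) \<Longrightarrow> E' a (h (mkn b)) \<longleftrightarrow> (\<exists>z. z \<epsilon> b \<and> a = h z)"
  unfolding mem_h mem_mkn using G_m by auto

lemma hn_op:
  assumes "C (op x y)"
  shows "C (mkn (Upr x x))" "C (mkn (Upr x y))" "C x" "C y"
proof -
  have "Pr (mkn (Upr x x)) m \<epsilon> op x y" "Pr (mkn (Upr x y)) m \<epsilon> op x y" unfolding op_def mem_mkn by auto
  then show 1: "C (mkn (Upr x x))" "C (mkn (Upr x y))" using hn_Pr[OF assms] by blast+
  have "Pr x m \<epsilon> mkn (Upr x y)" "Pr y m \<epsilon> mkn (Upr x y)" unfolding mem_mkn by auto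
  then show "C x" "C y" using hn_Pr[OF 1(2)] by blast+
qed

lemma h_op:
  assumes "C (op x y)" shows "h (op x y) = N.Pr (h x) (h y)"
proof -
  have u: "h (mkn (Upr a b)) = N.Upr (h a) (h b)" if "C (mkn (Upr a b))" for a b
    by (rule h_ext) (auto simp: h_mkn[OF that])
  show ?thesis unfolding op_def N.Pr_def u[OF assms[unfolded op_def]] u[OF hn_op(1)[OF assms]] u[OF hn_op(2)[OF assms]] ..
qed

lemma j_emp: "j emp = N.emp"
  by (rule h_ext) (simp add: j_mem)

lemma j_suc: "j (suc x) = N.suc (j x)"
  by (rule h_ext) (auto simp: j_mem)

lemma j_Pr: "j (Pr x y) = N.Pr (j x) (j y)"
proof -
  have "j (Upr a b) = N.Upr (j a) (j b)" for a b by (rule h_ext) (auto simp: j_mem)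
  then show ?thesis unfolding Pr_def N.Pr_def by simp
qed

lemma j_Pr_mem: "E' (N.Pr (j x) (j y)) (j f) \<longleftrightarrow> Pr x y \<epsilon> f"
  unfolding j_Pr[symmetric] j_mem by (simp add: j_inj)

lemma j_mem_j: "E' (j x) (j y) \<longleftrightarrow> x \<epsilon> y"
  unfolding j_mem by (simp add: j_inj)

lemma j_om: "j om = N.om"
proof (rule N.om_char)
  have "E' N.emp (j om)" unfolding j_emp[symmetric] j_mem_j by (rule emp_om)
  moreover have "E' (N.suc x) (j om)" if "E' x (j om)" for x
  proof -
    obtain n where n: "n \<epsilon> om" "x = j n" using \<open>E' x (j om)\<close> j_mem by blast
    show ?thesis unfolding n(2) j_suc[symmetric] j_mem_j by (rule suc_om[OF n(1)])
  qed
  ultimately show "N.inductv (j om)" unfolding N.inductv_def by blast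
  fix x assume "E' x (j om)"
  then obtain n where n: "n \<epsilon> om" "x = j n" using j_mem by blast
  then show "x = N.emp \<or> (\<exists>y. E' y (j om) \<and> x = N.suc y)"
    using om_cases[OF n(1)] j_emp j_suc j_mem_j by metis
qed

lemma j_small: 
  assumes "small a" shows "N.small (j a)"
proof -
  obtain f where f: "fun1 f" "\<And>x. x \<epsilon> a \<Longrightarrow> \<exists>n. n \<epsilon> om \<and> Pr n x \<epsilon> f" using assms unfolding small_def by blast
  define g where "g = Itr f (Times om a)"
  have g: "Pr n x \<epsilon> g \<longleftrightarrow> Pr n x \<epsilon> f \<and> n \<epsilon> om \<and> x \<epsilon> a" for n x unfolding g_def by auto
  have gj: "\<exists>n x. u = j n \<and> w = j x \<and> Pr n x \<epsilon> g" if uw: "E' (N.Pr u w) (j g)" for u w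
  proof -
    obtain t where t: "t \<epsilon> g" "N.Pr u w = j t" using uw j_mem by blast
    then obtain n x where n: "t = Pr n x" unfolding g_def by auto
    then have "u = j n \<and> w = j x" using t(2) j_Pr by simp
    then show ?thesis using t(1) n by blast
  qed
  have "N.fun1 (j g)" unfolding N.fun1_def
  proof (intro allI impI)
    fix u x y assume "E' (N.Pr u x) (j g)" "E' (N.Pr u y) (j g)"
    then obtain n x' n' y' where *: "u = j n" "x = j x'" "Pr n x' \<epsilon> g" "u = j n'" "y = j y'" "Pr n' y' \<epsilon> g" using gj by blast
    then have "n = n'" using j_inj by metis
    then show "x = y" using * f(1) unfolding g fun1_def by blast
  qed
  moreover have "\<exists>n. E' n N.om \<and> E' (N.Pr n x) (j g)" if x: "E' x (j a)" for x
  proof -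
    obtain x' where x': "x' \<epsilon> a" "x = j x'" using x j_mem by blast
    then obtain n where "n \<epsilon> om" "Pr n x' \<epsilon> g" using f(2) g by blast
    then have "E' (j n) N.om \<and> E' (N.Pr (j n) x) (j g)" unfolding x'(2) j_om[symmetric] j_mem_j j_Pr_mem by blast
    then show ?thesis by blast
  qed
  ultimately show ?thesis unfolding N.small_def by blast
qed

lemma j_trans: 
  assumes "trans_set a" shows "N.trans_set (j a)"
  unfolding N.trans_set_def N.sub_def
proof (intro allI impI)
  fix y z assume "E' y (j a)" "E' z y"
  then obtain y' z' where "y' \<epsilon> a" "z' \<epsilon> y'" "z = j z'" using j_mem by metis
  then show "E' z (j a)" using assms j_mem_j unfolding trans_set_def sub_def by blast
qed

lemma j_ordn:
  assumes "ordn a" shows "N.ordn (j a)"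
  unfolding N.ordn_def
proof (intro conjI allI impI)
  show "N.trans_set (j a)" using assms j_trans ordn_def by blast
  fix y assume "E' y (j a)"
  then obtain y' where "y' \<epsilon> a" "y = j y'" using j_mem by blast
  then show "N.trans_set y" using assms j_trans ordn_def by blast
qed

end

section \<open>The choiceless model\<close>

context zfc_nat
begin

lemma CP_iff: "p \<epsilon> CP \<longleftrightarrow> p = Pr (fs p) (sn p) \<and> isc (fs p) (sn p)"
proof
  assume "p \<epsilon> CP"
  then obtain a b where "p = Pr a b" "isc a b" using mem_CP by blast
  then show "p = Pr (fs p) (sn p) \<and> isc (fs p) (sn p)" by simp
next
  assume "p = Pr (fs p) (sn p) \<and> isc (fs p) (sn p)"
  then show "p \<epsilon> CP" unfolding mem_CP by blast
qed

lemma le_iff: "le p q \<longleftrightarrow> p \<epsilon> CP \<and> q \<epsilon> CP \<and> sub (fs q) (fs p) \<and> sub (sn q) (sn p)"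
proof
  assume "le p q"
  then obtain a b a' b' where "p \<epsilon> CP" "q \<epsilon> CP" "p = Pr a b" "q = Pr a' b'" "sub a' a" "sub b' b" using mem_CL by blast
  then show "p \<epsilon> CP \<and> q \<epsilon> CP \<and> sub (fs q) (fs p) \<and> sub (sn q) (sn p)" by simp
next
  assume "p \<epsilon> CP \<and> q \<epsilon> CP \<and> sub (fs q) (fs p) \<and> sub (sn q) (sn p)"
  then show "le p q" unfolding mem_CL using CP_iff by blast
qed

text \<open>Countable closure. The bound is the coordinatewise union: it is countable by choice in
  the ground model, and no bit gets both values because any two members of the chain are
  comparable.\<close>

lemma chain_bound:
  assumes d: "dfnt (\<lambda>e. s (e 0))" and sP: "\<And>n. n \<epsilon> om \<Longrightarrow> s n \<epsilon> CP" and dec: "\<And>n. n \<epsilon> om \<Longrightarrow> le (s (suc n)) (s n)"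
  shows "\<exists>p. p \<epsilon> CP \<and> (\<forall>n. n \<epsilon> om \<longrightarrow> le p (s n))"
proof -
  note sd = dfnt_app[of s, OF d]
  have mono: "le (s k) (s n)" if k: "k \<epsilon> om" and n: "n \<epsilon> k \<or> n = k" for k n
  proof -
    have "\<forall>n. n \<epsilon> k \<or> n = k \<longrightarrow> le (s k) (s n)"
    proof (rule om_induct[OF k, of "\<lambda>k. \<forall>n. n \<epsilon> k \<or> n = k \<longrightarrow> le (s k) (s n)"])
      show "dfn (\<lambda>e. \<forall>n. n \<epsilon> e 0 \<or> n = e 0 \<longrightarrow> le (s (e 0)) (s n))" by (intro dfns sd)
      show "\<forall>n. n \<epsilon> emp \<or> n = emp \<longrightarrow> le (s emp) (s n)" using L_refl[OF sP[OF emp_om]] by simp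
      fix k assume k: "k \<epsilon> om" and IH: "\<forall>n. n \<epsilon> k \<or> n = k \<longrightarrow> le (s k) (s n)"
      show "\<forall>n. n \<epsilon> suc k \<or> n = suc k \<longrightarrow> le (s (suc k)) (s n)"
      proof (intro allI impI)
        fix n assume "n \<epsilon> suc k \<or> n = suc k"
        then consider "n = suc k" | "n \<epsilon> k \<or> n = k" by auto
        then show "le (s (suc k)) (s n)"
        proof cases
          case 1 then show ?thesis using L_refl[OF sP[OF suc_om[OF k]]] by simp
        next
          case 2 then show ?thesis using IH L_trans[OF dec[OF k]] by blast
        qed
      qed
    qed
    then show ?thesis using n by blast
  qed
  have ic: "isc (fs (s n)) (sn (s n))" if "n \<epsilon> om" for n using sP[OF that] CP_iff by blast
  have fd: "dfnt (\<lambda>e. fs (s (e 0)))" "dfnt (\<lambda>e. sn (s (e 0)))" by (intro dfns sd)+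
  define A where "A = Uni (Img (\<lambda>n. fs (s n)) om)"
  define B where "B = Uni (Img (\<lambda>n. sn (s n)) om)"
  have A: "x \<epsilon> A \<longleftrightarrow> (\<exists>n. n \<epsilon> om \<and> x \<epsilon> fs (s n))" for x unfolding A_def mem_Uni mem_Img[OF fd(1)] by blast
  have B: "x \<epsilon> B \<longleftrightarrow> (\<exists>n. n \<epsilon> om \<and> x \<epsilon> sn (s n))" for x unfolding B_def mem_Uni mem_Img[OF fd(2)] by blast
  have "small A" unfolding A_def by (rule small_UN[OF fd(1)]) (use ic isc_def in blast)
  moreover have "small B" unfolding B_def by (rule small_UN[OF fd(2)]) (use ic isc_def in blast)
  moreover have "sub A IK" "sub B IK" using ic unfolding isc_def sub_def A B by blast+
  moreover have "\<not> x \<epsilon> B" if xA: "x \<epsilon> A" for x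
  proof
    assume xB: "x \<epsilon> B"
    obtain n k where n: "n \<epsilon> om" "x \<epsilon> fs (s n)" and k: "k \<epsilon> om" "x \<epsilon> sn (s k)" using xA xB unfolding A B by blast
    have "n \<epsilon> k \<or> n = k \<or> k \<epsilon> n" using ordn_linear[OF om_ordn[OF n(1)] om_ordn[OF k(1)]] .
    then consider "n \<epsilon> k \<or> n = k" | "k \<epsilon> n \<or> k = n" by blast
    then show False
    proof cases
      case 1
      then have "x \<epsilon> fs (s k)" using mono[OF k(1)] n(2) unfolding le_iff sub_def by blast
      then show False using ic[OF k(1)] k(2) unfolding isc_def by blast
    next
      case 2
      then have "x \<epsilon> sn (s n)" using mono[OF n(1)] k(2) unfolding le_iff sub_def by blast
      then show False using ic[OF n(1)] n(2) unfolding isc_def by blast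
    qed
  qed
  ultimately have "Pr A B \<epsilon> CP" unfolding CP_Pr isc_def by blast
  moreover have "sub (fs (s n)) A" "sub (sn (s n)) B" if "n \<epsilon> om" for n using that A B unfolding sub_def by blast+
  ultimately show ?thesis unfolding le_iff using sP by (intro exI[of _ "Pr A B"]) simp
qed

text \<open>Descending sequences of decisions, made with Dependent Choice and bounded by countable closure.\<close>

lemma fusion:
  assumes d: "dfn (\<lambda>e. \<psi> (e 0) (e 1))" and t0: "t0 \<epsilon> X" and X: "\<And>t. t \<epsilon> X \<Longrightarrow> sn t \<epsilon> CP"
    and step: "\<And>t. t \<epsilon> X \<Longrightarrow> \<exists>t'. t' \<epsilon> X \<and> le (sn t') (sn t) \<and> \<psi> t t'"
  shows "\<exists>s p. dfnt (\<lambda>e. s (e 0)) \<and> s emp = t0 \<and> (\<forall>n. n \<epsilon> om \<longrightarrow> s n \<epsilon> X \<and> \<psi> (s n) (s (suc n))) \<and>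
    p \<epsilon> CP \<and> (\<forall>n. n \<epsilon> om \<longrightarrow> le p (sn (s n)))"
proof -
  have d': "dfn (\<lambda>e. le (sn (e 1)) (sn (e 0)) \<and> \<psi> (e 0) (e 1))" by (intro dfns d)
  obtain s where s: "dfnt (\<lambda>e. s (e 0))" "s emp = t0"
    "\<And>n. n \<epsilon> om \<Longrightarrow> s n \<epsilon> X \<and> le (sn (s (suc n))) (sn (s n)) \<and> \<psi> (s n) (s (suc n))"
    using dc[of "\<lambda>t t'. le (sn t') (sn t) \<and> \<psi> t t'", OF d' t0 step] by blast
  have "\<exists>p. p \<epsilon> CP \<and> (\<forall>n. n \<epsilon> om \<longrightarrow> le p (sn (s n)))"
    by (rule chain_bound[of "\<lambda>n. sn (s n)"]) (intro dfns s(1), use s(3) X in blast, use s(3) in blast)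
  then show ?thesis using s by blast
qed

section \<open>Symmetric names of pairs, of the generic sets and of the family\<close>

lemma supp_op:
  assumes "nm x" "nm y" "supp e x" "supp e y" shows "supp e (op x y)"
proof -
  have 1: "supp e (mkn (Upr a b))" "nm (mkn (Upr a b))" if "a = x \<or> a = y" "b = x \<or> b = y" for a b
    by (rule supp_mkn; use that assms in auto) (rule nm_mkn; use that assms in auto)
  show ?thesis unfolding op_def by (rule supp_mkn) (use 1 in auto)
qed

lemma hn_S_op:
  assumes "hn S x" "hn S y" shows "hn S (op x y)"
proof -
  obtain e where e: "sub e Qc" "small e" "\<forall>i<Suc (Suc 0). supp e (case_nat x (\<lambda>_. y) i)"
  proof -
    define g where "g = case_nat x (\<lambda>_. y)"
    have "hn S (g i)" for i using assms unfolding g_def by (cases i) auto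
    then have "\<exists>e. sub e Qc \<and> small e \<and> (\<forall>i<Suc (Suc 0). supp e (g i))" by (rule S_common)
    then show thesis unfolding g_def by (elim exE conjE) (rule that)
  qed
  have s: "supp e x" "supp e y" using e(3)[rule_format, of 0] e(3)[rule_format, of 1] by simp_all
  have 1: "hn S (mkn (Upr a b))" "supp e (mkn (Upr a b))" if "a = x \<or> a = y" "b = x \<or> b = y" for a b
  proof -
    show "hn S (mkn (Upr a b))" by (rule hn_S_mkn[OF _ e(1,2)]) (use that assms s in auto)
    show "supp e (mkn (Upr a b))" by (rule supp_mkn) (use that hn_nm[OF assms(1)] hn_nm[OF assms(2)] s in auto)
  qed
  show ?thesis unfolding op_def by (rule hn_S_mkn[OF _ e(1,2)]) (use 1 in auto)
qed

lemma act_op: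
  assumes "nm x" "nm y" shows "act D (op x y) = op (act D x) (act D y)"
proof -
  have i: "Img (act D) (Upr a b) = Upr (act D a) (act D b)" for a b
  proof (rule ext)
    fix z
    have "z \<epsilon> Img (act D) (Upr a b) \<longleftrightarrow> (\<exists>u. u \<epsilon> Upr a b \<and> z = act D u)" by (rule mem_Img) (intro dfns)
    then show "z \<epsilon> Img (act D) (Upr a b) \<longleftrightarrow> z \<epsilon> Upr (act D a) (act D b)" by auto
  qed
  have u: "act D (mkn (Upr a b)) = mkn (Upr (act D a) (act D b))" if "nm a" "nm b" for a b
    using act_mkn[of "Upr a b" D] that i by auto
  have n: "nm (mkn (Upr a b))" if "nm a" "nm b" for a b by (rule nm_mkn) (use that in auto)
  show ?thesis unfolding op_def using u[OF n n] u assms by simp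
qed

text \<open>\<open>gn i d\<close> names the symmetric difference of \<open>d\<close> and the \<open>i\<close>-th generic subset of \<open>w1\<close>.\<close>

definition gbit :: "nat \<Rightarrow> nat \<Rightarrow> nat \<Rightarrow> nat \<Rightarrow> bool" where
  "gbit i d y p \<longleftrightarrow> (\<not> y \<epsilon> d \<and> Pr i y \<epsilon> sn p) \<or> (y \<epsilon> d \<and> Pr i y \<epsilon> fs p)"

definition gn :: "nat \<Rightarrow> nat \<Rightarrow> nat" where
  "gn i d = Sep (Times (Img chk w1) CP) (\<lambda>t. \<exists>y p. y \<epsilon> w1 \<and> t = Pr (chk y) p \<and> gbit i d y p)"

lemma gbit_dfn [dfns]: "dfnt s \<Longrightarrow> dfnt t \<Longrightarrow> dfnt u \<Longrightarrow> dfnt v \<Longrightarrow> dfn (\<lambda>e. gbit (s e) (t e) (u e) (v e))"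
  by (rule dfn4[of gbit]; (assumption | (unfold gbit_def, intro dfns)))

lemma gn_dfn [dfns]: "dfnt s \<Longrightarrow> dfnt t \<Longrightarrow> dfnt (\<lambda>e. gn (s e) (t e))"
  by (rule dfnt_app2[of gn]; (assumption | (unfold gn_def, intro dfns)))

lemma mem_gn: "t \<epsilon> gn i d \<longleftrightarrow> (\<exists>y p. y \<epsilon> w1 \<and> p \<epsilon> CP \<and> t = Pr (chk y) p \<and> gbit i d y p)"
proof -
  have m: "u \<epsilon> Img chk w1 \<longleftrightarrow> (\<exists>z. z \<epsilon> w1 \<and> u = chk z)" for u by (rule mem_Img) (intro dfns)
  have "t \<epsilon> gn i d \<longleftrightarrow> t \<epsilon> Times (Img chk w1) CP \<and> (\<exists>y p. y \<epsilon> w1 \<and> t = Pr (chk y) p \<and> gbit i d y p)"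
    unfolding gn_def by (rule mem_Sep) (intro dfns)
  then show ?thesis unfolding mem_Times m by auto
qed

lemma nm_gn: "nm (gn i d)"
  by (rule hn_I[OF dfn_const]) (use mem_gn nm_chk in blast)+

definition col :: "nat \<Rightarrow> nat \<Rightarrow> nat" where "col D i = Sep w1 (\<lambda>y. Pr i y \<epsilon> D)"

lemma mem_col [simp]: "y \<epsilon> col D i \<longleftrightarrow> y \<epsilon> w1 \<and> Pr i y \<epsilon> D"
  unfolding col_def by (rule mem_Sep) (intro dfns)

lemma gbit_flip: 
  assumes "y \<epsilon> w1" "gbit i d y p" shows "gbit i (sd d (col D i)) y (flip D p)"
proof -
  have "x \<epsilon> sn (flip D p) \<longleftrightarrow> (x \<epsilon> sn p \<and> \<not> x \<epsilon> D) \<or> (x \<epsilon> fs p \<and> x \<epsilon> D)"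
    "x \<epsilon> fs (flip D p) \<longleftrightarrow> (x \<epsilon> fs p \<and> \<not> x \<epsilon> D) \<or> (x \<epsilon> sn p \<and> x \<epsilon> D)" for x unfolding flip_def by auto
  then show ?thesis using assms unfolding gbit_def mem_sd mem_col by blast
qed

lemma act_gn: "act D (gn i d) = gn i (sd d (col D i))"
proof (rule ext)
  fix t
  have a: "t \<epsilon> act D (gn i d) \<longleftrightarrow> (\<exists>y p. y \<epsilon> w1 \<and> p \<epsilon> CP \<and> gbit i d y p \<and> t = Pr (chk y) (flip D p))"
    unfolding mem_act[OF nm_gn] mem_gn Pr_eq using act_chk by metis
  have dd: "sd (sd d (col D i)) (col D i) = d" by (rule ext) auto
  show "t \<epsilon> act D (gn i d) \<longleftrightarrow> t \<epsilon> gn i (sd d (col D i))"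
  proof
    assume "t \<epsilon> act D (gn i d)"
    then show "t \<epsilon> gn i (sd d (col D i))" unfolding a mem_gn using gbit_flip flip_CP by blast
  next
    assume "t \<epsilon> gn i (sd d (col D i))"
    then obtain y p where y: "y \<epsilon> w1" "p \<epsilon> CP" "t = Pr (chk y) p" "gbit i (sd d (col D i)) y p" unfolding mem_gn by blast
    have "gbit i d y (flip D p)" using gbit_flip[OF y(1,4), of D] unfolding dd .
    then show "t \<epsilon> act D (gn i d)" unfolding a using y flip_CP[OF y(2)] flip_inv[OF y(2)] by metis
  qed
qed

lemma supp_gn: "supp (Upr i i) (gn i d)"
  unfolding supp_def
proof (intro allI impI)
  fix D assume "\<forall>l y. l \<epsilon> Upr i i \<longrightarrow> \<not> Pr l y \<epsilon> D"
  then have "sd d (col D i) = d" by (intro ext) auto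
  then show "act D (gn i d) = gn i d" unfolding act_gn by simp
qed

lemma hn_S_gn:
  assumes "i \<epsilon> Qc" shows "hn S (gn i d)"
proof (rule hn_I[OF S_dfn0])
  have "sub (Upr i i) Qc" using assms by (simp add: sub_def)
  moreover have "small (Upr i i)"
    by (rule small_rel_image[of "Upr (Pr emp i) (Pr emp i)" om]) (auto simp: fun1_def small_om intro: exI[of _ emp])
  ultimately show "S (gn i d)" unfolding S_def using supp_gn by blast
  show "\<exists>z p. hn S z \<and> p \<epsilon> CP \<and> t = Pr z p" if "t \<epsilon> gn i d" for t using that mem_gn hn_S_chk by blast
qed

text \<open>All sets named by \<open>gn i\<close> differ by ground model sets, so that the whole family is fixed by the action
  although no single member is.\<close>

definition An :: "nat \<Rightarrow> nat" where "An i = mkn (Img (gn i) (Pow w1))"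
definition Fam :: nat where "Fam = mkn (Img (\<lambda>i. op (chk i) (An i)) Qc)"

lemma An_dfn [dfns]: "dfnt s \<Longrightarrow> dfnt (\<lambda>e. An (s e))"
  by (rule dfnt_app[of An]; (assumption | (unfold An_def, intro dfns)))

lemma mem_Img_gn: "z \<epsilon> Img (gn i) (Pow w1) \<longleftrightarrow> (\<exists>d. sub d w1 \<and> z = gn i d)"
  unfolding mem_Img[OF gn_dfn[OF dfnt_const dfnt_var]] by simp

lemma supp_An: "supp e (An i)"
  unfolding supp_def
proof (intro allI impI)
  fix D
  have m: "u \<epsilon> Img (act D) (Img (gn i) (Pow w1)) \<longleftrightarrow> (\<exists>z. z \<epsilon> Img (gn i) (Pow w1) \<and> u = act D z)" for u
    by (rule mem_Img) (intro dfns)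
  have "Img (act D) (Img (gn i) (Pow w1)) = Img (gn i) (Pow w1)"
  proof (rule ext)
    fix u
    have s: "sub (sd d (col D i)) w1" if "sub d w1" for d using that by (auto simp: sub_def)
    have dd: "sd (sd d (col D i)) (col D i) = d" for d by (rule ext) auto
    show "u \<epsilon> Img (act D) (Img (gn i) (Pow w1)) \<longleftrightarrow> u \<epsilon> Img (gn i) (Pow w1)"
      unfolding m mem_Img_gn using s dd act_gn by metis
  qed
  moreover have "nm z" if "z \<epsilon> Img (gn i) (Pow w1)" for z using that nm_gn unfolding mem_Img_gn by blast
  ultimately show "act D (An i) = An i" unfolding An_def using act_mkn by simp
qed

lemma hn_S_An: 
  assumes "i \<epsilon> Qc" shows "hn S (An i)"
  unfolding An_def
proof (rule hn_mkn[OF S_dfn0])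
  show "S (mkn (Img (gn i) (Pow w1)))" unfolding An_def[symmetric] S_def using supp_An small_emp emp_sub by blast
  show "hn S z" if "z \<epsilon> Img (gn i) (Pow w1)" for z using that hn_S_gn[OF assms] unfolding mem_Img_gn by blast
qed

lemma mem_Img_Fam: "z \<epsilon> Img (\<lambda>i. op (chk i) (An i)) Qc \<longleftrightarrow> (\<exists>i. i \<epsilon> Qc \<and> z = op (chk i) (An i))"
  by (rule mem_Img) (intro dfns)

lemma hn_S_Fam: "hn S Fam"
  unfolding Fam_def
proof (rule hn_S_mkn[where e = emp])
  fix z assume "z \<epsilon> Img (\<lambda>i. op (chk i) (An i)) Qc"
  then obtain i where i: "i \<epsilon> Qc" "z = op (chk i) (An i)" using mem_Img_Fam by blast
  show "hn S z" unfolding i(2) by (rule hn_S_op[OF hn_S_chk hn_S_An[OF i(1)]])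
  show "supp emp z" unfolding i(2) by (rule supp_op[OF nm_chk hn_nm[OF hn_S_An[OF i(1)]] supp_chk supp_An])
qed (rule emp_sub, rule small_emp)

end

text \<open>Level 0, of index 1, is an enumeration and level 1, of index 0, the set it exhausts. As
  a formula it can be moved between a condition forcing it and further generic extensions.\<close>

definition cov_fm :: fm where
  "cov_fm = ((\<^bold>\<forall>n. \<^bold>\<forall>x. \<^bold>\<forall>y. pair_in n x 0 \<^bold>\<and> pair_in n y 0 \<^bold>\<longrightarrow> x \<^bold>= y) \<^bold>\<and>
    (\<^bold>\<forall>x. x \<^bold>\<in> 1 \<^bold>\<longrightarrow> (\<^bold>\<exists>w. \<^bold>\<exists>n. is_omega w \<^bold>\<and> n \<^bold>\<in> w \<^bold>\<and> pair_in n x 0))) 2"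

definition tot_fm :: fm where
  "tot_fm = (\<^bold>\<forall>x. x \<^bold>\<in> 0 \<^bold>\<longrightarrow> (\<^bold>\<exists>y. y \<^bold>\<in> 0 \<^bold>\<and> pair_in x y 1)) 2"

lemma (in zf) sat_cov_fm:
  "sat E e cov_fm \<longleftrightarrow> fun1 (e 1) \<and> (\<forall>x. x \<epsilon> e 0 \<longrightarrow> (\<exists>n. n \<epsilon> om \<and> Pr n x \<epsilon> e 1))"
  unfolding cov_fm_def sat_2 fun1_def by simp blast

lemma (in zf) sat_tot_fm:
  "sat E e tot_fm \<longleftrightarrow> (\<forall>x. x \<epsilon> e 1 \<longrightarrow> (\<exists>y. y \<epsilon> e 1 \<and> Pr x y \<epsilon> e 0))"
  unfolding tot_fm_def sat_2 by simp

locale symext = zfc_nat E +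
  gext E "zfc_nat.CP E" "zfc_nat.CL E" "zfc_nat.cm E" "zfc_nat.S E" G E' h
  for E :: "nat \<Rightarrow> nat \<Rightarrow> bool" (infix "\<epsilon>" 50) and G E' h
begin

section \<open>The generic family in the symmetric model\<close>

lemma h_gn:
  assumes i: "i \<epsilon> Qc" and y: "y \<epsilon> w1"
  shows "E' (j y) (h (gn i d)) \<longleftrightarrow> (\<exists>p\<in>G. gbit i d y p)"
proof
  assume "E' (j y) (h (gn i d))"
  then obtain w s where w: "Pr w s \<epsilon> gn i d" "s \<in> G" "j y = h w" unfolding mem_h[OF hn_S_gn[OF i]] by blast
  then obtain y' where y': "w = chk y'" "gbit i d y' s" unfolding mem_gn by auto
  then have "j y = j y'" using w(3) unfolding j_def by simp
  then have "y = y'" using j_inj by blast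
  then show "\<exists>p\<in>G. gbit i d y p" using y'(2) w(2) by blast
next
  assume "\<exists>p\<in>G. gbit i d y p"
  then obtain p where p: "p \<in> G" "gbit i d y p" by blast
  then have "Pr (chk y) p \<epsilon> gn i d" unfolding mem_gn using y G_P by blast
  then show "E' (j y) (h (gn i d))" unfolding mem_h[OF hn_S_gn[OF i]] j_def using p(1) by blast
qed

text \<open>Conditions deciding bit \<open>y\<close> of column \<open>i\<close> are dense, so
  \<open>G\<close> decides it. Changing \<open>d\<close> at \<open>y\<close> then reverses whether
  \<open>j y\<close> belongs to the named set.\<close>

lemma gn_flip_neq:
  assumes i: "i \<epsilon> Qc" and y: "y \<epsilon> w1"
  shows "h (gn i d) \<noteq> h (gn i (sd d (Upr y y)))"
proof -
  have "\<exists>r\<in>G. le r cm \<and> (Pr i y \<epsilon> fs r \<or> Pr i y \<epsilon> sn r)"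
  proof (rule generic_below[OF G G_m], intro dfns)
    fix q assume "le q cm"
    then have q: "q \<epsilon> CP" using L_P by blast
    show "\<exists>r. le r q \<and> (Pr i y \<epsilon> fs r \<or> Pr i y \<epsilon> sn r)"
    proof (cases "Pr i y \<epsilon> fs q")
      case True then show ?thesis using L_refl[OF q] by blast
    next
      case False
      let ?r = "Pr (fs q) (Cup (sn q) (Upr (Pr i y) (Pr i y)))"
      have c: "isc (fs q) (sn q)" using q CP_iff by blast
      have "small (Upr (Pr i y) (Pr i y))"
        by (rule small_rel_image[of "Upr (Pr emp (Pr i y)) (Pr emp (Pr i y))" om]) (auto simp: fun1_def small_om intro: exI[of _ emp])
      then have "small (Cup (sn q) (Upr (Pr i y) (Pr i y)))" using c small_Cup unfolding isc_def by blast
      moreover have "sub (Cup (sn q) (Upr (Pr i y) (Pr i y))) IK" using c i y unfolding isc_def sub_def by auto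
      ultimately have "?r \<epsilon> CP" unfolding CP_Pr using c False unfolding isc_def by auto
      moreover have "sub (sn q) (Cup (sn q) (Upr (Pr i y) (Pr i y)))" by (simp add: sub_def)
      ultimately have "le ?r q" unfolding le_iff using q sub_refl by simp
      moreover have "Pr i y \<epsilon> sn ?r" by simp
      ultimately show ?thesis by blast
    qed
  qed
  then obtain r where r: "r \<in> G" "Pr i y \<epsilon> fs r \<or> Pr i y \<epsilon> sn r" by blast
  have ex: False if pq: "p \<in> G" "q \<in> G" "Pr i y \<epsilon> fs p" "Pr i y \<epsilon> sn q" for p q
  proof -
    obtain u where u: "le u p" "le u q" using G_dir[OF pq(1,2)] by blast
    then have "u \<epsilon> CP" "Pr i y \<epsilon> fs u" "Pr i y \<epsilon> sn u" using pq(3,4) unfolding le_iff sub_def by blast+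
    then show False using CP_iff unfolding isc_def by blast
  qed
  have "(\<exists>p\<in>G. gbit i d y p) \<noteq> (\<exists>p\<in>G. gbit i (sd d (Upr y y)) y p)"
    using r ex unfolding gbit_def by auto
  then show ?thesis using h_gn[OF i y] by metis
qed

lemma h_An: 
  assumes "i \<epsilon> Qc" shows "E' a (h (An i)) \<longleftrightarrow> (\<exists>d. sub d w1 \<and> a = h (gn i d))"
  unfolding An_def h_mkn[OF hn_S_An[OF assms, unfolded An_def]] mem_Img_gn by blast

lemma h_Fam: "E' a (h Fam) \<longleftrightarrow> (\<exists>i. i \<epsilon> Qc \<and> a = N.Pr (j i) (h (An i)))"
proof -
  have o: "h (op (chk i) (An i)) = N.Pr (j i) (h (An i))" if "i \<epsilon> Qc" for i
    unfolding j_def by (rule h_op[OF hn_S_op[OF hn_S_chk hn_S_An[OF that]]])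
  have "E' a (h Fam) \<longleftrightarrow> (\<exists>z. (\<exists>i. i \<epsilon> Qc \<and> z = op (chk i) (An i)) \<and> a = h z)"
    unfolding Fam_def h_mkn[OF hn_S_Fam[unfolded Fam_def]] mem_Img_Fam ..
  then show ?thesis using o by metis
qed

text \<open>If a partial choice function were defined at an index outside its support, flipping a bit not decided
  by the condition forcing the value would force a second value.\<close>

theorem partial_choice_small:
  assumes func: "\<And>a x y. E' (N.Pr a x) f \<Longrightarrow> E' (N.Pr a y) f \<Longrightarrow> x = y"
  shows "\<exists>e. small e \<and> (\<forall>i d. i \<epsilon> Qc \<longrightarrow> E' (N.Pr (j i) (h (gn i d))) f \<longrightarrow> i \<epsilon> e)"
proof -
  obtain f0 where f0: "hn S f0" "h f0 = f" using h_onto by blast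
  obtain e where e: "sub e Qc" "small e" "supp e f0" using hn_S[OF f0(1)] S_def by blast
  have "i \<epsilon> e" if i: "i \<epsilon> Qc" and inf: "E' (N.Pr (j i) (h (gn i d))) f" for i d
  proof (rule ccontr)
    assume ie: "\<not> i \<epsilon> e"
    have Cop: "hn S (op (chk i) (gn i d'))" for d' by (rule hn_S_op[OF hn_S_chk hn_S_gn[OF i]])
    have hop: "h (op (chk i) (gn i d')) = N.Pr (j i) (h (gn i d'))" for d' unfolding j_def by (rule h_op[OF Cop])
    obtain p where p: "p \<in> G" "fmem p (op (chk i) (gn i d)) f0" using inf h_mem[OF Cop f0(1)] f0(2) hop by metis
    have pP: "p \<epsilon> CP" using G_P[OF p(1)] .
    then have c: "isc (fs p) (sn p)" using CP_iff by blast
    \<comment> \<open>Column \<open>i\<close> has uncountably many bits, and \<open>p\<close>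
      decides only countably many of all bits.\<close>
    have "\<exists>y. y \<epsilon> w1 \<and> \<not> Pr i y \<epsilon> Cup (fs p) (sn p)"
    proof (rule ccontr)
      assume "\<not> ?thesis"
      then have *: "y \<epsilon> w1 \<Longrightarrow> Pr i y \<epsilon> Cup (fs p) (sn p)" for y by blast
      have "small (Img sn (Cup (fs p) (sn p)))"
        by (rule small_Img) (intro dfns, use c small_Cup isc_def in blast)
      moreover have "sub w1 (Img sn (Cup (fs p) (sn p)))"
        unfolding sub_def mem_Img[OF sn_dfn[OF dfnt_var]] using * sn_Pr by metis
      ultimately show False using small_sub not_small_w1 by blast
    qed
    then obtain y where y: "y \<epsilon> w1" "\<not> Pr i y \<epsilon> fs p" "\<not> Pr i y \<epsilon> sn p" by auto
    \<comment> \<open>Flipping the single bit \<open>(i, y)\<close> fixes \<open>p\<close>, which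
      does not decide it, and fixes \<open>f0\<close>, whose support omits column \<open>i\<close>;
      but it moves the value of the function at \<open>i\<close>.\<close>
    define D where "D = Upr (Pr i y) (Pr i y)"
    have "flip D p = Pr (fs p) (sn p)" unfolding flip_def Pr_eq D_def using y by (intro conjI ext) auto
    then have fp: "flip D p = p" using pP CP_iff by metis
    have "sub D IK" unfolding D_def sub_def using i y(1) by auto
    moreover have "\<forall>l x. l \<epsilon> e \<longrightarrow> \<not> Pr l x \<epsilon> D" unfolding D_def using ie by auto
    ultimately have af: "act D f0 = f0" using e(3) unfolding supp_def by blast
    have "col D i = Upr y y" by (rule ext) (use y(1) in \<open>auto simp: D_def\<close>)
    then have ao: "act D (op (chk i) (gn i d)) = op (chk i) (gn i (sd d (Upr y y)))"
      using act_op[OF nm_chk nm_gn] act_chk act_gn by simp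
    have "fmem p (op (chk i) (gn i (sd d (Upr y y)))) f0"
      using fmem_act[OF hn_nm[OF Cop] hn_nm[OF f0(1)] pP p(2), of D] unfolding fp af ao .
    then have "E' (N.Pr (j i) (h (gn i (sd d (Upr y y))))) f"
      using h_mem[OF Cop f0(1)] f0(2) hop p(1) by metis
    then have "h (gn i d) = h (gn i (sd d (Upr y y)))" using func inf by blast
    then show False using gn_flip_neq[OF i y(1)] by blast
  qed
  then show ?thesis using e(2) by blast
qed

text \<open>A descending sequence below a condition forcing an enumeration bounds each of its values
  to a single candidate. A lower bound then leaves countably many candidates in the ground model, so
  some \<open>b\<close> in \<open>w1\<close> is missed.\<close>

theorem w1_not_small_N: "\<not> N.small (j w1)"
proof
  assume "N.small (j w1)"
  then obtain g where g: "N.fun1 g" "\<And>x. E' x (j w1) \<Longrightarrow> \<exists>n. E' n N.om \<and> E' (N.Pr n x) g" unfolding N.small_def by blast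
  obtain g0 where g0: "hn S g0" "h g0 = g" using h_onto by blast
  define e where "e = case_nat (chk w1) (\<lambda>_. g0)"
  have Ce: "hn S (e i)" for i unfolding e_def using hn_S_chk g0 by (cases i) auto
  have e01: "e 0 = chk w1" "e 1 = g0" unfolding e_def by simp_all
  have "sat E' (\<lambda>i. h (e i)) cov_fm" unfolding N.sat_cov_fm e01 g0(2) using g unfolding j_def by blast
  then obtain p0 where p0: "p0 \<in> G" "fc (hn S) cov_fm p0 e" using truth[where e = e and A = cov_fm, OF Ce] by blast
  have Cop: "hn S (op (chk n) (chk b))" for n b by (rule hn_S_op[OF hn_S_chk hn_S_chk])
  \<comment> \<open>Forced values are unique: a generic filter through \<open>r\<close> would
    otherwise evaluate the name to a relation with two values at \<open>n\<close>.\<close>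
  have uniq: "b = b'" if r: "le r p0" "fmem r (op (chk n) (chk b)) g0" "fmem r (op (chk n) (chk b')) g0" for r n b b'
  proof -
    have "r \<epsilon> CP" using r(1) L_P by blast
    then obtain G2 where G2: "generic G2" "r \<in> G2" using generic_ex by blast
    then obtain E2 h2 where N2: "gext E CP CL cm S G2 E2 h2" using gext_ex by blast
    interpret X: gext E CP CL cm S G2 E2 h2 by (rule N2)
    have "p0 \<in> G2" using X.G_up[OF G2(2) r(1)] .
    then have "sat E2 (\<lambda>i. h2 (e i)) cov_fm" using X.truth[where e = e and A = cov_fm, OF Ce] p0(2) by blast
    then have f: "X.N.fun1 (h2 g0)" unfolding X.N.sat_cov_fm e01 by blast
    have o: "h2 (op (chk n) (chk c)) = X.N.Pr (X.j n) (X.j c)" for c unfolding X.j_def by (rule X.h_op[OF Cop])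
    have "E2 (X.N.Pr (X.j n) (X.j b)) (h2 g0)" "E2 (X.N.Pr (X.j n) (X.j b')) (h2 g0)"
      using X.h_mem[OF Cop g0(1)] G2(2) r(2,3) o by metis+
    then have "X.j b = X.j b'" using f unfolding X.N.fun1_def by blast
    then show ?thesis using X.j_inj by blast
  qed
  \<comment> \<open>\<open>a\<close> is the only value that some extension of \<open>p\<close> may
    still force at \<open>n\<close>. This leaves open whether there is a value at all.\<close>
  define dec where "dec n a p \<longleftrightarrow> (\<forall>b r. b \<epsilon> w1 \<longrightarrow> le r p \<longrightarrow> fmem r (op (chk n) (chk b)) g0 \<longrightarrow> b = a)" for n a p
  have dec_dfn: "dfn (\<lambda>e. dec (e 0) (e 1) (e 2))" unfolding dec_def by (intro dfns)
  have emp_w1: "emp \<epsilon> w1" by (rule ordn_trans[OF ordn_w1 om_w1 emp_om])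
  have step: "\<exists>q a. le q p \<and> a \<epsilon> w1 \<and> dec n a q" if p: "le p p0" for p n
  proof (cases "\<exists>r b. le r p \<and> b \<epsilon> w1 \<and> fmem r (op (chk n) (chk b)) g0")
    case True
    then obtain r b where r: "le r p" "b \<epsilon> w1" "fmem r (op (chk n) (chk b)) g0" by blast
    have "dec n b r" unfolding dec_def
    proof (intro allI impI)
      fix b' r' assume "le r' r" "fmem r' (op (chk n) (chk b')) g0"
      moreover have "fmem r' (op (chk n) (chk b)) g0"
        by (rule fmem_mono[OF hn_nm[OF Cop] hn_nm[OF g0(1)] \<open>le r' r\<close> r(3)])
      moreover have "le r' p0" using \<open>le r' r\<close> r(1) p L_trans by blast
      ultimately show "b' = b" using uniq by blast
    qed
    then show ?thesis using r by blast
  next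
    case False
    \<comment> \<open>If nothing can be forced at \<open>n\<close>, any value serves as the
      candidate; \<open>emp\<close> is the default.\<close>
    then have "dec n emp p" unfolding dec_def by blast
    then show ?thesis using L_refl L_P[OF p] emp_w1 by blast
  qed
  let ?\<phi> = "\<lambda>t. le (sn t) p0 \<and> dec (fs (fs t)) (sn (fs t)) (sn t)"
  \<comment> \<open>An entry consists of the index, the candidate value there and the condition that
    enforces this candidate.\<close>
  define X where "X = Sep (Times (Times om w1) CP) ?\<phi>"
  have X: "t \<epsilon> X \<longleftrightarrow> t \<epsilon> Times (Times om w1) CP \<and> ?\<phi> t" for t
    unfolding X_def by (rule mem_Sep) (intro dfns dfn3[of dec, OF dec_dfn])
  have XI: "Pr (Pr n a) p \<epsilon> X" if "n \<epsilon> om" "a \<epsilon> w1" "le p p0" "dec n a p" for n a p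
    unfolding X using that L_P by auto
  have p0P: "p0 \<epsilon> CP" using G_P[OF p0(1)] .
  obtain q0 a0 where q0: "le q0 p0" "a0 \<epsilon> w1" "dec emp a0 q0" using step[OF L_refl[OF p0P]] by blast
  let ?\<psi> = "\<lambda>t t'. fs (fs t') = suc (fs (fs t))"
  have "\<exists>s p. dfnt (\<lambda>e. s (e 0)) \<and> s emp = Pr (Pr emp a0) q0 \<and> (\<forall>n. n \<epsilon> om \<longrightarrow> s n \<epsilon> X \<and> ?\<psi> (s n) (s (suc n))) \<and>
    p \<epsilon> CP \<and> (\<forall>n. n \<epsilon> om \<longrightarrow> le p (sn (s n)))"
  proof (rule fusion)
    show "dfn (\<lambda>e. fs (fs (e 1)) = suc (fs (fs (e 0))))" by (intro dfns)
    show "Pr (Pr emp a0) q0 \<epsilon> X" by (rule XI[OF emp_om q0(2,1,3)])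
    show "sn t \<epsilon> CP" if "t \<epsilon> X" for t using that unfolding X by auto
    fix t assume t: "t \<epsilon> X"
    then obtain n a p where tp: "t = Pr (Pr n a) p" "n \<epsilon> om" unfolding X by auto
    have "le p p0" using t tp(1) unfolding X by simp
    then obtain q b where q: "le q p" "b \<epsilon> w1" "dec (suc n) b q" using step by blast
    have "Pr (Pr (suc n) b) q \<epsilon> X" by (rule XI[OF suc_om[OF tp(2)] q(2) L_trans[OF q(1) \<open>le p p0\<close>] q(3)])
    then show "\<exists>t'. t' \<epsilon> X \<and> le (sn t') (sn t) \<and> fs (fs t') = suc (fs (fs t))"
      using q(1) tp(1) by (intro exI[of _ "Pr (Pr (suc n) b) q"]) simp
  qed
  then obtain s p where s: "dfnt (\<lambda>e. s (e 0))" "s emp = Pr (Pr emp a0) q0"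
    "\<And>n. n \<epsilon> om \<Longrightarrow> s n \<epsilon> X \<and> ?\<psi> (s n) (s (suc n))" and p: "p \<epsilon> CP" "\<And>n. n \<epsilon> om \<Longrightarrow> le p (sn (s n))" by blast
  have idx: "fs (fs (s n)) = n" if "n \<epsilon> om" for n
    \<comment> \<open>The relation between successive entries increments the index, so the
      \<open>n\<close>-th entry treats \<open>n\<close>.\<close>
    by (rule om_induct[OF that, of "\<lambda>n. fs (fs (s n)) = n"]) (intro dfns dfnt_app[of s, OF s(1)], use s in auto)
  have vd: "dfnt (\<lambda>e. sn (fs (s (e 0))))" by (intro dfns dfnt_app[of s, OF s(1)])
  have "\<not> sub w1 (Img (\<lambda>n. sn (fs (s n))) om)"
    using small_sub[OF small_Img[OF vd small_om]] not_small_w1 by blast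
  then obtain b where b: "b \<epsilon> w1" "\<And>n. n \<epsilon> om \<Longrightarrow> b \<noteq> sn (fs (s n))" unfolding sub_def mem_Img[OF vd] by blast
  obtain G2 where G2: "generic G2" "p \<in> G2" using generic_ex p(1) by blast
  then obtain E2 h2 where N2: "gext E CP CL cm S G2 E2 h2" using gext_ex by blast
  interpret X: gext E CP CL cm S G2 E2 h2 by (rule N2)
  have "le p p0" using p(2)[OF emp_om] s(3)[OF emp_om] L_trans unfolding X by blast
  then have "p0 \<in> G2" using X.G_up[OF G2(2)] by blast
  then have "sat E2 (\<lambda>i. h2 (e i)) cov_fm" using X.truth[where e = e and A = cov_fm, OF Ce] p0(2) by blast
  moreover have "E2 (X.j b) (h2 (e 0))" unfolding e01 X.j_def[symmetric] X.j_mem_j by (rule b(1))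
  ultimately obtain n' where n': "E2 n' X.N.om" "E2 (X.N.Pr n' (X.j b)) (h2 g0)" unfolding X.N.sat_cov_fm e01 by blast
  then obtain n where n: "n \<epsilon> om" "n' = X.j n" unfolding X.j_om[symmetric] X.j_mem by blast
  have "h2 (op (chk n) (chk b)) = X.N.Pr (X.j n) (X.j b)" unfolding X.j_def by (rule X.h_op[OF Cop])
  then obtain r where r: "r \<in> G2" "fmem r (op (chk n) (chk b)) g0" using n'(2) n(2) X.h_mem[OF Cop g0(1)] by metis
  obtain u where u: "le u r" "le u p" using X.G_dir[OF r(1) G2(2)] by blast
  have "fmem u (op (chk n) (chk b)) g0" by (rule fmem_mono[OF hn_nm[OF Cop] hn_nm[OF g0(1)] u(1) r(2)])
  moreover have "le u (sn (s n))" using u(2) p(2)[OF n(1)] L_trans by blast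
  moreover have "dec n (sn (fs (s n))) (sn (s n))" using s(3)[OF n(1)] idx[OF n(1)] unfolding X by simp
  ultimately have "b = sn (fs (s n))" using b(1) unfolding dec_def by blast
  then show False using b(2)[OF n(1)] by blast
qed

text \<open>Below any \<open>q\<close>, the ground model chooses names for the successive terms
  while extending conditions. Countable closure gives one condition forcing all the relations, and
  countable supports make the resulting sequence name symmetric.\<close>

theorem dc_N:
  assumes X: "X \<noteq> N.emp" and tot: "\<And>x. E' x X \<Longrightarrow> \<exists>y. E' y X \<and> E' (N.Pr x y) R"
  shows "N.dc_seq X R"
proof -
  obtain X0 R0 where X0: "hn S X0" "h X0 = X" and R0: "hn S R0" "h R0 = R" using h_onto by metis
  define e where "e = case_nat R0 (\<lambda>_. X0)"
  have Ce: "hn S (e i)" for i unfolding e_def using X0 R0 by (cases i) auto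
  have e01: "e 0 = R0" "e 1 = X0" unfolding e_def by simp_all
  have ne: "\<forall>i. nm (e i)" using Ce hn_nm by blast
  have "sat E' (\<lambda>i. h (e i)) tot_fm" unfolding N.sat_tot_fm e01 X0(2) R0(2) using tot by blast
  then obtain p1 where p1: "p1 \<in> G" "fc (hn S) tot_fm p1 e" using truth[where e = e and A = tot_fm, OF Ce] by blast
  obtain a where "E' a X" using X N.empI by blast
  then obtain z0 s0 where z0: "Pr z0 s0 \<epsilon> X0" "s0 \<in> G" using mem_h[OF X0(1)] X0(2) by blast
  obtain p0 where p0: "p0 \<in> G" "le p0 p1" "le p0 s0" using G_dir[OF p1(1) z0(2)] by blast
  have Cz: "hn S z" if "z \<epsilon> Dom X0" for z using hn_Dom[OF X0(1) that] .
  have "fc (hn S) dc_fm p0 e"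
  proof (rule fc_dense[OF hn_nm ne G_P[OF p0(1)]], assumption, intro allI impI)
    fix q assume q: "le q p0"
    have qP: "q \<epsilon> CP" using q L_P by blast
    let ?\<phi> = "\<lambda>t. le (sn t) q \<and> fmem (sn t) (fs t) X0"
    \<comment> \<open>An entry pairs a name from the domain of \<open>X0\<close> with a condition
      forcing it into \<open>X0\<close>. Restricting to \<open>Dom X0\<close> keeps the candidates
      in a set.\<close>
    define XX where "XX = Sep (Times (Dom X0) CP) ?\<phi>"
    have XX: "t \<epsilon> XX \<longleftrightarrow> t \<epsilon> Times (Dom X0) CP \<and> ?\<phi> t" for t
      unfolding XX_def by (rule mem_Sep) (intro dfns)
    have XXI: "Pr z p \<epsilon> XX" if "z \<epsilon> Dom X0" "le p q" "fmem p z X0" for z p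
      unfolding XX using that L_P by auto
    let ?\<psi> = "\<lambda>t t'. fmem (sn t') (op (fs t) (fs t')) R0"
    have "\<exists>s p. dfnt (\<lambda>e. s (e 0)) \<and> s emp = Pr z0 q \<and> (\<forall>n. n \<epsilon> om \<longrightarrow> s n \<epsilon> XX \<and> ?\<psi> (s n) (s (suc n))) \<and>
      p \<epsilon> CP \<and> (\<forall>n. n \<epsilon> om \<longrightarrow> le p (sn (s n)))"
    proof (rule fusion)
      show "dfn (\<lambda>e. fmem (sn (e 1)) (op (fs (e 0)) (fs (e 1))) R0)" by (intro dfns)
      have "fmem q z0 X0" by (rule fmem_own[OF hn_nm[OF X0(1)] z0(1) L_trans[OF q p0(3)]])
      then show "Pr z0 q \<epsilon> XX" using XXI z0(1) L_refl[OF qP] by auto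
      show "sn t \<epsilon> CP" if "t \<epsilon> XX" for t using that unfolding XX by auto
      fix t assume t: "t \<epsilon> XX"
      then obtain z p where zp: "t = Pr z p" "z \<epsilon> Dom X0" "p \<epsilon> CP" unfolding XX by auto
      have p: "le p q" "fmem p z X0" using t zp(1) unfolding XX by simp_all
      \<comment> \<open>The next name and condition are found by looking into a generic extension
        through \<open>p\<close>: totality holds there, its witness has a name in
        \<open>Dom X0\<close>, and the facts used are forced by members of the filter.\<close>
      obtain G2 where G2: "generic G2" "p \<in> G2" using generic_ex zp(3) by blast
      then obtain E2 h2 where N2: "gext E CP CL cm S G2 E2 h2" using gext_ex by blast
      interpret X: gext E CP CL cm S G2 E2 h2 by (rule N2)
      have "p1 \<in> G2" using X.G_up[OF G2(2)] L_trans[OF p(1) L_trans[OF q p0(2)]] by blast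
      then have "sat E2 (\<lambda>i. h2 (e i)) tot_fm" using X.truth[where e = e and A = tot_fm, OF Ce] p1(2) by blast
      moreover have "E2 (h2 z) (h2 X0)" using X.h_mem[OF Cz[OF zp(2)] X0(1)] G2(2) p(2) by blast
      ultimately obtain b where b: "E2 b (h2 X0)" "E2 (X.N.Pr (h2 z) b) (h2 R0)" unfolding X.N.sat_tot_fm e01 by blast
      then obtain w s where w: "Pr w s \<epsilon> X0" "s \<in> G2" "b = h2 w" unfolding X.mem_h[OF X0(1)] by blast
      have wD: "w \<epsilon> Dom X0" using w(1) by auto
      have Cop: "hn S (op z w)" by (rule hn_S_op[OF Cz[OF zp(2)] Cz[OF wD]])
      obtain r where r: "r \<in> G2" "fmem r (op z w) R0" using b(2) w(3) X.h_op[OF Cop] X.h_mem[OF Cop R0(1)] by metis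
      obtain u where u: "u \<in> G2" "le u r" "le u s" using X.G_dir[OF r(1) w(2)] by blast
      obtain v where v: "le v u" "le v p" using X.G_dir[OF u(1) G2(2)] by blast
      have "fmem v (op z w) R0" by (rule fmem_mono[OF hn_nm[OF Cop] hn_nm[OF R0(1)] L_trans[OF v(1) u(2)] r(2)])
      moreover have "fmem v w X0" by (rule fmem_own[OF hn_nm[OF X0(1)] w(1) L_trans[OF v(1) u(3)]])
      then have "Pr w v \<epsilon> XX" using XXI[OF wD L_trans[OF v(2) p(1)]] by blast
      ultimately show "\<exists>t'. t' \<epsilon> XX \<and> le (sn t') (sn t) \<and> ?\<psi> t t'"
        using v(2) zp(1) by (intro exI[of _ "Pr w v"]) simp
    qed
    then obtain s p where s: "dfnt (\<lambda>e. s (e 0))" "s emp = Pr z0 q"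
      "\<And>n. n \<epsilon> om \<Longrightarrow> s n \<epsilon> XX \<and> ?\<psi> (s n) (s (suc n))" and p: "p \<epsilon> CP" "\<And>n. n \<epsilon> om \<Longrightarrow> le p (sn (s n))" by blast
    note sd = dfnt_app[of s, OF s(1)]
    have xD: "fs (s n) \<epsilon> Dom X0" if "n \<epsilon> om" for n using s(3)[OF that] unfolding XX by auto
    define f0 where "f0 = mkn (Img (\<lambda>n. op (chk n) (fs (s n))) om)"
    have mI: "z \<epsilon> Img (\<lambda>n. op (chk n) (fs (s n))) om \<longleftrightarrow> (\<exists>n. n \<epsilon> om \<and> z = op (chk n) (fs (s n)))" for z
      by (rule mem_Img) (intro dfns sd)
    have Cop: "hn S (op (chk n) (fs (s n)))" if "n \<epsilon> om" for n by (rule hn_S_op[OF hn_S_chk Cz[OF xD[OF that]]])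
    have Cf0: "hn S f0"
    proof -
      \<comment> \<open>Choice in the ground model selects one support for each term. Their union is
        countable and supports every element of \<open>f0\<close>.\<close>
      let ?w = "\<lambda>e n. small e \<and> supp e (fs (s n))"
      define W where "W n = Sep (Pow Qc) (\<lambda>e. ?w e n)" for n
      have Wd: "dfnt (\<lambda>e. W (e 0))" unfolding W_def by (intro dfns sd)
      have "e \<epsilon> W n \<longleftrightarrow> e \<epsilon> Pow Qc \<and> ?w e n" for e n unfolding W_def by (rule mem_Sep) (intro dfns)
      then have W: "e \<epsilon> W n \<longleftrightarrow> sub e Qc \<and> ?w e n" for e n by simp
      have "\<exists>e. e \<epsilon> W n" if "n \<epsilon> om" for n using hn_S[OF Cz[OF xD[OF that]]] W S_def by blast
      then obtain c where c: "\<And>n. n \<epsilon> om \<Longrightarrow> App c (W n) \<epsilon> W n" using choice_App[OF Wd, of om] by blast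
      have Fd: "dfnt (\<lambda>e. App c (W (e 0)))" by (intro dfns Wd)
      define ee where "ee = Uni (Img (\<lambda>n. App c (W n)) om)"
      have ee: "z \<epsilon> ee \<longleftrightarrow> (\<exists>n. n \<epsilon> om \<and> z \<epsilon> App c (W n))" for z unfolding ee_def mem_Uni mem_Img[OF Fd] by blast
      have "small ee" unfolding ee_def by (rule small_UN[OF Fd]) (use c W in blast)
      moreover have "sub ee Qc" unfolding sub_def ee using c W unfolding sub_def by blast
      moreover have "supp ee (op (chk n) (fs (s n)))" if n: "n \<epsilon> om" for n
      proof (rule supp_op[OF nm_chk hn_nm[OF Cz[OF xD[OF n]]] supp_chk])
        have "supp (App c (W n)) (fs (s n))" using c[OF n] W by blast
        then show "supp ee (fs (s n))" by (rule supp_mono) (use ee n in \<open>auto simp: sub_def\<close>)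
      qed
      ultimately show ?thesis unfolding f0_def by (intro hn_S_mkn[of _ ee]) (use mI Cop in auto)
    qed
    have "fc (hn S) dc_fm p e"
    proof (rule fc_if_generic[OF Ce p(1)])
      fix G2 E2 h2 assume N2: "gext E CP CL cm S G2 E2 h2" and pG: "p \<in> G2"
      interpret X: gext E CP CL cm S G2 E2 h2 by (rule N2)
      have hop: "h2 (op (chk n) (fs (s n))) = X.N.Pr (X.j n) (h2 (fs (s n)))" if "n \<epsilon> om" for n
        unfolding X.j_def by (rule X.h_op[OF Cop[OF that]])
      have f: "E2 a (h2 f0) \<longleftrightarrow> (\<exists>n. n \<epsilon> om \<and> a = X.N.Pr (X.j n) (h2 (fs (s n))))" for a
      proof -
        have "E2 a (h2 f0) \<longleftrightarrow> (\<exists>z. (\<exists>n. n \<epsilon> om \<and> z = op (chk n) (fs (s n))) \<and> a = h2 z)"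
          unfolding f0_def X.h_mkn[OF Cf0[unfolded f0_def]] mI ..
        then show ?thesis using hop by metis
      qed
      have fP: "E2 (X.N.Pr (X.j n) x) (h2 f0) \<longleftrightarrow> n \<epsilon> om \<and> x = h2 (fs (s n))" for n x
        unfolding f by (auto simp: X.j_inj)
      have sG: "sn (s n) \<in> G2" if "n \<epsilon> om" for n using X.G_up[OF pG p(2)[OF that]] .
      have inX: "E2 (h2 (fs (s n))) (h2 X0)" if n: "n \<epsilon> om" for n
        using X.h_mem[OF Cz[OF xD[OF n]] X0(1)] sG[OF n] s(3)[OF n] unfolding XX by blast
      have omj: "E2 (X.j n) X.N.om \<longleftrightarrow> n \<epsilon> om" for n unfolding X.j_om[symmetric] X.j_mem_j ..
      have "X.N.isfun (h2 f0) X.N.om (h2 X0)"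
        unfolding X.N.isfun_def X.N.isrel_def
      proof (intro conjI allI impI)
        fix t assume "E2 t (h2 f0)"
        then show "\<exists>x y. E2 x X.N.om \<and> E2 y (h2 X0) \<and> t = X.N.Pr x y" unfolding f using inX omj by blast
      next
        fix x assume "E2 x X.N.om"
        then obtain n where n: "n \<epsilon> om" "x = X.j n" unfolding X.j_om[symmetric] X.j_mem by blast
        then show "\<exists>y. E2 (X.N.Pr x y) (h2 f0) \<and> (\<forall>z. E2 (X.N.Pr x z) (h2 f0) \<longrightarrow> z = y)" using fP by blast
      qed
      moreover have "E2 (X.N.Pr x y) (h2 R0)" if kx: "E2 (X.N.Pr k x) (h2 f0)" "E2 (X.N.Pr (X.N.suc k) y) (h2 f0)" for k x y
      proof -
        obtain n where n: "n \<epsilon> om" "k = X.j n" "x = h2 (fs (s n))" using kx(1) unfolding f by auto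
        have y: "y = h2 (fs (s (suc n)))" using kx(2) unfolding n(2) X.j_suc[symmetric] fP by blast
        have Co: "hn S (op (fs (s n)) (fs (s (suc n))))" by (rule hn_S_op[OF Cz[OF xD[OF n(1)]] Cz[OF xD[OF suc_om[OF n(1)]]]])
        have "E2 (h2 (op (fs (s n)) (fs (s (suc n))))) (h2 R0)"
          using X.h_mem[OF Co R0(1)] sG[OF suc_om[OF n(1)]] s(3)[OF n(1)] by blast
        then show ?thesis unfolding X.h_op[OF Co] n(3) y .
      qed
      ultimately have "X.N.dc_seq (h2 X0) (h2 R0)" unfolding X.N.dc_seq_def by blast
      then show "sat E2 (\<lambda>i. h2 (e i)) dc_fm" unfolding X.N.sat_dc_fm e01 .
    qed
    moreover have "le p q" using p(2)[OF emp_om] s(2) by simp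
    ultimately show "\<exists>r. le r q \<and> fc (hn S) dc_fm r e" by blast
  qed
  then have "sat E' (\<lambda>i. h (e i)) dc_fm" using truth[where e = e and A = dc_fm, OF Ce] p0(1) by blast
  then show ?thesis unfolding N.sat_dc_fm e01 X0(2) R0(2) .
qed

end

section \<open>A forcing notion collapsing a cardinal\<close>

text \<open>The collapse is carried out over an arbitrary model of ZF. The properties of
  \<open>Q\<close> are chosen to transfer from the ground model, so that the finite injections need
  no recomputation inside the symmetric model.\<close>

locale collapse = zf E for E :: "nat \<Rightarrow> nat \<Rightarrow> bool" (infix "\<epsilon>" 50) +
  fixes Q k P m
  assumes Q_fun1: "q \<epsilon> Q \<Longrightarrow> fun1 q" and Q_inj1: "q \<epsilon> Q \<Longrightarrow> inj1 q" and Q_sub: "q \<epsilon> Q \<Longrightarrow> sub q (Times om k)"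
    and Q_Dom: "q \<epsilon> Q \<Longrightarrow> n \<epsilon> om \<Longrightarrow> \<exists>q'. q' \<epsilon> Q \<and> sub q q' \<and> n \<epsilon> Dom q'"
    and Q_Ran: "q \<epsilon> Q \<Longrightarrow> a \<epsilon> k \<Longrightarrow> \<exists>q'. q' \<epsilon> Q \<and> sub q q' \<and> a \<epsilon> Ran q'"
    and P_Q: "t \<epsilon> P \<Longrightarrow> \<exists>q a. q \<epsilon> Q \<and> t = Pr q a"
    and Q_P: "q \<epsilon> Q \<Longrightarrow> \<exists>a. Pr q a \<epsilon> P"
    and m_in_P: "m \<epsilon> P" and fs_m: "fs m = emp"
begin

text \<open>Conditions are compared by their first components only: those with the same first component are equivalent,
  hence an antichain is a partial choice function.\<close>

definition L :: nat where
  "L = Sep (Times P P) (\<lambda>t. \<exists>p q. t = Pr p q \<and> sub (fs q) (fs p))"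

lemma Pr_L: "Pr p q \<epsilon> L \<longleftrightarrow> p \<epsilon> P \<and> q \<epsilon> P \<and> sub (fs q) (fs p)"
proof -
  have "Pr p q \<epsilon> L \<longleftrightarrow> Pr p q \<epsilon> Times P P \<and> (\<exists>p' q'. Pr p q = Pr p' q' \<and> sub (fs q') (fs p'))"
    unfolding L_def by (rule mem_Sep) (intro dfns)
  then show ?thesis by auto
qed

lemma isrel_L: "isrel L P P"
proof -
  have "t \<epsilon> L \<longleftrightarrow> t \<epsilon> Times P P \<and> (\<exists>p' q'. t = Pr p' q' \<and> sub (fs q') (fs p'))" for t
    unfolding L_def by (rule mem_Sep) (intro dfns)
  then show ?thesis unfolding isrel_def by auto
qed

sublocale forcing E P L m
proof
  show "Pr p r \<epsilon> L" if "Pr p q \<epsilon> L" "Pr q r \<epsilon> L" for p q r using that unfolding Pr_L sub_def by blast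
qed (use m_in_P fs_m in \<open>auto simp: Pr_L sub_def\<close>)

sublocale sforcing E P L m "\<lambda>_. True"
proof
  show "dfn (\<lambda>e. True)" by (rule dfn_const)
  show "\<exists>B. nm B \<and> (\<forall>x. x \<epsilon> b \<longrightarrow> Pr x m \<epsilon> B)" if "\<And>x. x \<epsilon> b \<Longrightarrow> nm x" for b
    using nm_mkn[OF that] mem_mkn by blast
qed (use nm_chk in simp_all)

text \<open>The name of the union of the injections occurring as first components of members of the
  generic filter.\<close>

definition bijection_name :: nat where
  "bijection_name = Sep (Times (Img (\<lambda>t. op (chk (fs t)) (chk (sn t))) (Times om k)) P)
     (\<lambda>t. \<exists>n a p. t = Pr (op (chk n) (chk a)) p \<and> Pr n a \<epsilon> fs p)"

lemma mem_bijection_name: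
  "t \<epsilon> bijection_name \<longleftrightarrow> (\<exists>n a p. p \<epsilon> P \<and> t = Pr (op (chk n) (chk a)) p \<and> Pr n a \<epsilon> fs p)"
proof -
  have I: "u \<epsilon> Img (\<lambda>t. op (chk (fs t)) (chk (sn t))) (Times om k) \<longleftrightarrow> (\<exists>n a. n \<epsilon> om \<and> a \<epsilon> k \<and> u = op (chk n) (chk a))" for u
  proof -
    have "u \<epsilon> Img (\<lambda>t. op (chk (fs t)) (chk (sn t))) (Times om k) \<longleftrightarrow> (\<exists>t. t \<epsilon> Times om k \<and> u = op (chk (fs t)) (chk (sn t)))"
      by (rule mem_Img) (intro dfns)
    also have "\<dots> \<longleftrightarrow> (\<exists>n a. n \<epsilon> om \<and> a \<epsilon> k \<and> u = op (chk n) (chk a))"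
      unfolding mem_Times by (metis fs_Pr sn_Pr)
    finally show ?thesis .
  qed
  have "t \<epsilon> bijection_name \<longleftrightarrow> t \<epsilon> Times (Img (\<lambda>t. op (chk (fs t)) (chk (sn t))) (Times om k)) P
      \<and> (\<exists>n a p. t = Pr (op (chk n) (chk a)) p \<and> Pr n a \<epsilon> fs p)"
    unfolding bijection_name_def by (rule mem_Sep) (intro dfns)
  moreover have "n \<epsilon> om \<and> a \<epsilon> k" if p: "p \<epsilon> P" and na: "Pr n a \<epsilon> fs p" for n a p
  proof -
    have "sub (fs p) (Times om k)" using P_Q[OF p] Q_sub by auto
    then show ?thesis using na unfolding sub_def by auto
  qed
  ultimately show ?thesis unfolding mem_Times I by fastforce
qed

lemma nm_bijection_name: "nm bijection_name"
proof (rule hn_I[OF dfn_const])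
  show "\<exists>z p. nm z \<and> p \<epsilon> P \<and> t = Pr z p" if "t \<epsilon> bijection_name" for t
    using that nm_op[OF nm_chk nm_chk] unfolding mem_bijection_name by blast
qed simp

text \<open>Any two injections from the filter have a common extension in \<open>Q\<close>, so their
  union is a functional and injective relation. By density it has domain \<open>om\<close> and range
  \<open>k\<close>, and \<open>om \<epsilon> k\<close> refutes initiality.\<close>

theorem collapses:
  assumes k: "om \<epsilon> k" shows "fc nm ((\<^bold>\<not> cardinal 0) 1) m (\<lambda>_. chk k)"
proof (rule fc_if_generic[OF nm_chk m_in_P])
  fix G E' h assume "gext E P L m (\<lambda>_. True) G E' h"
  then interpret X: gext E P L m "\<lambda>_. True" G E' h .
  let ?F = "h bijection_name"
  have F: "E' a ?F \<longleftrightarrow> (\<exists>n b p. p \<in> G \<and> Pr n b \<epsilon> fs p \<and> a = X.N.Pr (X.j n) (X.j b))" for a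
  proof -
    have "h (op (chk n) (chk b)) = X.N.Pr (X.j n) (X.j b)" for n b
      unfolding X.j_def by (rule X.h_op[OF nm_op[OF nm_chk nm_chk]])
    then show ?thesis unfolding X.mem_h[OF nm_bijection_name] mem_bijection_name using X.G_P by fastforce
  qed
  have FP: "E' (X.N.Pr (X.j n) (X.j b)) ?F \<longleftrightarrow> (\<exists>p. p \<in> G \<and> Pr n b \<epsilon> fs p)" for n b
    unfolding F by (auto simp: X.j_inj)
  have dir: "\<exists>q. q \<epsilon> Q \<and> u \<epsilon> q \<and> v \<epsilon> q" if u: "p \<in> G" "u \<epsilon> fs p" and v: "p' \<in> G" "v \<epsilon> fs p'" for u v p p'
  proof -
    obtain r where "r \<in> G" "le r p" "le r p'" using X.G_dir[OF u(1) v(1)] by blast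
    moreover from this obtain q a where "q \<epsilon> Q" "r = Pr q a" using P_Q X.G_P by blast
    ultimately have "q \<epsilon> Q \<and> u \<epsilon> q \<and> v \<epsilon> q" using u(2) v(2) unfolding Pr_L sub_def by auto
    then show ?thesis by blast
  qed
  have range: "n \<epsilon> om \<and> b \<epsilon> k" if "p \<in> G" "Pr n b \<epsilon> fs p" for p n b
    using dir[OF that that] Q_sub unfolding sub_def by fastforce
  \<comment> \<open>Density in \<open>Q\<close> passes to density in \<open>P\<close>: every element
    of \<open>Q\<close> is a first component of some condition, and the order ignores second
    components.\<close>
  have dense: "\<exists>p. p \<in> G \<and> D (fs p)"
    if dD: "dfn (\<lambda>e. D (fs (e 0)))" and ex: "\<And>q. q \<epsilon> Q \<Longrightarrow> \<exists>q'. q' \<epsilon> Q \<and> sub q q' \<and> D q'" for D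
  proof -
    have "\<exists>r\<in>G. le r m \<and> D (fs r)"
    proof (rule generic_below[OF X.G X.G_m, of "\<lambda>p. D (fs p)", OF dD])
      fix p assume p: "le p m"
      then obtain q a where q: "q \<epsilon> Q" "p = Pr q a" using P_Q L_P by blast
      obtain q' where q': "q' \<epsilon> Q" "sub q q'" "D q'" using ex[OF q(1)] by blast
      obtain a' where "Pr q' a' \<epsilon> P" using Q_P[OF q'(1)] by blast
      then have "le (Pr q' a') p \<and> D (fs (Pr q' a'))" using q' q p unfolding Pr_L by simp
      then show "\<exists>r. le r p \<and> D (fs r)" by blast
    qed
    then show ?thesis by blast
  qed
  have mo: "E' x X.N.om \<longleftrightarrow> (\<exists>n. n \<epsilon> om \<and> x = X.j n)" for x unfolding X.j_om[symmetric] X.j_mem ..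
  have "X.N.isbij ?F X.N.om (X.j k)"
    unfolding X.N.isbij_def X.N.isinj_def X.N.isfun_def X.N.isrel_def
  proof (intro conjI allI impI)
    fix t assume "E' t ?F"
    then obtain n b p where t: "p \<in> G" "Pr n b \<epsilon> fs p" "t = X.N.Pr (X.j n) (X.j b)" unfolding F by blast
    then have "E' (X.j n) X.N.om" "E' (X.j b) (X.j k)" using range unfolding mo X.j_mem by blast+
    then show "\<exists>x y. E' x X.N.om \<and> E' y (X.j k) \<and> t = X.N.Pr x y" using t(3) by blast
  next
    fix x assume "E' x X.N.om"
    then obtain n where n: "n \<epsilon> om" "x = X.j n" unfolding mo by blast
    have "\<exists>p. p \<in> G \<and> n \<epsilon> Dom (fs p)" by (rule dense) (intro dfns, rule Q_Dom[OF _ n(1)])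
    then obtain p b where p: "p \<in> G" "Pr n b \<epsilon> fs p" by auto
    have "z = X.j b" if xz: "E' (X.N.Pr x z) ?F" for z
    proof -
      obtain n' b' p' where z: "p' \<in> G" "Pr n' b' \<epsilon> fs p'" "X.N.Pr x z = X.N.Pr (X.j n') (X.j b')"
        using xz unfolding F by blast
      then have e: "n' = n" "z = X.j b'" using n(2) X.j_inj by auto
      obtain q where "q \<epsilon> Q" "Pr n b \<epsilon> q" "Pr n' b' \<epsilon> q" using dir[OF p z(1,2)] by blast
      then have "b' = b" using Q_fun1 e(1) unfolding fun1_def by blast
      then show ?thesis using e(2) by simp
    qed
    moreover have "E' (X.N.Pr x (X.j b)) ?F" unfolding n(2) FP using p by blast
    ultimately show "\<exists>y. E' (X.N.Pr x y) ?F \<and> (\<forall>z. E' (X.N.Pr x z) ?F \<longrightarrow> z = y)" by blast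
  next
    fix x y z assume A: "E' (X.N.Pr x z) ?F \<and> E' (X.N.Pr y z) ?F"
    obtain n b p where x: "p \<in> G" "Pr n b \<epsilon> fs p" "X.N.Pr x z = X.N.Pr (X.j n) (X.j b)"
      using A unfolding F by blast
    obtain n' b' p' where y: "p' \<in> G" "Pr n' b' \<epsilon> fs p'" "X.N.Pr y z = X.N.Pr (X.j n') (X.j b')"
      using A unfolding F by blast
    have e: "b' = b" "x = X.j n" "y = X.j n'" using x(3) y(3) X.j_inj by auto
    obtain q where "q \<epsilon> Q" "Pr n b \<epsilon> q" "Pr n' b' \<epsilon> q" using dir[OF x(1,2) y(1,2)] by blast
    then have "n = n'" using Q_inj1 e(1) unfolding inj1_def by blast
    then show "x = y" using e by simp
  next
    fix y assume "E' y (X.j k)"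
    then obtain b where b: "b \<epsilon> k" "y = X.j b" unfolding X.j_mem by blast
    have "\<exists>p. p \<in> G \<and> b \<epsilon> Ran (fs p)" by (rule dense) (intro dfns, rule Q_Ran[OF _ b(1)])
    then obtain p n where p: "p \<in> G" "Pr n b \<epsilon> fs p" by auto
    then show "\<exists>x. E' (X.N.Pr x y) ?F" unfolding b(2) using FP by blast
  qed
  moreover have "E' X.N.om (X.j k)" unfolding X.j_om[symmetric] X.j_mem_j by (rule k)
  ultimately have "\<not> X.N.iscard (X.j k)" unfolding X.N.iscard_def by blast
  then show "sat E' (\<lambda>i. h (chk k)) ((\<^bold>\<not> cardinal 0) 1)" unfolding sat_1 X.j_def by simp
qed

end

context forcing
begin

lemma sat_ex_CCC2_collapsing_cardinals:
  assumes L: "isrel L P P" and k: "iscard k" "sub om k"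
    and ccc: "\<And>A. sub A P \<Longrightarrow> (\<And>p q. p \<epsilon> A \<Longrightarrow> q \<epsilon> A \<Longrightarrow> p \<noteq> q \<Longrightarrow> \<not> (\<exists>r. le r p \<and> le r q)) \<Longrightarrow> \<exists>f. isinj f A om"
    and c: "fc nm ((\<^bold>\<not> cardinal 0) 1) m (\<lambda>_. chk k)"
  shows "sat E z ex_CCC2_collapsing_cardinals"
proof -
  let ?v = "z(0 := P, Suc 0 := L, Suc (Suc 0) := m)"
  have "tv E z ?v (Suc (Suc (Suc 0))) (notion_of_forcing 0 (Suc 0) (Suc (Suc 0)))"
    unfolding notion_of_forcing_def using L L_refl L_trans m_P L_m by simp blast
  moreover have "tv E z ?v (Suc (Suc (Suc 0))) (CCC2 0 (Suc 0))"
    unfolding CCC2_def antichain_def compatible_def using ccc by simp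
  moreover have "tv E z ?v (Suc (Suc (Suc 0))) (collapses_cardinals 0 (Suc 0) (Suc (Suc 0)))"
  proof -
    let ?w = "?v(Suc (Suc (Suc 0)) := k, Suc (Suc (Suc (Suc 0))) := chk k)"
    have "tv E z ?w 5 (forces ((\<^bold>\<not> cardinal 0) 1) 0 (Suc 0) (Suc (Suc 0)) (\<lambda>_. Suc (Suc (Suc (Suc 0)))))"
      using c by (subst tv_forces) simp_all
    moreover have "tv E z ?w 5 (is_check_name (Suc (Suc 0)) (Suc (Suc (Suc 0))) (Suc (Suc (Suc (Suc 0)))))"
      unfolding is_check_name_def using check_name_ex[of k] by (simp add: eval_nat_numeral)
    ultimately show ?thesis
      unfolding collapses_cardinals_def using k by (simp add: eval_nat_numeral) blast
  qed
  ultimately show ?thesis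
    unfolding ex_CCC2_collapsing_cardinals_def sat_0[where v = z] tv_simps(4,9) by blast
qed

end

context symext
begin

section \<open>The forcing notion inside the symmetric model\<close>

lemma mem_j_rel:
  assumes q: "sub q (Times A B)"
  shows "E' t (j q) \<longleftrightarrow> (\<exists>n a. Pr n a \<epsilon> q \<and> t = N.Pr (j n) (j a))"
proof
  assume "E' t (j q)"
  then obtain u where u: "u \<epsilon> q" "t = j u" using j_mem by blast
  then obtain n a where "u = Pr n a" using q unfolding sub_def by auto
  then show "\<exists>n a. Pr n a \<epsilon> q \<and> t = N.Pr (j n) (j a)" using u j_Pr by blast
qed (use j_Pr_mem in blast)

lemma Qc_sub: "q \<epsilon> Qc \<Longrightarrow> sub q (Times om w1)"
  unfolding mem_Qc by blast

lemma j_Qc_fun1: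
  assumes "q \<epsilon> Qc" shows "N.fun1 (j q)"
  unfolding N.fun1_def
proof (intro allI impI)
  fix n x y assume "E' (N.Pr n x) (j q)" "E' (N.Pr n y) (j q)"
  then obtain n' x' n'' y' where *: "Pr n' x' \<epsilon> q" "n = j n'" "x = j x'" "Pr n'' y' \<epsilon> q" "n = j n''" "y = j y'"
    unfolding mem_j_rel[OF Qc_sub[OF assms]] N.Pr_eq by blast
  then have "n'' = n'" using j_inj by simp
  then have "x' = y'" using * assms unfolding mem_Qc fun1_def by blast
  then show "x = y" using * by simp
qed

lemma j_Qc_inj1:
  assumes "q \<epsilon> Qc" shows "N.inj1 (j q)"
  unfolding N.inj1_def
proof (intro allI impI)
  fix n l x assume "E' (N.Pr n x) (j q)" "E' (N.Pr l x) (j q)"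
  then obtain n' x' l' y' where *: "Pr n' x' \<epsilon> q" "n = j n'" "x = j x'" "Pr l' y' \<epsilon> q" "l = j l'" "x = j y'"
    unfolding mem_j_rel[OF Qc_sub[OF assms]] N.Pr_eq by blast
  then have "y' = x'" using j_inj by simp
  then have "n' = l'" using * assms unfolding mem_Qc inj1_def by blast
  then show "n = l" using * by simp
qed

lemma j_sub: "sub a b \<Longrightarrow> N.sub (j a) (j b)"
  unfolding N.sub_def sub_def j_mem by blast

text \<open>The forcing is defined within the symmetric model from the indexed family
  \<open>Fam\<close>. Having a symmetric name for that function is what makes \<open>PP\<close> a
  set of the model.\<close>

definition PP :: nat where
  "PP = N.Sep (N.Times (j Qc) (N.Uni (N.Ran (h Fam)))) (\<lambda>t. \<exists>i a A. t = N.Pr i a \<and> E' (N.Pr i A) (h Fam) \<and> E' a A)"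

lemma mem_PP: "E' t PP \<longleftrightarrow> (\<exists>i d. i \<epsilon> Qc \<and> sub d w1 \<and> t = N.Pr (j i) (h (gn i d)))"
proof -
  have m: "E' t PP \<longleftrightarrow> E' t (N.Times (j Qc) (N.Uni (N.Ran (h Fam)))) \<and> (\<exists>i a A. t = N.Pr i a \<and> E' (N.Pr i A) (h Fam) \<and> E' a A)"
    unfolding PP_def by (rule N.mem_Sep) (intro dfns)
  show ?thesis
  proof
    assume "E' t PP"
    then obtain i a A where t: "t = N.Pr i a" "E' (N.Pr i A) (h Fam)" "E' a A" unfolding m by blast
    then obtain q where q: "q \<epsilon> Qc" "i = j q" "A = h (An q)" unfolding h_Fam by auto
    then obtain d where "sub d w1" "a = h (gn q d)" using t(3) h_An by blast
    then show "\<exists>i d. i \<epsilon> Qc \<and> sub d w1 \<and> t = N.Pr (j i) (h (gn i d))" using t(1) q by blast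
  next
    assume "\<exists>i d. i \<epsilon> Qc \<and> sub d w1 \<and> t = N.Pr (j i) (h (gn i d))"
    then obtain i d where i: "i \<epsilon> Qc" "sub d w1" "t = N.Pr (j i) (h (gn i d))" by blast
    have A: "E' (N.Pr (j i) (h (An i))) (h Fam)" using i(1) h_Fam by blast
    have a: "E' (h (gn i d)) (h (An i))" using i h_An by blast
    have "E' (j i) (j Qc)" using i(1) j_mem_j by blast
    then have "E' t (N.Times (j Qc) (N.Uni (N.Ran (h Fam))))" unfolding N.mem_Times N.mem_Uni N.mem_Ran using A a i(3) by blast
    then show "E' t PP" unfolding m using A a i(3) by blast
  qed
qed

abbreviation mm :: nat where "mm \<equiv> N.Pr N.emp (h (gn emp emp))"

sublocale K: collapse E' "j Qc" "j w1" PP mm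
proof
  show "N.fun1 q" if "E' q (j Qc)" for q using that j_Qc_fun1 unfolding j_mem by blast
  show "N.inj1 q" if "E' q (j Qc)" for q using that j_Qc_inj1 unfolding j_mem by blast
  show "N.sub q (N.Times N.om (j w1))" if q: "E' q (j Qc)" for q
  proof -
    obtain q' where q': "q' \<epsilon> Qc" "q = j q'" using q unfolding j_mem by blast
    have "E' (j n) N.om \<and> E' (j a) (j w1)" if "Pr n a \<epsilon> q'" for n a
      using that Qc_sub[OF q'(1)] unfolding j_om[symmetric] j_mem_j sub_def by auto
    then show ?thesis unfolding N.sub_def q'(2) mem_j_rel[OF Qc_sub[OF q'(1)]] N.mem_Times by blast
  qed
  show "\<exists>q'. E' q' (j Qc) \<and> N.sub q q' \<and> E' n (N.Dom q')" if q: "E' q (j Qc)" and n: "E' n N.om" for q n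
  proof -
    obtain q0 n0 where 0: "q0 \<epsilon> Qc" "q = j q0" "n0 \<epsilon> om" "n = j n0" using q n unfolding j_om[symmetric] j_mem by blast
    obtain q' where q': "q' \<epsilon> Qc" "sub q0 q'" "n0 \<epsilon> Dom q'" using Qc_Dom[OF 0(1,3)] by blast
    then obtain a where "Pr n0 a \<epsilon> q'" by auto
    then have "E' n (N.Dom (j q'))" unfolding N.mem_Dom 0(4) using j_Pr_mem by blast
    then show ?thesis using q' j_sub[OF q'(2)] j_mem_j unfolding 0(2) by blast
  qed
  show "\<exists>q'. E' q' (j Qc) \<and> N.sub q q' \<and> E' a (N.Ran q')" if q: "E' q (j Qc)" and a: "E' a (j w1)" for q a
  proof -
    obtain q0 a0 where 0: "q0 \<epsilon> Qc" "q = j q0" "a0 \<epsilon> w1" "a = j a0" using q a unfolding j_mem by blast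
    obtain q' where q': "q' \<epsilon> Qc" "sub q0 q'" "a0 \<epsilon> Ran q'" using Qc_Ran[OF 0(1,3)] by blast
    then obtain n where "Pr n a0 \<epsilon> q'" by auto
    then have "E' a (N.Ran (j q'))" unfolding N.mem_Ran 0(4) using j_Pr_mem by blast
    then show ?thesis using q' j_sub[OF q'(2)] j_mem_j unfolding 0(2) by blast
  qed
  show "\<exists>q a. E' q (j Qc) \<and> t = N.Pr q a" if "E' t PP" for t using that j_mem_j unfolding mem_PP by blast
  show "\<exists>a. E' (N.Pr q a) PP" if q: "E' q (j Qc)" for q
  proof -
    obtain q' where "q' \<epsilon> Qc" "q = j q'" using q unfolding j_mem by blast
    then have "E' (N.Pr q (h (gn q' emp))) PP" unfolding mem_PP using emp_sub by blast
    then show ?thesis by blast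
  qed
  show "E' mm PP" unfolding mem_PP j_emp[symmetric] using emp_Qc emp_sub by blast
  show "N.fs mm = N.emp" by simp
qed

lemma countable_antichain:
  assumes A: "N.sub A PP"
    and anti: "\<And>p q. E' p A \<Longrightarrow> E' q A \<Longrightarrow> p \<noteq> q \<Longrightarrow> \<not> (\<exists>r. E' (N.Pr r p) K.L \<and> E' (N.Pr r q) K.L)"
  shows "\<exists>f. N.isinj f A N.om"
proof -
  \<comment> \<open>Of two conditions with the same first component, either one is a common
    extension of both.\<close>
  have eq: "x = y" if "E' (N.Pr i x) A" "E' (N.Pr i y) A" for i x y
  proof -
    have P: "E' (N.Pr i x) PP" "E' (N.Pr i y) PP" using A that unfolding N.sub_def by blast+
    then have "E' (N.Pr (N.Pr i x) (N.Pr i x)) K.L" "E' (N.Pr (N.Pr i x) (N.Pr i y)) K.L" unfolding K.Pr_L by simp_all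
    then have "N.Pr i x = N.Pr i y" using anti[OF that] by blast
    then show ?thesis by simp
  qed
  then obtain e where e: "small e" "\<And>i d. i \<epsilon> Qc \<Longrightarrow> E' (N.Pr (j i) (h (gn i d))) A \<Longrightarrow> i \<epsilon> e"
    using partial_choice_small[of A] by blast
  \<comment> \<open>The inverse of the first projection on \<open>A\<close>. It is functional since
    \<open>A\<close> is an antichain, so the countable set of indices that occur enumerates
    \<open>A\<close>.\<close>
  define g where "g = N.Img (\<lambda>t. N.Pr (N.fs t) t) A"
  have g: "E' u g \<longleftrightarrow> (\<exists>t. E' t A \<and> u = N.Pr (N.fs t) t)" for u
    unfolding g_def by (rule N.mem_Img) (intro dfns)
  have AP: "\<exists>i d. i \<epsilon> Qc \<and> t = N.Pr (j i) (h (gn i d))" if "E' t A" for t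
    using that A unfolding N.sub_def mem_PP by blast
  have "N.small A"
  proof (rule N.small_rel_image[of g, OF _ j_small[OF e(1)]])
    show "N.fun1 g" unfolding N.fun1_def
    proof (intro allI impI)
      fix n x y assume "E' (N.Pr n x) g" "E' (N.Pr n y) g"
      then have *: "E' x A" "E' y A" "N.fs x = N.fs y" unfolding g by auto
      obtain i d i' d' where "x = N.Pr (j i) (h (gn i d))" "y = N.Pr (j i') (h (gn i' d'))" using AP *(1,2) by blast
      then show "x = y" using * eq by auto
    qed
    fix t assume t: "E' t A"
    then obtain i d where i: "i \<epsilon> Qc" "t = N.Pr (j i) (h (gn i d))" using AP by blast
    have "i \<epsilon> e" using e(2) i t by blast
    moreover have "E' (N.Pr (j i) t) g" unfolding g using t i(2) by auto
    ultimately show "\<exists>x. E' x (j e) \<and> E' (N.Pr x t) g" using j_mem_j by blast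
  qed
  then obtain f where f: "\<And>t. E' t f \<Longrightarrow> \<exists>x n. E' x A \<and> E' n N.om \<and> t = N.Pr x n" "\<And>x. E' x A \<Longrightarrow> \<exists>n. E' (N.Pr x n) f"
    "N.fun1 f" "\<And>x y n. E' (N.Pr x n) f \<Longrightarrow> E' (N.Pr y n) f \<Longrightarrow> x = y"
    using N.small_injection[of A] by blast
  have "N.isinj f A N.om" unfolding N.isinj_def N.isfun_def N.isrel_def
  proof (intro conjI allI impI)
    fix x assume "E' x A"
    then show "\<exists>y. E' (N.Pr x y) f \<and> (\<forall>z. E' (N.Pr x z) f \<longrightarrow> z = y)" using f(2,3) unfolding N.fun1_def by blast
  qed (use f(1,4) in blast)+
  then show ?thesis by blast
qed

text \<open>Elements of \<open>j w1\<close> are images of countable ordinals and stay countable in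
  the extension, so a bijection from one of them would enumerate \<open>j w1\<close>.\<close>

lemma iscard_j_w1: "N.iscard (j w1)"
  unfolding N.iscard_def
proof (intro conjI allI impI notI)
  show "N.ordn (j w1)" by (rule j_ordn[OF ordn_w1])
  fix a assume "E' a (j w1)" and "\<exists>f. N.isbij f a (j w1)"
  then obtain f where f: "N.isbij f a (j w1)" by blast
  obtain a' where a: "a' \<epsilon> w1" "a = j a'" using \<open>E' a (j w1)\<close> j_mem by blast
  have fu: "N.isfun f a (j w1)" and onto: "\<And>y. E' y (j w1) \<Longrightarrow> \<exists>x. E' (N.Pr x y) f"
    using f unfolding N.isbij_def N.isinj_def by blast+
  have dom: "E' x a" if "E' (N.Pr x y) f" for x y using fu that unfolding N.isfun_def N.isrel_def by fastforce
  have "N.small (j w1)"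
  proof (rule N.small_rel_image[of f a])
    show "N.fun1 f" unfolding N.fun1_def
    proof (intro allI impI)
      fix n x y assume xy: "E' (N.Pr n x) f" "E' (N.Pr n y) f"
      obtain z where z: "\<forall>u. E' (N.Pr n u) f \<longrightarrow> u = z" using fu dom[OF xy(1)] unfolding N.isfun_def by blast
      show "x = y" using z xy by blast
    qed
    show "N.small a" using j_small a mem_w1 by blast
    show "\<exists>x. E' x a \<and> E' (N.Pr x y) f" if "E' y (j w1)" for y using onto[OF that] dom by blast
  qed
  then show False using w1_not_small_N by blast
qed

lemma om_sub_j_w1: "N.sub N.om (j w1)"
proof -
  have "sub om w1" unfolding sub_def using ordn_trans[OF ordn_w1 om_w1] by blast
  then show ?thesis unfolding j_om[symmetric] by (rule j_sub)
qed

lemma sat_ex_CCC2_collapsing_cardinals: "sat E' z ex_CCC2_collapsing_cardinals"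
proof (rule K.sat_ex_CCC2_collapsing_cardinals[OF K.isrel_L iscard_j_w1 om_sub_j_w1])
  have "E' N.om (j w1)" unfolding j_om[symmetric] j_mem_j by (rule om_w1)
  then show "K.fc K.nm ((\<^bold>\<not> cardinal 0) 1) mm (\<lambda>_. K.chk (j w1))" by (rule K.collapses)
  show "\<exists>f. N.isinj f A N.om" if "N.sub A PP" "\<And>p q. E' p A \<Longrightarrow> E' q A \<Longrightarrow> p \<noteq> q \<Longrightarrow> \<not> (\<exists>r. K.le r p \<and> K.le r q)" for A
    using countable_antichain that by blast
qed

end

section \<open>Relative consistency\<close>

lemma nat_model:
  assumes "consistent ZFC" shows "\<exists>(E :: nat \<Rightarrow> nat \<Rightarrow> bool) z. \<forall>A\<in>ZFC. sat E z A"
proof -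
  obtain R :: "nat \<Rightarrow> nat \<Rightarrow> bool" and Q e where Q: "equivp Q"
    and cong: "\<forall>x x' y y'. Q x x' \<longrightarrow> Q y y' \<longrightarrow> R x y \<longrightarrow> R x' y'"
    and T: "\<forall>A\<in>ZFC. satq UNIV R Q e A"
    using completeness[OF assms] by blast
  \<comment> \<open>The rewriting rules for levels read equality as identity, hence these two axioms
    are unfolded by hand over \<open>Q\<close>. Infinity supplies the empty set and pairing the
    singletons for \<open>quotient_model\<close>.\<close>
  have "satq UNIV R Q e infinity" "satq UNIV R Q e pairing" using T unfolding ZFC_def ZF_def by blast+
  note ax = this[unfolded infinity_def is_inductive_def is_empty_def is_succ_def pairing_def is_upair_def
    mem_def eq_def neg_def con_def dis_def imp_def iff_def all_def ex_def, simplified]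
  have inf: "\<exists>v. \<forall>z. \<not> R z v" using ax(1) by blast
  have pair: "\<exists>u. \<forall>z. R z u \<longleftrightarrow> Q z x" for x using ax(2) by meson
  have "\<exists>(E :: nat \<Rightarrow> nat \<Rightarrow> bool) h. h ` UNIV = UNIV \<and> (\<forall>x\<in>UNIV. \<forall>y\<in>UNIV. h x = h y \<longleftrightarrow> Q x y)
    \<and> (\<forall>x\<in>UNIV. \<forall>y\<in>UNIV. E (h x) (h y) \<longleftrightarrow> R x y)
    \<and> (\<forall>A e. (\<forall>i. e i \<in> UNIV) \<longrightarrow> (sat E (\<lambda>i. h (e i)) A \<longleftrightarrow> satq UNIV R Q e A))"
    by (rule quotient_model)
      (use Q cong inf pair in \<open>auto intro: equivp_reflp equivp_symp elim: equivp_transp\<close>)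
  then obtain E :: "nat \<Rightarrow> nat \<Rightarrow> bool" and h
    where E: "\<forall>A e. (\<forall>i. e i \<in> UNIV) \<longrightarrow> (sat E (\<lambda>i. h (e i)) A \<longleftrightarrow> satq UNIV R Q e A)"
    by (elim exE conjE) (rule that)
  have "sat E (\<lambda>i. h (e i)) A" if "A \<in> ZFC" for A using E[rule_format, of e A] T that by simp
  then show ?thesis by (intro exI ballI)
qed

lemma consistent_if_sat:
  assumes "\<And>A. A \<in> T \<Longrightarrow> sat E e A" shows "consistent T"
  unfolding consistent_def
proof (rule notI, elim exE conjE)
  fix A assume "T \<turnstile> A" "T \<turnstile> Neg A"
  then have "sat E e A" "sat E e (Neg A)" using soundness assms by blast+
  then show False by simp
qed

theorem theorem6p4:
  assumes "consistent ZFC"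
  shows "consistent (ZF \<union> {dependent_choice, ex_CCC2_collapsing_cardinals})"
proof -
  obtain E :: "nat \<Rightarrow> nat \<Rightarrow> bool" and z where sat: "\<forall>A\<in>ZFC. sat E z A" using nat_model[OF assms] by blast
  interpret set_structure E .
  interpret zf E by (rule zf_if_sat_ZF[where z = z]) (use sat in \<open>auto simp: ZFC_def\<close>)
  interpret zfc E by (rule zfc_if_choice[where z = z]) (use sat in \<open>auto simp: ZFC_def\<close>)
  interpret zfc_nat E ..
  \<comment> \<open>The carrier is the natural numbers, so a filter generic over the model exists.
    The extension by symmetric names is again such a structure and serves as ground model for the
    second forcing.\<close>
  obtain G where "generic G" using generic_ex[OF m_P] by blast
  then obtain E' h where "gext E CP CL cm S G E' h" using gext_ex by blast
  then interpret gext E CP CL cm S G E' h .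
  interpret symext E G E' h ..
  have "N.dc_seq X R" if "X \<noteq> N.emp \<and> (\<forall>x. E' x X \<longrightarrow> (\<exists>y. E' y X \<and> E' (N.Pr x y) R))" for X R
    by (rule dc_N) (use that in blast)+
  then have "sat E' z dependent_choice" unfolding N.sat_dependent_choice by blast
  moreover note sat_ex_CCC2_collapsing_cardinals N.sat_ZF
  ultimately have "sat E' z A" if "A \<in> ZF \<union> {dependent_choice, ex_CCC2_collapsing_cardinals}" for A using that by auto
  then show ?thesis by (rule consistent_if_sat)
qed

end
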